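(* Let $D \subset \mathbb{P}^{s+2}$ be a smooth surface (so of codimension $s$) that is the scheme-theoretic base locus of a linear system of hypersurfaces of degree $d$ in $\mathbb{P}^{s+2}$. Then a generic complete intersection of $s-1$ hypersurfaces of degree $d$ containing $D$ is a nodal threefold.
   Context: All varieties are over the complex numbers. A threefold is called nodal if its only singularities (if any) are ordinary double points (ODPs, nodes), i.e. isolated hypersurface singularities analytically equivalent to $x_1^2+x_2^2+x_3^2+x_4^2=0$ at the origin of $\mathbb{C}^4$. "Generic" means that the $s-1$ hypersurfaces are chosen in a nonempty Zariski open subset of the parameter space of $(s-1)$-tuples of degree $d$ hypersurfaces containing $D$. *)

theory Defs
  imports "HOL-Analysis.Analysis" "HOL-Library.Poly_Mapping"
begin

section \<open>Complex polynomials in several variables\<close>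

text \<open>
  The monomial \<open>m :: 'v \<Rightarrow>\<^sub>0 nat\<close> stands for the product of the
  \<open>x v ^ m v\<close>; the ring operations are those of the monoid algebra in
  \<^theory>\<open>HOL-Library.Poly_Mapping\<close>.
\<close>

type_synonym 'v cpoly = "('v \<Rightarrow>\<^sub>0 nat) \<Rightarrow>\<^sub>0 complex"

definition poly_val :: "('v \<Rightarrow> complex) \<Rightarrow> 'v cpoly \<Rightarrow> complex" where
  "poly_val x p =
     (\<Sum>m\<in>Poly_Mapping.keys p. Poly_Mapping.lookup p m *
        (\<Prod>v\<in>Poly_Mapping.keys m. x v ^ Poly_Mapping.lookup m v))"

definition poly_const :: "complex \<Rightarrow> 'v cpoly" where
  "poly_const c = Poly_Mapping.single 0 c"

definition poly_var :: "'v \<Rightarrow> 'v cpoly" where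
  "poly_var v = Poly_Mapping.single (Poly_Mapping.single v 1) 1"

definition partial_deriv :: "'v \<Rightarrow> 'v cpoly \<Rightarrow> 'v cpoly" where
  "partial_deriv v p =
     (\<Sum>m\<in>Poly_Mapping.keys p.
        Poly_Mapping.single (m - Poly_Mapping.single v 1)
          (of_nat (Poly_Mapping.lookup m v) * Poly_Mapping.lookup p m))"

definition forms :: "nat \<Rightarrow> 'v cpoly set" where
  "forms d = {p. \<forall>m\<in>Poly_Mapping.keys p.
                   (\<Sum>v\<in>Poly_Mapping.keys m. Poly_Mapping.lookup m v) = d}"

global_interpretation cpoly: vector_space "\<lambda>c p. poly_const c * (p :: 'v cpoly)"
  by unfold_locales
    (simp_all add: poly_const_def distrib_left distrib_right single_add mult_single
       flip: mult.assoc)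

global_interpretation cideal: module "(*) :: 'v cpoly \<Rightarrow> 'v cpoly \<Rightarrow> 'v cpoly"
  by unfold_locales (simp_all add: algebra_simps)


section \<open>Subvarieties of projective space\<close>

text \<open>
  The homogeneous coordinates of the projective space of dimension
  \<open>CARD('n) - 1\<close> are indexed by \<open>'n\<close>.  A subset of projective space is
  represented by the set of all vectors of homogeneous coordinates of its points, i.e. by
  a set of nonzero vectors that is stable under multiplication by nonzero scalars.
\<close>

definition zero_locus :: "'n::finite cpoly set \<Rightarrow> (complex^'n) set" where
  "zero_locus G = {x. x \<noteq> 0 \<and> (\<forall>g\<in>G. poly_val (($) x) g = 0)}"

definition algebraic_set :: "(complex^'n::finite) set \<Rightarrow> bool" where
  "algebraic_set Z \<longleftrightarrow> (\<exists>G \<subseteq> (\<Union>d. forms d). Z = zero_locus G)"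

definition irreducible_set :: "(complex^'n::finite) set \<Rightarrow> bool" where
  "irreducible_set Z \<longleftrightarrow> algebraic_set Z \<and> Z \<noteq> {} \<and>
     (\<forall>A B. algebraic_set A \<longrightarrow> algebraic_set B \<longrightarrow> Z = A \<union> B \<longrightarrow> Z = A \<or> Z = B)"

definition irreducible_chain :: "(complex^'n::finite) set \<Rightarrow> nat \<Rightarrow> bool" where
  "irreducible_chain Z k \<longleftrightarrow>
     (\<exists>C :: nat \<Rightarrow> (complex^'n) set.
        (\<forall>i\<le>k. irreducible_set (C i) \<and> C i \<subseteq> Z) \<and> (\<forall>i<k. C i \<subset> C (Suc i)))"

text \<open>Krull dimension for the Zariski topology.\<close>

definition has_dimension :: "(complex^'n::finite) set \<Rightarrow> nat \<Rightarrow> bool" where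
  "has_dimension Z k \<longleftrightarrow> irreducible_chain Z k \<and> (\<forall>j. irreducible_chain Z j \<longrightarrow> j \<le> k)"

definition vanishing_ideal :: "(complex^'n::finite) set \<Rightarrow> 'n cpoly set" where
  "vanishing_ideal Z = {p. \<forall>x\<in>Z. poly_val (($) x) p = 0}"

text \<open>
  The linear subspace whose projectivisation is the embedded projective tangent space, at
  the point with coordinates \<open>x\<close>, of the closed subscheme with equations \<open>G\<close>.  Its
  vector space dimension exceeds that of the Zariski tangent space by one.
\<close>

definition tangent_space :: "'n::finite cpoly set \<Rightarrow> complex^'n \<Rightarrow> (complex^'n) set" where
  "tangent_space G x =
     {v. \<forall>g\<in>G. (\<Sum>i\<in>UNIV. poly_val (($) x) (partial_deriv i g) * v $ i) = 0}"

text \<open>Varieties are irreducible.\<close>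

definition smooth_variety :: "nat \<Rightarrow> (complex^'n::finite) set \<Rightarrow> bool" where
  "smooth_variety k Z \<longleftrightarrow> irreducible_set Z \<and> has_dimension Z k \<and>
     (\<forall>x\<in>Z. vec.dim (tangent_space (vanishing_ideal Z) x) = k + 1)"


section \<open>Linear systems and generic tuples of hypersurfaces\<close>

definition linear_system :: "nat \<Rightarrow> 'n::finite cpoly set \<Rightarrow> bool" where
  "linear_system d W \<longleftrightarrow> W \<subseteq> forms d \<and> cpoly.subspace W"

text \<open>
  Equality of the closed subscheme defined by \<open>W\<close> with the reduced scheme \<open>D\<close>: on each
  standard affine chart the ideal generated by \<open>W\<close> and the ideal of \<open>D\<close> coincide, i.e.
  they agree after inverting the coordinate \<open>i\<close>.
\<close>

definition scheme_base_locus :: "'n::finite cpoly set \<Rightarrow> (complex^'n) set \<Rightarrow> bool" where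
  "scheme_base_locus W D \<longleftrightarrow> W \<subseteq> vanishing_ideal D \<and>
     (\<forall>f\<in>vanishing_ideal D. \<forall>i. \<exists>N. poly_var i ^ N * f \<in> cideal.span W)"

text \<open>Hypersurfaces are given by their equations, which are unique up to a nonzero constant.\<close>

definition hypersurfaces_through ::
    "nat \<Rightarrow> (complex^'n::finite) set \<Rightarrow> 'n cpoly set" where
  "hypersurfaces_through d D = {f \<in> forms d. f \<noteq> 0 \<and> f \<in> vanishing_ideal D}"

definition hypersurface_tuples ::
    "nat \<Rightarrow> nat \<Rightarrow> (complex^'n::finite) set \<Rightarrow> (nat \<Rightarrow> 'n cpoly) set" where
  "hypersurface_tuples r d D = {..<r} \<rightarrow>\<^sub>E hypersurfaces_through d D"

text \<open>
  The variable \<open>(j, m)\<close> stands for the coefficient of the monomial \<open>m\<close> in the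
  \<open>j\<close>-th equation.  The parameter space is a product of projective spaces, so its Zariski
  closed subsets are cut out by polynomials in these coefficients that are homogeneous in the
  coefficients of each single equation.
\<close>

definition multihomogeneous :: "(nat \<times> 'm) cpoly \<Rightarrow> bool" where
  "multihomogeneous P \<longleftrightarrow>
     (\<exists>e :: nat \<Rightarrow> nat. \<forall>M\<in>Poly_Mapping.keys P. \<forall>j.
        (\<Sum>v\<in>{v \<in> Poly_Mapping.keys M. fst v = j}. Poly_Mapping.lookup M v) = e j)"

definition zariski_open_in ::
    "(nat \<Rightarrow> 'n::finite cpoly) set \<Rightarrow> (nat \<Rightarrow> 'n cpoly) set \<Rightarrow> bool" where
  "zariski_open_in T U \<longleftrightarrow>
     (\<exists>S :: (nat \<times> ('n \<Rightarrow>\<^sub>0 nat)) cpoly set.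
        (\<forall>P\<in>S. multihomogeneous P) \<and>
        U = {F \<in> T. \<exists>P\<in>S. poly_val (\<lambda>(j, m). Poly_Mapping.lookup (F j) m) P \<noteq> 0})"

definition generic_tuple ::
    "nat \<Rightarrow> nat \<Rightarrow> (complex^'n::finite) set \<Rightarrow> ((nat \<Rightarrow> 'n cpoly) \<Rightarrow> bool) \<Rightarrow> bool" where
  "generic_tuple r d D Q \<longleftrightarrow>
     (\<exists>U. zariski_open_in (hypersurface_tuples r d D) U \<and> U \<noteq> {} \<and> (\<forall>F\<in>U. Q F))"


section \<open>Germs of complex spaces\<close>

definition holomorphic_on_open :: "(complex^'m::finite \<Rightarrow> complex) \<Rightarrow> (complex^'m) set \<Rightarrow> bool" where
  "holomorphic_on_open f U \<longleftrightarrow> open U \<and>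
     (\<forall>z\<in>U. \<exists>f'. (f has_derivative f') (at z) \<and> (\<forall>c v. f' (c *s v) = c * f' v))"

definition holomorphic_near :: "(complex^'m::finite \<Rightarrow> complex) \<Rightarrow> complex^'m \<Rightarrow> bool" where
  "holomorphic_near f p \<longleftrightarrow> (\<exists>U. p \<in> U \<and> holomorphic_on_open f U)"

text \<open>
  Membership of the germ of \<open>f\<close> at \<open>p\<close> in the ideal generated by the finite set \<open>G\<close>
  in the ring of germs of holomorphic functions at \<open>p\<close>.
\<close>

definition in_germ_ideal ::
    "complex^'m::finite \<Rightarrow> (complex^'m \<Rightarrow> complex) set \<Rightarrow> (complex^'m \<Rightarrow> complex) \<Rightarrow> bool" where
  "in_germ_ideal p G f \<longleftrightarrow>
     (\<exists>U a. p \<in> U \<and> open U \<and> (\<forall>g\<in>G. holomorphic_on_open (a g) U) \<and>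
            (\<forall>z\<in>U. f z = (\<Sum>g\<in>G. a g z * g z)))"

text \<open>
  Isomorphism of the complex space germs at \<open>p\<close> and \<open>q\<close> with the finite sets of
  equations \<open>G\<close> and \<open>H\<close>, in possibly different ambient dimensions.  A morphism of germs
  is induced by a holomorphic map \<open>\<Phi>\<close> of the ambient germs that pulls the equations of
  the target back into the ideal of the source; two such maps induce the same morphism iff
  their components agree modulo the ideal of the source.
\<close>

definition germs_isomorphic ::
    "complex^'a::finite \<Rightarrow> (complex^'a \<Rightarrow> complex) set \<Rightarrow>
     complex^'b::finite \<Rightarrow> (complex^'b \<Rightarrow> complex) set \<Rightarrow> bool" where
  "germs_isomorphic p G q H \<longleftrightarrow>
     (\<exists>(\<Phi> :: complex^'a \<Rightarrow> complex^'b) (\<Psi> :: complex^'b \<Rightarrow> complex^'a).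
        (\<forall>i. holomorphic_near (\<lambda>z. \<Phi> z $ i) p) \<and> \<Phi> p = q \<and>
        (\<forall>i. holomorphic_near (\<lambda>w. \<Psi> w $ i) q) \<and> \<Psi> q = p \<and>
        (\<forall>h\<in>H. in_germ_ideal p G (h \<circ> \<Phi>)) \<and>
        (\<forall>g\<in>G. in_germ_ideal q H (g \<circ> \<Psi>)) \<and>
        (\<forall>i. in_germ_ideal p G (\<lambda>z. \<Psi> (\<Phi> z) $ i - z $ i)) \<and>
        (\<forall>i. in_germ_ideal q H (\<lambda>w. \<Phi> (\<Psi> w) $ i - w $ i)))"


section \<open>Nodal threefolds\<close>

text \<open>
  The standard chart where the coordinate \<open>i\<close> is nonzero is identified with the affine
  hyperplane \<open>z $ i = 1\<close>; whence the extra equation.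
\<close>

definition ordinary_double_point :: "'n::finite cpoly set \<Rightarrow> complex^'n \<Rightarrow> bool" where
  "ordinary_double_point G x \<longleftrightarrow>
     (\<exists>i. x $ i \<noteq> 0 \<and>
        germs_isomorphic
          (inverse (x $ i) *s x)
          (insert (\<lambda>z. z $ i - 1) ((\<lambda>g z. poly_val (($) z) g) ` G))
          (0 :: complex^4)
          {\<lambda>w. \<Sum>j\<in>UNIV. (w $ j)\<^sup>2})"

text \<open>
  Here \<open>G\<close> is a finite set of forms, and the threefold is the closed subscheme with
  equations \<open>G\<close>.
  It is automatically reduced: its local rings are regular or those of an ordinary double point.
\<close>

definition nodal_threefold :: "'n::finite cpoly set \<Rightarrow> bool" where
  "nodal_threefold G \<longleftrightarrow>
     irreducible_set (zero_locus G) \<and> has_dimension (zero_locus G) 3 \<and>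
     (\<forall>x\<in>zero_locus G. vec.dim (tangent_space G x) = 3 + 1 \<or> ordinary_double_point G x)"

text \<open>The codimension equals the number \<open>r\<close> of equations.\<close>

definition complete_intersection :: "nat \<Rightarrow> (nat \<Rightarrow> 'n::finite cpoly) \<Rightarrow> bool" where
  "complete_intersection r F \<longleftrightarrow>
     (\<exists>k. has_dimension (zero_locus (F ` {..<r})) k \<and> k + r = CARD('n) - 1)"

end

theory Submission
  imports Defs "HOL-Complex_Analysis.Complex_Analysis" "HOL-Computational_Algebra.Fundamental_Theorem_Algebra"
begin

text \<open>
  Let \<open>g 0, \<dots>\<close> be a basis of the forms of degree \<open>d\<close> through \<open>D\<close>, and let \<open>X t\<close> be cut out by the \<open>r = s - 1\<close>
  forms \<open>F t j\<close>, the sums of the \<open>t (j, i) g i\<close>.  If the parameters \<open>t\<close> with a bad point were contained in no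
  hypersurface of the parameter space, then the bad locus would have a tangent vector that moves only one
  chosen \<open>t (j, i)\<close>, and differentiating the equations of the bad locus along it gives a contradiction.  Hence, for general \<open>t\<close>, \<open>X t\<close> is smooth outside \<open>D\<close>, and near a
  singular point, which lies on \<open>D\<close>, it is given in a smooth fourfold by
  \<open>f = y\<^sub>1 A + y\<^sub>2 B\<close>, where \<open>D\<close> is \<open>y\<^sub>1 = y\<^sub>2 = 0\<close> and \<open>y\<^sub>1, A, y\<^sub>2, B\<close> are
  coordinates: an ordinary double point, whose punctured neighbourhood is connected.

  The smooth locus of \<open>X t\<close> is connected: given a smooth point \<open>x\<close>, take a line from \<open>x\<close> to a point near a fixed
  \<open>x0 \<in> D\<close> and modify the equations so that they vanish along the line; the parameters on the line at which the
  moving point lies in the component of \<open>x0\<close> form an open and closed subset of the complex plane minus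
  a finite set.  Irreducibility follows by the identity theorem.  A chain of \<open>k + 1\<close> irreducible
  closed subsets yields \<open>k + 1\<close> polynomials that are algebraically independent on the cone over the
  largest one; five of them on \<open>X t\<close> contradict the same tangent vector argument, because their differentials are
  dependent at every smooth point.
\<close>

text \<open>The tangent vector of the overview is found by accumulation. All parameters but one are
  fixed and every witness is made algebraic over the remaining one; the weak Nullstellensatz then
  provides points over uncountably many of its values, and some of these accumulate at one of their
  number. Uncountability of the complex numbers thus does the work of generic smoothness, for
  smoothness off \<open>D\<close>, for nondegeneracy on \<open>D\<close> and for the bound on the
  dimension.

  The point \<open>x0\<close> lies on every member of the system, and general members are smooth
  there. So \<open>x0\<close> marks one component of the smooth locus throughout a family, and
  connectedness becomes a question about a single moving point. The family that follows this point
  starts and ends at the same parameter \<open>t\<close>.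

  The remaining danger is that a node separates the smooth locus. It does not, because the cone
  \<open>w1 w2 + w3 w4 = 0\<close> without its vertex is an image of a product of two punctured
  neighbourhoods of 0 in the plane, hence connected.\<close>

no_notation fps_nth (infixl \<open>$\<close> 75)

section \<open>Polynomial functions\<close>

text \<open>Polynomials are treated as functions: over an infinite field nothing is lost, and
  substitution, determinants and derivatives need no bookkeeping of coefficients. The set
  \<open>V\<close> bounds the variables that may occur, which is what elimination has to
  control.\<close>

inductive polyfn :: "'v set \<Rightarrow> (('v \<Rightarrow> complex) \<Rightarrow> complex) \<Rightarrow> bool" for V where
  polyfn_const: "polyfn V (\<lambda>_. c)"
| polyfn_var: "v \<in> V \<Longrightarrow> polyfn V (\<lambda>z. z v)"
| polyfn_add: "polyfn V f \<Longrightarrow> polyfn V g \<Longrightarrow> polyfn V (\<lambda>z. f z + g z)"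
| polyfn_mult: "polyfn V f \<Longrightarrow> polyfn V g \<Longrightarrow> polyfn V (\<lambda>z. f z * g z)"

lemma polyfn_mono: "polyfn S f \<Longrightarrow> S \<subseteq> T \<Longrightarrow> polyfn T f"
  by (induction rule: polyfn.induct) (auto intro: polyfn.intros)

lemma polyfn_sum: "(\<And>i. i \<in> A \<Longrightarrow> polyfn V (f i)) \<Longrightarrow> polyfn V (\<lambda>z. \<Sum>i\<in>A. f i z)"
  by (induction A rule: infinite_finite_induct) (auto intro: polyfn.intros)

lemma polyfn_prod: "(\<And>i. i \<in> A \<Longrightarrow> polyfn V (f i)) \<Longrightarrow> polyfn V (\<lambda>z. \<Prod>i\<in>A. f i z)"
  by (induction A rule: infinite_finite_induct) (auto intro: polyfn.intros)

lemma polyfn_power: "polyfn V f \<Longrightarrow> polyfn V (\<lambda>z. f z ^ n)"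
  by (induction n) (auto intro: polyfn.intros)

lemma polyfn_uminus: "polyfn V f \<Longrightarrow> polyfn V (\<lambda>z. - f z)"
  using polyfn_mult[OF polyfn_const[of V "-1"], of f] by simp

lemma polyfn_diff: "polyfn V f \<Longrightarrow> polyfn V g \<Longrightarrow> polyfn V (\<lambda>z. f z - g z)"
  using polyfn_add[of V f "\<lambda>z. - g z"] polyfn_uminus[of V g] by simp

lemmas polyfn_intros = polyfn_const polyfn_var polyfn_add polyfn_mult polyfn_sum polyfn_prod
  polyfn_power polyfn_uminus polyfn_diff

lemma polyfn_cong: "polyfn V f \<Longrightarrow> (\<And>v. v \<in> V \<Longrightarrow> z v = z' v) \<Longrightarrow> f z = f z'"
  by (induction rule: polyfn.induct) auto

lemma polyfn_comp:
  "polyfn V f \<Longrightarrow> (\<And>v. v \<in> V \<Longrightarrow> polyfn W (h v)) \<Longrightarrow> polyfn W (\<lambda>z. f (\<lambda>v. h v z))"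
  by (induction rule: polyfn.induct) (auto intro: polyfn.intros)

lemma continuous_on_polyfn:
  fixes h :: "'a::topological_space \<Rightarrow> 'v \<Rightarrow> complex"
  shows "polyfn V f \<Longrightarrow> (\<And>v. v \<in> V \<Longrightarrow> continuous_on S (\<lambda>x. h x v)) \<Longrightarrow>
    continuous_on S (\<lambda>x. f (h x))"
  by (induction rule: polyfn.induct) (auto intro!: continuous_intros)

lemma tendsto_polyfn:
  "polyfn V f \<Longrightarrow> (\<And>v. v \<in> V \<Longrightarrow> ((\<lambda>x. h x v) \<longlongrightarrow> l v) F) \<Longrightarrow> ((\<lambda>x. f (h x)) \<longlongrightarrow> f l) F"
  by (induction rule: polyfn.induct) (auto intro!: tendsto_intros)

lemma holomorphic_on_polyfn:
  "polyfn V f \<Longrightarrow> (\<And>v. v \<in> V \<Longrightarrow> (\<lambda>x. h x v) holomorphic_on S) \<Longrightarrow>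
    (\<lambda>x. f (h x)) holomorphic_on S"
  by (induction rule: polyfn.induct) (auto intro!: holomorphic_intros)

lemma polyfn_expand:
  assumes "polyfn (insert y T) Q"
  shows "\<exists>m q. (\<forall>j. polyfn T (q j)) \<and> (\<forall>z. Q z = (\<Sum>j<(m::nat). q j z * z y ^ j))"
  using assms
proof (induction rule: polyfn.induct)
  case (polyfn_const c)
  show ?case
    by (rule exI[of _ 1], rule exI[of _ "\<lambda>_ _. c"]) (auto intro: polyfn.intros)
next
  case (polyfn_var v)
  show ?case
  proof (cases "v \<in> T")
    case True
    then show ?thesis
      by (intro exI[of _ 1] exI[of _ "\<lambda>_ z. z v"]) (auto intro: polyfn.intros)
  next
    case False
    with polyfn_var have "v = y" by simp
    then show ?thesis
      by (intro exI[of _ 2] exI[of _ "\<lambda>j _. if j = 1 then 1 else 0"])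
        (auto intro: polyfn.intros simp: numeral_2_eq_2)
  qed
next
  case (polyfn_add f g)
  then obtain m q m' q' where *: "\<forall>j. polyfn T (q j)" "\<forall>j. polyfn T (q' j)"
    "\<And>z. f z = (\<Sum>j<(m::nat). q j z * z y ^ j)" "\<And>z. g z = (\<Sum>j<(m'::nat). q' j z * z y ^ j)"
    by blast
  define r where "r j z = (if j < m then q j z else 0) + (if j < m' then q' j z else 0)" for j z
  have "polyfn T (r j)" for j
    unfolding r_def using * by (cases "j < m"; cases "j < m'") (auto intro!: polyfn_intros)
  moreover have "f z + g z = (\<Sum>j<max m m'. r j z * z y ^ j)" for z
  proof -
    have "f z = (\<Sum>j<max m m'. (if j < m then q j z else 0) * z y ^ j)"
      unfolding * by (rule sum.mono_neutral_cong_left) auto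
    moreover have "g z = (\<Sum>j<max m m'. (if j < m' then q' j z else 0) * z y ^ j)"
      unfolding * by (rule sum.mono_neutral_cong_left) auto
    ultimately show ?thesis by (simp add: r_def sum.distrib distrib_right)
  qed
  ultimately show ?case by blast
next
  case (polyfn_mult f g)
  then obtain m q m' q' where *: "\<forall>j. polyfn T (q j)" "\<forall>j. polyfn T (q' j)"
    "\<And>z. f z = (\<Sum>j<(m::nat). q j z * z y ^ j)" "\<And>z. g z = (\<Sum>j<(m'::nat). q' j z * z y ^ j)"
    by blast
  define r where "r k z = (\<Sum>(i,j)\<in>{p\<in>{..<m}\<times>{..<m'}. fst p + snd p = k}. q i z * q' j z)" for k z
  have "polyfn T (r k)" for k
    unfolding r_def using * by (auto intro!: polyfn_intros simp: case_prod_beta)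
  moreover have "f z * g z = (\<Sum>k<m+m'. r k z * z y ^ k)" for z
  proof -
    have "f z * g z = (\<Sum>p\<in>{..<m}\<times>{..<m'}. q (fst p) z * q' (snd p) z * z y ^ (fst p + snd p))"
      unfolding * sum_product sum.cartesian_product
      by (rule sum.cong) (simp_all add: case_prod_beta power_add mult_ac)
    also have "\<dots> = (\<Sum>k<m+m'. \<Sum>p\<in>{p\<in>{..<m}\<times>{..<m'}. fst p + snd p = k}.
        q (fst p) z * q' (snd p) z * z y ^ (fst p + snd p))"
      by (rule sum.group[symmetric]) auto
    also have "\<dots> = (\<Sum>k<m+m'. r k z * z y ^ k)"
      by (auto simp: r_def sum_distrib_right case_prod_beta intro!: sum.cong)
    finally show ?thesis .
  qed
  ultimately show ?case by blast
qed

text \<open>Induction with \<open>f' g' - f g = f' (g' - g) + g (f' - f)\<close>. In the doubled set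
  of variables \<open>Inl\<close> holds the point \<open>z\<close> and \<open>Inr\<close> the point
  \<open>z'\<close>. The quotients are polynomials in both points, so their diagonal values are the
  partial derivatives, and difference quotients have limits along sequences as well as along
  curves.\<close>

lemma polyfn_hadamard:
  assumes "polyfn V f" "finite V"
  shows "\<exists>A. (\<forall>v. polyfn (Inl ` V \<union> Inr ` V) (A v)) \<and>
    (\<forall>z z'. f z' - f z = (\<Sum>v\<in>V. A v (case_sum z z') * (z' v - z v)))"
  using assms(1)
proof (induction rule: polyfn.induct)
  case (polyfn_const c)
  then show ?case by (intro exI[of _ "\<lambda>_ _. 0"]) (auto intro: polyfn.intros)
next
  case (polyfn_var v)
  have "z' v - z v = (\<Sum>i\<in>V. (if i = v then 1 else 0) * (z' i - z i))" for z z' :: "'a \<Rightarrow> complex"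
    using polyfn_var \<open>finite V\<close> by (simp add: if_distrib[of "\<lambda>x. x * _"] cong: if_cong)
  then show ?case
    by (intro exI[of _ "\<lambda>i _. if i = v then 1 else 0"]) (auto intro: polyfn.intros)
next
  case (polyfn_add f g)
  then obtain A B where *: "\<forall>v. polyfn (Inl ` V \<union> Inr ` V) (A v)" "\<forall>v. polyfn (Inl ` V \<union> Inr ` V) (B v)"
    "\<And>z z'. f z' - f z = (\<Sum>v\<in>V. A v (case_sum z z') * (z' v - z v))"
    "\<And>z z'. g z' - g z = (\<Sum>v\<in>V. B v (case_sum z z') * (z' v - z v))" by blast
  have "f z' + g z' - (f z + g z) =
      (\<Sum>v\<in>V. (A v (case_sum z z') + B v (case_sum z z')) * (z' v - z v))" for z z'
    unfolding add_diff_add * by (simp add: distrib_right sum.distrib)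
  with *(1,2) show ?case
    by (intro exI[of _ "\<lambda>v z. A v z + B v z"]) (auto intro: polyfn.intros(3))
next
  case (polyfn_mult f g)
  then obtain A B where *: "\<forall>v. polyfn (Inl ` V \<union> Inr ` V) (A v)" "\<forall>v. polyfn (Inl ` V \<union> Inr ` V) (B v)"
    "\<And>z z'. f z' - f z = (\<Sum>v\<in>V. A v (case_sum z z') * (z' v - z v))"
    "\<And>z z'. g z' - g z = (\<Sum>v\<in>V. B v (case_sum z z') * (z' v - z v))" by blast
  have "polyfn (Inl ` V \<union> Inr ` V) (\<lambda>z. f (\<lambda>v. z (Inr v)))"
    "polyfn (Inl ` V \<union> Inr ` V) (\<lambda>z. g (\<lambda>v. z (Inl v)))"
    using polyfn_mult.hyps
      polyfn_comp[of V f "Inl ` V \<union> Inr ` V" "\<lambda>v z. z (Inr v)"]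
      polyfn_comp[of V g "Inl ` V \<union> Inr ` V" "\<lambda>v z. z (Inl v)"]
    by (simp_all add: polyfn_var)
  moreover have "f z' * g z' - f z * g z =
      (\<Sum>v\<in>V. (f (\<lambda>v. case_sum z z' (Inr v)) * B v (case_sum z z') +
        g (\<lambda>v. case_sum z z' (Inl v)) * A v (case_sum z z')) * (z' v - z v))" for z z'
  proof -
    have "f z' * g z' - f z * g z = f z' * (g z' - g z) + g z * (f z' - f z)"
      by (simp add: algebra_simps)
    then show ?thesis
      unfolding *(3,4) by (simp add: sum_distrib_left distrib_right sum.distrib mult.assoc)
  qed
  ultimately show ?case using *(1,2)
    by (intro exI[of _ "\<lambda>v z. f (\<lambda>v. z (Inr v)) * B v z + g (\<lambda>v. z (Inl v)) * A v z"])
      (auto intro!: polyfn.intros(3,4))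
qed

section \<open>Partial derivatives and zeros of polynomial functions\<close>

definition pdv :: "'v \<Rightarrow> (('v \<Rightarrow> complex) \<Rightarrow> complex) \<Rightarrow> ('v \<Rightarrow> complex) \<Rightarrow> complex" where
  "pdv v f z = deriv (\<lambda>h. f (z(v := h))) (z v)"

lemma polyfn_line_deriv_hadamard:
  assumes A: "\<And>v. polyfn (Inl ` V \<union> Inr ` V) (A v)"
    "\<And>z z'. f z' - f z = (\<Sum>v\<in>V. A v (case_sum z z') * (z' v - z v))"
    and w: "\<And>v. v \<in> V \<Longrightarrow> ((\<lambda>t. c t v) has_field_derivative w v) (at t0)"
  shows "((\<lambda>t. f (c t)) has_field_derivative (\<Sum>v\<in>V. A v (case_sum (c t0) (c t0)) * w v)) (at t0)"
proof -
  have "((\<lambda>t. \<Sum>v\<in>V. A v (case_sum (c t0) (c t)) * ((c t v - c t0 v) / (t - t0))) \<longlongrightarrow>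
      (\<Sum>v\<in>V. A v (case_sum (c t0) (c t0)) * w v)) (at t0)"
  proof (intro tendsto_sum tendsto_mult)
    fix v assume v: "v \<in> V"
    have lim: "((\<lambda>t. c t v) \<longlongrightarrow> c t0 v) (at t0)" if "v \<in> V" for v
      using DERIV_isCont[OF w[OF that]] by (simp add: isCont_def)
    show "((\<lambda>t. A v (case_sum (c t0) (c t))) \<longlongrightarrow> A v (case_sum (c t0) (c t0))) (at t0)"
      by (rule tendsto_polyfn[OF A(1)]) (auto intro: lim)
    show "((\<lambda>t. (c t v - c t0 v) / (t - t0)) \<longlongrightarrow> w v) (at t0)"
      using w[OF v] by (simp add: has_field_derivative_iff)
  qed
  moreover have "(\<Sum>v\<in>V. A v (case_sum (c t0) (c t)) * ((c t v - c t0 v) / (t - t0))) =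
      (f (c t) - f (c t0)) / (t - t0)" for t
    unfolding A(2) by (simp add: sum_divide_distrib)
  ultimately show ?thesis by (simp add: has_field_derivative_iff)
qed

lemma pdv_eq_hadamard:
  assumes A: "\<And>v. polyfn (Inl ` V \<union> Inr ` V) (A v)"
    "\<And>z z'. f z' - f z = (\<Sum>v\<in>V. A v (case_sum z z') * (z' v - z v))"
    and "v \<in> V" "finite V"
  shows "pdv v f z = A v (case_sum z z)"
proof -
  have "((\<lambda>t. f (z(v := t))) has_field_derivative
      (\<Sum>i\<in>V. A i (case_sum (z(v := z v)) (z(v := z v))) * (if i = v then 1 else 0))) (at (z v))"
    by (rule polyfn_line_deriv_hadamard[OF A]) (auto intro!: derivative_eq_intros)
  then show ?thesis
    unfolding pdv_def using assms(3,4)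
    by (auto dest!: DERIV_imp_deriv simp: if_distrib[of "\<lambda>x. _ * x"] cong: if_cong)
qed

lemma polyfn_pdv:
  assumes "polyfn V f" "finite V" "v \<in> V"
  shows "polyfn V (pdv v f)"
proof -
  obtain A where A: "\<And>v. polyfn (Inl ` V \<union> Inr ` V) (A v)"
    "\<And>z z'. f z' - f z = (\<Sum>v\<in>V. A v (case_sum z z') * (z' v - z v))"
    using polyfn_hadamard[OF assms(1,2)] by metis
  have "polyfn V (\<lambda>z. A v (\<lambda>s. (case s of Inl i \<Rightarrow> (\<lambda>z. z i) | Inr i \<Rightarrow> (\<lambda>z. z i)) z))"
    by (rule polyfn_comp[OF A(1)]) (auto intro: polyfn_var)
  also have "(\<lambda>z. A v (\<lambda>s. (case s of Inl i \<Rightarrow> (\<lambda>z. z i) | Inr i \<Rightarrow> (\<lambda>z. z i)) z)) = pdv v f"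
  proof
    fix z :: "'a \<Rightarrow> complex"
    have "(\<lambda>s. (case s of Inl i \<Rightarrow> (\<lambda>z. z i) | Inr i \<Rightarrow> (\<lambda>z. z i)) z) = case_sum z z"
      by (auto split: sum.split)
    then show "A v (\<lambda>s. (case s of Inl i \<Rightarrow> (\<lambda>z. z i) | Inr i \<Rightarrow> (\<lambda>z. z i)) z) = pdv v f z"
      using pdv_eq_hadamard[OF A assms(3,2)] by simp
  qed
  finally show ?thesis .
qed

lemma polyfn_chain:
  assumes "polyfn V f" "finite V" "\<And>v. v \<in> V \<Longrightarrow> ((\<lambda>t. c t v) has_field_derivative w v) (at t0)"
  shows "((\<lambda>t. f (c t)) has_field_derivative (\<Sum>v\<in>V. pdv v f (c t0) * w v)) (at t0)"
proof -
  obtain A where A: "\<And>v. polyfn (Inl ` V \<union> Inr ` V) (A v)"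
    "\<And>z z'. f z' - f z = (\<Sum>v\<in>V. A v (case_sum z z') * (z' v - z v))"
    using polyfn_hadamard[OF assms(1,2)] by metis
  have "pdv v f (c t0) = A v (case_sum (c t0) (c t0))" if "v \<in> V" for v
    using pdv_eq_hadamard[OF A that assms(2)] .
  then show ?thesis
    using polyfn_line_deriv_hadamard[OF A assms(3)] by simp
qed

text \<open>On the line in direction \<open>v\<close> the function is entire and all its Taylor
  coefficients at \<open>z v\<close> are 0. Read contrapositively, a polynomial that is nonzero on
  this line has finite order there.\<close>

lemma polyfn_iterated_pdv_zero:
  assumes f: "polyfn V f" "finite V" "v \<in> V" and z: "\<And>j. (pdv v ^^ j) f z = 0"
  shows "f (z(v := h)) = 0"
proof -
  have it: "polyfn V ((pdv v ^^ j) f)" for j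
    by (induction j) (auto intro: polyfn_pdv f)
  have der: "(deriv ^^ j) (\<lambda>h. f (z(v := h))) = (\<lambda>h. (pdv v ^^ j) f (z(v := h)))" for j
  proof (induction j)
    case (Suc j)
    have "deriv (\<lambda>h. (pdv v ^^ j) f (z(v := h))) h = pdv v ((pdv v ^^ j) f) (z(v := h))" for h
      by (simp add: pdv_def)
    then have "deriv (\<lambda>h. (pdv v ^^ j) f (z(v := h))) = (\<lambda>h. pdv v ((pdv v ^^ j) f) (z(v := h)))"
      by (rule ext)
    with Suc show ?case by (simp del: fun_upd_apply)
  qed auto
  have hol: "(\<lambda>h. f (z(v := h))) holomorphic_on UNIV"
  proof (rule holomorphic_on_polyfn[OF f(1)])
    fix i show "(\<lambda>h. (z(v := h)) i) holomorphic_on UNIV"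
      by (cases "i = v") (auto intro: holomorphic_intros)
  qed
  have "(\<lambda>h. f (z(v := h))) h = 0"
    by (rule holomorphic_fun_eq_0_on_connected[OF hol, where z = "z v"])
      (use der z in \<open>auto simp: fun_eq_iff\<close>)
  then show ?thesis .
qed

lemma polyfn_zeros_finite:
  assumes "polyfn {v} f" "f z0 \<noteq> 0"
  shows "finite {c. f (z(v := c)) = 0}"
proof -
  obtain m q where q: "\<And>j. polyfn {} (q j)" "\<And>z. f z = (\<Sum>j<(m::nat). q j z * z v ^ j)"
    using polyfn_expand[of v "{}" f] assms(1) by auto
  define p where "p = (\<Sum>j<m. monom (q j z) j)"
  have q': "q j z' = q j z" for j z' by (rule polyfn_cong[OF q(1)]) auto
  have p: "poly p c = f (z'(v := c))" for c z'
    unfolding p_def by (simp add: q(2) poly_sum poly_monom q'[of _ "z'(v := c)"])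
  have "poly p (z0 v) \<noteq> 0" using p[of "z0 v" z0] assms(2) by simp
  then have "finite {c. poly p c = 0}" using poly_roots_finite[of p] by fastforce
  then show ?thesis using p[of _ z] by simp
qed

lemma polyfn_line_zeros_finite:
  assumes f: "polyfn V f" "finite V" and l: "\<And>v. v \<in> V \<Longrightarrow> polyfn {()} (\<lambda>z. l (z ()) v)"
    and "f (l c0) \<noteq> 0"
  shows "finite {c. f (l c) = 0}"
proof -
  have "polyfn {()} (\<lambda>z. f (\<lambda>v. l (z ()) v))"
    using polyfn_comp[OF f(1), where W = "{()}" and h = "\<lambda>v z. l (z ()) v"] l by auto
  from polyfn_zeros_finite[OF this, where z0 = "\<lambda>_. c0" and z = "\<lambda>_. 0"] assms(4)
  show ?thesis by simp
qed

text \<open>On the line through \<open>z\<close> and \<open>z'\<close> neither function vanishes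
  identically, so each has only finitely many zeros on it.\<close>

lemma polyfn_mult_nonzero:
  assumes "polyfn V f" "polyfn V g" "finite V" "f z \<noteq> 0" "g z' \<noteq> 0"
  shows "\<exists>z. f z * g z \<noteq> 0"
proof -
  define l where "l c v = z v + c * (z' v - z v)" for c :: complex and v
  have l: "polyfn {()} (\<lambda>x. l (x ()) v)" for v
    unfolding l_def by (auto intro!: polyfn_intros)
  have [simp]: "l 0 = z" "l 1 = z'" by (auto simp: l_def)
  have "finite {c. f (l c) = 0}" "finite {c. g (l c) = 0}"
    using polyfn_line_zeros_finite[OF assms(1,3) l, of 0] polyfn_line_zeros_finite[OF assms(2,3) l, of 1]
      assms by auto
  then have "finite ({c. f (l c) = 0} \<union> {c. g (l c) = 0})" by simp
  then obtain c where "c \<notin> {c. f (l c) = 0} \<union> {c. g (l c) = 0}"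
    using ex_new_if_finite infinite_UNIV_char_0 by metis
  then show ?thesis by (intro exI[of _ "l c"]) auto
qed

lemma polyfn_prod_nonzero:
  assumes "finite A" "finite V" "\<And>i. i \<in> A \<Longrightarrow> polyfn V (f i)" "\<And>i. i \<in> A \<Longrightarrow> \<exists>z. f i z \<noteq> 0"
  shows "\<exists>z. (\<Prod>i\<in>A. f i z) \<noteq> 0"
  using assms
proof (induction A rule: finite_induct)
  case (insert a A)
  then obtain z z' where "(\<Prod>i\<in>A. f i z) \<noteq> 0" "f a z' \<noteq> 0" by blast
  then obtain z where "f a z * (\<Prod>i\<in>A. f i z) \<noteq> 0"
    using polyfn_mult_nonzero[of V "f a" "\<lambda>z. \<Prod>i\<in>A. f i z" z' z] insert
    by (auto intro!: polyfn_prod)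
  then show ?case using insert by auto
qed auto

section \<open>A weak Nullstellensatz\<close>

text \<open>Gaussian elimination by induction on the number of equations: a nonzero entry
  \<open>\<alpha> p N\<close> is the pivot of the last one.\<close>

lemma linear_dependence:
  fixes \<alpha> :: "'a \<Rightarrow> nat \<Rightarrow> complex"
  assumes "finite A" "card A > N"
  shows "\<exists>l. (\<exists>a\<in>A. l a \<noteq> 0) \<and> (\<forall>i<N. (\<Sum>a\<in>A. l a * \<alpha> a i) = 0)"
  using assms
proof (induction N arbitrary: A \<alpha>)
  case 0
  then show ?case by (intro exI[of _ "\<lambda>_. 1"]) (auto simp: card_gt_0_iff)
next
  case (Suc N)
  show ?case
  proof (cases "\<exists>p\<in>A. \<alpha> p N \<noteq> 0")
    case False
    obtain l where "\<exists>a\<in>A. l a \<noteq> 0" "\<forall>i<N. (\<Sum>a\<in>A. l a * \<alpha> a i) = 0"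
      using Suc.IH[of A \<alpha>] Suc.prems by auto
    then show ?thesis using False by (intro exI[of _ l]) (auto simp: less_Suc_eq)
  next
    case True
    then obtain p where p: "p \<in> A" "\<alpha> p N \<noteq> 0" by blast
    define \<beta> where "\<beta> a i = \<alpha> a i - \<alpha> a N / \<alpha> p N * \<alpha> p i" for a i
    have "card (A - {p}) > N" using Suc.prems p by (simp add: card_Diff_singleton)
    then obtain m where m: "\<exists>a\<in>A-{p}. m a \<noteq> 0" "\<And>i. i < N \<Longrightarrow> (\<Sum>a\<in>A-{p}. m a * \<beta> a i) = 0"
      using Suc.IH[of "A - {p}" \<beta>] Suc.prems by auto
    \<comment> \<open>With this value at the pivot every equation for \<open>l\<close> and
      \<open>\<alpha>\<close> turns into the one for \<open>m\<close> and \<open>\<beta>\<close>;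
      for the last equation the latter is trivial because \<open>\<beta> a N = 0\<close>.\<close>
    define s where "s = - (\<Sum>a\<in>A-{p}. m a * (\<alpha> a N / \<alpha> p N))"
    define l where "l a = (if a = p then s else m a)" for a
    have sp: "(\<Sum>a\<in>A. l a * \<alpha> a i) = s * \<alpha> p i + (\<Sum>a\<in>A-{p}. m a * \<alpha> a i)" for i
      using Suc.prems(1) p(1) by (auto simp: sum.remove[of A p] l_def intro!: sum.cong)
    have "(\<Sum>a\<in>A. l a * \<alpha> a i) = (\<Sum>a\<in>A-{p}. m a * \<beta> a i)" for i
      unfolding sp \<beta>_def s_def
      by (simp add: right_diff_distrib sum_subtractf sum_distrib_right mult.assoc)
    moreover have "\<beta> a N = 0" for a using p by (simp add: \<beta>_def)
    ultimately have "\<forall>i<Suc N. (\<Sum>a\<in>A. l a * \<alpha> a i) = 0"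
      using m by (auto simp: less_Suc_eq)
    moreover have "\<exists>a\<in>A. l a \<noteq> 0" using m by (auto simp: l_def)
    ultimately show ?thesis by blast
  qed
qed

text \<open>Monomials are coded by lists of variables, so one monomial has many codes. This is
  harmless: only the countability of \<open>lists V\<close> is going to matter.\<close>

definition mono_fn :: "'v list \<Rightarrow> ('v \<Rightarrow> complex) \<Rightarrow> complex" where
  "mono_fn xs z = prod_list (map z xs)"

lemma polyfn_monomials:
  assumes "polyfn V f"
  shows "\<exists>L c. finite L \<and> L \<subseteq> lists V \<and> (\<forall>z. f z = (\<Sum>xs\<in>L. c xs * mono_fn xs z))"
  using assms
proof (induction rule: polyfn.induct)
  case (polyfn_const c)
  then show ?case by (intro exI[of _ "{[]}"] exI[of _ "\<lambda>_. c"]) (auto simp: mono_fn_def)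
next
  case (polyfn_var v)
  then show ?case by (intro exI[of _ "{[v]}"] exI[of _ "\<lambda>_. 1"]) (auto simp: mono_fn_def)
next
  case (polyfn_add f g)
  then obtain L c M d where *: "finite L" "L \<subseteq> lists V" "finite M" "M \<subseteq> lists V"
    "\<And>z. f z = (\<Sum>xs\<in>L. c xs * mono_fn xs z)" "\<And>z. g z = (\<Sum>xs\<in>M. d xs * mono_fn xs z)"
    by blast
  define e where "e xs = (if xs \<in> L then c xs else 0) + (if xs \<in> M then d xs else 0)" for xs
  have "f z = (\<Sum>xs\<in>L\<union>M. (if xs \<in> L then c xs else 0) * mono_fn xs z)"
    "g z = (\<Sum>xs\<in>L\<union>M. (if xs \<in> M then d xs else 0) * mono_fn xs z)" for z
    unfolding * using *(1,3) by (auto intro!: sum.mono_neutral_cong_left)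
  then have "f z + g z = (\<Sum>xs\<in>L\<union>M. e xs * mono_fn xs z)" for z
    by (simp add: e_def distrib_right sum.distrib)
  then show ?case using *(1-4)
    by (intro exI[of _ "L \<union> M"] exI[of _ e]) auto
next
  case (polyfn_mult f g)
  then obtain L c M d where *: "finite L" "L \<subseteq> lists V" "finite M" "M \<subseteq> lists V"
    "\<And>z. f z = (\<Sum>xs\<in>L. c xs * mono_fn xs z)" "\<And>z. g z = (\<Sum>xs\<in>M. d xs * mono_fn xs z)"
    by blast
  define N where "N = (\<lambda>(xs,ys). xs @ ys) ` (L \<times> M)"
  define e where "e zs = (\<Sum>p\<in>{p\<in>L\<times>M. fst p @ snd p = zs}. c (fst p) * d (snd p))" for zs
  have "f z * g z = (\<Sum>zs\<in>N. e zs * mono_fn zs z)" for z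
  proof -
    have "f z * g z = (\<Sum>p\<in>L\<times>M. c (fst p) * d (snd p) * mono_fn (fst p @ snd p) z)"
      unfolding * sum_product sum.cartesian_product
      by (rule sum.cong) (simp_all add: case_prod_beta mono_fn_def mult_ac)
    also have "\<dots> = (\<Sum>zs\<in>N. \<Sum>p\<in>{p\<in>L\<times>M. fst p @ snd p = zs}.
        c (fst p) * d (snd p) * mono_fn (fst p @ snd p) z)"
      by (rule sum.group[symmetric]) (use *(1,3) in \<open>auto simp: N_def\<close>)
    also have "\<dots> = (\<Sum>zs\<in>N. e zs * mono_fn zs z)"
      by (auto simp: e_def sum_distrib_right intro!: sum.cong)
    finally show ?thesis .
  qed
  moreover have "N \<subseteq> lists V" using *(2,4) by (force simp: N_def)
  ultimately show ?case using *(1,3)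
    by (intro exI[of _ N] exI[of _ e]) (auto simp: N_def)
qed

text \<open>Polynomials in finitely many variables form a space of countable dimension.\<close>

lemma uncountable_polyfn_dependent:
  assumes V: "finite V" and E: "uncountable E" and g: "\<And>c. c \<in> E \<Longrightarrow> polyfn V (g c)"
  shows "\<exists>C l. finite C \<and> C \<subseteq> E \<and> (\<exists>c\<in>C. l c \<noteq> 0) \<and> (\<forall>z. (\<Sum>c\<in>C. l c * g c z) = 0)"
proof -
  have "\<forall>c\<in>E. \<exists>L a. finite L \<and> L \<subseteq> lists V \<and> (\<forall>z. g c z = (\<Sum>xs\<in>L. a xs * mono_fn xs z))"
    using polyfn_monomials[OF g] by blast
  then obtain L a where La: "\<And>c. c \<in> E \<Longrightarrow> finite (L c) \<and> L c \<subseteq> lists V"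
    "\<And>c z. c \<in> E \<Longrightarrow> g c z = (\<Sum>xs\<in>L c. a c xs * mono_fn xs z)" by metis
  have cK: "countable {K. finite K \<and> K \<subseteq> lists V}"
    using countable_Collect_finite_subset[of "lists V"] V by (auto simp: countable_finite)
  have E_eq: "E = (\<Union>K\<in>{K. finite K \<and> K \<subseteq> lists V}. {c\<in>E. L c = K})"
    using La by auto
  \<comment> \<open>There are countably many finite supports, so uncountably many of the functions
    share one support \<open>K\<close>. Any \<open>card K + 1\<close> of these are linearly
    dependent.\<close>
  have "\<exists>K\<in>{K. finite K \<and> K \<subseteq> lists V}. uncountable {c\<in>E. L c = K}"
  proof (rule ccontr)
    assume "\<not> ?thesis"
    then have "countable (\<Union>K\<in>{K. finite K \<and> K \<subseteq> lists V}. {c\<in>E. L c = K})"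
      by (intro countable_UN[OF cK]) simp
    then have "countable E" unfolding E_eq[symmetric] .
    with E show False by simp
  qed
  then obtain K where K: "finite K" "uncountable {c\<in>E. L c = K}" by auto
  then have "infinite {c\<in>E. L c = K}" using countable_finite by blast
  then obtain C where C: "finite C" "card C = Suc (card K)" "C \<subseteq> {c\<in>E. L c = K}"
    using infinite_arbitrarily_large by blast
  obtain h where h: "bij_betw h {..<card K} K" using ex_bij_betw_nat_finite[OF K(1)]
    by (auto simp: atLeast0LessThan)
  obtain l where l: "\<exists>c\<in>C. l c \<noteq> 0" "\<And>i. i < card K \<Longrightarrow> (\<Sum>c\<in>C. l c * a c (h i)) = 0"
    using linear_dependence[OF C(1), of "card K" "\<lambda>c i. a c (h i)"] C(2) by auto
  have l': "(\<Sum>c\<in>C. l c * a c xs) = 0" if "xs \<in> K" for xs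
  proof -
    have "xs \<in> h ` {..<card K}" using h that by (simp add: bij_betw_def)
    then show ?thesis using l(2) by auto
  qed
  have "(\<Sum>c\<in>C. l c * g c z) = 0" for z
  proof -
    have "(\<Sum>c\<in>C. l c * g c z) = (\<Sum>c\<in>C. \<Sum>xs\<in>K. l c * a c xs * mono_fn xs z)"
      using C(3) La(2) by (intro sum.cong) (auto simp: sum_distrib_left mult.assoc)
    also have "\<dots> = (\<Sum>xs\<in>K. (\<Sum>c\<in>C. l c * a c xs) * mono_fn xs z)"
      by (subst sum.swap) (simp add: sum_distrib_right)
    finally show ?thesis using l' by simp
  qed
  with C l(1) show ?thesis by blast
qed

section \<open>Ideals of polynomial functions and elimination of variables\<close>

definition pideal :: "'v set \<Rightarrow> (('v \<Rightarrow> complex) \<Rightarrow> complex) set \<Rightarrow> bool" where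
  "pideal V I \<longleftrightarrow> (\<forall>f\<in>I. polyfn V f) \<and> (\<lambda>_. 0) \<in> I \<and> (\<forall>f\<in>I. \<forall>g\<in>I. (\<lambda>z. f z + g z) \<in> I) \<and>
     (\<forall>f\<in>I. \<forall>g. polyfn V g \<longrightarrow> (\<lambda>z. g z * f z) \<in> I)"

definition padd :: "'v set \<Rightarrow> (('v \<Rightarrow> complex) \<Rightarrow> complex) set \<Rightarrow> (('v \<Rightarrow> complex) \<Rightarrow> complex) \<Rightarrow>
    (('v \<Rightarrow> complex) \<Rightarrow> complex) set" where
  "padd V I h = {k. \<exists>f\<in>I. \<exists>g. polyfn V g \<and> k = (\<lambda>z. f z + g z * h z)}"

text \<open>The variables in \<open>T\<close> are algebraically independent modulo \<open>I\<close>.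
  For \<open>T = {}\<close> this says that the ideal is proper.\<close>

definition indep :: "(('v \<Rightarrow> complex) \<Rightarrow> complex) set \<Rightarrow> 'v set \<Rightarrow> bool" where
  "indep I T \<longleftrightarrow> (\<forall>f\<in>I. polyfn T f \<longrightarrow> (\<forall>z. f z = 0))"

lemma pidealD:
  assumes "pideal V I"
  shows "f \<in> I \<Longrightarrow> polyfn V f" "(\<lambda>_. 0) \<in> I" "f \<in> I \<Longrightarrow> g \<in> I \<Longrightarrow> (\<lambda>z. f z + g z) \<in> I"
    "f \<in> I \<Longrightarrow> polyfn V g \<Longrightarrow> (\<lambda>z. g z * f z) \<in> I"
  using assms by (auto simp: pideal_def)

lemma pideal_sum:
  assumes "pideal V I" "\<And>i. i \<in> A \<Longrightarrow> f i \<in> I"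
  shows "(\<lambda>z. \<Sum>i\<in>A. f i z) \<in> I"
  using assms(2) by (induction A rule: infinite_finite_induct) (auto intro: pidealD[OF assms(1)])

lemma pideal_padd:
  assumes I: "pideal V I" and h: "polyfn V h"
  shows "pideal V (padd V I h)"
  unfolding pideal_def
proof (intro conjI ballI allI impI)
  fix k assume "k \<in> padd V I h"
  then obtain f g where k: "f \<in> I" "polyfn V g" "k = (\<lambda>z. f z + g z * h z)" by (auto simp: padd_def)
  then show "polyfn V k" using pidealD(1)[OF I] h by (auto intro: polyfn.intros)
  { fix k' assume "k' \<in> padd V I h"
    then obtain f' g' where k': "f' \<in> I" "polyfn V g'" "k' = (\<lambda>z. f' z + g' z * h z)" by (auto simp: padd_def)
    have "(\<lambda>z. k z + k' z) = (\<lambda>z. (f z + f' z) + (g z + g' z) * h z)"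
      by (simp add: k k' algebra_simps)
    moreover have "(\<lambda>z. f z + f' z) \<in> I" using pidealD(3)[OF I] k k' by auto
    moreover have "polyfn V (\<lambda>z. g z + g' z)" using k k' by (auto intro: polyfn.intros)
    ultimately show "(\<lambda>z. k z + k' z) \<in> padd V I h"
      by (auto simp: padd_def intro!: bexI[of _ "\<lambda>z. f z + f' z"] exI[of _ "\<lambda>z. g z + g' z"]) }
  { fix e assume e: "polyfn V e"
    have "(\<lambda>z. e z * k z) = (\<lambda>z. e z * f z + (e z * g z) * h z)"
      by (simp add: k algebra_simps)
    moreover have "(\<lambda>z. e z * f z) \<in> I" using pidealD(4)[OF I] k e by auto
    moreover have "polyfn V (\<lambda>z. e z * g z)" using k e by (auto intro: polyfn.intros)
    ultimately show "(\<lambda>z. e z * k z) \<in> padd V I h"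
      by (auto simp: padd_def intro!: bexI[of _ "\<lambda>z. e z * f z"] exI[of _ "\<lambda>z. e z * g z"]) }
next
  show "(\<lambda>_. 0) \<in> padd V I h"
    using pidealD(2)[OF I] by (auto simp: padd_def intro!: bexI[of _ "\<lambda>_. 0"] exI[of _ "\<lambda>_. 0"] polyfn_const)
qed

lemma not_indep_padd:
  assumes "\<not> indep (padd V I h) T"
  shows "\<exists>f g. f \<in> I \<and> polyfn V g \<and> polyfn T (\<lambda>z. f z + g z * h z) \<and> (\<exists>z. f z + g z * h z \<noteq> 0)"
proof -
  obtain k z where k: "k \<in> padd V I h" "polyfn T k" "k z \<noteq> 0"
    using assms by (auto simp: indep_def)
  then obtain f g where "f \<in> I" "polyfn V g" "k = (\<lambda>z. f z + g z * h z)"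
    by (auto simp: padd_def)
  with k show ?thesis by (intro exI[of _ f] exI[of _ g]) auto
qed

lemma padd_subset: "I \<subseteq> padd V I h"
  by (auto simp: padd_def intro!: exI[of _ "\<lambda>_. 0"] polyfn_const)

lemma padd_self: "pideal V I \<Longrightarrow> h \<in> padd V I h"
  by (auto simp: padd_def intro!: bexI[of _ "\<lambda>_. 0"] exI[of _ "\<lambda>_. 1"] polyfn_const pidealD(2))

text \<open>If the specialisation \<open>v = c\<close> destroyed independence for uncountably many \<open>c\<close>, then a linear
  relation between the cofactors, multiplied by the product of the \<open>v - c\<close>, would be a polynomial
  relation between the variables in \<open>insert v T\<close>.\<close>

lemma specialise_countable:
  assumes V: "finite V" and I: "pideal V I" and ind: "indep I (insert v T)"
    and v: "v \<notin> T" "insert v T \<subseteq> V"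
  shows "countable {c. \<not> indep (padd V I (\<lambda>z. z v - c)) T}"
proof (rule ccontr)
  define E where "E = {c. \<not> indep (padd V I (\<lambda>z. z v - c)) T}"
  assume "uncountable {c. \<not> indep (padd V I (\<lambda>z. z v - c)) T}"
  then have unc: "uncountable E" by (simp add: E_def)
  define P where "P c p \<longleftrightarrow> fst p \<in> I \<and> polyfn V (snd p) \<and>
      polyfn T (\<lambda>z. fst p z + snd p z * (z v - c)) \<and> (\<exists>z. fst p z + snd p z * (z v - c) \<noteq> 0)" for c p
  have "\<forall>c\<in>E. \<exists>p. P c p"
  proof
    fix c assume "c \<in> E"
    then show "\<exists>p. P c p"
      unfolding E_def using not_indep_padd[of V I "\<lambda>z. z v - c" T] by (simp add: P_def)
  qed
  then obtain p where p: "\<forall>c\<in>E. P c (p c)" using bchoice by metis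
  define f g where "f c = fst (p c)" and "g c = snd (p c)" for c
  have fg: "\<And>c. c \<in> E \<Longrightarrow> f c \<in> I" "\<And>c. c \<in> E \<Longrightarrow> polyfn V (g c)"
    "\<And>c. c \<in> E \<Longrightarrow> polyfn T (\<lambda>z. f c z + g c z * (z v - c))"
    "\<And>c. c \<in> E \<Longrightarrow> \<exists>z. f c z + g c z * (z v - c) \<noteq> 0"
    unfolding f_def g_def by (drule p[rule_format], simp only: P_def)+
  from uncountable_polyfn_dependent[OF V unc, of g]
  obtain C l where C': "finite C \<and> C \<subseteq> E \<and> (\<exists>c\<in>C. l c \<noteq> 0) \<and> (\<forall>z. (\<Sum>c\<in>C. l c * g c z) = 0)"
    using fg(2) by blast
  have C: "finite C" "C \<subseteq> E" "\<exists>c\<in>C. l c \<noteq> 0" "\<And>z. (\<Sum>c\<in>C. l c * g c z) = 0"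
    using C' by auto
  define q where "q c z = f c z + g c z * (z v - c)" for c z
  define F where "F z = (\<Sum>c\<in>C. l c * (\<Prod>b\<in>C-{c}. z v - b) * q c z)" for z
  have F: "F = (\<lambda>z. \<Sum>c\<in>C. l c * (\<Prod>b\<in>C-{c}. z v - b) * f c z)"
  proof
    fix z
    have "(\<Prod>b\<in>C-{c}. z v - b) * (z v - c) = (\<Prod>b\<in>C. z v - b)" if "c \<in> C" for c
      using C(1) that by (simp add: prod.remove[of C c])
    then have "F z = (\<Sum>c\<in>C. l c * (\<Prod>b\<in>C-{c}. z v - b) * f c z) +
        (\<Sum>c\<in>C. (\<Prod>b\<in>C. z v - b) * (l c * g c z))"
      unfolding F_def q_def distrib_left sum.distrib
      by (intro arg_cong2[where f = "(+)"] sum.cong refl) (auto simp: mult_ac)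
    then show "F z = (\<Sum>c\<in>C. l c * (\<Prod>b\<in>C-{c}. z v - b) * f c z)"
      by (simp add: C(4) flip: sum_distrib_left)
  qed
  have "F \<in> I"
    unfolding F
    by (intro pideal_sum[OF I] pidealD(4)[OF I]) (use C fg v in \<open>auto intro!: polyfn_intros\<close>)
  moreover have "polyfn (insert v T) (q c)" if "c \<in> C" for c
    unfolding q_def using C(2) that by (intro polyfn_mono[OF fg(3)]) auto
  then have "polyfn (insert v T) F"
    unfolding F_def by (auto intro!: polyfn_intros)
  ultimately have F0: "F z = 0" for z using ind by (auto simp: indep_def)
  obtain c0 where c0: "c0 \<in> C" "l c0 \<noteq> 0" using C(3) by blast
  obtain z where z: "q c0 z \<noteq> 0" using fg(4)[of c0] c0 C(2) by (auto simp: q_def)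
  \<comment> \<open>Setting \<open>v\<close> to \<open>c0\<close> kills all other summands of
    \<open>F\<close>, whose products contain \<open>v - c0\<close>, and does not change
    \<open>q c0\<close>, which is a polynomial in \<open>T\<close> alone.\<close>
  define z' where "z' = z(v := c0)"
  have "q c0 z' = q c0 z"
    unfolding q_def using c0 C(2) v by (intro polyfn_cong[OF fg(3)]) (auto simp: z'_def)
  moreover have "F z' = l c0 * (\<Prod>b\<in>C-{c0}. c0 - b) * q c0 z'"
  proof -
    have "F z' = (\<Sum>c\<in>{c0}. l c * (\<Prod>b\<in>C-{c}. z' v - b) * q c z')"
      unfolding F_def
    proof (rule sum.mono_neutral_right)
      show "\<forall>i\<in>C - {c0}. l i * (\<Prod>b\<in>C-{i}. z' v - b) * q i z' = 0"
        using c0 C(1) by (auto simp: z'_def prod_zero_iff)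
    qed (use c0 C(1) in auto)
    then show ?thesis by (simp add: z'_def)
  qed
  moreover have "(\<Prod>b\<in>C-{c0}. c0 - b) \<noteq> 0" using C(1) by (auto simp: prod_zero_iff)
  ultimately show False using F0[of z'] c0 z by auto
qed

lemma specialise_exists:
  assumes "finite V" "pideal V I" "indep I (insert v T)" "v \<notin> T" "insert v T \<subseteq> V"
  obtains c where "indep (padd V I (\<lambda>z. z v - c)) T"
proof -
  have "uncountable (UNIV :: complex set)" by (rule uncountable_UNIV_complex)
  with specialise_countable[OF assms] have "{c. \<not> indep (padd V I (\<lambda>z. z v - c)) T} \<noteq> UNIV" by auto
  then show ?thesis using that by auto
qed

text \<open>A variable outside \<open>S\<close> either satisfies a polynomial relation over
  \<open>S\<close> already, or is independent together with \<open>S\<close>; in the second case it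
  can be fixed to a constant without destroying the independence of \<open>S\<close>, and then the
  relation is \<open>y - c\<close>.\<close>

lemma algebraic_extension:
  assumes V: "finite V" and I: "pideal V I" "indep I S" and S: "S \<subseteq> V"
    and W: "finite W" "W \<subseteq> V - S"
  shows "\<exists>J. I \<subseteq> J \<and> pideal V J \<and> indep J S \<and>
    (\<forall>y\<in>W. \<exists>Q\<in>J. polyfn (insert y S) Q \<and> (\<exists>z. Q z \<noteq> 0))"
  using W
proof (induction W rule: finite_induct)
  case empty
  then show ?case using I by blast
next
  case (insert y W)
  then obtain J where J: "I \<subseteq> J" "pideal V J" "indep J S"
    "\<forall>y\<in>W. \<exists>Q\<in>J. polyfn (insert y S) Q \<and> (\<exists>z. Q z \<noteq> 0)" by auto
  show ?case
  proof (cases "indep J (insert y S)")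
    case False
    then have "\<exists>Q\<in>J. polyfn (insert y S) Q \<and> (\<exists>z. Q z \<noteq> 0)" by (auto simp: indep_def)
    then show ?thesis using J by blast
  next
    case True
    have y: "y \<notin> S" "insert y S \<subseteq> V" using insert S by auto
    obtain c where c: "indep (padd V J (\<lambda>z. z y - c)) S"
      using specialise_exists[OF V J(2) True y] .
    have py: "polyfn (insert y S) (\<lambda>z. z y - c)" by (auto intro: polyfn_intros)
    have "(\<lambda>z. z y - c) \<in> padd V J (\<lambda>z. z y - c)" using padd_self[OF J(2)] .
    moreover have "\<exists>z. z y - c \<noteq> 0" by (rule exI[of _ "\<lambda>_. c + 1"]) simp
    ultimately have "\<exists>Q\<in>padd V J (\<lambda>z. z y - c). polyfn (insert y S) Q \<and> (\<exists>z. Q z \<noteq> 0)"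
      using py by (intro bexI[of _ "\<lambda>z. z y - c"]) auto
    moreover have "pideal V (padd V J (\<lambda>z. z y - c))"
      using polyfn_mono[OF py y(2)] J(2) by (rule pideal_padd[rotated])
    ultimately show ?thesis
      using J c padd_subset[of J V "\<lambda>z. z y - c"]
      by (intro exI[of _ "padd V J (\<lambda>z. z y - c)"]) blast
  qed
qed

text \<open>If every \<open>y - c\<close> generated the unit ideal together with \<open>J\<close>,
  then every linear factor would be invertible modulo \<open>J\<close>. A nonzero polynomial in
  \<open>y\<close> that lies in \<open>J\<close> splits into linear factors; cancelling them one by
  one would leave a nonzero constant in \<open>J\<close>.\<close>

lemma linear_factor:
  assumes J: "pideal V J" "indep J {}" and Q: "Q \<in> J" "polyfn {y} Q" "Q z0 \<noteq> 0" and y: "y \<in> V"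
  shows "\<exists>c. indep (padd V J (\<lambda>z. z y - c)) {}"
proof (rule ccontr)
  assume "\<not> ?thesis"
  then have no_indep: "\<not> indep (padd V J (\<lambda>z. z y - c)) {}" for c by blast
  define P where "P c p \<longleftrightarrow> fst p \<in> J \<and> polyfn V (snd p) \<and>
      polyfn {} (\<lambda>z. fst p z + snd p z * (z y - c)) \<and> (\<exists>z. fst p z + snd p z * (z y - c) \<noteq> 0)" for c p
  have "\<forall>c. \<exists>p. P c p"
  proof
    fix c show "\<exists>p. P c p"
      using not_indep_padd[OF no_indep[of c]] by (simp add: P_def)
  qed
  from choice[OF this] obtain u where u: "\<And>c. P c (u c)" by blast
  define f g where "f c = fst (u c)" and "g c = snd (u c)" for c
  have fg: "\<And>c. f c \<in> J" "\<And>c. polyfn V (g c)"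
    "\<And>c. polyfn {} (\<lambda>z. f c z + g c z * (z y - c))" "\<And>c. \<exists>z. f c z + g c z * (z y - c) \<noteq> 0"
    unfolding f_def g_def by (insert u, simp_all only: P_def)
  have "\<exists>k. k \<noteq> 0 \<and> (\<forall>z. f c z + g c z * (z y - c) = k)" for c
    using fg(4)[of c] polyfn_cong[OF fg(3)[of c]] by (metis emptyE)
  then obtain k where k: "\<And>c. k c \<noteq> 0" "\<And>c z. f c z + g c z * (z y - c) = k c" by metis
  have no: "p = 0" if "(\<lambda>z. poly p (z y)) \<in> J" for p
    using that
  proof (induction "degree p" arbitrary: p)
    case 0
    then obtain a where "p = [:a:]" using degree_eq_zeroE by metis
    then show ?case using J(2) 0 by (auto simp: indep_def polyfn_const)
  next
    case (Suc n)
    obtain c where "poly p c = 0"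
      using Fundamental_Theorem_Algebra.fundamental_theorem_of_algebra[of p] Suc(2)
      by (auto simp: constant_degree)
    then obtain r where r: "p = [:-c,1:] * r" by (auto simp: poly_eq_0_iff_dvd dvd_def)
    have pr: "poly p x = (x - c) * poly r x" for x by (simp add: r algebra_simps)
    have poly: "polyfn V (\<lambda>z. poly q (z y))" for q
      unfolding poly_altdef using y by (auto intro!: polyfn_intros)
    \<comment> \<open>The identity \<open>1 = (f c + g c (y - c)) / k c\<close> is multiplied by
      \<open>r\<close>, which shows that the cofactor of the root \<open>c\<close> lies in
      \<open>J\<close> again.\<close>
    have "poly r (z y) = poly r (z y) * (1 / k c) * f c z + (g c z * (1 / k c)) * poly p (z y)" for z
    proof -
      have "poly r (z y) * k c = poly r (z y) * f c z + g c z * poly p (z y)"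
        unfolding k(2)[of c z, symmetric] pr by (simp add: algebra_simps)
      then show ?thesis using k(1)[of c] by (simp add: field_simps)
    qed
    then have "(\<lambda>z. poly r (z y)) =
        (\<lambda>z. poly r (z y) * (1 / k c) * f c z + (g c z * (1 / k c)) * poly p (z y))" by auto
    also have "\<dots> \<in> J"
      by (intro pidealD(3)[OF J(1)] pidealD(4)[OF J(1)] fg Suc.prems polyfn_mult polyfn_const poly)
    finally have "(\<lambda>z. poly r (z y)) \<in> J" .
    moreover have "p \<noteq> 0" using Suc(2) by auto
    then have "degree p = degree [:-c,1:] + degree r"
      unfolding r by (intro degree_mult_eq) auto
    then have "n = degree r" using Suc(2) by simp
    ultimately have "r = 0" using Suc(1) by blast
    then show ?case by (simp add: r)
  qed
  obtain m q where q: "\<And>j. polyfn {} (q j)" "\<And>z. Q z = (\<Sum>j<(m::nat). q j z * z y ^ j)"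
    using polyfn_expand[OF Q(2)] by auto
  define p where "p = (\<Sum>j<m. monom (q j z0) j)"
  have p: "poly p (z y) = Q z" for z
  proof -
    have "q j z0 = q j z" for j by (rule polyfn_cong[OF q(1)]) auto
    then show ?thesis by (simp add: p_def q(2) poly_sum poly_monom)
  qed
  then have "(\<lambda>z. poly p (z y)) \<in> J" using Q(1) by simp
  then have "p = 0" by (rule no)
  then show False using p[of z0] Q(3) by simp
qed

lemma maximal_extension:
  assumes V: "finite V" and J: "pideal V J" "indep J {}"
    and Q: "\<forall>y\<in>V. \<exists>Q\<in>J. polyfn {y} Q \<and> (\<exists>z. Q z \<noteq> 0)" and W: "finite W" "W \<subseteq> V"
  shows "\<exists>K. J \<subseteq> K \<and> pideal V K \<and> indep K {} \<and> (\<forall>y\<in>W. \<exists>c. (\<lambda>z. z y - c) \<in> K)"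
  using W
proof (induction W rule: finite_induct)
  case empty
  then show ?case using J by blast
next
  case (insert y W)
  then obtain K where K: "J \<subseteq> K" "pideal V K" "indep K {}" "\<forall>y\<in>W. \<exists>c. (\<lambda>z. z y - c) \<in> K" by auto
  have y: "y \<in> V" using insert by auto
  then obtain Q z where "Q \<in> K" "polyfn {y} Q" "Q z \<noteq> 0" using Q K(1) by blast
  then obtain c where c: "indep (padd V K (\<lambda>z. z y - c)) {}"
    using linear_factor[OF K(2,3)] y by blast
  have "polyfn V (\<lambda>z. z y - c)" using y by (auto intro: polyfn_intros)
  then have "pideal V (padd V K (\<lambda>z. z y - c))" by (rule pideal_padd[OF K(2)])
  then show ?case
    using K c padd_subset[of K V "\<lambda>z. z y - c"] padd_self[OF K(2), of "\<lambda>z. z y - c"]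
    by (intro exI[of _ "padd V K (\<lambda>z. z y - c)"]) blast
qed

text \<open>The ideal is enlarged, first until every variable is algebraic over the constants, then
  until every variable \<open>y\<close> is congruent to a constant \<open>x y\<close>, remaining
  proper throughout. By Hadamard each polynomial is then congruent to its value at \<open>x\<close>;
  for a member of \<open>I\<close> this value is a constant in a proper ideal, hence 0.\<close>

theorem weak_nullstellensatz:
  assumes V: "finite V" and I: "pideal V I" "indep I {}"
  shows "\<exists>z. \<forall>f\<in>I. f z = 0"
proof -
  obtain J where J: "I \<subseteq> J" "pideal V J" "indep J {}"
    "\<forall>y\<in>V. \<exists>Q\<in>J. polyfn {y} Q \<and> (\<exists>z. Q z \<noteq> 0)"
    using algebraic_extension[OF V I, of V] V by auto
  obtain K where K: "J \<subseteq> K" "pideal V K" "indep K {}" "\<forall>y\<in>V. \<exists>c. (\<lambda>z. z y - c) \<in> K"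
    using maximal_extension[OF V J(2-4) V] by auto
  then obtain x where x: "\<And>y. y \<in> V \<Longrightarrow> (\<lambda>z. z y - x y) \<in> K" by metis
  have "(\<lambda>z. f x - f z) \<in> K" if f: "polyfn V f" for f
  proof -
    obtain A where A: "\<And>v. polyfn (Inl ` V \<union> Inr ` V) (A v)"
      "\<And>z z'. f z' - f z = (\<Sum>v\<in>V. A v (case_sum z z') * (z' v - z v))"
      using polyfn_hadamard[OF f V] by metis
    have "f x - f z = (\<Sum>v\<in>V. - A v (case_sum z x) * (z v - x v))" for z
      unfolding A by (rule sum.cong) (auto simp: algebra_simps)
    then have "(\<lambda>z. f x - f z) = (\<lambda>z. \<Sum>v\<in>V. - A v (case_sum z x) * (z v - x v))" by auto
    also have "\<dots> \<in> K"
    proof (intro pideal_sum[OF K(2)] pidealD(4)[OF K(2)] x polyfn_uminus)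
      fix v
      have "polyfn V (\<lambda>z. A v (\<lambda>s. (case s of Inl i \<Rightarrow> (\<lambda>z. z i) | Inr i \<Rightarrow> (\<lambda>_. x i)) z))"
        by (rule polyfn_comp[OF A(1)]) (auto intro: polyfn_intros)
      moreover have "case_sum z x = (\<lambda>s. (case s of Inl i \<Rightarrow> (\<lambda>z. z i) | Inr i \<Rightarrow> (\<lambda>_. x i)) z)"
        for z :: "'a \<Rightarrow> complex"
        by (auto split: sum.split)
      ultimately show "polyfn V (\<lambda>z. A v (case_sum z x))" by simp
    qed
    finally show ?thesis .
  qed
  then have "f x = 0" if "f \<in> I" for f
  proof -
    have f: "f \<in> K" using that J K by auto
    then have "(\<lambda>z. (f x - f z) + f z) \<in> K"
      using \<open>\<And>f. polyfn V f \<Longrightarrow> (\<lambda>z. f x - f z) \<in> K\<close> pidealD(1,3)[OF K(2)] by blast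
    then have "(\<lambda>_. f x) \<in> K" by simp
    then show ?thesis using K(3) by (auto simp: indep_def polyfn_const)
  qed
  then show ?thesis by blast
qed

section \<open>Tangent vectors in general position\<close>

text \<open>Finitely many variables admit only countably many choices of orders, so one choice is
  shared by uncountably many \<open>c\<close>.\<close>

lemma polyfn_order_pigeonhole:
  assumes unc: "uncountable E" and V: "finite V"
    and n: "\<And>c. c \<in> E \<Longrightarrow> \<forall>y\<in>V. \<exists>j::nat. P y j c"
  shows "\<exists>j. uncountable {c\<in>E. \<forall>y\<in>V. P y (j y) c}"
  using V n
proof (induction V rule: finite_induct)
  case empty
  then show ?case using unc by simp
next
  case (insert v V)
  then obtain j where j: "uncountable {c\<in>E. \<forall>y\<in>V. P y (j y) c}" by auto
  have eq: "{c\<in>E. \<forall>y\<in>V. P y (j y) c} = (\<Union>k. {c\<in>E. P v k c \<and> (\<forall>y\<in>V. P y (j y) c)})"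
    using insert.prems by auto
  have "\<exists>k. uncountable {c\<in>E. P v k c \<and> (\<forall>y\<in>V. P y (j y) c)}"
  proof (rule ccontr)
    assume "\<not> ?thesis"
    then have "countable (\<Union>k. {c\<in>E. P v k c \<and> (\<forall>y\<in>V. P y (j y) c)})"
      by (intro countable_UN) auto
    then show False using j unfolding eq by simp
  qed
  then obtain k where k: "uncountable {c\<in>E. P v k c \<and> (\<forall>y\<in>V. P y (j y) c)}" by blast
  have "{c\<in>E. P v k c \<and> (\<forall>y\<in>V. P y (j y) c)} = {c\<in>E. \<forall>y\<in>insert v V. P y ((j(v := k)) y) c}"
    using insert.hyps by auto
  then show ?case using k by (intro exI[of _ "j(v := k)"]) simp
qed

lemma specialise_many:
  assumes V: "finite V" and U: "finite U" "t1 \<notin> U" "insert t1 U \<subseteq> V"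
    and I: "pideal V I" "indep I (insert t1 U)"
  shows "\<exists>J. I \<subseteq> J \<and> pideal V J \<and> indep J {t1} \<and> (\<forall>t\<in>U. \<exists>c. (\<lambda>z. z t - c) \<in> J)"
  using U I
proof (induction U arbitrary: I rule: finite_induct)
  case empty
  then show ?case by auto
next
  case (insert t U)
  have i: "indep I (insert t (insert t1 U))" using insert.prems by (simp add: insert_commute)
  obtain c where c: "indep (padd V I (\<lambda>z. z t - c)) (insert t1 U)"
    using specialise_exists[OF V insert.prems(3) i] insert by auto
  have "polyfn V (\<lambda>z. z t - c)" using insert.prems by (auto intro: polyfn_intros)
  then have p: "pideal V (padd V I (\<lambda>z. z t - c))" by (rule pideal_padd[OF insert.prems(3)])
  obtain J where J: "padd V I (\<lambda>z. z t - c) \<subseteq> J" "pideal V J" "indep J {t1}" "\<forall>t\<in>U. \<exists>c. (\<lambda>z. z t - c) \<in> J"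
    using insert.IH[OF _ _ p c] insert.prems by auto
  have "(\<lambda>z. z t - c) \<in> J" using J(1) padd_self[OF insert.prems(3)] by auto
  then show ?case using J padd_subset[of I V "\<lambda>z. z t - c"] by (intro exI[of _ J]) auto
qed

text \<open>Otherwise each point of \<open>Y\<close> would be isolated in \<open>Y\<close> by a
  member of a countable basis, which would inject \<open>Y\<close> into this basis.\<close>

lemma uncountable_islimpt_self:
  fixes Y :: "'a::second_countable_topology set"
  assumes "uncountable Y"
  shows "\<exists>p\<in>Y. p islimpt Y"
proof (rule ccontr)
  assume neg: "\<not> ?thesis"
  obtain B :: "'a set set" where B: "countable B" "topological_basis B"
    using ex_countable_basis by blast
  have "\<exists>b\<in>B. b \<inter> Y = {p}" if p: "p \<in> Y" for p
  proof -
    have "\<not> p islimpt Y" using neg p by blast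
    then obtain T where T: "p \<in> T" "open T" "\<forall>y\<in>Y. y \<in> T \<longrightarrow> y = p"
      unfolding islimpt_def by blast
    obtain b where b: "b \<in> B" "p \<in> b" "b \<subseteq> T" using topological_basisE[OF B(2) T(2,1)] .
    have "b \<inter> Y = {p}" using b(2,3) T(3) p by blast
    with b(1) show ?thesis ..
  qed
  then have "\<forall>p\<in>Y. \<exists>b. b \<in> B \<and> b \<inter> Y = {p}" by blast
  from bchoice[OF this] obtain b where b: "\<forall>p\<in>Y. b p \<in> B \<and> b p \<inter> Y = {p}" by (rule exE)
  have "inj_on b Y"
  proof (rule inj_onI)
    fix p q assume p: "p \<in> Y" and q: "q \<in> Y" and eq: "b p = b q"
    have "{p} = b p \<inter> Y" by (rule sym, rule conjunct2, rule bspec[OF b p])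
    also have "\<dots> = b q \<inter> Y" by (rule arg_cong[OF eq])
    also have "\<dots> = {q}" by (rule conjunct2, rule bspec[OF b q])
    finally have "{p} = {q}" .
    then show "p = q" by simp
  qed
  moreover have "countable (b ` Y)" using b by (intro countable_subset[OF _ B(1)]) auto
  ultimately show False using assms countable_image_inj_on by blast
qed

text \<open>The map \<open>y\<close> embeds \<open>E\<close> in a countable product of copies of the
  complex numbers, a second countable space; the coordinate \<open>None\<close> keeps
  \<open>c\<close> itself and makes the map injective. This is where the type of variables has to be
  countable.\<close>

lemma uncountable_self_limit:
  fixes x :: "complex \<Rightarrow> 'v::countable \<Rightarrow> complex"
  assumes "uncountable E"
  shows "\<exists>c\<in>E. \<exists>s :: nat \<Rightarrow> complex. (\<forall>n. s n \<in> E \<and> s n \<noteq> c) \<and> s \<longlonglongrightarrow> c \<and>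
    (\<forall>v. (\<lambda>n. x (s n) v) \<longlonglongrightarrow> x c v)"
proof -
  define y where "y c v = (case v of None \<Rightarrow> c | Some v \<Rightarrow> x c v)" for c v
  have inj: "inj_on y E" by (rule inj_onI) (metis y_def option.simps(4))
  have unc: "uncountable (y ` E)" using assms inj countable_image_inj_on by blast
  obtain p where p: "p \<in> y ` E" "p islimpt (y ` E)"
    using uncountable_islimpt_self[OF unc] by blast
  then obtain c where c: "c \<in> E" "p = y c" by blast
  obtain u where u: "\<And>n. u n \<in> y ` E - {p}" "u \<longlonglongrightarrow> p"
    using p(2) unfolding islimpt_sequential by blast
  then have "\<forall>n. \<exists>s. s \<in> E \<and> u n = y s" by blast
  then obtain s where s: "\<And>n. s n \<in> E \<and> u n = y (s n)" by metis
  have lim: "(\<lambda>n. y (s n) v) \<longlonglongrightarrow> y c v" for v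
  proof -
    have "(\<lambda>n. u n v) \<longlonglongrightarrow> p v"
      by (rule continuous_on_tendsto_compose[OF continuous_on_product_coordinates u(2)]) auto
    then show ?thesis using s c by simp
  qed
  have "s n \<noteq> c" for n using u(1)[of n] s[of n] c by auto
  moreover have "s \<longlonglongrightarrow> c" using lim[of None] by (simp add: y_def)
  moreover have "(\<lambda>n. x (s n) v) \<longlonglongrightarrow> x c v" for v using lim[of "Some v"] by (simp add: y_def)
  ultimately show ?thesis using c s by blast
qed

text \<open>Implicit differentiation along a sequence: the Hadamard expansion of
  \<open>R (x n) - R x0 = 0\<close> writes the slope as \<open>- A t / A y\<close>, and
  \<open>A y\<close> tends to the nonzero partial derivative.\<close>

lemma simple_root_slope:
  assumes R: "polyfn {y, t} R" "y \<noteq> t" and dR: "pdv y R x0 \<noteq> 0" "R x0 = 0" "\<And>n. R (x n) = 0"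
    and lim: "(\<lambda>n. x n y) \<longlonglongrightarrow> x0 y" "(\<lambda>n. x n t) \<longlonglongrightarrow> x0 t" "\<And>n. x n t \<noteq> x0 t"
  shows "\<exists>w. (\<lambda>n. (x n y - x0 y) / (x n t - x0 t)) \<longlonglongrightarrow> w"
proof -
  obtain A where A: "\<And>v. polyfn (Inl ` {y,t} \<union> Inr ` {y,t}) (A v)"
    "\<And>z z'. R z' - R z = (\<Sum>v\<in>{y,t}. A v (case_sum z z') * (z' v - z v))"
    using polyfn_hadamard[OF R(1)] by auto
  have Alim: "(\<lambda>n. A v (case_sum x0 (x n))) \<longlonglongrightarrow> A v (case_sum x0 x0)" for v
    by (rule tendsto_polyfn[OF A(1)]) (use lim in auto)
  have Ay: "A y (case_sum x0 x0) \<noteq> 0"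
    using pdv_eq_hadamard[OF A, of y] dR(1) by simp
  then have ev: "\<forall>\<^sub>F n in sequentially. A y (case_sum x0 (x n)) \<noteq> 0"
    using tendsto_imp_eventually_ne[OF Alim] by auto
  have "(\<lambda>n. - A t (case_sum x0 (x n)) / A y (case_sum x0 (x n))) \<longlonglongrightarrow>
      - A t (case_sum x0 x0) / A y (case_sum x0 x0)"
    using Ay by (intro tendsto_intros Alim)
  moreover have "\<forall>\<^sub>F n in sequentially. - A t (case_sum x0 (x n)) / A y (case_sum x0 (x n)) =
      (x n y - x0 y) / (x n t - x0 t)"
    using ev
  proof eventually_elim
    case (elim n)
    have "A y (case_sum x0 (x n)) * (x n y - x0 y) + A t (case_sum x0 (x n)) * (x n t - x0 t) = 0"
      using A(2)[of "x n" x0] R(2) dR by simp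
    then show ?case using elim lim(3)[of n]
      by (simp add: divide_eq_eq eq_divide_eq add_eq_0_iff mult.commute)
  qed
  ultimately have "(\<lambda>n. (x n y - x0 y) / (x n t - x0 t)) \<longlonglongrightarrow> - A t (case_sum x0 x0) / A y (case_sum x0 x0)"
    by (rule Lim_transform_eventually)
  then show ?thesis by blast
qed

text \<open>A weak form of generic smoothness of the projection to the variables in \<open>T\<close>.  The vector \<open>w\<close> is a limit of difference quotients along a sequence of zeros.\<close>

theorem tangent_vector_over_direction:
  fixes V :: "'v::countable set"
  assumes V: "finite V" and I: "pideal V I" "indep I T" and T: "T \<subseteq> V" "t1 \<in> T"
  obtains z w where "w t1 = 1" "\<And>t. t \<in> T - {t1} \<Longrightarrow> w t = 0"
    "\<And>p. p \<in> I \<Longrightarrow> p z = 0" "\<And>p. p \<in> I \<Longrightarrow> (\<Sum>v\<in>V. pdv v p z * w v) = 0"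
proof -
  have finT: "finite T" using T V finite_subset by blast
  have "insert t1 (T - {t1}) = T" using T by auto
  \<comment> \<open>All parameters but \<open>t1\<close> become constants, so their slopes along the
    sequence are going to be 0.\<close>
  then obtain J where J: "I \<subseteq> J" "pideal V J" "indep J {t1}" "\<forall>t\<in>T-{t1}. \<exists>c. (\<lambda>z. z t - c) \<in> J"
    using specialise_many[OF V, of "T - {t1}" t1 I] I T finT by auto
  \<comment> \<open>Every other variable is now algebraic over \<open>t1\<close>; in effect the zero
    locus is cut down to a curve over the \<open>t1\<close>-line.\<close>
  obtain K where K: "J \<subseteq> K" "pideal V K" "indep K {t1}"
    "\<forall>y\<in>V-{t1}. \<exists>Q\<in>K. polyfn (insert y {t1}) Q \<and> (\<exists>z. Q z \<noteq> 0)"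
    using algebraic_extension[OF V J(2,3), of "V - {t1}"] T V by auto
  have "\<forall>y\<in>V-{t1}. \<exists>Q. Q \<in> K \<and> polyfn {y, t1} Q \<and> (\<exists>z. Q z \<noteq> 0)" using K(4) by auto
  from bchoice[OF this] obtain Q where Q: "\<And>y. y \<in> V - {t1} \<Longrightarrow> Q y \<in> K"
    "\<And>y. y \<in> V - {t1} \<Longrightarrow> polyfn {y, t1} (Q y)" "\<And>y. y \<in> V - {t1} \<Longrightarrow> \<exists>z. Q y z \<noteq> 0" by auto
  have t1: "t1 \<in> V" using T by auto
  \<comment> \<open>Values of \<open>t1\<close> to be avoided: for those in \<open>B1\<close> the
    ideal of the fibre is not proper, and for those in \<open>B2 y\<close> the relation
    \<open>Q y\<close> becomes trivial.\<close>
  define B1 where "B1 = {c. \<not> indep (padd V K (\<lambda>z. z t1 - c)) {}}"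
  define B2 where "B2 y = {c. \<forall>z. z t1 = c \<longrightarrow> Q y z = 0}" for y
  have "countable B1"
    unfolding B1_def using specialise_countable[OF V K(2), of t1 "{}"] K(3) t1 by simp
  moreover have "finite (B2 y)" if y: "y \<in> V - {t1}" for y
  proof -
    obtain z0 where "Q y z0 \<noteq> 0" using Q(3)[OF y] by blast
    moreover have "polyfn {()} (\<lambda>z. (z0(t1 := z ())) v)" for v
      by (cases "v = t1") (auto intro: polyfn_intros)
    ultimately have "finite {c. Q y (z0(t1 := c)) = 0}"
      using polyfn_line_zeros_finite[OF Q(2)[OF y], of "\<lambda>c. z0(t1 := c)" "z0 t1"] by simp
    moreover have "B2 y \<subseteq> {c. Q y (z0(t1 := c)) = 0}" by (auto simp: B2_def)
    ultimately show ?thesis using finite_subset by blast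
  qed
  then have "countable (\<Union>y\<in>V-{t1}. B2 y)" using V by (intro countable_finite) auto
  ultimately have cB: "countable (B1 \<union> (\<Union>y\<in>V-{t1}. B2 y))" by simp
  define E where "E = UNIV - (B1 \<union> (\<Union>y\<in>V-{t1}. B2 y))"
  have "uncountable E"
    unfolding E_def by (rule uncountable_minus_countable[OF uncountable_UNIV_complex cB])
  have "\<exists>x. x t1 = c \<and> (\<forall>f\<in>K. f x = 0)" if "c \<in> E" for c
  proof -
    have pt: "polyfn V (\<lambda>z. z t1 - c)" using t1 by (intro polyfn_intros)
    have "indep (padd V K (\<lambda>z. z t1 - c)) {}" using that by (auto simp: E_def B1_def)
    then obtain x where x: "\<forall>f\<in>padd V K (\<lambda>z. z t1 - c). f x = 0"
      using weak_nullstellensatz[OF V pideal_padd[OF K(2) pt]] by blast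
    have "x t1 - c = 0" using bspec[OF x padd_self[OF K(2)]] .
    moreover have "f x = 0" if "f \<in> K" for f
      using bspec[OF x subsetD[OF padd_subset that]] .
    ultimately show ?thesis by (intro exI[of _ x]) simp
  qed
  then have "\<forall>c\<in>E. \<exists>x. x t1 = c \<and> (\<forall>f\<in>K. f x = 0)" by blast
  from bchoice[OF this] obtain x where x: "\<And>c. c \<in> E \<Longrightarrow> x c t1 = c"
    "\<And>c f. c \<in> E \<Longrightarrow> f \<in> K \<Longrightarrow> f (x c) = 0" by auto
  \<comment> \<open>The coordinate \<open>x c y\<close> may be a multiple root of
    \<open>Q y\<close>. Some derivative with respect to \<open>y\<close> has a simple root there, as
    \<open>simple_root_slope\<close> demands; its order has to be the same at all points of the
    sequence and at the limit, whence the pigeonhole.\<close>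
  define P where "P y j c \<longleftrightarrow> (pdv y ^^ j) (Q y) (x c) = 0 \<and> (pdv y ^^ Suc j) (Q y) (x c) \<noteq> 0" for y j c
  have P: "\<exists>j. P y j c" if c: "c \<in> E" and y: "y \<in> V - {t1}" for y c
  proof -
    have "\<exists>z. z t1 = c \<and> Q y z \<noteq> 0" using c y by (auto simp: E_def B2_def)
    then obtain z where z: "z t1 = c" "Q y z \<noteq> 0" by blast
    have "Q y ((x c)(y := z y)) = Q y z"
      by (rule polyfn_cong[OF Q(2)[OF y]]) (use y z x(1)[OF c] in auto)
    then have "\<exists>j. (pdv y ^^ j) (Q y) (x c) \<noteq> 0"
      using polyfn_iterated_pdv_zero[OF Q(2)[OF y], of y "x c" "z y"] z(2) by auto
    moreover have "(pdv y ^^ 0) (Q y) (x c) = 0" using x(2)[OF c Q(1)[OF y]] by simp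
    ultimately obtain j where "\<forall>i\<le>j. (pdv y ^^ i) (Q y) (x c) = 0" "(pdv y ^^ Suc j) (Q y) (x c) \<noteq> 0"
      using ex_least_nat_less[of "\<lambda>j. (pdv y ^^ j) (Q y) (x c) \<noteq> 0"] by (metis (lifting))
    then show ?thesis by (auto simp: P_def)
  qed
  obtain j where j: "uncountable {c\<in>E. \<forall>y\<in>V-{t1}. P y (j y) c}"
    using polyfn_order_pigeonhole[OF \<open>uncountable E\<close>, of "V - {t1}" P] P V by auto
  from uncountable_self_limit[OF j, of x]
  obtain c s where cs: "c \<in> {c\<in>E. \<forall>y\<in>V-{t1}. P y (j y) c}"
    "(\<forall>n. s n \<in> {c\<in>E. \<forall>y\<in>V-{t1}. P y (j y) c} \<and> s n \<noteq> c) \<and> s \<longlonglongrightarrow> c \<and>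
      (\<forall>v. (\<lambda>n. x (s n) v) \<longlonglongrightarrow> x c v)" by (elim bexE exE)
  then have c: "c \<in> E" "\<And>y. y \<in> V - {t1} \<Longrightarrow> P y (j y) c"
    and s: "\<And>n. s n \<in> E" "\<And>n y. y \<in> V - {t1} \<Longrightarrow> P y (j y) (s n)" "\<And>n. s n \<noteq> c"
      "\<And>v. (\<lambda>n. x (s n) v) \<longlonglongrightarrow> x c v" "s \<longlonglongrightarrow> c" by simp_all
  define r where "r v n = (x (s n) v - x c v) / (x (s n) t1 - x c t1)" for v n
  have "\<exists>w. r v \<longlonglongrightarrow> w" if v: "v \<in> V" for v
  proof (cases "v = t1")
    case True
    then have "r v = (\<lambda>n. 1)" using s(1,3) c(1) by (auto simp: r_def x(1))
    then show ?thesis by auto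
  next
    case False
    define R where "R = (pdv v ^^ j v) (Q v)"
    have "polyfn {v, t1} R"
      unfolding R_def
    proof (induction "j v")
      case 0
      then show ?case using Q(2)[of v] v False by simp
    next
      case (Suc m)
      have it: "polyfn {v, t1} ((pdv v ^^ m) (Q v))" for m
        by (induction m) (use Q(2)[of v] v False in \<open>auto intro: polyfn_pdv\<close>)
      then show ?case by blast
    qed
    then show ?thesis
      unfolding r_def
      by (rule simple_root_slope[where R = R])
        (use c(2)[of v] s v False c(1) in \<open>auto simp: R_def P_def x(1)\<close>)
  qed
  then obtain w where w: "\<And>v. v \<in> V \<Longrightarrow> r v \<longlonglongrightarrow> w v" by metis
  have "r t1 = (\<lambda>n. 1)" using s(1,3) c(1) by (auto simp: r_def x(1))
  then have 1: "w t1 = 1" using w[OF t1] by (auto simp: LIMSEQ_const_iff)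
  have 2: "w t = 0" if t: "t \<in> T - {t1}" for t
  proof -
    obtain k where "(\<lambda>z. z t - k) \<in> K" using J(4) K(1) t by blast
    then have "x c' t - k = 0" if "c' \<in> E" for c' using x(2)[OF that] by fast
    then have "r t = (\<lambda>n. 0)" using s(1) c(1) by (auto simp: r_def)
    then show ?thesis using w[of t] t T by (auto simp: LIMSEQ_const_iff)
  qed
  have 3: "p (x c) = 0" if "p \<in> I" for p using that x(2)[OF c(1)] J(1) K(1) by blast
  have 4: "(\<Sum>v\<in>V. pdv v p (x c) * w v) = 0" if p: "p \<in> I" for p
  proof -
    have pp: "polyfn V p" using pidealD(1)[OF I(1) p] .
    obtain A where A: "\<And>v. polyfn (Inl ` V \<union> Inr ` V) (A v)"
      "\<And>z z'. p z' - p z = (\<Sum>v\<in>V. A v (case_sum z z') * (z' v - z v))"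
      using polyfn_hadamard[OF pp V] by metis
    have pK: "p (x c') = 0" if "c' \<in> E" for c' using that p x(2) J(1) K(1) by blast
    have "(\<Sum>v\<in>V. A v (case_sum (x c) (x (s n))) * r v n) = 0" for n
    proof -
      have "(\<Sum>v\<in>V. A v (case_sum (x c) (x (s n))) * r v n) =
          (p (x (s n)) - p (x c)) / (x (s n) t1 - x c t1)"
        unfolding A r_def by (simp add: sum_divide_distrib)
      then show ?thesis using pK[OF c(1)] pK[OF s(1)] by simp
    qed
    moreover have "(\<lambda>n. \<Sum>v\<in>V. A v (case_sum (x c) (x (s n))) * r v n) \<longlonglongrightarrow>
        (\<Sum>v\<in>V. A v (case_sum (x c) (x c)) * w v)"
    proof (intro tendsto_sum tendsto_mult w)
      fix v show "(\<lambda>n. A v (case_sum (x c) (x (s n)))) \<longlonglongrightarrow> A v (case_sum (x c) (x c))"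
        by (rule tendsto_polyfn[OF A(1)]) (use s(4) in auto)
    qed
    ultimately have "(\<Sum>v\<in>V. A v (case_sum (x c) (x c)) * w v) = 0"
      by (simp add: LIMSEQ_const_iff)
    then show ?thesis using pdv_eq_hadamard[OF A _ V] by simp
  qed
  show ?thesis by (rule that[of w "x c"]) (rule 1, rule 2, assumption, rule 3, assumption, rule 4, assumption)
qed

section \<open>Evaluation of polynomials in several variables\<close>

abbreviation lk :: "('a \<Rightarrow>\<^sub>0 'b::zero) \<Rightarrow> 'a \<Rightarrow> 'b" where "lk \<equiv> Poly_Mapping.lookup"
abbreviation ks :: "('a \<Rightarrow>\<^sub>0 'b::zero) \<Rightarrow> 'a set" where "ks \<equiv> Poly_Mapping.keys"

definition mval :: "('v \<Rightarrow> complex) \<Rightarrow> ('v \<Rightarrow>\<^sub>0 nat) \<Rightarrow> complex" where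
  "mval x m = (\<Prod>v\<in>ks m. x v ^ lk m v)"

lemma mval_superset: "finite K \<Longrightarrow> ks m \<subseteq> K \<Longrightarrow> mval x m = (\<Prod>v\<in>K. x v ^ lk m v)"
  unfolding mval_def by (rule prod.mono_neutral_left) (auto simp: in_keys_iff)

lemma mval_add: "mval x (m + m') = mval x m * mval x m'"
proof -
  have "finite (ks m \<union> ks m')" "ks (m + m') \<subseteq> ks m \<union> ks m'" by (auto simp: keys_add)
  then show ?thesis
    by (simp add: mval_superset[of "ks m \<union> ks m'"] lookup_add power_add prod.distrib)
qed

lemma mval_0 [simp]: "mval x 0 = 1" by (simp add: mval_def)

lemma mval_single_1 [simp]: "mval x (Poly_Mapping.single v (Suc 0)) = x v" by (simp add: mval_def)

lemma poly_val_mval: "poly_val x p = (\<Sum>m\<in>ks p. lk p m * mval x m)"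
  by (simp add: poly_val_def mval_def)

lemma poly_val_superset: "finite K \<Longrightarrow> ks p \<subseteq> K \<Longrightarrow> poly_val x p = (\<Sum>m\<in>K. lk p m * mval x m)"
  unfolding poly_val_mval by (rule sum.mono_neutral_left) (auto simp: in_keys_iff)

lemma poly_val_0 [simp]: "poly_val x 0 = 0" by (simp add: poly_val_def)

lemma poly_val_add: "poly_val x (p + q) = poly_val x p + poly_val x q"
proof -
  have "finite (ks p \<union> ks q)" "ks (p + q) \<subseteq> ks p \<union> ks q" by (auto simp: keys_add)
  then show ?thesis
    by (simp add: poly_val_superset[of "ks p \<union> ks q"] lookup_add distrib_right sum.distrib)
qed

lemma poly_val_sum: "poly_val x (\<Sum>i\<in>A. f i) = (\<Sum>i\<in>A. poly_val x (f i))"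
  by (induction A rule: infinite_finite_induct) (auto simp: poly_val_add)

lemma poly_val_single [simp]: "poly_val x (Poly_Mapping.single m c) = c * mval x m"
  by (cases "c = 0") (auto simp: poly_val_mval)

lemma cpoly_sum_monomials: "(p :: 'm \<Rightarrow>\<^sub>0 'c::comm_monoid_add) = (\<Sum>m\<in>ks p. Poly_Mapping.single m (lk p m))"
proof (rule poly_mapping_eqI)
  fix k
  show "lk p k = lk (\<Sum>m\<in>ks p. Poly_Mapping.single m (lk p m)) k"
    by (auto simp: lookup_sum lookup_single when_def in_keys_iff)
qed

lemma poly_val_mult: "poly_val x (p * q) = poly_val x p * poly_val x q"
proof -
  have "p * q = (\<Sum>m\<in>ks p. \<Sum>m'\<in>ks q. Poly_Mapping.single (m + m') (lk p m * lk q m'))"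
    by (subst cpoly_sum_monomials[of p], subst cpoly_sum_monomials[of q])
      (simp add: sum_product mult_single)
  then have "poly_val x (p * q) = (\<Sum>m\<in>ks p. \<Sum>m'\<in>ks q. lk p m * lk q m' * mval x (m + m'))"
    by (simp add: poly_val_sum)
  also have "\<dots> = poly_val x p * poly_val x q"
    by (simp add: poly_val_mval sum_product mval_add mult_ac)
  finally show ?thesis .
qed

lemma poly_val_const [simp]: "poly_val x (poly_const c) = c" by (simp add: poly_const_def)
lemma poly_val_var [simp]: "poly_val x (poly_var v) = x v" by (simp add: poly_var_def)
lemma poly_val_power: "poly_val x (p ^ n) = poly_val x p ^ n"
  by (induction n) (simp_all add: poly_val_mult flip: poly_const_def[of 1, simplified])

lemma polyfn_mval: "ks m \<subseteq> V \<Longrightarrow> polyfn V (\<lambda>z. mval z m)"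
  unfolding mval_def by (auto intro!: polyfn_intros)

lemma polyfn_poly_val: "(\<And>m. m \<in> ks p \<Longrightarrow> ks m \<subseteq> V) \<Longrightarrow> polyfn V (\<lambda>z. poly_val z p)"
  unfolding poly_val_mval by (auto intro!: polyfn_intros polyfn_mval)

lemma polyfn_poly_val_UNIV: "polyfn UNIV (\<lambda>z. poly_val z p)"
  by (rule polyfn_poly_val) simp

lemma polyfn_imp_poly_val:
  "polyfn V f \<Longrightarrow> \<exists>p. (\<forall>m\<in>ks p. ks m \<subseteq> V) \<and> (\<forall>z. poly_val z p = f z)"
proof (induction rule: polyfn.induct)
  case (polyfn_const c)
  then show ?case by (intro exI[of _ "poly_const c"]) (auto simp: poly_const_def)
next
  case (polyfn_var v)
  then show ?case by (intro exI[of _ "poly_var v"]) (auto simp: poly_var_def)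
next
  case (polyfn_add f g)
  then obtain p q where "\<forall>m\<in>ks p. ks m \<subseteq> V" "\<forall>m\<in>ks q. ks m \<subseteq> V"
    "\<forall>z. poly_val z p = f z" "\<forall>z. poly_val z q = g z" by blast
  then show ?case using keys_add[of p q]
    by (intro exI[of _ "p + q"] conjI ballI allI) (blast, simp add: poly_val_add)
next
  case (polyfn_mult f g)
  then obtain p q where pq: "\<forall>m\<in>ks p. ks m \<subseteq> V" "\<forall>m\<in>ks q. ks m \<subseteq> V"
    "\<forall>z. poly_val z p = f z" "\<forall>z. poly_val z q = g z" by blast
  have "ks m \<subseteq> V" if m: "m \<in> ks (p * q)" for m
  proof -
    obtain a b where "m = a + b" "a \<in> ks p" "b \<in> ks q"
      using subsetD[OF keys_mult m] by blast
    then show ?thesis using pq keys_add[of a b] by blast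
  qed
  with pq show ?case by (intro exI[of _ "p * q"]) (auto simp: poly_val_mult)
qed

lemma pdv_eqI: "((\<lambda>h. f (z(v := h))) has_field_derivative D) (at (z v)) \<Longrightarrow> pdv v f z = D"
  unfolding pdv_def by (rule DERIV_imp_deriv)

lemma pdv_mval:
  fixes m :: "'v \<Rightarrow>\<^sub>0 nat"
  shows "((\<lambda>h. mval (z(i := h)) m) has_field_derivative
    of_nat (lk m i) * mval z (m - Poly_Mapping.single i 1)) (at (z i))"
proof -
  define K where "K = insert i (ks m)"
  define C where "C = (\<Prod>v\<in>K-{i}. z v ^ lk m v)"
  have m: "mval (z(i := h)) m = h ^ lk m i * C" for h
    unfolding C_def by (subst mval_superset[of K]) (auto simp: K_def prod.remove[of _ i] intro!: prod.cong)
  have "((\<lambda>h. h ^ lk m i * C) has_field_derivative of_nat (lk m i) * z i ^ (lk m i - 1) * C) (at (z i))"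
    by (auto intro!: derivative_eq_intros)
  moreover have "mval z (m - Poly_Mapping.single i 1) = z i ^ (lk m i - 1) * C"
  proof -
    have "ks (m - Poly_Mapping.single i 1) \<subseteq> K"
      by (auto simp: K_def in_keys_iff lookup_minus)
    then have "mval z (m - Poly_Mapping.single i 1) =
        z i ^ (lk m i - 1) * (\<Prod>v\<in>K-{i}. z v ^ (lk m v - lk (Poly_Mapping.single i 1) v))"
      by (subst mval_superset[of K]) (auto simp: K_def prod.remove[of _ i] lookup_minus)
    also have "(\<Prod>v\<in>K-{i}. z v ^ (lk m v - lk (Poly_Mapping.single i 1) v)) = C"
      unfolding C_def by (rule prod.cong) (auto simp: lookup_single when_def)
    finally show ?thesis .
  qed
  ultimately show ?thesis by (simp add: m mult.assoc)
qed

lemma poly_val_partial_deriv_at: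
  "((\<lambda>h. poly_val (z(i := h)) p) has_field_derivative poly_val z (partial_deriv i p)) (at (z i))"
proof -
  have "((\<lambda>h. \<Sum>m\<in>ks p. lk p m * mval (z(i := h)) m) has_field_derivative
      (\<Sum>m\<in>ks p. lk p m * (of_nat (lk m i) * mval z (m - Poly_Mapping.single i 1)))) (at (z i))"
    by (intro DERIV_sum DERIV_cmult pdv_mval)
  then show ?thesis
    unfolding partial_deriv_def poly_val_sum poly_val_single poly_val_mval[symmetric]
    by (simp add: mult_ac)
qed

lemma poly_val_partial_deriv: "poly_val z (partial_deriv i p) = pdv i (\<lambda>z. poly_val z p) z"
  by (rule sym, rule pdv_eqI, rule poly_val_partial_deriv_at)

lemma poly_val_chain:
  fixes p :: "'v::finite cpoly"
  assumes "\<And>v. ((\<lambda>t. c t v) has_field_derivative w v) (at t0)"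
  shows "((\<lambda>t. poly_val (c t) p) has_field_derivative
    (\<Sum>v\<in>UNIV. poly_val (c t0) (partial_deriv v p) * w v)) (at t0)"
proof -
  have "((\<lambda>t. poly_val (c t) p) has_field_derivative
      (\<Sum>v\<in>UNIV. pdv v (\<lambda>z. poly_val z p) (c t0) * w v)) (at t0)"
    by (rule polyfn_chain[OF polyfn_poly_val_UNIV]) (use assms in auto)
  also have "(\<lambda>v. pdv v (\<lambda>z. poly_val z p) (c t0) * w v) =
      (\<lambda>v. poly_val (c t0) (partial_deriv v p) * w v)"
    by (rule ext, rule arg_cong2[where f = "(*)"], rule sym, rule poly_val_partial_deriv, rule refl)
  finally show ?thesis .
qed

definition mdeg :: "('v \<Rightarrow>\<^sub>0 nat) \<Rightarrow> nat" where
  "mdeg m = (\<Sum>v\<in>ks m. lk m v)"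

lemma mval_scale: "mval (\<lambda>v. c * x v) m = c ^ mdeg m * mval x m"
  by (simp add: mval_def mdeg_def power_mult_distrib prod.distrib power_sum)

lemma forms_iff: "p \<in> forms d \<longleftrightarrow> (\<forall>m\<in>ks p. mdeg m = d)"
  by (simp add: forms_def mdeg_def)

lemma poly_val_forms_scale:
  "p \<in> forms d \<Longrightarrow> poly_val (\<lambda>v. c * x v) p = c ^ d * poly_val x p"
  unfolding poly_val_mval sum_distrib_left
  by (rule sum.cong) (auto simp: mval_scale forms_iff)

lemma forms_add: "p \<in> forms d \<Longrightarrow> q \<in> forms d \<Longrightarrow> p + q \<in> forms d"
  using keys_add[of p q] by (auto simp: forms_iff)

lemma forms_0: "0 \<in> forms d" by (simp add: forms_iff)

lemma lookup_poly_const_mult: "lk (poly_const c * p) m = c * lk p m"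
  by (simp add: poly_const_def map.rep_eq when_def flip: mult_map_scale_conv_mult)

lemma forms_scale: "p \<in> forms d \<Longrightarrow> poly_const c * p \<in> forms d"
  by (auto simp: forms_iff in_keys_iff lookup_poly_const_mult)

text \<open>Differentiation of \<open>p (c x) = c ^ d p x\<close>. With the factor \<open>c\<close>
  on the left, in place of an exponent \<open>d - 1\<close> on the right, the case
  \<open>d = 0\<close> is no exception.\<close>

lemma poly_val_partial_scale:
  fixes p :: "'v::finite cpoly"
  assumes "p \<in> forms d"
  shows "c * poly_val (\<lambda>v. c * x v) (partial_deriv i p) = c ^ d * poly_val x (partial_deriv i p)"
proof -
  have "((\<lambda>t. poly_val (\<lambda>v. c * (x(i := t)) v) p) has_field_derivative
      (\<Sum>v\<in>UNIV. poly_val (\<lambda>v. c * (x(i := x i)) v) (partial_deriv v p) * (if v = i then c else 0))) (at (x i))"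
  proof (rule poly_val_chain)
    fix v
    show "((\<lambda>t. c * (x(i := t)) v) has_field_derivative (if v = i then c else 0)) (at (x i))"
      by (cases "v = i") (auto intro!: derivative_eq_intros)
  qed
  moreover have "((\<lambda>t. c ^ d * poly_val (x(i := t)) p) has_field_derivative
      c ^ d * poly_val x (partial_deriv i p)) (at (x i))"
    by (rule DERIV_cmult[OF poly_val_partial_deriv_at])
  ultimately have "(\<Sum>v\<in>UNIV. poly_val (\<lambda>v. c * (x(i := x i)) v) (partial_deriv v p) * (if v = i then c else 0)) =
      c ^ d * poly_val x (partial_deriv i p)"
    unfolding poly_val_forms_scale[OF assms] by (rule DERIV_unique)
  then show ?thesis
    by (simp add: if_distrib[of "\<lambda>x. _ * x"] mult.commute[of c] cong: if_cong)
qed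

lemma poly_val_euler:
  fixes p :: "'v::finite cpoly"
  assumes "p \<in> forms d"
  shows "(\<Sum>i\<in>UNIV. poly_val x (partial_deriv i p) * x i) = of_nat d * poly_val x p"
proof -
  have "((\<lambda>t. poly_val (\<lambda>v. t * x v) p) has_field_derivative
      (\<Sum>v\<in>UNIV. poly_val (\<lambda>v. 1 * x v) (partial_deriv v p) * x v)) (at 1)"
    by (rule poly_val_chain) (auto intro!: derivative_eq_intros)
  moreover have "((\<lambda>t. t ^ d * poly_val x p) has_field_derivative of_nat d * poly_val x p) (at 1)"
    by (auto intro!: derivative_eq_intros)
  ultimately show ?thesis
    unfolding poly_val_forms_scale[OF assms] by (auto dest: DERIV_unique)
qed

lemma vanishing_coeffs:
  fixes a :: "nat \<Rightarrow> complex"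
  assumes "\<And>c. c \<noteq> 0 \<Longrightarrow> (\<Sum>e\<le>N. a e * c ^ e) = 0" "e \<le> N"
  shows "a e = 0"
proof -
  define p where "p = (\<Sum>e\<le>N. monom (a e) e)"
  have p: "poly p c = (\<Sum>e\<le>N. a e * c ^ e)" for c by (simp add: p_def poly_sum poly_monom)
  have "infinite (UNIV - {0::complex})" using infinite_UNIV_char_0 by simp
  moreover have "UNIV - {0} \<subseteq> {c. poly p c = 0}" using assms(1) p by auto
  ultimately have "infinite {c. poly p c = 0}" using finite_subset by blast
  then have "p = 0" using poly_roots_finite by blast
  moreover have "coeff p e = a e"
    using assms(2) by (simp add: p_def coeff_sum)
  ultimately show ?thesis by simp
qed

definition restrict_keys :: "('m \<Rightarrow> bool) \<Rightarrow> ('m \<Rightarrow>\<^sub>0 complex) \<Rightarrow> ('m \<Rightarrow>\<^sub>0 complex)" where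
  "restrict_keys Q p = (\<Sum>m\<in>{m\<in>ks p. Q m}. Poly_Mapping.single m (lk p m))"

lemma lookup_restrict_keys: "lk (restrict_keys Q p) m = (if Q m then lk p m else 0)"
proof -
  have "lk (restrict_keys Q p) m = (\<Sum>k\<in>{m\<in>ks p. Q m}. if k = m then lk p k else 0)"
    by (simp add: restrict_keys_def lookup_sum lookup_single when_def)
  also have "\<dots> = (if Q m then lk p m else 0)"
    by (auto simp: in_keys_iff)
  finally show ?thesis .
qed

lemma keys_restrict_keys: "ks (restrict_keys Q p) = {m\<in>ks p. Q m}"
  by (auto simp: in_keys_iff lookup_restrict_keys split: if_splits)

lemma poly_val_restrict_keys: "poly_val x (restrict_keys Q p) = (\<Sum>m\<in>{m\<in>ks p. Q m}. lk p m * mval x m)"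
  by (simp add: restrict_keys_def poly_val_sum)

text \<open>A grading of the monomials is seen by rescaling the variables. Below, \<open>D\<close>
  is the total degree or the degree in one block of variables.\<close>

lemma poly_val_graded:
  fixes D :: "('v \<Rightarrow>\<^sub>0 nat) \<Rightarrow> nat"
  assumes "\<And>m. m \<in> ks p \<Longrightarrow> D m \<le> N" and "\<And>m. m \<in> ks p \<Longrightarrow> mval y m = c ^ D m * mval x m"
  shows "poly_val y p = (\<Sum>e\<le>N. poly_val x (restrict_keys (\<lambda>m. D m = e) p) * c ^ e)"
proof -
  have "poly_val y p = (\<Sum>e\<le>N. \<Sum>m\<in>{m\<in>ks p. D m = e}. lk p m * mval y m)"
    unfolding poly_val_mval by (rule sum.group[symmetric]) (use assms(1) in auto)
  also have "\<dots> = (\<Sum>e\<le>N. poly_val x (restrict_keys (\<lambda>m. D m = e) p) * c ^ e)"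
    unfolding poly_val_restrict_keys sum_distrib_right
    by (intro sum.cong refl) (auto simp: assms(2))
  finally show ?thesis .
qed

text \<open>The value at \<open>y c\<close> is a polynomial in \<open>c\<close> with infinitely many
  zeros, so its coefficients vanish. Consequently the ideal of a set that is stable under the
  rescalings is homogeneous for the grading.\<close>

lemma graded_components_vanish:
  fixes D :: "('v \<Rightarrow>\<^sub>0 nat) \<Rightarrow> nat"
  assumes "\<And>c. c \<noteq> 0 \<Longrightarrow> poly_val (y c) p = 0"
    and "\<And>m c. m \<in> ks p \<Longrightarrow> mval (y c) m = c ^ D m * mval x m"
  shows "poly_val x (restrict_keys (\<lambda>m. D m = e) p) = 0"
proof (cases "\<exists>m\<in>ks p. D m = e")
  case False
  then show ?thesis by (auto simp: poly_val_restrict_keys intro!: sum.neutral)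
next
  case True
  define N where "N = Max (D ` ks p)"
  have N: "D m \<le> N" if "m \<in> ks p" for m using that by (auto simp: N_def)
  have "e \<le> N" using True N by auto
  show ?thesis
    by (rule vanishing_coeffs[OF _ \<open>e \<le> N\<close>])
      (use poly_val_graded[OF N assms(2)] assms(1) in auto)
qed

lemma poly_val_sum_graded:
  fixes D :: "('v \<Rightarrow>\<^sub>0 nat) \<Rightarrow> nat"
  shows "\<exists>N. poly_val x p = (\<Sum>e\<le>N. poly_val x (restrict_keys (\<lambda>m. D m = e) p))"
proof -
  have "D m \<le> Max (D ` ks p)" if "m \<in> ks p" for m using that by auto
  from poly_val_graded[OF this, where y = x and c = 1 and x = x] show ?thesis by auto
qed

lemma restrict_mdeg_forms: "restrict_keys (\<lambda>m. mdeg m = e) p \<in> forms e"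
  by (auto simp: forms_iff keys_restrict_keys)

lemma cone_components_vanish:
  assumes "\<And>c. c \<noteq> 0 \<Longrightarrow> poly_val (\<lambda>v. c * x v) p = 0"
  shows "poly_val x (restrict_keys (\<lambda>m. mdeg m = e) p) = 0"
  by (rule graded_components_vanish[where y = "\<lambda>c v. c * x v"]) (auto simp: assms mval_scale)

lemma pdv_linear:
  assumes "\<And>k. k \<in> A \<Longrightarrow> polyfn V (f k)" "finite V" "i \<in> V"
  shows "pdv i (\<lambda>z. \<Sum>k\<in>A. c k * f k z) z = (\<Sum>k\<in>A. c k * pdv i (f k) z)"
proof (rule pdv_eqI, intro DERIV_sum DERIV_cmult)
  fix k assume k: "k \<in> A"
  have "((\<lambda>h. f k (z(i := h))) has_field_derivative
      (\<Sum>v\<in>V. pdv v (f k) (z(i := z i)) * (if v = i then 1 else 0))) (at (z i))"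
  proof (rule polyfn_chain[OF assms(1)[OF k] assms(2)])
    fix v show "((\<lambda>t. (z(i := t)) v) has_field_derivative (if v = i then 1 else 0)) (at (z i))"
      by (cases "v = i") (auto intro!: derivative_eq_intros)
  qed
  then show "((\<lambda>h. f k (z(i := h))) has_field_derivative pdv i (f k) z) (at (z i))"
    using assms(2,3) by (simp add: if_distrib[of "\<lambda>x. _ * x"] cong: if_cong)
qed

lemma poly_val_partial_deriv_linear:
  fixes f :: "'k \<Rightarrow> 'v::finite cpoly"
  shows "poly_val z (partial_deriv i (\<Sum>k\<in>A. poly_const (c k) * f k)) =
    (\<Sum>k\<in>A. c k * poly_val z (partial_deriv i (f k)))"
  unfolding poly_val_partial_deriv poly_val_sum poly_val_mult poly_val_const
  by (rule pdv_linear[where V = UNIV]) (auto intro: polyfn_poly_val_UNIV)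

section \<open>General members of the linear system\<close>

text \<open>A point of \<open>Y\<close> consists of parameters, the variables in \<open>T\<close>, and of witnesses for a condition on them.
  The premise excludes tangent vectors of the Zariski closure of \<open>Y\<close> that move no parameter but \<open>t1\<close>.\<close>

lemma generic_avoid:
  fixes V :: "'v::countable set"
  assumes V: "finite V" "T \<subseteq> V" "t1 \<in> T"
    and no_tangent: "\<And>z w. w t1 = 1 \<Longrightarrow> (\<And>t. t \<in> T - {t1} \<Longrightarrow> w t = 0) \<Longrightarrow>
      (\<And>p. polyfn V p \<Longrightarrow> (\<And>y. y \<in> Y \<Longrightarrow> p y = 0) \<Longrightarrow>
        p z = 0 \<and> ((\<lambda>\<tau>. p (\<lambda>v. z v + \<tau> * w v)) has_field_derivative 0) (at 0)) \<Longrightarrow> False"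
  shows "\<exists>P. polyfn T P \<and> (\<exists>z. P z \<noteq> 0) \<and> (\<forall>y\<in>Y. P y = 0)"
proof (rule ccontr)
  assume neg: "\<not> ?thesis"
  define I where "I = {p. polyfn V p \<and> (\<forall>y\<in>Y. p y = 0)}"
  have I: "pideal V I" by (auto simp: pideal_def I_def intro: polyfn.intros)
  have ind: "indep I T" using neg by (auto simp: indep_def I_def)
  obtain z w where zw: "w t1 = 1" "\<And>t. t \<in> T - {t1} \<Longrightarrow> w t = 0"
    "\<And>p. p \<in> I \<Longrightarrow> p z = 0" "\<And>p. p \<in> I \<Longrightarrow> (\<Sum>v\<in>V. pdv v p z * w v) = 0"
    by (rule tangent_vector_over_direction[OF V(1) I ind V(2,3)]) (rule that)
  show False
  proof (rule no_tangent[of w z])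
    show "w t1 = 1" by (rule zw(1))
    show "\<And>t. t \<in> T - {t1} \<Longrightarrow> w t = 0" by (rule zw(2))
    fix p assume p: "polyfn V p" "\<And>y. y \<in> Y \<Longrightarrow> p y = 0"
    then have pI: "p \<in> I" by (simp add: I_def)
    have "((\<lambda>\<tau>. p (\<lambda>v. z v + \<tau> * w v)) has_field_derivative
        (\<Sum>v\<in>V. pdv v p (\<lambda>v. z v + 0 * w v) * w v)) (at 0)"
      by (rule polyfn_chain[OF p(1) V(1)]) (auto intro!: derivative_eq_intros)
    then show "p z = 0 \<and> ((\<lambda>\<tau>. p (\<lambda>v. z v + \<tau> * w v)) has_field_derivative 0) (at 0)"
      using zw(3)[OF pI] zw(4)[OF pI] by simp
  qed
qed

lemma DERIV_poly_combination:
  fixes h :: "nat \<Rightarrow> 'v::finite cpoly"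
  shows "((\<lambda>\<tau>. \<Sum>i<q. (a i + \<tau> * b i) * poly_val (\<lambda>l. x l + \<tau> * \<xi> l) (h i)) has_field_derivative
    (\<Sum>i<q. b i * poly_val x (h i) + a i * (\<Sum>l\<in>UNIV. poly_val x (partial_deriv l (h i)) * \<xi> l))) (at 0)"
proof (intro DERIV_sum)
  fix i
  have "((\<lambda>\<tau>. poly_val (\<lambda>l. x l + \<tau> * \<xi> l) (h i)) has_field_derivative
      (\<Sum>l\<in>UNIV. poly_val (\<lambda>l. x l + 0 * \<xi> l) (partial_deriv l (h i)) * \<xi> l)) (at 0)"
    by (rule poly_val_chain) (auto intro!: derivative_eq_intros)
  then show "((\<lambda>\<tau>. (a i + \<tau> * b i) * poly_val (\<lambda>l. x l + \<tau> * \<xi> l) (h i)) has_field_derivative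
      b i * poly_val x (h i) + a i * (\<Sum>l\<in>UNIV. poly_val x (partial_deriv l (h i)) * \<xi> l)) (at 0)"
    by (auto intro!: derivative_eq_intros)
qed

text \<open>A complement of \<open>T\<close> has dimension greater than \<open>r\<close>, so
  \<open>r\<close> linear forms have a common nonzero zero in it.\<close>

lemma vector_outside_killed:
  fixes T :: "(complex^'n::finite) set" and a :: "nat \<Rightarrow> 'n \<Rightarrow> complex"
  assumes T: "vec.subspace T" "vec.dim T + r < CARD('n)"
  shows "\<exists>v. v \<notin> T \<and> (\<forall>j<r. (\<Sum>l\<in>UNIV. a j l * v $ l) = 0)"
proof -
  obtain B0 where B0: "B0 \<subseteq> T" "vec.independent B0" "T \<subseteq> vec.span B0" "card B0 = vec.dim T"
    using vec.basis_exists[of T] by blast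
  obtain B where B: "B0 \<subseteq> B" "vec.independent B" "UNIV \<subseteq> vec.span B"
    using vec.maximal_independent_subset_extend[of B0 UNIV] B0(2) by auto
  have finB: "finite B" using B(2) vec.finiteI_independent by blast
  have "vec.span B = UNIV" using B(3) by blast
  then have "card B = vec.dim (UNIV :: (complex^'n) set)"
    using vec.dim_eq_card[OF _ B(2), of UNIV] by simp
  then have cardB: "card B = CARD('n)" by (simp add: vec_dim_card card_cart_basis)
  have "card (B - B0) > r"
    using B(1) finB T(2) B0(4) cardB by (simp add: card_Diff_subset finite_subset)
  then obtain c where c: "\<exists>b\<in>B-B0. c b \<noteq> 0" "\<And>j. j < r \<Longrightarrow> (\<Sum>b\<in>B-B0. c b * (\<Sum>l\<in>UNIV. a j l * b $ l)) = 0"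
    using linear_dependence[of "B - B0" r "\<lambda>b j. \<Sum>l\<in>UNIV. a j l * b $ l"] finB by auto
  define v where "v = (\<Sum>b\<in>B-B0. c b *s b)"
  have "(\<Sum>l\<in>UNIV. a j l * v $ l) = 0" if "j < r" for j
  proof -
    have "(\<Sum>l\<in>UNIV. a j l * v $ l) = (\<Sum>b\<in>B-B0. c b * (\<Sum>l\<in>UNIV. a j l * b $ l))"
      unfolding v_def sum_component sum_distrib_left vector_smult_component
      by (subst sum.swap) (simp add: mult_ac)
    then show ?thesis using c(2)[OF that] by simp
  qed
  moreover have "v \<notin> T"
  proof
    assume "v \<in> T"
    then have "v \<in> vec.span B0" using B0(3) by blast
    moreover have finB0: "finite B0" using finB B(1) finite_subset by blast
    ultimately obtain e where e: "v = (\<Sum>b\<in>B0. e b *s b)" by (auto simp: vec.span_finite)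
    define k where "k b = (if b \<in> B0 then - e b else c b)" for b
    have "(\<Sum>b\<in>B. k b *s b) = (\<Sum>b\<in>B-B0. k b *s b) + (\<Sum>b\<in>B0. k b *s b)"
      using sum.subset_diff[OF B(1) finB] .
    also have "(\<Sum>b\<in>B-B0. k b *s b) = v" unfolding v_def by (rule sum.cong) (auto simp: k_def)
    also have "(\<Sum>b\<in>B0. k b *s b) = - v"
      unfolding e sum_negf[symmetric] by (rule sum.cong) (auto simp: k_def)
    finally have "(\<Sum>b\<in>B. k b *s b) = 0" by simp
    then have k0: "k b = 0" if "b \<in> B" for b
      using vec.independentD[OF B(2) finB subset_refl _ that] by blast
    obtain b where "b \<in> B - B0" "c b \<noteq> 0" using c(1) by blast
    then show False using k0[of b] by (simp add: k_def)
  qed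
  ultimately show ?thesis by blast
qed

definition ev :: "'n::finite cpoly \<Rightarrow> complex^'n \<Rightarrow> complex" where
  "ev f x = poly_val (($) x) f"

definition dv :: "'n::finite cpoly \<Rightarrow> complex^'n \<Rightarrow> complex^'n \<Rightarrow> complex" where
  "dv f x v = (\<Sum>l\<in>UNIV. ev (partial_deriv l f) x * v $ l)"

text \<open>Here \<open>r = s - 1\<close>, so \<open>r + 4\<close> is the number of homogeneous
  coordinates. The hypothesis on the base scheme enters as follows: the \<open>g i\<close> cut out
  \<open>D\<close> as a set (\<open>g_base\<close>), and at points of \<open>D\<close> the common
  kernel of their differentials is the cone over the embedded tangent plane
  (\<open>tangent\<close>), of vector space dimension 3 (\<open>dim_tangent\<close>). The point
  \<open>x0\<close> is the base point of the argument for connectedness.\<close>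

locale base_locus =
  fixes D :: "(complex^'n::finite) set" and d r q :: nat and g :: "nat \<Rightarrow> 'n cpoly" and x0 :: "complex^'n"
  assumes card_n: "CARD('n) = r + 4"
    and g_form: "\<And>i. i < q \<Longrightarrow> g i \<in> forms d"
    and D_nonzero: "0 \<notin> D"
    and x0: "x0 \<in> D"
    and g_D: "\<And>i x. i < q \<Longrightarrow> x \<in> D \<Longrightarrow> ev (g i) x = 0"
    and g_base: "\<And>x. x \<noteq> 0 \<Longrightarrow> (\<And>i. i < q \<Longrightarrow> ev (g i) x = 0) \<Longrightarrow> x \<in> D"
    and dim_tangent: "\<And>x. x \<in> D \<Longrightarrow> vec.dim {v. \<forall>i<q. dv (g i) x v = 0} = 3"
    and tangent: "\<And>x f v. x \<in> D \<Longrightarrow> f \<in> vanishing_ideal D \<Longrightarrow> (\<And>i. i < q \<Longrightarrow> dv (g i) x v = 0) \<Longrightarrow> dv f x v = 0"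
begin

definition F :: "(nat \<times> nat \<Rightarrow> complex) \<Rightarrow> nat \<Rightarrow> 'n cpoly" where
  "F t j = (\<Sum>i<q. poly_const (t (j, i)) * g i)"

definition X :: "(nat \<times> nat \<Rightarrow> complex) \<Rightarrow> (complex^'n) set" where
  "X t = {x. x \<noteq> 0 \<and> (\<forall>j<r. ev (F t j) x = 0)}"

definition indep_at :: "(nat \<times> nat \<Rightarrow> complex) \<Rightarrow> complex^'n \<Rightarrow> bool" where
  "indep_at t x \<longleftrightarrow> (\<forall>lam. (\<forall>v. (\<Sum>j<r. lam j * dv (F t j) x v) = 0) \<longrightarrow> (\<forall>j<r. lam j = 0))"

definition hess :: "'n cpoly \<Rightarrow> complex^'n \<Rightarrow> complex^'n \<Rightarrow> 'n \<Rightarrow> complex" where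
  "hess f x w l = (\<Sum>k\<in>UNIV. ev (partial_deriv l (partial_deriv k f)) x * w $ k)"

text \<open>By the last clause, the Hessian of the singular combination of the equations at a singular point
  induces a nondegenerate pairing of the tangent space of \<open>D\<close> with the quotient of that of \<open>X t\<close> by it.\<close>

definition good :: "(nat \<times> nat \<Rightarrow> complex) \<Rightarrow> bool" where
  "good t \<longleftrightarrow> indep_at t x0 \<and> (\<forall>x. x \<in> X t \<longrightarrow> x \<notin> D \<longrightarrow> indep_at t x) \<and>
     (\<forall>x\<in>D. \<forall>lam j0 w \<beta>. j0 < r \<longrightarrow> lam j0 = 1 \<longrightarrow> (\<forall>v. (\<Sum>j<r. lam j * dv (F t j) x v) = 0) \<longrightarrow>
        (\<forall>j<r. dv (F t j) x w = 0) \<longrightarrow>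
        (\<forall>l. (\<Sum>j<r. lam j * hess (F t j) x w l) = (\<Sum>i<q. \<beta> i * ev (partial_deriv l (g i)) x)) \<longrightarrow>
        (\<forall>i<q. dv (g i) x w = 0))"

lemma ev_F: "ev (F t j) x = (\<Sum>i<q. t (j, i) * ev (g i) x)"
  by (simp add: F_def ev_def poly_val_sum poly_val_mult)

lemma ev_partial_F: "ev (partial_deriv l (F t j)) x = (\<Sum>i<q. t (j, i) * ev (partial_deriv l (g i)) x)"
  unfolding F_def ev_def by (rule poly_val_partial_deriv_linear)

lemma dv_F: "dv (F t j) x v = (\<Sum>i<q. t (j, i) * dv (g i) x v)"
  unfolding dv_def ev_partial_F sum_distrib_left sum_distrib_right
  by (subst sum.swap) (simp add: mult_ac)

lemma ev_partial_partial_F: "ev (partial_deriv l (partial_deriv k (F t j))) x =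
    (\<Sum>i<q. t (j, i) * ev (partial_deriv l (partial_deriv k (g i))) x)"
proof -
  have eq: "(\<lambda>z. poly_val z (partial_deriv k (F t j))) =
      (\<lambda>z. \<Sum>i<q. t (j, i) * poly_val z (partial_deriv k (g i)))"
    unfolding F_def poly_val_partial_deriv_linear ..
  show ?thesis
    unfolding ev_def poly_val_partial_deriv[of _ l] eq
    by (rule pdv_linear[where V = UNIV]) (auto intro: polyfn_poly_val_UNIV)
qed

lemma hess_F: "hess (F t j) x w l = (\<Sum>i<q. t (j, i) * hess (g i) x w l)"
  unfolding hess_def ev_partial_partial_F sum_distrib_left sum_distrib_right
  by (subst sum.swap) (simp add: mult_ac)

lemma D_sub_X: "x \<in> D \<Longrightarrow> x \<in> X t"
  using D_nonzero by (auto simp: X_def ev_F g_D)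

end

text \<open>One type of variables serves all three bad loci: the parameters \<open>Tv\<close>, the
  point \<open>Xv\<close>, the coefficients \<open>Lv\<close> of a linear relation between the
  differentials, a vector \<open>Wv\<close>, and auxiliary scalars \<open>Bv\<close>.\<close>

type_synonym 'n pvar = "((nat \<times> nat) + 'n) + (nat + ('n + nat))"

abbreviation (input) Tv :: "nat \<Rightarrow> nat \<Rightarrow> 'n pvar" where "Tv j i \<equiv> Inl (Inl (j, i))"
abbreviation (input) Xv :: "'n \<Rightarrow> 'n pvar" where "Xv l \<equiv> Inl (Inr l)"
abbreviation (input) Lv :: "nat \<Rightarrow> 'n pvar" where "Lv j \<equiv> Inr (Inl j)"
abbreviation (input) Wv :: "'n \<Rightarrow> 'n pvar" where "Wv l \<equiv> Inr (Inr (Inl l))"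
abbreviation (input) Bv :: "nat \<Rightarrow> 'n pvar" where "Bv i \<equiv> Inr (Inr (Inr i))"

context base_locus
begin

definition pars :: "'n pvar set" where "pars = (\<lambda>p. Inl (Inl p)) ` ({..<r} \<times> {..<q})"

text \<open>The bound \<open>Suc q\<close> makes \<open>Bv 0\<close> available for every
  \<open>q\<close>; \<open>sing_off\<close> uses it as the inverse of a value of
  \<open>g i0\<close>.\<close>

definition vars :: "'n pvar set" where
  "vars = pars \<union> range Xv \<union> Lv ` {..<r} \<union> range Wv \<union> Bv ` {..<Suc q}"

lemma finite_vars: "finite vars" by (simp add: vars_def pars_def)

lemma vars_simps [simp]:
  "j < r \<Longrightarrow> i < q \<Longrightarrow> Tv j i \<in> vars" "Xv l \<in> vars" "j < r \<Longrightarrow> Lv j \<in> vars" "Wv l \<in> vars"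
  "i < Suc q \<Longrightarrow> Bv i \<in> vars"
  by (auto simp: vars_def pars_def)

lemma pars_subset: "pars \<subseteq> vars" by (auto simp: vars_def)

lemma polyfn_vars_poly_val: "polyfn vars (\<lambda>z. poly_val (\<lambda>l. z (Xv l)) p)"
  by (rule polyfn_comp[OF polyfn_poly_val_UNIV]) (auto intro: polyfn_var)

lemma polyfn_vars_combination:
  "j < r \<Longrightarrow> polyfn vars (\<lambda>z. \<Sum>i<q. z (Tv j i) * poly_val (\<lambda>l. z (Xv l)) (h i))"
  by (intro polyfn_sum polyfn_mult polyfn_var polyfn_vars_poly_val) auto

lemma polyfn_vars_combination2:
  "polyfn vars (\<lambda>z. \<Sum>j<r. z (Lv j) * (\<Sum>i<q. z (Tv j i) * poly_val (\<lambda>l. z (Xv l)) (h i)))"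
  by (intro polyfn_sum polyfn_mult polyfn_vars_combination) (auto intro: polyfn_var)

text \<open>Being off \<open>D\<close> is an open condition. It is made closed by the Rabinowitsch
  device: \<open>Bv 0\<close> inverts \<open>g i0\<close>. Likewise \<open>Lv j0 = 1\<close> says
  that the relation between the differentials is nontrivial.\<close>

definition sing_off :: "nat \<Rightarrow> nat \<Rightarrow> ('n pvar \<Rightarrow> complex) set" where
  "sing_off i0 j0 = {z. (\<forall>j<r. (\<Sum>i<q. z (Tv j i) * poly_val (\<lambda>l. z (Xv l)) (g i)) = 0) \<and>
    (\<forall>k. (\<Sum>j<r. z (Lv j) * (\<Sum>i<q. z (Tv j i) * poly_val (\<lambda>l. z (Xv l)) (partial_deriv k (g i)))) = 0) \<and>
    z (Lv j0) = 1 \<and> z (Bv 0) * poly_val (\<lambda>l. z (Xv l)) (g i0) = 1}"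

text \<open>A Bertini argument: differentiate the equation of each member along the tangent vector,
  multiply by the coefficients \<open>Lv j\<close> of the relation and add. The terms with the
  velocity of the point cancel by the relation; the only moving parameter contributes
  \<open>g i0\<close>, which is therefore 0 at a point where it is invertible.\<close>

lemma thin_singular_off_D:
  assumes i0: "i0 < q" and j0: "j0 < r"
  shows "\<exists>P. polyfn pars P \<and> (\<exists>z. P z \<noteq> 0) \<and> (\<forall>y\<in>sing_off i0 j0. P y = 0)"
proof (rule generic_avoid[OF finite_vars pars_subset])
  show "Tv j0 i0 \<in> pars" using i0 j0 by (auto simp: pars_def)
  fix z w :: "'n pvar \<Rightarrow> complex"
  assume w1: "w (Tv j0 i0) = 1" and w0: "\<And>t. t \<in> pars - {Tv j0 i0} \<Longrightarrow> w t = 0"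
    and tan: "\<And>p. polyfn vars p \<Longrightarrow> (\<And>y. y \<in> sing_off i0 j0 \<Longrightarrow> p y = 0) \<Longrightarrow>
      p z = 0 \<and> ((\<lambda>\<tau>. p (\<lambda>v. z v + \<tau> * w v)) has_field_derivative 0) (at 0)"
  define x \<xi> where "x = (\<lambda>l. z (Xv l))" and "\<xi> = (\<lambda>l. w (Xv l))"
  have \<delta>: "w (Tv j i) = (if j = j0 \<and> i = i0 then 1 else 0)" if "j < r" "i < q" for j i
    using w0[of "Tv j i"] w1 that by (auto simp: pars_def)
  have 1: "(\<Sum>i<q. w (Tv j i) * poly_val x (g i) +
      z (Tv j i) * (\<Sum>l\<in>UNIV. poly_val x (partial_deriv l (g i)) * \<xi> l)) = 0" if j: "j < r" for j
  proof -
    have "((\<lambda>\<tau>. \<Sum>i<q. (z (Tv j i) + \<tau> * w (Tv j i)) * poly_val (\<lambda>l. z (Xv l) + \<tau> * w (Xv l)) (g i))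
        has_field_derivative 0) (at 0)"
      using tan[OF polyfn_vars_combination[OF j, of g]] j by (auto simp: sing_off_def)
    then show ?thesis
      unfolding x_def \<xi>_def by (rule DERIV_unique[OF DERIV_poly_combination])
  qed
  have 2: "(\<Sum>j<r. z (Lv j) * (\<Sum>i<q. z (Tv j i) * poly_val x (partial_deriv k (g i)))) = 0" for k
    using tan[OF polyfn_vars_combination2[of "\<lambda>i. partial_deriv k (g i)"]] by (auto simp: sing_off_def x_def)
  have 3: "z (Lv j0) = 1"
    using tan[OF polyfn_diff[OF polyfn_var polyfn_const], of "Lv j0" 1] j0 by (auto simp: sing_off_def)
  have 4: "z (Bv 0) * poly_val x (g i0) = 1"
    using tan[OF polyfn_diff[OF polyfn_mult[OF polyfn_var polyfn_vars_poly_val] polyfn_const],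
        of "Bv 0" "g i0" 1] by (auto simp: sing_off_def x_def)
  have "0 = (\<Sum>j<r. z (Lv j) * (\<Sum>i<q. w (Tv j i) * poly_val x (g i) +
      z (Tv j i) * (\<Sum>l\<in>UNIV. poly_val x (partial_deriv l (g i)) * \<xi> l)))"
    using 1 by simp
  also have "\<dots> = (\<Sum>j<r. z (Lv j) * (\<Sum>i<q. w (Tv j i) * poly_val x (g i))) +
      (\<Sum>j<r. z (Lv j) * (\<Sum>i<q. z (Tv j i) * (\<Sum>l\<in>UNIV. poly_val x (partial_deriv l (g i)) * \<xi> l)))"
    by (simp add: sum.distrib distrib_left)
  also have "(\<Sum>j<r. z (Lv j) * (\<Sum>i<q. w (Tv j i) * poly_val x (g i))) = poly_val x (g i0)"
  proof -
    have "(\<Sum>i<q. w (Tv j i) * poly_val x (g i)) = (if j = j0 then poly_val x (g i0) else 0)" if "j < r" for j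
    proof -
      have "(\<Sum>i<q. w (Tv j i) * poly_val x (g i)) = (\<Sum>i<q. if i = i0 then (if j = j0 then poly_val x (g i0) else 0) else 0)"
        by (rule sum.cong) (auto simp: \<delta> that)
      then show ?thesis using i0 by simp
    qed
    then have "(\<Sum>j<r. z (Lv j) * (\<Sum>i<q. w (Tv j i) * poly_val x (g i))) =
        (\<Sum>j<r. if j = j0 then poly_val x (g i0) else 0)"
      by (intro sum.cong) (auto simp: 3)
    then show ?thesis using j0 by simp
  qed
  also have "(\<Sum>j<r. z (Lv j) * (\<Sum>i<q. z (Tv j i) * (\<Sum>l\<in>UNIV. poly_val x (partial_deriv l (g i)) * \<xi> l))) =
      (\<Sum>l\<in>UNIV. \<xi> l * (\<Sum>j<r. z (Lv j) * (\<Sum>i<q. z (Tv j i) * poly_val x (partial_deriv l (g i)))))"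
    (is "?L = ?R")
  proof -
    have "?L = (\<Sum>j<r. \<Sum>i<q. \<Sum>l\<in>UNIV. \<xi> l * (z (Lv j) * (z (Tv j i) * poly_val x (partial_deriv l (g i)))))"
      by (simp add: sum_distrib_left mult_ac)
    also have "\<dots> = (\<Sum>j<r. \<Sum>l\<in>UNIV. \<Sum>i<q. \<xi> l * (z (Lv j) * (z (Tv j i) * poly_val x (partial_deriv l (g i)))))"
      by (intro sum.cong refl sum.swap)
    also have "\<dots> = ?R"
      by (subst sum.swap) (simp add: sum_distrib_left)
    finally show ?thesis .
  qed
  finally have "poly_val x (g i0) = 0" by (simp add: 2)
  then show False using 4 by simp
qed

lemma DERIV_sum_mult:
  assumes "\<And>j. j \<in> A \<Longrightarrow> (f j has_field_derivative f' j) (at 0)"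
  shows "((\<lambda>\<tau>. \<Sum>j\<in>A. (a j + \<tau> * b j) * f j \<tau>) has_field_derivative
    (\<Sum>j\<in>A. b j * f j 0 + a j * f' j)) (at 0)"
proof (intro DERIV_sum)
  fix j assume "j \<in> A"
  from assms[OF this] show "((\<lambda>\<tau>. (a j + \<tau> * b j) * f j \<tau>) has_field_derivative
    b j * f j 0 + a j * f' j) (at 0)"
    by (auto intro!: derivative_eq_intros)
qed

lemma delta_sum:
  assumes \<delta>: "\<And>j i. j < r \<Longrightarrow> i < q \<Longrightarrow> w (Tv j i) = (if j = j0 \<and> i = i0 then 1 else 0)"
    and "j0 < r" "i0 < q" "lam j0 = 1"
  shows "(\<Sum>j<r. lam j * (\<Sum>i<q. w (Tv j i) * c i)) = (c i0 :: complex)"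
proof -
  have "(\<Sum>i<q. w (Tv j i) * c i) = (if j = j0 then c i0 else 0)" if "j < r" for j
  proof -
    have "(\<Sum>i<q. w (Tv j i) * c i) = (\<Sum>i<q. if i = i0 then (if j = j0 then c i0 else 0) else 0)"
      by (rule sum.cong) (auto simp: \<delta> that)
    then show ?thesis using assms(3) by simp
  qed
  then have "(\<Sum>j<r. lam j * (\<Sum>i<q. w (Tv j i) * c i)) = (\<Sum>j<r. if j = j0 then c i0 else 0)"
    by (intro sum.cong) (auto simp: assms(4))
  then show ?thesis using assms(2) by simp
qed

lemma polyfn_vars_sum_W:
  "(\<And>k. polyfn vars (f k)) \<Longrightarrow> polyfn vars (\<lambda>z. \<Sum>k\<in>UNIV. f k z * z (Wv k))"
  by (intro polyfn_sum polyfn_mult polyfn_var) auto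

text \<open>Witnesses for a violation of the last clause of \<open>good\<close>. The last equation
  says, after scaling, that the vector \<open>Wv\<close> is not tangent to \<open>D\<close>.\<close>

definition degen_on :: "nat \<Rightarrow> nat \<Rightarrow> ('n pvar \<Rightarrow> complex) set" where
  "degen_on i0 j0 = {z.
    (\<forall>i<q. poly_val (\<lambda>l. z (Xv l)) (g i) = 0) \<and>
    (\<forall>k. (\<Sum>j<r. z (Lv j) * (\<Sum>i<q. z (Tv j i) * poly_val (\<lambda>l. z (Xv l)) (partial_deriv k (g i)))) = 0) \<and>
    (\<forall>j<r. (\<Sum>k\<in>UNIV. (\<Sum>i<q. z (Tv j i) * poly_val (\<lambda>l. z (Xv l)) (partial_deriv k (g i))) * z (Wv k)) = 0) \<and>
    (\<forall>l. (\<Sum>k\<in>UNIV. (\<Sum>j<r. z (Lv j) * (\<Sum>i<q. z (Tv j i) *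
        poly_val (\<lambda>l. z (Xv l)) (partial_deriv l (partial_deriv k (g i))))) * z (Wv k)) -
      (\<Sum>i<q. z (Bv i) * poly_val (\<lambda>l. z (Xv l)) (partial_deriv l (g i))) = 0) \<and>
    z (Lv j0) = 1 \<and> (\<Sum>k\<in>UNIV. poly_val (\<lambda>l. z (Xv l)) (partial_deriv k (g i0)) * z (Wv k)) = 1}"

text \<open>The velocity \<open>\<xi>\<close> of the point is tangent to \<open>D\<close>
  (\<open>E1\<close>). Differentiating the relation between the differentials and pairing the result
  with \<open>u\<close> leaves three terms. The first vanishes since \<open>u\<close> is annihilated
  by the differentials of the equations (\<open>E3\<close>); the Hessian term is a combination of
  differentials of the \<open>g i\<close> evaluated at \<open>\<xi>\<close> (\<open>E4\<close>),
  hence 0; so the last one, the differential of \<open>g i0\<close> at \<open>u\<close>, is 0 and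
  not 1.\<close>

lemma thin_degenerate_on_D:
  assumes i0: "i0 < q" and j0: "j0 < r"
  shows "\<exists>P. polyfn pars P \<and> (\<exists>z. P z \<noteq> 0) \<and> (\<forall>y\<in>degen_on i0 j0. P y = 0)"
proof (rule generic_avoid[OF finite_vars pars_subset])
  show "Tv j0 i0 \<in> pars" using i0 j0 by (auto simp: pars_def)
  fix z w :: "'n pvar \<Rightarrow> complex"
  assume w1: "w (Tv j0 i0) = 1" and w0: "\<And>t. t \<in> pars - {Tv j0 i0} \<Longrightarrow> w t = 0"
    and tan: "\<And>p. polyfn vars p \<Longrightarrow> (\<And>y. y \<in> degen_on i0 j0 \<Longrightarrow> p y = 0) \<Longrightarrow>
      p z = 0 \<and> ((\<lambda>\<tau>. p (\<lambda>v. z v + \<tau> * w v)) has_field_derivative 0) (at 0)"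
  define x \<xi> where "x = (\<lambda>l. z (Xv l))" and "\<xi> = (\<lambda>l. w (Xv l))"
  define lam \<mu> where "lam = (\<lambda>j. z (Lv j))" and "\<mu> = (\<lambda>j. w (Lv j))"
  define u where "u = (\<lambda>k. z (Wv k))"
  have \<delta>: "w (Tv j i) = (if j = j0 \<and> i = i0 then 1 else 0)" if "j < r" "i < q" for j i
    using w0[of "Tv j i"] w1 that by (auto simp: pars_def)
  define dF where "dF j k = (\<Sum>i<q. z (Tv j i) * poly_val x (partial_deriv k (g i)))" for j k
  define hF where "hF j l k = (\<Sum>i<q. z (Tv j i) * poly_val x (partial_deriv l (partial_deriv k (g i))))" for j l k
  have E1: "(\<Sum>l\<in>UNIV. poly_val x (partial_deriv l (g i)) * \<xi> l) = 0" if i: "i < q" for i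
  proof -
    have "((\<lambda>\<tau>. poly_val (\<lambda>l. z (Xv l) + \<tau> * w (Xv l)) (g i)) has_field_derivative 0) (at 0)"
      using tan[OF polyfn_vars_poly_val[of "g i"]] i by (auto simp: degen_on_def)
    moreover have "((\<lambda>\<tau>. poly_val (\<lambda>l. z (Xv l) + \<tau> * w (Xv l)) (g i)) has_field_derivative
      (\<Sum>l\<in>UNIV. poly_val (\<lambda>l. z (Xv l) + 0 * w (Xv l)) (partial_deriv l (g i)) * w (Xv l))) (at 0)"
      by (rule poly_val_chain) (auto intro!: derivative_eq_intros)
    ultimately show ?thesis unfolding x_def \<xi>_def by (auto dest: DERIV_unique)
  qed
  have E2: "(\<Sum>j<r. \<mu> j * dF j k + lam j * (\<Sum>i<q. w (Tv j i) * poly_val x (partial_deriv k (g i)) +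
      z (Tv j i) * (\<Sum>l\<in>UNIV. poly_val x (partial_deriv l (partial_deriv k (g i))) * \<xi> l))) = 0" for k
  proof -
    have "((\<lambda>\<tau>. \<Sum>j<r. (z (Lv j) + \<tau> * w (Lv j)) * (\<Sum>i<q. (z (Tv j i) + \<tau> * w (Tv j i)) *
        poly_val (\<lambda>l. z (Xv l) + \<tau> * w (Xv l)) (partial_deriv k (g i)))) has_field_derivative 0) (at 0)"
      using tan[OF polyfn_vars_combination2[of "\<lambda>i. partial_deriv k (g i)"]] by (auto simp: degen_on_def)
    from DERIV_unique[OF DERIV_sum_mult[OF DERIV_poly_combination] this]
    show ?thesis by (simp add: x_def \<xi>_def lam_def \<mu>_def dF_def)
  qed
  have E3: "(\<Sum>k\<in>UNIV. dF j k * u k) = 0" if j: "j < r" for j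
    using tan[OF polyfn_vars_sum_W[OF polyfn_vars_combination[OF j, of "\<lambda>i. partial_deriv _ (g i)"]]] j
    by (auto simp: degen_on_def x_def u_def dF_def)
  have E4: "(\<Sum>k\<in>UNIV. (\<Sum>j<r. lam j * hF j l k) * u k) = (\<Sum>i<q. z (Bv i) * poly_val x (partial_deriv l (g i)))" for l
  proof -
    have "polyfn vars (\<lambda>z. (\<Sum>k\<in>UNIV. (\<Sum>j<r. z (Lv j) * (\<Sum>i<q. z (Tv j i) *
        poly_val (\<lambda>l. z (Xv l)) (partial_deriv l (partial_deriv k (g i))))) * z (Wv k)) -
      (\<Sum>i<q. z (Bv i) * poly_val (\<lambda>l. z (Xv l)) (partial_deriv l (g i))))"
    proof (intro polyfn_diff polyfn_vars_sum_W polyfn_vars_combination2)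
      show "polyfn vars (\<lambda>z. \<Sum>i<q. z (Bv i) * poly_val (\<lambda>l. z (Xv l)) (partial_deriv l (g i)))"
        by (intro polyfn_sum polyfn_mult polyfn_vars_poly_val polyfn_var) auto
    qed
    from tan[OF this] show ?thesis by (auto simp: degen_on_def x_def u_def hF_def lam_def)
  qed
  have E5: "lam j0 = 1"
    using tan[OF polyfn_diff[OF polyfn_var polyfn_const], of "Lv j0" 1] j0 by (auto simp: degen_on_def lam_def)
  have E6: "(\<Sum>k\<in>UNIV. poly_val x (partial_deriv k (g i0)) * u k) = 1"
    using tan[OF polyfn_diff[OF polyfn_vars_sum_W[OF polyfn_vars_poly_val[of "partial_deriv _ (g i0)"]]
          polyfn_const[of _ 1]]]
    by (auto simp: degen_on_def x_def u_def)
  have E2': "(\<Sum>j<r. \<mu> j * dF j k) + poly_val x (partial_deriv k (g i0)) +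
      (\<Sum>l\<in>UNIV. \<xi> l * (\<Sum>j<r. lam j * hF j l k)) = 0" for k
  proof -
    have "(\<Sum>j<r. lam j * (\<Sum>i<q. z (Tv j i) * (\<Sum>l\<in>UNIV. poly_val x (partial_deriv l (partial_deriv k (g i))) * \<xi> l))) =
      (\<Sum>j<r. \<Sum>l\<in>UNIV. \<xi> l * (lam j * hF j l k))"
    proof (rule sum.cong[OF refl])
      fix j
      have "(\<Sum>i<q. z (Tv j i) * (\<Sum>l\<in>UNIV. poly_val x (partial_deriv l (partial_deriv k (g i))) * \<xi> l)) =
         (\<Sum>l\<in>UNIV. \<Sum>i<q. \<xi> l * (z (Tv j i) * poly_val x (partial_deriv l (partial_deriv k (g i)))))"
        by (subst sum.swap) (simp add: sum_distrib_left mult_ac)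
      then show "lam j * (\<Sum>i<q. z (Tv j i) * (\<Sum>l\<in>UNIV. poly_val x (partial_deriv l (partial_deriv k (g i))) * \<xi> l)) =
        (\<Sum>l\<in>UNIV. \<xi> l * (lam j * hF j l k))"
        by (simp add: hF_def sum_distrib_left mult_ac)
    qed
    also have "\<dots> = (\<Sum>l\<in>UNIV. \<xi> l * (\<Sum>j<r. lam j * hF j l k))"
      by (subst sum.swap) (simp add: sum_distrib_left)
    finally show ?thesis
      using E2[of k] delta_sum[of w j0 i0 lam "\<lambda>i. poly_val x (partial_deriv k (g i))", OF \<delta> j0 i0 E5]
      by (simp add: sum.distrib distrib_left add.assoc)
  qed
  have "0 = (\<Sum>k\<in>UNIV. u k * ((\<Sum>j<r. \<mu> j * dF j k) + poly_val x (partial_deriv k (g i0)) +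
      (\<Sum>l\<in>UNIV. \<xi> l * (\<Sum>j<r. lam j * hF j l k))))"
    by (simp add: E2')
  also have "\<dots> = (\<Sum>k\<in>UNIV. u k * (\<Sum>j<r. \<mu> j * dF j k)) + (\<Sum>k\<in>UNIV. poly_val x (partial_deriv k (g i0)) * u k) +
      (\<Sum>k\<in>UNIV. u k * (\<Sum>l\<in>UNIV. \<xi> l * (\<Sum>j<r. lam j * hF j l k)))"
    by (simp add: distrib_left sum.distrib mult_ac)
  also have "(\<Sum>k\<in>UNIV. u k * (\<Sum>j<r. \<mu> j * dF j k)) = (\<Sum>j<r. \<mu> j * (\<Sum>k\<in>UNIV. dF j k * u k))"
    unfolding sum_distrib_left by (subst sum.swap) (simp add: mult_ac)
  also have "\<dots> = 0" by (simp add: E3)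
  also have "(\<Sum>k\<in>UNIV. u k * (\<Sum>l\<in>UNIV. \<xi> l * (\<Sum>j<r. lam j * hF j l k))) =
      (\<Sum>l\<in>UNIV. \<xi> l * (\<Sum>k\<in>UNIV. (\<Sum>j<r. lam j * hF j l k) * u k))"
    unfolding sum_distrib_left[of "u _"] sum_distrib_left[of "\<xi> _" _ UNIV]
    by (subst sum.swap) (simp add: mult_ac)
  also have "\<dots> = (\<Sum>i<q. z (Bv i) * (\<Sum>l\<in>UNIV. poly_val x (partial_deriv l (g i)) * \<xi> l))"
    unfolding E4 sum_distrib_left by (subst sum.swap) (simp add: mult_ac)
  also have "\<dots> = 0" by (simp add: E1)
  finally show False using E6 by simp
qed

definition sing_at :: "nat \<Rightarrow> nat \<Rightarrow> ('n pvar \<Rightarrow> complex) set" where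
  "sing_at i0 j0 = {z.
    (\<forall>k. (\<Sum>j<r. z (Lv j) * (\<Sum>i<q. z (Tv j i) * poly_val (($) x0) (partial_deriv k (g i)))) = 0) \<and>
    (\<forall>j<r. (\<Sum>k\<in>UNIV. (\<Sum>i<q. z (Tv j i) * poly_val (($) x0) (partial_deriv k (g i))) * z (Wv k)) = 0) \<and>
    z (Lv j0) = 1 \<and> (\<Sum>k\<in>UNIV. poly_val (($) x0) (partial_deriv k (g i0)) * z (Wv k)) = 1}"

text \<open>The same computation at a fixed point: the Hessian term disappears, and the vector
  \<open>u\<close> is killed by the differentials of all equations but not by that of
  \<open>g i0\<close>.\<close>

lemma thin_singular_at_x0:
  assumes i0: "i0 < q" and j0: "j0 < r"
  shows "\<exists>P. polyfn pars P \<and> (\<exists>z. P z \<noteq> 0) \<and> (\<forall>y\<in>sing_at i0 j0. P y = 0)"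
proof (rule generic_avoid[OF finite_vars pars_subset])
  show "Tv j0 i0 \<in> pars" using i0 j0 by (auto simp: pars_def)
  fix z w :: "'n pvar \<Rightarrow> complex"
  assume w1: "w (Tv j0 i0) = 1" and w0: "\<And>t. t \<in> pars - {Tv j0 i0} \<Longrightarrow> w t = 0"
    and tan: "\<And>p. polyfn vars p \<Longrightarrow> (\<And>y. y \<in> sing_at i0 j0 \<Longrightarrow> p y = 0) \<Longrightarrow>
      p z = 0 \<and> ((\<lambda>\<tau>. p (\<lambda>v. z v + \<tau> * w v)) has_field_derivative 0) (at 0)"
  define a where "a i k = poly_val (($) x0) (partial_deriv k (g i))" for i k
  define lam \<mu> where "lam = (\<lambda>j. z (Lv j))" and "\<mu> = (\<lambda>j. w (Lv j))"
  define u where "u = (\<lambda>k. z (Wv k))"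
  have \<delta>: "w (Tv j i) = (if j = j0 \<and> i = i0 then 1 else 0)" if "j < r" "i < q" for j i
    using w0[of "Tv j i"] w1 that by (auto simp: pars_def)
  define dF where "dF j k = (\<Sum>i<q. z (Tv j i) * a i k)" for j k
  have pT: "polyfn vars (\<lambda>z. \<Sum>i<q. z (Tv j i) * a i k)" if "j < r" for j k
    using that by (intro polyfn_sum polyfn_mult polyfn_var polyfn_const) auto
  have pLT: "polyfn vars (\<lambda>z. \<Sum>j<r. z (Lv j) * (\<Sum>i<q. z (Tv j i) * a i k))" for k
    by (intro polyfn_sum polyfn_mult pT) (auto intro: polyfn_var)
  have E2: "(\<Sum>j<r. \<mu> j * dF j k + lam j * (\<Sum>i<q. w (Tv j i) * a i k)) = 0" for k
  proof -
    have d1: "((\<lambda>\<tau>. \<Sum>j<r. (z (Lv j) + \<tau> * w (Lv j)) * (\<Sum>i<q. (z (Tv j i) + \<tau> * w (Tv j i)) * a i k))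
        has_field_derivative 0) (at 0)"
      using tan[OF pLT[of k]] by (auto simp: sing_at_def a_def)
    have d2: "((\<lambda>\<tau>. \<Sum>i<q. (z (Tv j i) + \<tau> * w (Tv j i)) * a i k) has_field_derivative
        (\<Sum>i<q. w (Tv j i) * a i k)) (at 0)" for j
      by (auto intro!: derivative_eq_intros)
    show ?thesis
      using DERIV_unique[OF DERIV_sum_mult[OF d2] d1] by (simp add: lam_def \<mu>_def dF_def)
  qed
  have E3: "(\<Sum>k\<in>UNIV. dF j k * u k) = 0" if j: "j < r" for j
    using tan[OF polyfn_vars_sum_W[OF pT[OF j]]] j
    by (auto simp: sing_at_def a_def u_def dF_def)
  have E5: "lam j0 = 1"
    using tan[OF polyfn_diff[OF polyfn_var polyfn_const], of "Lv j0" 1] j0 by (auto simp: sing_at_def a_def lam_def)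
  have E6: "(\<Sum>k\<in>UNIV. a i0 k * u k) = 1"
    using tan[OF polyfn_diff[OF polyfn_vars_sum_W[OF polyfn_const[of _ "a i0 _"]] polyfn_const[of _ 1]]]
    by (auto simp: sing_at_def a_def u_def)
  have E2': "(\<Sum>j<r. \<mu> j * dF j k) + a i0 k = 0" for k
    using E2[of k] delta_sum[of w j0 i0 lam "\<lambda>i. a i k", OF \<delta> j0 i0 E5] by (simp add: sum.distrib)
  have "0 = (\<Sum>k\<in>UNIV. u k * ((\<Sum>j<r. \<mu> j * dF j k) + a i0 k))"
    by (simp add: E2')
  also have "\<dots> = (\<Sum>k\<in>UNIV. u k * (\<Sum>j<r. \<mu> j * dF j k)) + (\<Sum>k\<in>UNIV. a i0 k * u k)"
    by (simp add: distrib_left sum.distrib mult_ac)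
  also have "(\<Sum>k\<in>UNIV. u k * (\<Sum>j<r. \<mu> j * dF j k)) = (\<Sum>j<r. \<mu> j * (\<Sum>k\<in>UNIV. dF j k * u k))"
    unfolding sum_distrib_left by (subst sum.swap) (simp add: mult_ac)
  also have "\<dots> = 0" by (simp add: E3)
  finally show False using E6 by simp
qed

lemma covector_relation_iff:
  "(\<forall>v. (\<Sum>j<r. lam j * dv (F t j) x v) = 0) \<longleftrightarrow>
    (\<forall>k. (\<Sum>j<r. lam j * (\<Sum>i<q. t (j, i) * ev (partial_deriv k (g i)) x)) = 0)" (is "?l \<longleftrightarrow> ?r")
proof -
  have eq: "(\<Sum>j<r. lam j * dv (F t j) x v) =
      (\<Sum>k\<in>UNIV. (\<Sum>j<r. lam j * (\<Sum>i<q. t (j, i) * ev (partial_deriv k (g i)) x)) * v $ k)" for v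
    unfolding dv_def ev_partial_F sum_distrib_right sum_distrib_left[of "lam _" _ UNIV]
    by (subst sum.swap) (simp add: mult_ac sum_distrib_left)
  show ?thesis
  proof
    assume ?l
    show ?r
    proof
      fix k
      have "(\<Sum>j<r. lam j * dv (F t j) x (axis k 1)) = 0" using \<open>?l\<close> by blast
      then show "(\<Sum>j<r. lam j * (\<Sum>i<q. t (j, i) * ev (partial_deriv k (g i)) x)) = 0"
        unfolding eq by (simp add: axis_def if_distrib[of "\<lambda>x. _ * x"] cong: if_cong)
    qed
  next
    assume ?r then show ?l unfolding eq by simp
  qed
qed

definition point :: "(nat \<times> nat \<Rightarrow> complex) \<Rightarrow> complex^'n \<Rightarrow> (nat \<Rightarrow> complex) \<Rightarrow> complex^'n \<Rightarrow>
    (nat \<Rightarrow> complex) \<Rightarrow> 'n pvar \<Rightarrow> complex" where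
  "point t x lam w b v = (case v of Inl (Inl p) \<Rightarrow> t p | Inl (Inr l) \<Rightarrow> x $ l | Inr (Inl j) \<Rightarrow> lam j |
    Inr (Inr (Inl k)) \<Rightarrow> w $ k | Inr (Inr (Inr i)) \<Rightarrow> b i)"

lemma not_indep_normalised:
  assumes "\<not> indep_at t x"
  obtains lam j0 where "j0 < r" "lam j0 = 1" "\<And>v. (\<Sum>j<r. lam j * dv (F t j) x v) = 0"
proof -
  obtain lam j0 where l: "j0 < r" "lam j0 \<noteq> 0" "\<And>v. (\<Sum>j<r. lam j * dv (F t j) x v) = 0"
    using assms by (auto simp: indep_at_def)
  have "(\<Sum>j<r. (lam j / lam j0) * dv (F t j) x v) = (\<Sum>j<r. lam j * dv (F t j) x v) / lam j0" for v
    by (simp add: sum_divide_distrib)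
  then have "\<And>v. (\<Sum>j<r. (lam j / lam j0) * dv (F t j) x v) = 0" using l(3) by simp
  then show ?thesis using that[of j0 "\<lambda>j. lam j / lam j0"] l(1,2) by simp
qed

text \<open>The product of the three polynomials over all pairs of indices. As it involves only the
  parameters, its value at a tuple of parameters and witnesses does not depend on the witnesses, so
  its nonvanishing excludes all of them at once.\<close>

lemma generic_good:
  "\<exists>P. polyfn ({..<r} \<times> {..<q}) P \<and> (\<exists>t. P t \<noteq> 0) \<and> (\<forall>t. P t \<noteq> 0 \<longrightarrow> good t)"
proof -
  define th where "th Y P \<longleftrightarrow> polyfn pars P \<and> (\<exists>z. P z \<noteq> 0) \<and> (\<forall>y\<in>Y. P y = 0)"
    for Y and P :: "('n pvar \<Rightarrow> complex) \<Rightarrow> complex"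
  define P1 P2 P3 where "P1 i j = (SOME P. th (sing_off i j) P)" and "P2 i j = (SOME P. th (degen_on i j) P)"
    and "P3 i j = (SOME P. th (sing_at i j) P)" for i j
  have th: "th (sing_off i j) (P1 i j)" "th (degen_on i j) (P2 i j)" "th (sing_at i j) (P3 i j)"
    if ij: "i < q" "j < r" for i j
  proof -
    have e: "\<exists>P. th (sing_off i j) P" "\<exists>P. th (degen_on i j) P" "\<exists>P. th (sing_at i j) P"
      unfolding th_def
      by (rule thin_singular_off_D[OF ij], rule thin_degenerate_on_D[OF ij], rule thin_singular_at_x0[OF ij])
    show "th (sing_off i j) (P1 i j)" "th (degen_on i j) (P2 i j)" "th (sing_at i j) (P3 i j)"
      unfolding P1_def P2_def P3_def
      by (rule someI_ex[OF e(1)], rule someI_ex[OF e(2)], rule someI_ex[OF e(3)])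
  qed
  note P1 = th(1)[unfolded th_def] and P2 = th(2)[unfolded th_def] and P3 = th(3)[unfolded th_def]
  define P where "P z = (\<Prod>p\<in>{..<q}\<times>{..<r}. P1 (fst p) (snd p) z * (P2 (fst p) (snd p) z * P3 (fst p) (snd p) z))" for z
  have finp: "finite pars" by (simp add: pars_def)
  have pP: "polyfn pars P"
    unfolding P_def by (rule polyfn_prod) (use P1 P2 P3 in \<open>auto intro!: polyfn_mult\<close>)
  have "\<exists>z. P z \<noteq> 0"
    unfolding P_def
  proof (rule polyfn_prod_nonzero[OF _ finp])
    fix p assume "p \<in> {..<q}\<times>{..<r}"
    then have p: "fst p < q" "snd p < r" by auto
    note Q = P1[OF p, THEN conjunct1] P2[OF p, THEN conjunct1] P3[OF p, THEN conjunct1]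
    show "polyfn pars (\<lambda>z. P1 (fst p) (snd p) z * (P2 (fst p) (snd p) z * P3 (fst p) (snd p) z))"
      by (intro polyfn_mult Q)
    from P1[OF p] obtain a where a: "P1 (fst p) (snd p) a \<noteq> 0" by (elim conjE exE)
    from P2[OF p] obtain b where b: "P2 (fst p) (snd p) b \<noteq> 0" by (elim conjE exE)
    from P3[OF p] obtain c where c: "P3 (fst p) (snd p) c \<noteq> 0" by (elim conjE exE)
    obtain e where e: "P2 (fst p) (snd p) e * P3 (fst p) (snd p) e \<noteq> 0"
      using polyfn_mult_nonzero[of pars "P2 (fst p) (snd p)" "P3 (fst p) (snd p)" b c, OF Q(2) Q(3) finp b c]
      by (elim exE)
    show "\<exists>z. P1 (fst p) (snd p) z * (P2 (fst p) (snd p) z * P3 (fst p) (snd p) z) \<noteq> 0"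
      using polyfn_mult_nonzero[of pars "P1 (fst p) (snd p)" "\<lambda>z. P2 (fst p) (snd p) z * P3 (fst p) (snd p) z" a e,
        OF Q(1) polyfn_mult[OF Q(2) Q(3)] finp a e] .
  qed auto
  then obtain z0 where z0: "P z0 \<noteq> 0" by blast
  define P' where "P' t = P (point t 0 (\<lambda>_. 0) 0 (\<lambda>_. 0))" for t
  have P'_eq: "P (point t x lam w b) = P' t" for t x lam w b
    unfolding P'_def by (rule polyfn_cong[OF pP]) (auto simp: pars_def point_def)
  have "polyfn ({..<r} \<times> {..<q}) P'"
    unfolding P'_def
  proof (rule polyfn_comp[OF pP])
    fix v assume "v \<in> pars"
    then show "polyfn ({..<r} \<times> {..<q}) (\<lambda>t. point t 0 (\<lambda>_. 0) 0 (\<lambda>_. 0) v)"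
      by (auto simp: pars_def point_def intro: polyfn_var)
  qed
  moreover have "P' (\<lambda>p. z0 (Inl (Inl p))) \<noteq> 0"
  proof -
    have "P' (\<lambda>p. z0 (Inl (Inl p))) = P z0"
      unfolding P'_def by (rule polyfn_cong[OF pP]) (auto simp: pars_def point_def)
    then show ?thesis using z0 by simp
  qed
  moreover have "good t" if t: "P' t \<noteq> 0" for t
  proof -
    have nz: "P1 i0 j0 (point t x lam w b) \<noteq> 0" "P2 i0 j0 (point t x lam w b) \<noteq> 0" "P3 i0 j0 (point t x lam w b) \<noteq> 0"
      if "i0 < q" "j0 < r" for x lam w b i0 j0
    proof -
      have "P (point t x lam w b) \<noteq> 0" using t P'_eq by simp
      moreover have "(i0, j0) \<in> {..<q}\<times>{..<r}" using that by simp
      ultimately show "P1 i0 j0 (point t x lam w b) \<noteq> 0" "P2 i0 j0 (point t x lam w b) \<noteq> 0" "P3 i0 j0 (point t x lam w b) \<noteq> 0"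
        unfolding P_def by (auto simp: prod_zero_iff)
    qed
    note [simp] = point_def
    have A: "indep_at t x0"
    proof (rule ccontr)
      assume "\<not> indep_at t x0"
      then obtain lam j0 where l: "j0 < r" "lam j0 = 1" "\<And>v. (\<Sum>j<r. lam j * dv (F t j) x0 v) = 0"
        by (rule not_indep_normalised) (rule that)
      \<comment> \<open>The differentials of \<open>r\<close> equations have a common kernel of
        dimension at least 4, while the tangent space of \<open>D\<close> has dimension 3.\<close>
      obtain w where w: "w \<notin> {v. \<forall>i<q. dv (g i) x0 v = 0}"
        "\<forall>j<r. (\<Sum>l\<in>UNIV. ev (partial_deriv l (F t j)) x0 * w $ l) = 0"
        using vector_outside_killed[of "{v. \<forall>i<q. dv (g i) x0 v = 0}" r "\<lambda>j l. ev (partial_deriv l (F t j)) x0"]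
          dim_tangent[OF x0] card_n
        by (auto simp: vec.subspace_def dv_def distrib_left sum.distrib sum_distrib_left[symmetric] mult.left_commute)
      then obtain i0 where i0: "i0 < q" "dv (g i0) x0 w \<noteq> 0" by blast
      define u where "u = (1 / dv (g i0) x0 w) *s w"
      have 1: "(\<Sum>k\<in>UNIV. ev (partial_deriv k (F t j)) x0 * u $ k) = 0" if "j < r" for j
        using w(2) that by (simp add: u_def mult.left_commute[of _ "inverse _"] divide_inverse flip: sum_distrib_left)
      have 2: "(\<Sum>k\<in>UNIV. ev (partial_deriv k (g i0)) x0 * u $ k) = 1"
        using i0(2) by (simp add: u_def dv_def mult.left_commute[of _ "inverse _"] divide_inverse flip: sum_distrib_left)
      have 3: "\<forall>k. (\<Sum>j<r. lam j * (\<Sum>i<q. t (j, i) * ev (partial_deriv k (g i)) x0)) = 0"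
        using l(3) covector_relation_iff by blast
      have "point t 0 lam u (\<lambda>_. 0) \<in> sing_at i0 j0"
        unfolding sing_at_def using 1[unfolded ev_partial_F] 2 3 l(2) by (simp add: ev_def)
      from bspec[OF P3[OF i0(1) l(1), THEN conjunct2, THEN conjunct2] this]
      have "P3 i0 j0 (point t 0 lam u (\<lambda>_. 0)) = 0" .
      then show False using nz(3)[OF i0(1) l(1)] by simp
    qed
    have B: "indep_at t x" if xX: "x \<in> X t" "x \<notin> D" for x
    proof (rule ccontr)
      assume "\<not> indep_at t x"
      then obtain lam j0 where l: "j0 < r" "lam j0 = 1" "\<And>v. (\<Sum>j<r. lam j * dv (F t j) x v) = 0"
        by (rule not_indep_normalised) (rule that)
      obtain i0 where i0: "i0 < q" "ev (g i0) x \<noteq> 0" using g_base[of x] xX by (auto simp: X_def)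
      have "\<forall>k. (\<Sum>j<r. lam j * (\<Sum>i<q. t (j, i) * ev (partial_deriv k (g i)) x)) = 0"
        using l(3) covector_relation_iff by blast
      moreover have "\<forall>j<r. (\<Sum>i<q. t (j, i) * ev (g i) x) = 0" using xX by (auto simp: X_def ev_F)
      ultimately have "point t x lam 0 (\<lambda>_. 1 / ev (g i0) x) \<in> sing_off i0 j0"
        unfolding sing_off_def using l(2) i0(2) by (simp add: ev_def)
      from bspec[OF P1[OF i0(1) l(1), THEN conjunct2, THEN conjunct2] this]
      have "P1 i0 j0 (point t x lam 0 (\<lambda>_. 1 / ev (g i0) x)) = 0" .
      then show False using nz(1)[OF i0(1) l(1)] by simp
    qed
    have C: "dv (g i0) x w = 0"
      if x: "x \<in> D" and j0: "j0 < r" "lam j0 = 1" and l: "\<forall>v. (\<Sum>j<r. lam j * dv (F t j) x v) = 0"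
        and w: "\<forall>j<r. dv (F t j) x w = 0"
        and h: "\<forall>l. (\<Sum>j<r. lam j * hess (F t j) x w l) = (\<Sum>i<q. b i * ev (partial_deriv l (g i)) x)"
        and i0: "i0 < q" for x lam j0 w b i0
    proof (rule ccontr)
      assume nz0: "dv (g i0) x w \<noteq> 0"
      define k where "k = 1 / dv (g i0) x w"
      define u where "u = k *s w"
      have dvu: "dv f x u = k * dv f x w" for f by (simp add: u_def dv_def sum_distrib_left mult_ac)
      have hu: "hess f x u l = k * hess f x w l" for f l by (simp add: u_def hess_def sum_distrib_left mult_ac)
      have 1: "\<forall>i<q. ev (g i) x = 0" using x g_D by auto
      have 2: "\<forall>k. (\<Sum>j<r. lam j * (\<Sum>i<q. t (j, i) * ev (partial_deriv k (g i)) x)) = 0"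
        using l covector_relation_iff by blast
      have 3: "\<forall>j<r. (\<Sum>k\<in>UNIV. (\<Sum>i<q. t (j, i) * ev (partial_deriv k (g i)) x) * u $ k) = 0"
        using w dvu[of "F t _"] by (simp add: dv_def ev_partial_F)
      have 4: "(\<Sum>k\<in>UNIV. (\<Sum>j<r. lam j * (\<Sum>i<q. t (j, i) * ev (partial_deriv l (partial_deriv k (g i))) x)) * u $ k) -
        (\<Sum>i<q. k * b i * ev (partial_deriv l (g i)) x) = 0" for l
      proof -
        have "(\<Sum>k\<in>UNIV. (\<Sum>j<r. lam j * (\<Sum>i<q. t (j, i) * ev (partial_deriv l (partial_deriv k (g i))) x)) * u $ k) =
          (\<Sum>j<r. lam j * hess (F t j) x u l)"
          unfolding hess_def ev_partial_partial_F sum_distrib_left[of "lam _" _ UNIV] sum_distrib_right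
          by (subst sum.swap) (simp add: mult_ac sum_distrib_left)
        also have "\<dots> = k * (\<Sum>i<q. b i * ev (partial_deriv l (g i)) x)"
          using h by (simp add: hu mult.left_commute[of _ k] flip: sum_distrib_left)
        finally show ?thesis by (simp add: sum_distrib_left mult.assoc)
      qed
      have 5: "(\<Sum>k\<in>UNIV. ev (partial_deriv k (g i0)) x * u $ k) = 1"
        using nz0 dvu[of "g i0"] by (simp add: k_def dv_def)
      have "point t x lam u (\<lambda>i. k * b i) \<in> degen_on i0 j0"
        unfolding degen_on_def using 1 2 3 4 5 j0(2) by (simp add: ev_def)
      from bspec[OF P2[OF i0 j0(1), THEN conjunct2, THEN conjunct2] this]
      have "P2 i0 j0 (point t x lam u (\<lambda>i. k * b i)) = 0" .
      then show False using nz(2)[OF i0 j0(1)] by simp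
    qed
    show ?thesis unfolding good_def using A B C by blast
  qed
  ultimately show ?thesis by blast
qed

end

section \<open>Holomorphic maps in several variables\<close>

lemma hol_open: "holomorphic_on_open f U \<Longrightarrow> open U"
  by (simp add: holomorphic_on_open_def)

lemma hol_subset: "holomorphic_on_open f U \<Longrightarrow> open V \<Longrightarrow> V \<subseteq> U \<Longrightarrow> holomorphic_on_open f V"
  by (auto simp: holomorphic_on_open_def)

lemma hol_const: "open U \<Longrightarrow> holomorphic_on_open (\<lambda>_. c) U"
  by (auto simp: holomorphic_on_open_def intro!: exI[of _ "\<lambda>_. 0"])

lemma hol_coord: "open U \<Longrightarrow> holomorphic_on_open (\<lambda>z. z $ k) U"
  unfolding holomorphic_on_open_def
  by (auto intro!: exI[of _ "\<lambda>z. z $ k"] bounded_linear_imp_has_derivative bounded_linear_vec_nth)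

lemma hol_add: "holomorphic_on_open f U \<Longrightarrow> holomorphic_on_open g U \<Longrightarrow> holomorphic_on_open (\<lambda>z. f z + g z) U"
  unfolding holomorphic_on_open_def
proof (intro conjI ballI; elim conjE)
  fix z assume *: "z \<in> U" "\<forall>z\<in>U. \<exists>f'. (f has_derivative f') (at z) \<and> (\<forall>c v. f' (c *s v) = c * f' v)"
    "\<forall>z\<in>U. \<exists>f'. (g has_derivative f') (at z) \<and> (\<forall>c v. f' (c *s v) = c * f' v)"
  then obtain f' g' where "(f has_derivative f') (at z)" "\<forall>c v. f' (c *s v) = c * f' v"
    "(g has_derivative g') (at z)" "\<forall>c v. g' (c *s v) = c * g' v" by blast
  then show "\<exists>f'. ((\<lambda>z. f z + g z) has_derivative f') (at z) \<and> (\<forall>c v. f' (c *s v) = c * f' v)"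
    by (intro exI[of _ "\<lambda>v. f' v + g' v"]) (auto intro!: derivative_intros simp: algebra_simps)
qed auto

lemma hol_mult: "holomorphic_on_open f U \<Longrightarrow> holomorphic_on_open g U \<Longrightarrow> holomorphic_on_open (\<lambda>z. f z * g z) U"
  unfolding holomorphic_on_open_def
proof (intro conjI ballI; elim conjE)
  fix z assume *: "z \<in> U" "\<forall>z\<in>U. \<exists>f'. (f has_derivative f') (at z) \<and> (\<forall>c v. f' (c *s v) = c * f' v)"
    "\<forall>z\<in>U. \<exists>f'. (g has_derivative f') (at z) \<and> (\<forall>c v. f' (c *s v) = c * f' v)"
  then obtain f' g' where "(f has_derivative f') (at z)" "\<forall>c v. f' (c *s v) = c * f' v"
    "(g has_derivative g') (at z)" "\<forall>c v. g' (c *s v) = c * g' v" by blast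
  then show "\<exists>f'. ((\<lambda>z. f z * g z) has_derivative f') (at z) \<and> (\<forall>c v. f' (c *s v) = c * f' v)"
    by (intro exI[of _ "\<lambda>v. f z * g' v + f' v * g z"]) (auto intro!: derivative_intros simp: algebra_simps)
qed auto

lemma hol_inverse:
  assumes "holomorphic_on_open f U" "\<And>z. z \<in> U \<Longrightarrow> f z \<noteq> 0"
  shows "holomorphic_on_open (\<lambda>z. inverse (f z)) U"
  unfolding holomorphic_on_open_def
proof (intro conjI ballI)
  show "open U" using hol_open[OF assms(1)] .
  fix z assume z: "z \<in> U"
  then obtain f' where f': "(f has_derivative f') (at z)" "\<forall>c v. f' (c *s v) = c * f' v"
    using assms(1) by (auto simp: holomorphic_on_open_def)
  have "((\<lambda>z. inverse (f z)) has_derivative (\<lambda>v. - (inverse (f z) * f' v * inverse (f z)))) (at z)"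
    by (rule Deriv.has_derivative_inverse[OF assms(2)[OF z] f'(1)])
  then show "\<exists>f'. ((\<lambda>z. inverse (f z)) has_derivative f') (at z) \<and> (\<forall>c v. f' (c *s v) = c * f' v)"
    using f'(2) by (intro exI[of _ "\<lambda>v. - (inverse (f z) * f' v * inverse (f z))"]) auto
qed

lemma hol_uminus: "holomorphic_on_open f U \<Longrightarrow> holomorphic_on_open (\<lambda>z. - f z) U"
  using hol_mult[OF hol_const[of U "-1"], of f] by (simp add: hol_open)

lemma hol_diff: "holomorphic_on_open f U \<Longrightarrow> holomorphic_on_open g U \<Longrightarrow> holomorphic_on_open (\<lambda>z. f z - g z) U"
  using hol_add[of f U "\<lambda>z. - g z"] hol_uminus[of g U] by simp

lemma hol_divide: "holomorphic_on_open f U \<Longrightarrow> holomorphic_on_open g U \<Longrightarrow> (\<And>z. z \<in> U \<Longrightarrow> g z \<noteq> 0) \<Longrightarrow>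
    holomorphic_on_open (\<lambda>z. f z / g z) U"
  unfolding divide_inverse by (intro hol_mult hol_inverse)

lemma hol_sum: "open U \<Longrightarrow> (\<And>i. i \<in> A \<Longrightarrow> holomorphic_on_open (f i) U) \<Longrightarrow>
    holomorphic_on_open (\<lambda>z. \<Sum>i\<in>A. f i z) U"
  by (induction A rule: infinite_finite_induct) (auto intro: hol_const hol_add)

lemma hol_prod: "open U \<Longrightarrow> (\<And>i. i \<in> A \<Longrightarrow> holomorphic_on_open (f i) U) \<Longrightarrow>
    holomorphic_on_open (\<lambda>z. \<Prod>i\<in>A. f i z) U"
  by (induction A rule: infinite_finite_induct) (auto intro: hol_const hol_mult)

lemma hol_polyfn: "polyfn V f \<Longrightarrow> open U \<Longrightarrow> (\<And>v. v \<in> V \<Longrightarrow> holomorphic_on_open (\<lambda>z. h z v) U) \<Longrightarrow>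
    holomorphic_on_open (\<lambda>z. f (h z)) U"
  by (induction rule: polyfn.induct) (auto intro: hol_const hol_add hol_mult)

lemma hol_ev: "open U \<Longrightarrow> holomorphic_on_open (ev f) U"
  unfolding ev_def by (rule hol_polyfn[OF polyfn_poly_val_UNIV]) (auto intro: hol_coord)

lemma hol_det:
  fixes M :: "complex^'a \<Rightarrow> complex^'n^'n"
  assumes "open U" "\<And>i j. holomorphic_on_open (\<lambda>z. M z $ i $ j) U"
  shows "holomorphic_on_open (\<lambda>z. det (M z)) U"
  unfolding det_def using assms by (intro hol_sum hol_mult hol_prod hol_const)

definition pdc :: "(complex^'m::finite \<Rightarrow> complex) \<Rightarrow> 'm \<Rightarrow> complex^'m \<Rightarrow> complex" where
  "pdc f k z = deriv (\<lambda>h. f (z + h *s axis k 1)) 0"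

lemma vec_eq_sum_axis: "(v :: complex^'m::finite) = (\<Sum>k\<in>UNIV. (v $ k) *s axis k 1)"
  by (simp add: vec_eq_iff axis_def if_distrib[of "\<lambda>x. _ * x"] cong: if_cong)

lemma has_derivative_line:
  "((\<lambda>h :: complex. z + h *s v) has_derivative (\<lambda>h. h *s (v :: complex^'m::finite))) (at h0)"
proof -
  have "linear (\<lambda>h. h *s v)" by (rule linearI) (auto simp: vec_eq_iff algebra_simps)
  then have "bounded_linear (\<lambda>h. h *s v)" by (simp add: linear_conv_bounded_linear)
  then show ?thesis by (auto intro!: derivative_eq_intros bounded_linear_imp_has_derivative)
qed

lemma hol_has_derivative:
  assumes "holomorphic_on_open f U" "z \<in> U"
  shows "(f has_derivative (\<lambda>v. \<Sum>k\<in>UNIV. pdc f k z * v $ k)) (at z)"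
proof -
  obtain f' where f': "(f has_derivative f') (at z)" "\<And>c v. f' (c *s v) = c * f' v"
    using assms by (auto simp: holomorphic_on_open_def)
  have lin: "linear f'" using f'(1) has_derivative_linear by blast
  have pd: "pdc f k z = f' (axis k 1)" for k
  proof -
    have "((\<lambda>h. f (z + h *s axis k 1)) has_derivative (\<lambda>h. f' (h *s axis k 1))) (at 0)"
      by (rule has_derivative_compose[OF has_derivative_line]) (use f'(1) in simp)
    then have "((\<lambda>h. f (z + h *s axis k 1)) has_field_derivative f' (axis k 1)) (at 0)"
      by (simp add: has_field_derivative_def f'(2) mult.commute[of _ "f' _"])
    then show ?thesis unfolding pdc_def by (rule DERIV_imp_deriv)
  qed
  have exp: "f' v = (\<Sum>k\<in>UNIV. f' (axis k 1) * v $ k)" for v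
  proof -
    have "f' v = f' (\<Sum>k\<in>UNIV. (v $ k) *s axis k 1)"
      by (rule arg_cong[OF vec_eq_sum_axis])
    also have "\<dots> = (\<Sum>k\<in>UNIV. f' ((v $ k) *s axis k 1))"
      by (rule linear_sum[OF lin])
    finally have "f' v = (\<Sum>k\<in>UNIV. f' ((v $ k) *s axis k 1))" .
    then show ?thesis unfolding f'(2) by (simp only: mult.commute)
  qed
  have "f' = (\<lambda>v. \<Sum>k\<in>UNIV. pdc f k z * v $ k)"
    unfolding pd by (rule ext, rule exp)
  then show ?thesis using f'(1) by simp
qed

lemma hol_continuous_on: "holomorphic_on_open f U \<Longrightarrow> continuous_on U f"
  by (rule has_derivative_continuous_on) (rule has_derivative_at_withinI, rule hol_has_derivative)

lemma pdc_eqI: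
  assumes "holomorphic_on_open f U" "z \<in> U" "(f has_derivative (\<lambda>v. \<Sum>k\<in>UNIV. a k * v $ k)) (at z)"
  shows "pdc f k z = a k"
proof -
  have "(\<lambda>v. \<Sum>k\<in>UNIV. pdc f k z * v $ k) = (\<lambda>v. \<Sum>k\<in>UNIV. a k * v $ k)"
    using has_derivative_unique[OF hol_has_derivative[OF assms(1,2)] assms(3)] .
  from fun_cong[OF this, of "axis k 1"] show ?thesis
    by (simp add: axis_def if_distrib[of "\<lambda>x. _ * x"] cong: if_cong)
qed

lemma has_derivative_vecI:
  fixes f :: "'a::real_normed_vector \<Rightarrow> complex^'m::finite"
  assumes "\<And>i. ((\<lambda>x. f x $ i) has_derivative (\<lambda>h. f' h $ i)) (at z)"
  shows "(f has_derivative f') (at z)"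
  unfolding has_derivative_componentwise_within[of f]
proof
  fix b :: "complex^'m" assume "b \<in> Basis"
  then obtain i e where b: "b = axis i e" by (auto simp: Basis_vec_def)
  show "((\<lambda>x. f x \<bullet> b) has_derivative (\<lambda>x. f' x \<bullet> b)) (at z)"
    unfolding b inner_axis by (intro has_derivative_inner_left assms)
qed

lemma hol_curve:
  assumes f: "holomorphic_on_open f U" "c \<tau> \<in> U"
    and c: "\<And>k. ((\<lambda>t. c t $ k) has_field_derivative c' k) (at \<tau>)"
  shows "((\<lambda>t. f (c t)) has_field_derivative (\<Sum>k\<in>UNIV. pdc f k (c \<tau>) * c' k)) (at \<tau>)"
proof -
  have "(c has_derivative (\<lambda>h. \<chi> k. c' k * h)) (at \<tau>)"
    by (rule has_derivative_vecI) (use c in \<open>simp add: has_field_derivative_def\<close>)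
  from has_derivative_compose[OF this hol_has_derivative[OF f]]
  have "((\<lambda>t. f (c t)) has_derivative (\<lambda>h. \<Sum>k\<in>UNIV. pdc f k (c \<tau>) * (c' k * h))) (at \<tau>)" by simp
  also have "(\<lambda>h. \<Sum>k\<in>UNIV. pdc f k (c \<tau>) * (c' k * h)) = (*) (\<Sum>k\<in>UNIV. pdc f k (c \<tau>) * c' k)"
    by (simp add: fun_eq_iff sum_distrib_right mult.assoc)
  finally show ?thesis by (simp add: has_field_derivative_def)
qed

lemma hol_compose:
  assumes f: "holomorphic_on_open f V" and h: "\<And>k. holomorphic_on_open (\<lambda>z. h z $ k) U"
    and hU: "\<And>z. z \<in> U \<Longrightarrow> h z \<in> V"
  shows "holomorphic_on_open (\<lambda>z. f (h z)) U"
    and "z \<in> U \<Longrightarrow> pdc (\<lambda>z. f (h z)) l z = (\<Sum>k\<in>UNIV. pdc f k (h z) * pdc (\<lambda>z. h z $ k) l z)"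
proof -
  have U: "open U" using hol_open[OF h] .
  have der: "((\<lambda>z. f (h z)) has_derivative
      (\<lambda>v. \<Sum>l\<in>UNIV. (\<Sum>k\<in>UNIV. pdc f k (h z) * pdc (\<lambda>z. h z $ k) l z) * v $ l)) (at z)"
    if z: "z \<in> U" for z
  proof -
    have "(h has_derivative (\<lambda>v. \<chi> k. \<Sum>l\<in>UNIV. pdc (\<lambda>z. h z $ k) l z * v $ l)) (at z)"
      by (rule has_derivative_vecI) (simp add: hol_has_derivative[OF h z])
    from has_derivative_compose[OF this hol_has_derivative[OF f hU[OF z]]]
    have "((\<lambda>z. f (h z)) has_derivative
      (\<lambda>v. \<Sum>k\<in>UNIV. pdc f k (h z) * (\<Sum>l\<in>UNIV. pdc (\<lambda>z. h z $ k) l z * v $ l))) (at z)" by simp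
    also have "(\<lambda>v. \<Sum>k\<in>UNIV. pdc f k (h z) * (\<Sum>l\<in>UNIV. pdc (\<lambda>z. h z $ k) l z * v $ l)) =
      (\<lambda>v. \<Sum>l\<in>UNIV. (\<Sum>k\<in>UNIV. pdc f k (h z) * pdc (\<lambda>z. h z $ k) l z) * v $ l)"
      unfolding sum_distrib_left sum_distrib_right by (subst sum.swap) (simp add: mult_ac)
    finally show ?thesis .
  qed
  show hol: "holomorphic_on_open (\<lambda>z. f (h z)) U"
    unfolding holomorphic_on_open_def
  proof (intro conjI ballI U)
    fix z assume "z \<in> U"
    from der[OF this] show "\<exists>f'. ((\<lambda>z. f (h z)) has_derivative f') (at z) \<and> (\<forall>c v. f' (c *s v) = c * f' v)"
      by (intro exI conjI) (auto simp: sum_distrib_left mult_ac)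
  qed
  show "pdc (\<lambda>z. f (h z)) l z = (\<Sum>k\<in>UNIV. pdc f k (h z) * pdc (\<lambda>z. h z $ k) l z)" if "z \<in> U"
    by (rule pdc_eqI[OF hol that der[OF that]])
qed

lemma norm_smult_axis: "norm (c *s axis k (1::complex) :: complex^'m::finite) = cmod c"
proof -
  have "c *s axis k (1::complex) = (axis k c :: complex^'m)" by (simp add: vec_eq_iff axis_def)
  then show ?thesis
    by (simp add: norm_vec_def L2_set_def axis_def if_distrib[of "\<lambda>x. (norm x)\<^sup>2"] cong: if_cong)
qed

lemma hol_slice:
  assumes "holomorphic_on_open f U" "ball z \<rho> \<subseteq> U"
  shows "(\<lambda>h. f (z + h *s axis k 1)) holomorphic_on ball 0 \<rho>"
proof (rule holomorphic_onI)
  fix h :: complex assume h: "h \<in> ball 0 \<rho>"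
  have U: "z + h *s axis k 1 \<in> U"
    using assms(2) h by (auto simp: dist_norm norm_smult_axis subset_iff)
  have "((\<lambda>t. f (z + t *s axis k 1)) has_field_derivative
      (\<Sum>i\<in>UNIV. pdc f i (z + h *s axis k 1) * (if i = k then 1 else 0))) (at h)"
    by (rule hol_curve[where c = "\<lambda>t. z + t *s axis k 1" and \<tau> = h and U = U])
      (use assms(1) U in \<open>auto intro!: derivative_eq_intros simp: axis_def\<close>)
  then show "(\<lambda>h. f (z + h *s axis k 1)) field_differentiable at h within ball 0 \<rho>"
    using field_differentiable_at_within field_differentiable_def by blast
qed

text \<open>Two nearby slices in direction \<open>k\<close> differ by a holomorphic function that is
  uniformly small on a disc of fixed radius; the Cauchy estimate bounds its derivative at the
  centre.\<close>

lemma continuous_on_pdc: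
  assumes f: "holomorphic_on_open f U"
  shows "continuous_on U (pdc f k)"
proof (rule continuous_at_imp_continuous_on, rule ballI)
  fix z assume z: "z \<in> U"
  obtain R where R: "R > 0" "cball z R \<subseteq> U" using hol_open[OF f] z open_contains_cball by blast
  define \<rho> where "\<rho> = R / 2"
  have \<rho>: "\<rho> > 0" using R by (simp add: \<rho>_def)
  have uc: "uniformly_continuous_on (cball z R) f"
    by (rule compact_uniformly_continuous) (use hol_continuous_on[OF f] R(2) continuous_on_subset in auto)
  show "isCont (pdc f k) z"
    unfolding continuous_at_eps_delta
  proof (intro allI impI)
    fix e :: real assume e: "e > 0"
    \<comment> \<open>Chosen so that the Cauchy estimate on the disc of radius \<open>\<rho>\<close>
      gives \<open>e / 2\<close>.\<close>
    define e' where "e' = e * \<rho> / 2"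
    have e': "e' > 0" using e \<rho> by (simp add: e'_def)
    obtain d where d: "d > 0" "\<And>x y. x \<in> cball z R \<Longrightarrow> y \<in> cball z R \<Longrightarrow> dist x y < d \<Longrightarrow> dist (f x) (f y) < e'"
      using uc e' unfolding uniformly_continuous_on_def by metis
    show "\<exists>d>0. \<forall>x'. dist x' z < d \<longrightarrow> dist (pdc f k x') (pdc f k z) < e"
    proof (intro exI[of _ "min d \<rho>"] conjI allI impI)
      show "min d \<rho> > 0" using d \<rho> by simp
      fix y assume y: "dist y z < min d \<rho>"
      have in_ball: "x + h *s axis k 1 \<in> cball z R" if "dist x z < \<rho>" "cmod h \<le> \<rho>" for x h
      proof -
        have "norm (x + h *s axis k 1 - z) \<le> norm (x - z) + norm (h *s axis k (1::complex) :: complex^'a)"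
          by (metis add.commute add_diff_eq norm_triangle_ineq)
        also have "\<dots> \<le> R" using that by (simp add: dist_norm norm_smult_axis \<rho>_def)
        finally show ?thesis by (simp add: dist_norm norm_minus_commute)
      qed
      have ballU: "ball x \<rho> \<subseteq> U" if "dist x z < \<rho>" for x
      proof
        fix u assume "u \<in> ball x \<rho>"
        then have "dist z u < R" using that dist_triangle[of z u x] by (simp add: \<rho>_def dist_commute)
        then show "u \<in> U" using R(2) by auto
      qed
      define \<phi> where "\<phi> h = f (y + h *s axis k 1) - f (z + h *s axis k 1)" for h
      have hol: "\<phi> holomorphic_on ball 0 \<rho>"
        unfolding \<phi>_def using y \<rho> by (intro holomorphic_on_diff hol_slice[OF f] ballU) auto
      have "continuous_on (cball 0 \<rho>) (\<lambda>h. f (x + h *s axis k 1))" if "dist x z < \<rho>" for x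
      proof (rule continuous_on_compose2[OF continuous_on_subset[OF hol_continuous_on[OF f] R(2)]])
        show "continuous_on (cball 0 \<rho>) (\<lambda>h. x + h *s axis k (1::complex))"
          by (rule continuous_at_imp_continuous_on, rule ballI, rule has_derivative_continuous,
              rule has_derivative_line)
      qed (use in_ball[OF that] in \<open>auto simp: dist_norm\<close>)
      then have cont: "continuous_on (cball 0 \<rho>) \<phi>"
        unfolding \<phi>_def using y \<rho> by (intro continuous_on_diff) auto
      have bd: "\<phi> h \<in> ball 0 e'" if "h \<in> ball 0 \<rho>" for h
      proof -
        have "dist (f (y + h *s axis k 1)) (f (z + h *s axis k 1)) < e'"
          using y that \<rho> by (intro d(2) in_ball) (auto simp: dist_norm)
        then show ?thesis by (simp add: \<phi>_def dist_norm norm_minus_commute)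
      qed
      have "cmod ((deriv ^^ 1) \<phi> 0) \<le> fact 1 * e' / \<rho> ^ 1"
        by (rule Cauchy_higher_deriv_bound[OF hol cont bd \<rho>]) auto
      then have "cmod (deriv \<phi> 0) \<le> e / 2" using \<rho> by (simp add: e'_def)
      moreover have "deriv \<phi> 0 = pdc f k y - pdc f k z"
        unfolding \<phi>_def pdc_def
        using y \<rho> hol_slice[OF f ballU] by (intro deriv_diff) (auto intro!: holomorphic_on_imp_differentiable_at[of _ "ball 0 \<rho>"])
      ultimately show "dist (pdc f k y) (pdc f k z) < e" using e by (simp add: dist_norm)
    qed
  qed
qed

text \<open>Open polydiscs, in place of balls, because they are respected by the coordinatewise maps
  below that set some coordinates to a constant or rename them.\<close>

definition pbox :: "complex^'m::finite \<Rightarrow> real \<Rightarrow> (complex^'m) set" where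
  "pbox c \<epsilon> = {w. \<forall>k. w $ k \<in> ball (c $ k) \<epsilon>}"

lemma open_pbox: "open (pbox c \<epsilon>)"
proof -
  have "pbox c \<epsilon> = (\<Inter>k. (\<lambda>w. w $ k) -` ball (c $ k) \<epsilon>)" by (auto simp: pbox_def)
  also have "open \<dots>" by (intro open_INT) (auto intro!: open_vimage continuous_intros)
  finally show ?thesis .
qed

lemma convex_pbox: "convex (pbox c \<epsilon>)"
proof -
  have "pbox c \<epsilon> = (\<Inter>k. (\<lambda>w. w $ k) -` ball (c $ k) \<epsilon>)" by (auto simp: pbox_def)
  also have "convex \<dots>"
    by (intro convex_INT convex_linear_vimage convex_ball) (auto intro: bounded_linear.linear bounded_linear_vec_nth)
  finally show ?thesis .
qed

lemma pbox_subset_open: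
  assumes "open V" "c \<in> V"
  shows "\<exists>\<epsilon>>0. pbox c \<epsilon> \<subseteq> V"
proof -
  obtain e where e: "e > 0" "ball c e \<subseteq> V" using assms open_contains_ball by blast
  define \<epsilon> where "\<epsilon> = e / real (CARD('a))"
  have \<epsilon>: "\<epsilon> > 0" using e by (simp add: \<epsilon>_def)
  have "pbox c \<epsilon> \<subseteq> ball c e"
  proof
    fix w assume w: "w \<in> pbox c \<epsilon>"
    have "norm (c - w) \<le> (\<Sum>k\<in>UNIV. norm ((c - w) $ k))" unfolding norm_vec_def by (rule L2_set_le_sum) auto
    also have "\<dots> < (\<Sum>k\<in>(UNIV::'a set). \<epsilon>)"
      by (rule sum_strict_mono) (use w in \<open>auto simp: pbox_def dist_norm\<close>)
    also have "\<dots> = e" by (simp add: \<epsilon>_def)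
    finally show "w \<in> ball c e" by (simp add: dist_norm)
  qed
  then show ?thesis using e(2) \<epsilon> by blast
qed

definition jac :: "(complex^'m::finite \<Rightarrow> complex^'k::finite) \<Rightarrow> complex^'m \<Rightarrow> complex^'m \<Rightarrow> complex^'k" where
  "jac f z v = (\<chi> i. \<Sum>k\<in>UNIV. pdc (\<lambda>z. f z $ i) k z * v $ k)"

lemma jac_linear: "linear (jac f z)"
  by (rule linearI) (auto simp: jac_def vec_eq_iff algebra_simps sum.distrib scaleR_sum_right)

lemma jac_scale: "jac f z (c *s v) = c *s jac f z v"
  by (auto simp: jac_def vec_eq_iff sum_distrib_left mult_ac)

text \<open>The real inverse function theorem applies because complex partial derivatives are
  continuous. The derivative of the inverse map is the inverse of a complex linear map, hence
  complex linear, so the inverse is holomorphic.\<close>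

theorem hol_inverse_function:
  fixes f :: "complex^'m::finite \<Rightarrow> complex^'m"
  assumes f: "\<And>i. holomorphic_on_open (\<lambda>z. f z $ i) U" and p: "p \<in> U"
    and inj: "\<And>v. jac f p v = 0 \<Longrightarrow> v = 0"
  obtains \<epsilon> N h where "\<epsilon> > 0" "open N" "p \<in> N" "N \<subseteq> U" "homeomorphism N (pbox (f p) \<epsilon>) f h"
    "\<And>i. holomorphic_on_open (\<lambda>w. h w $ i) (pbox (f p) \<epsilon>)"
    "\<And>z v. z \<in> N \<Longrightarrow> jac f z v = 0 \<Longrightarrow> v = 0"
proof -
  have U: "open U" using hol_open[OF f] .
  have bl: "bounded_linear (jac f z)" for z using jac_linear linear_conv_bounded_linear by blast
  define f' where "f' z = Blinfun (jac f z)" for z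
  have f'_apply: "blinfun_apply (f' z) = jac f z" for z
    unfolding f'_def by (rule bounded_linear_Blinfun_apply[OF bl])
  have der: "(f has_derivative blinfun_apply (f' z)) (at z)" if "z \<in> U" for z
    unfolding f'_apply by (rule has_derivative_vecI) (simp add: jac_def hol_has_derivative[OF f that])
  have cont: "continuous_on U f'"
  proof (rule continuous_on_blinfun_componentwise)
    fix b :: "complex^'m"
    show "continuous_on U (\<lambda>z. blinfun_apply (f' z) b)"
      unfolding f'_apply jac_def
      by (intro continuous_on_vec_lambda continuous_on_sum continuous_on_mult continuous_on_pdc[OF f] continuous_on_const)
  qed
  have inj': "inj (jac f p)" using inj linear_injective_0[OF jac_linear] by blast
  obtain k where k: "linear k" "k \<circ> jac f p = id"
    using linear_injective_left_inverse[OF jac_linear inj'] by blast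
  have "bounded_linear k" using k(1) linear_conv_bounded_linear by blast
  then have "Blinfun k o\<^sub>L f' p = id_blinfun"
    using k(2) by (intro blinfun_eqI) (simp add: bounded_linear_Blinfun_apply f'_apply fun_eq_iff)
  then obtain U' V g g' where *: "open U'" "U' \<subseteq> U" "p \<in> U'" "open V" "f p \<in> V" "homeomorphism U' V f g"
    "\<And>y. y \<in> V \<Longrightarrow> (g has_derivative (g' y)) (at y)"
    "\<And>y. y \<in> V \<Longrightarrow> g' y = inv (blinfun_apply (f'(g y)))"
    "\<And>y. y \<in> V \<Longrightarrow> bij (blinfun_apply (f'(g y)))"
    using inverse_function_theorem[OF U der cont p] by blast
  obtain \<epsilon> where \<epsilon>: "\<epsilon> > 0" "pbox (f p) \<epsilon> \<subseteq> V" using pbox_subset_open[OF *(4,5)] by blast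
  define N where "N = {z\<in>U'. f z \<in> pbox (f p) \<epsilon>}"
  have contf: "continuous_on U' f" using *(6) homeomorphism_cont1 by blast
  have "open N"
    using continuous_open_preimage[OF contf *(1) open_pbox] by (simp add: N_def vimage_def Int_def)
  moreover have "p \<in> N" using *(3) \<epsilon>(1) by (simp add: N_def pbox_def)
  moreover have "N \<subseteq> U" using *(2) by (auto simp: N_def)
  moreover have "homeomorphism N (pbox (f p) \<epsilon>) f g"
  proof (rule homeomorphism_of_subsets[OF *(6)])
    show "N \<subseteq> U'" by (auto simp: N_def)
    show "f ` N = pbox (f p) \<epsilon>"
    proof
      show "pbox (f p) \<epsilon> \<subseteq> f ` N"
      proof
        fix w assume w: "w \<in> pbox (f p) \<epsilon>"
        then have "f (g w) = w" "g w \<in> U'" using *(6) \<epsilon>(2) by (auto simp: homeomorphism_def)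
        then show "w \<in> f ` N" using w by (intro image_eqI[of _ _ "g w"]) (auto simp: N_def)
      qed
    qed (auto simp: N_def)
  qed (use \<epsilon>(2) in auto)
  moreover have "holomorphic_on_open (\<lambda>w. g w $ i) (pbox (f p) \<epsilon>)" for i
    unfolding holomorphic_on_open_def
  proof (intro conjI ballI open_pbox)
    fix w assume w: "w \<in> pbox (f p) \<epsilon>"
    then have wV: "w \<in> V" using \<epsilon> by auto
    have "((\<lambda>w. g w $ i) has_derivative (\<lambda>v. g' w v $ i)) (at w)"
      using bounded_linear.has_derivative[OF bounded_linear_vec_nth *(7)[OF wV]] by simp
    moreover have "g' w (c *s v) = c *s g' w v" for c v
    proof -
      have b: "bij (jac f (g w))" using *(9)[OF wV] by (simp add: f'_apply)
      have "jac f (g w) (c *s g' w v) = c *s v"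
        using b unfolding *(8)[OF wV] f'_apply jac_scale by (simp add: bij_is_surj surj_f_inv_f)
      then show ?thesis
        unfolding *(8)[OF wV] f'_apply using b by (metis bij_inv_eq_iff)
    qed
    ultimately show "\<exists>f'. ((\<lambda>w. g w $ i) has_derivative f') (at w) \<and> (\<forall>c v. f' (c *s v) = c * f' v)"
      by (intro exI[of _ "\<lambda>v. g' w v $ i"]) auto
  qed
  moreover have "v = 0" if "z \<in> N" "jac f z v = 0" for z v
  proof -
    have "f z \<in> V" "g (f z) = z" using that(1) *(6) by (auto simp: N_def homeomorphism_def)
    then have "bij (jac f z)" using *(9)[of "f z"] by (simp add: f'_apply)
    then show ?thesis using that(2) linear_injective_0[OF jac_linear] bij_is_inj by blast
  qed
  ultimately show ?thesis using that \<epsilon>(1) by blast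
qed

section \<open>Charts given by polynomials\<close>

text \<open>The numerators in Cramer's rule. They are polynomials in the entries, so a linear system
  with polynomial entries has a polynomial solution after multiplication by the determinant.\<close>

definition csol :: "complex^'n^'n \<Rightarrow> complex^'n \<Rightarrow> complex^'n::finite" where
  "csol A b = (\<chi> k. det (\<chi> i j. if j = k then b $ i else A $ i $ j))"

lemma inj_imp_det_nonzero:
  fixes A :: "complex^'n::finite^'n"
  assumes "\<And>v. A *v v = 0 \<Longrightarrow> v = 0"
  shows "det A \<noteq> 0"
proof -
  have "inj ((*v) A)"
    by (rule injI) (use assms in \<open>metis matrix_vector_mult_diff_distrib right_minus_eq\<close>)
  then show ?thesis
    using matrix_left_invertible_injective[of A] invertible_left_inverse[of A] invertible_det_nz[of A] by auto
qed

lemma cramer_csol: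
  assumes "det A \<noteq> 0"
  shows "A *v x = b \<longleftrightarrow> det A *s x = csol A b"
  unfolding cramer[OF assms] csol_def using assms by (auto simp: vec_eq_iff field_simps)

lemma det_nonzero_inj: "det (A :: complex^'n::finite^'n) \<noteq> 0 \<Longrightarrow> A *v v = 0 \<Longrightarrow> v = 0"
  using cramer_csol[of A v 0] cramer_csol[of A 0 0] by (metis matrix_vector_mult_0_right vector_mul_eq_0 vector_smult_rzero)

text \<open>The functions \<open>G k\<close> replace the coordinates with index in \<open>J\<close>,
  and the others are kept. In these coordinates the locus \<open>G = 0\<close> is a coordinate
  subspace.\<close>

definition chart :: "'m set \<Rightarrow> ('m \<Rightarrow> 'm cpoly) \<Rightarrow> complex^'m::finite \<Rightarrow> complex^'m" where
  "chart J G x = (\<chi> k. if k \<in> J then ev (G k) x else x $ k)"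

definition jacM :: "'m set \<Rightarrow> ('m \<Rightarrow> 'm cpoly) \<Rightarrow> complex^'m::finite \<Rightarrow> complex^'m^'m" where
  "jacM J G x = (\<chi> k l. if k \<in> J then ev (partial_deriv l (G k)) x else if k = l then 1 else 0)"

lemma jacM_mult: "(jacM J G x *v v) $ k = (if k \<in> J then dv (G k) x v else v $ k)"
  by (simp add: jacM_def matrix_vector_mult_def dv_def if_distrib[of "\<lambda>x. x * _"] cong: if_cong)

lemma pdc_ev: "pdc (ev f) k x = ev (partial_deriv k f) x"
proof -
  have "((\<lambda>h. poly_val (\<lambda>l. (x + h *s axis k 1) $ l) f) has_field_derivative
      (\<Sum>l\<in>UNIV. poly_val (\<lambda>l. (x + 0 *s axis k 1) $ l) (partial_deriv l f) * (if l = k then 1 else 0))) (at 0)"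
    by (rule poly_val_chain) (auto intro!: derivative_eq_intros simp: axis_def)
  then have "((\<lambda>h. ev f (x + h *s axis k 1)) has_field_derivative ev (partial_deriv k f) x) (at 0)"
    unfolding ev_def by (simp add: if_distrib[of "\<lambda>x. _ * x"] del: vector_add_component vector_smult_component cong: if_cong)
  then show ?thesis unfolding pdc_def by (rule DERIV_imp_deriv)
qed

lemma hol_chart: "open U \<Longrightarrow> holomorphic_on_open (\<lambda>z. chart J G z $ k) U"
  by (cases "k \<in> J") (auto simp: chart_def intro: hol_ev hol_coord)

lemma pdc_coord: "pdc (\<lambda>z. z $ k) l x = (if k = l then 1 else 0)"
  unfolding pdc_def
  by (rule DERIV_imp_deriv) (auto intro!: derivative_eq_intros simp: axis_def)

lemma jac_chart: "jac (chart J G) x v = jacM J G x *v v"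
proof -
  have "jac (chart J G) x v $ k = (jacM J G x *v v) $ k" for k
  proof (cases "k \<in> J")
    case True
    then have "(\<lambda>z. chart J G z $ k) = ev (G k)" by (auto simp: chart_def)
    then show ?thesis using True by (simp add: jac_def jacM_mult pdc_ev dv_def)
  next
    case False
    then have "(\<lambda>z. chart J G z $ k) = (\<lambda>z. z $ k)" by (auto simp: chart_def)
    then show ?thesis using False
      by (simp add: jac_def jacM_mult pdc_coord if_distrib[of "\<lambda>x. x * _"] cong: if_cong)
  qed
  then show ?thesis by (simp add: vec_eq_iff)
qed

lemma chart_inverse:
  assumes U: "open U" "p \<in> U" and p: "det (jacM J G p) \<noteq> 0"
  obtains \<epsilon> N h where "\<epsilon> > 0" "open N" "p \<in> N" "N \<subseteq> U"
    "homeomorphism N (pbox (chart J G p) \<epsilon>) (chart J G) h"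
    "\<And>i. holomorphic_on_open (\<lambda>w. h w $ i) (pbox (chart J G p) \<epsilon>)"
    "\<And>z. z \<in> N \<Longrightarrow> det (jacM J G z) \<noteq> 0"
proof -
  have inj: "v = 0" if "jac (chart J G) p v = 0" for v
    using that det_nonzero_inj[OF p] by (simp add: jac_chart)
  show ?thesis
  proof (rule hol_inverse_function[of "chart J G" U p, OF hol_chart[OF U(1)] U(2) inj])
    fix \<epsilon> N h
    assume *: "\<epsilon> > 0" "open N" "p \<in> N" "N \<subseteq> U"
      "homeomorphism N (pbox (chart J G p) \<epsilon>) (chart J G) h"
      "\<And>i. holomorphic_on_open (\<lambda>w. h w $ i) (pbox (chart J G p) \<epsilon>)"
      "\<And>z v. z \<in> N \<Longrightarrow> jac (chart J G) z v = 0 \<Longrightarrow> v = 0"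
    show ?thesis
    proof (rule that[OF *(1-6)])
      show "det (jacM J G z) \<noteq> 0" if "z \<in> N" for z
        using *(7)[OF that] by (intro inj_imp_det_nonzero) (simp add: jac_chart)
    qed
  qed
qed

lemma open_line_preimage:
  assumes "open S"
  shows "open {t::complex. a + t *s (v::complex^'m::finite) \<in> S}"
proof -
  have "continuous_on UNIV (\<lambda>t. a + t *s v)"
    by (rule continuous_at_imp_continuous_on, rule ballI, rule has_derivative_continuous, rule has_derivative_line)
  from open_vimage[OF assms this] show ?thesis by (simp add: vimage_def)
qed

lemma matrix_vector_sum: "M *v (\<Sum>k\<in>A. f k) = (\<Sum>k\<in>A. M *v (f k :: complex^'n::finite))"
  by (induction A rule: infinite_finite_induct) (auto simp: matrix_vector_right_distrib)

text \<open>The chain rule for \<open>chart J G (h c) = c\<close> along a line determines the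
  velocity \<open>u\<close> of the preimage.\<close>

lemma chart_inverse_curve:
  assumes h: "homeomorphism N (pbox c0 \<epsilon>) (chart J G) h"
    "\<And>i. holomorphic_on_open (\<lambda>w. h w $ i) (pbox c0 \<epsilon>)"
    and \<tau>: "a + \<tau> *s v \<in> pbox c0 \<epsilon>"
  obtains u where "\<And>k. ((\<lambda>t. h (a + t *s v) $ k) has_field_derivative u $ k) (at \<tau>)"
    "jacM J G (h (a + \<tau> *s v)) *v u = v"
proof -
  define u where "u = (\<chi> k. \<Sum>i\<in>UNIV. pdc (\<lambda>w. h w $ k) i (a + \<tau> *s v) * v $ i)"
  have u: "((\<lambda>t. h (a + t *s v) $ k) has_field_derivative u $ k) (at \<tau>)" for k
  proof -
    have "((\<lambda>t. h (a + t *s v) $ k) has_field_derivative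
        (\<Sum>i\<in>UNIV. pdc (\<lambda>w. h w $ k) i (a + \<tau> *s v) * v $ i)) (at \<tau>)"
      by (rule hol_curve[where c = "\<lambda>t. a + t *s v" and U = "pbox c0 \<epsilon>"])
        (use h(2) \<tau> in \<open>auto intro!: derivative_eq_intros\<close>)
    then show ?thesis by (simp add: u_def)
  qed
  have S: "open {t. a + t *s v \<in> pbox c0 \<epsilon>}" by (rule open_line_preimage[OF open_pbox])
  have "(jacM J G (h (a + \<tau> *s v)) *v u) $ k = v $ k" for k
  proof -
    have "((\<lambda>t. chart J G (h (a + t *s v)) $ k) has_field_derivative
        (\<Sum>i\<in>UNIV. pdc (\<lambda>z. chart J G z $ k) i (h (a + \<tau> *s v)) * u $ i)) (at \<tau>)"
      by (rule hol_curve[where c = "\<lambda>t. h (a + t *s v)" and U = UNIV]) (auto intro: hol_chart u)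
    moreover have "((\<lambda>t. chart J G (h (a + t *s v)) $ k) has_field_derivative v $ k) (at \<tau>)"
    proof (rule has_field_derivative_transform_within_open[OF _ S])
      show "((\<lambda>t. (a + t *s v) $ k) has_field_derivative v $ k) (at \<tau>)"
        by (auto intro!: derivative_eq_intros)
      show "(a + t *s v) $ k = chart J G (h (a + t *s v)) $ k" if "t \<in> {t. a + t *s v \<in> pbox c0 \<epsilon>}" for t
        using that h(1) by (simp add: homeomorphism_def)
    qed (use \<tau> in auto)
    ultimately have "(\<Sum>i\<in>UNIV. pdc (\<lambda>z. chart J G z $ k) i (h (a + \<tau> *s v)) * u $ i) = v $ k"
      by (rule DERIV_unique)
    then show ?thesis by (simp add: jac_def flip: jac_chart)
  qed
  then have "jacM J G (h (a + \<tau> *s v)) *v u = v" by (simp add: vec_eq_iff)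
  with u show ?thesis using that by blast
qed

lemma polyfn_det:
  fixes M :: "('v \<Rightarrow> complex) \<Rightarrow> complex^'n::finite^'n"
  shows "(\<And>i j. polyfn V (\<lambda>z. M z $ i $ j)) \<Longrightarrow> polyfn V (\<lambda>z. det (M z))"
  unfolding det_def by (intro polyfn_sum polyfn_mult polyfn_prod polyfn_const)

lemma convex_line_preimage: "convex S \<Longrightarrow> convex {t::complex. a + t *s (v::complex^'m::finite) \<in> S}"
proof -
  assume "convex S"
  moreover have "{t. a + t *s v \<in> S} = (\<lambda>t. t *s v) -` ((\<lambda>x. x - a) ` S)"
    by (auto simp: image_iff algebra_simps intro!: bexI)
  moreover have "linear (\<lambda>t. t *s v)" by (rule linearI) (auto simp: vec_eq_iff algebra_simps)
  ultimately show ?thesis using convex_linear_vimage convex_translation_subtract by metis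
qed

lemma polyfn_jacM: "polyfn UNIV (\<lambda>z. jacM J G (\<chi> i. z i) $ i $ j)"
proof -
  have "(($) (\<chi> i. z i)) = z" for z :: "'a \<Rightarrow> complex" by (rule ext) simp
  then show ?thesis
    by (cases "i \<in> J"; cases "i = j") (auto simp: jacM_def ev_def intro: polyfn_const polyfn_poly_val_UNIV)
qed

context base_locus
begin

text \<open>The tangent space of \<open>D\<close> lies in the kernel of the differentials of the
  \<open>G k\<close>; the latter has dimension at most \<open>CARD('n) - (r + 1) = 3\<close>, which
  is the dimension of the former.\<close>

lemma tangent_eq_kernel:
  assumes y: "y \<in> D" and G: "\<And>k x. k \<in> J \<Longrightarrow> x \<in> D \<Longrightarrow> ev (G k) x = 0" and J: "card J = r + 1"
    and det: "det (jacM J G y) \<noteq> 0"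
  shows "{v. \<forall>k\<in>J. dv (G k) y v = 0} = {v. \<forall>i<q. dv (g i) y v = 0}"
proof -
  define M where "M = jacM J G y"
  have lin: "dv f y (a + b) = dv f y a + dv f y b" "dv f y (c *s a) = c * dv f y a" "dv f y 0 = 0" for f a b c
    by (auto simp: dv_def algebra_simps sum.distrib sum_distrib_left)
  define T where "T = {v. \<forall>k\<in>J. dv (G k) y v = 0}"
  define S where "S = {v. \<forall>i<q. dv (g i) y v = 0}"
  have sub: "vec.subspace T" "vec.subspace S" by (auto simp: vec.subspace_def T_def S_def lin)
  have ST: "S \<subseteq> T"
    using tangent[OF y] G by (auto simp: T_def S_def vanishing_ideal_def ev_def)
  define e where "e k = (1 / det M) *s csol M (axis k 1)" for k
  have e: "M *v e k = axis k 1" for k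
    using det by (simp add: cramer_csol e_def M_def)
  have "T \<subseteq> vec.span (e ` (- J))"
  proof
    fix v assume v: "v \<in> T"
    define u where "u = (\<Sum>k\<in>-J. v $ k *s e k)"
    have "M *v u = (\<Sum>k\<in>-J. v $ k *s (M *v e k))"
      by (simp add: u_def matrix_vector_sum vector_scalar_commute)
    also have "\<dots> = (\<Sum>k\<in>-J. v $ k *s axis k 1)" by (simp only: e)
    also have "\<dots> = M *v v"
    proof -
      have "(\<Sum>k\<in>-J. v $ k *s axis k 1) $ i = (if i \<in> J then 0 else v $ i)" for i
        by (simp add: axis_def if_distrib[of "\<lambda>x. _ * x"] cong: if_cong)
      then show ?thesis using v by (simp add: vec_eq_iff M_def jacM_mult T_def)
    qed
    finally have "M *v (u - v) = 0" by (simp add: matrix_vector_mult_diff_distrib)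
    then have "u = v" using det_nonzero_inj[of M "u - v"] det by (simp add: M_def)
    then show "v \<in> vec.span (e ` (- J))"
      unfolding u_def by (metis (no_types, lifting) imageI vec.span_base vec.span_scale vec.span_sum)
  qed
  then have "vec.dim T \<le> card (e ` (- J))" by (intro vec.dim_le_card) auto
  also have "\<dots> \<le> card (- J)" by (rule card_image_le) simp
  also have "\<dots> = 3" using J card_n by (simp add: Compl_eq_Diff_UNIV card_Diff_subset)
  finally have "vec.dim T \<le> vec.dim S" using dim_tangent[OF y] by (simp add: S_def)
  then have "S = T" by (intro vec.subspace_dim_equal sub ST)
  then show ?thesis by (simp add: T_def S_def)
qed

text \<open>For \<open>f\<close> vanishing on \<open>D\<close>, the derivative of \<open>f\<close> along the manifold \<open>G = 0\<close> is,
  up to a nonvanishing factor, again a polynomial that vanishes on \<open>D\<close>; so the order of vanishing of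
  \<open>f\<close> on that manifold at the given point cannot be finite.\<close>

lemma D_local:
  assumes p: "p \<in> D" and G: "\<And>k x. k \<in> J \<Longrightarrow> x \<in> D \<Longrightarrow> ev (G k) x = 0" and J: "card J = r + 1"
    and U: "open U" "p \<in> U" and det: "det (jacM J G p) \<noteq> 0"
  obtains \<epsilon> N h where "\<epsilon> > 0" "open N" "p \<in> N" "N \<subseteq> U"
    "homeomorphism N (pbox (chart J G p) \<epsilon>) (chart J G) h"
    "\<And>i. holomorphic_on_open (\<lambda>w. h w $ i) (pbox (chart J G p) \<epsilon>)"
    "\<And>z. z \<in> N \<Longrightarrow> det (jacM J G z) \<noteq> 0"
    "\<And>c. c \<in> pbox (chart J G p) \<epsilon> \<Longrightarrow> (\<And>k. k \<in> J \<Longrightarrow> c $ k = 0) \<Longrightarrow> h c \<in> D"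
proof -
  have U0: "open (U - {0})" "p \<in> U - {0}" using U p D_nonzero by auto
  obtain \<epsilon> N h where N: "\<epsilon> > 0" "open N" "p \<in> N" "N \<subseteq> U - {0}"
    "homeomorphism N (pbox (chart J G p) \<epsilon>) (chart J G) h"
    "\<And>i. holomorphic_on_open (\<lambda>w. h w $ i) (pbox (chart J G p) \<epsilon>)"
    "\<And>z. z \<in> N \<Longrightarrow> det (jacM J G z) \<noteq> 0"
    using chart_inverse[OF U0 det] by metis
  have "h c \<in> D" if c: "c \<in> pbox (chart J G p) \<epsilon>" "\<And>k. k \<in> J \<Longrightarrow> c $ k = 0" for c
  proof -
    \<comment> \<open>The point \<open>c\<close> is reached from the image \<open>a\<close> of
      \<open>p\<close> along the straight line in chart coordinates; \<open>h\<close> maps this line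
      to a holomorphic curve \<open>\<psi>\<close> on which all \<open>G k\<close> vanish.\<close>
    define a where "a = chart J G p"
    define v where "v = c - a"
    have aJ: "a $ k = 0" if "k \<in> J" for k using G[OF that p] that by (simp add: a_def chart_def)
    have vJ: "v $ k = 0" if "k \<in> J" for k using c(2)[OF that] aJ[OF that] by (simp add: v_def)
    define S where "S = {t. a + t *s v \<in> pbox a \<epsilon>}"
    have S: "open S" "convex S" "0 \<in> S" "1 \<in> S"
      unfolding S_def
      by (rule open_line_preimage[OF open_pbox], rule convex_line_preimage[OF convex_pbox])
        (use c N(1) in \<open>auto simp: v_def a_def pbox_def\<close>)
    define \<psi> where "\<psi> t = h (a + t *s v)" for t
    have \<psi>N: "\<psi> t \<in> N" if "t \<in> S" for t
      using that N(5) unfolding S_def \<psi>_def a_def homeomorphism_def by blast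
    have \<psi>0: "\<psi> 0 = p" using N(3,5) by (simp add: \<psi>_def a_def homeomorphism_def)
    define \<Delta> where "\<Delta> y = det (jacM J G y)" for y
    have \<psi>': "((\<lambda>t. \<psi> t $ k) has_field_derivative csol (jacM J G (\<psi> t)) v $ k / \<Delta> (\<psi> t)) (at t)"
      if t: "t \<in> S" for t k
    proof -
      obtain u where u: "\<And>k. ((\<lambda>t. h (a + t *s v) $ k) has_field_derivative u $ k) (at t)"
        "jacM J G (h (a + t *s v)) *v u = v"
        using chart_inverse_curve[OF N(5)[folded a_def] N(6)[folded a_def], of a t v] t by (auto simp: S_def)
      have d: "\<Delta> (\<psi> t) \<noteq> 0" using N(7)[OF \<psi>N[OF t]] by (simp add: \<Delta>_def)
      then have "\<Delta> (\<psi> t) *s u = csol (jacM J G (\<psi> t)) v"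
        using u(2) cramer_csol[of "jacM J G (\<psi> t)" u v] by (simp add: \<Delta>_def \<psi>_def)
      then have "csol (jacM J G (\<psi> t)) v $ k = \<Delta> (\<psi> t) * u $ k" by (metis vector_smult_component)
      then show ?thesis using u(1)[of k] d by (simp add: \<psi>_def)
    qed
    have \<psi>_hol: "(\<lambda>t. \<psi> t $ k) holomorphic_on S" for k
      using \<psi>' by (auto simp: holomorphic_on_def field_differentiable_def intro: has_field_derivative_at_within)
    have ev_hol: "(\<lambda>t. ev f (\<psi> t)) holomorphic_on S" for f
      unfolding ev_def by (rule holomorphic_on_polyfn[OF polyfn_poly_val_UNIV]) (rule \<psi>_hol)
    have pol: "polyfn UNIV (\<lambda>z. det (jacM J G (\<chi> i. z i)))"
      by (rule polyfn_det) (rule polyfn_jacM)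
    have pol2: "polyfn UNIV (\<lambda>z. csol (jacM J G (\<chi> i. z i)) v $ l)" for l
      unfolding csol_def
    proof (simp, rule polyfn_det)
      fix i j
      show "polyfn UNIV (\<lambda>z. (\<chi> i j. if j = l then v $ i else jacM J G (\<chi> i. z i) $ i $ j) $ i $ j)"
        by (cases "j = l") (auto intro: polyfn_const polyfn_jacM)
    qed
    \<comment> \<open>Multiplication by \<open>\<Delta>\<close> once makes the derivative in
      direction \<open>v\<close> polynomial; the second factor makes \<open>\<delta> f\<close>
      vanish also at the points of \<open>D\<close> where the chart degenerates. Both factors are
      undone by \<open>w\<close> below.\<close>
    have "\<exists>e. \<forall>y. ev e y = \<Delta> y * (\<Sum>l\<in>UNIV. ev (partial_deriv l f) y * csol (jacM J G y) v $ l)" for f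
    proof -
      have "polyfn UNIV (\<lambda>z. det (jacM J G (\<chi> i. z i)) *
          (\<Sum>l\<in>UNIV. poly_val z (partial_deriv l f) * csol (jacM J G (\<chi> i. z i)) v $ l))"
        by (intro polyfn_mult polyfn_sum pol pol2 polyfn_poly_val_UNIV)
      from polyfn_imp_poly_val[OF this] obtain e where "\<And>z. poly_val z e = det (jacM J G (\<chi> i. z i)) *
          (\<Sum>l\<in>UNIV. poly_val z (partial_deriv l f) * csol (jacM J G (\<chi> i. z i)) v $ l)" by blast
      then show ?thesis by (intro exI[of _ e]) (simp add: ev_def \<Delta>_def)
    qed
    then obtain \<delta> where \<delta>: "\<And>f y. ev (\<delta> f) y = \<Delta> y * (\<Sum>l\<in>UNIV. ev (partial_deriv l f) y * csol (jacM J G y) v $ l)"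
      by metis
    define I where "I = {f. \<forall>x\<in>D. ev f x = 0}"
    have \<delta>I: "\<delta> f \<in> I" if f: "f \<in> I" for f
    proof -
      have "ev (\<delta> f) y = 0" if y: "y \<in> D" for y
      proof (cases "\<Delta> y = 0")
        case False
        define u where "u = csol (jacM J G y) v"
        have "jacM J G y *v ((1 / \<Delta> y) *s u) = v"
          using False by (simp add: cramer_csol \<Delta>_def u_def)
        then have "jacM J G y *v u = \<Delta> y *s v"
          using False by (metis (no_types, lifting) divide_self_if mult.commute times_divide_eq_right
              vector_scalar_commute vector_smult_assoc vector_smult_lid mult_1)
        then have "(jacM J G y *v u) $ k = \<Delta> y * v $ k" for k by simp
        then have "dv (G k) y u = 0" if "k \<in> J" for k
          using vJ[OF that] that by (metis jacM_mult mult_zero_right)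
        then have "u \<in> {v. \<forall>i<q. dv (g i) y v = 0}"
          using tangent_eq_kernel[of y J G, OF y G J] False by (auto simp: \<Delta>_def)
        then have "dv f y u = 0"
          using tangent[OF y, of f u] f by (auto simp: I_def vanishing_ideal_def ev_def)
        then show ?thesis by (simp add: \<delta> dv_def u_def)
      qed (simp add: \<delta>)
      then show ?thesis by (simp add: I_def)
    qed
    define w where "w t = 1 / (\<Delta> (\<psi> t))\<^sup>2" for t
    have w_hol: "w holomorphic_on S"
    proof -
      have "(\<lambda>t. \<Delta> (\<psi> t)) holomorphic_on S"
        using holomorphic_on_polyfn[OF pol, of "\<lambda>t i. \<psi> t $ i" S] \<psi>_hol by (simp add: \<Delta>_def)
      then show ?thesis
        unfolding w_def using N(7)[OF \<psi>N] by (auto intro!: holomorphic_intros simp: \<Delta>_def)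
    qed
    have dG: "deriv (\<lambda>t. ev f (\<psi> t)) t = ev (\<delta> f) (\<psi> t) * w t" if t: "t \<in> S" for t f
    proof -
      have "((\<lambda>t. ev f (\<psi> t)) has_field_derivative
          (\<Sum>l\<in>UNIV. ev (partial_deriv l f) (\<psi> t) * (csol (jacM J G (\<psi> t)) v $ l / \<Delta> (\<psi> t)))) (at t)"
        unfolding ev_def by (rule poly_val_chain) (rule \<psi>'[OF t])
      moreover have "(\<Sum>l\<in>UNIV. ev (partial_deriv l f) (\<psi> t) * (csol (jacM J G (\<psi> t)) v $ l / \<Delta> (\<psi> t))) =
          ev (\<delta> f) (\<psi> t) * w t"
        using N(7)[OF \<psi>N[OF t]]
        by (simp add: \<delta> w_def \<Delta>_def power2_eq_square sum_divide_distrib)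
      ultimately show ?thesis by (metis DERIV_imp_deriv)
    qed
    \<comment> \<open>All members of \<open>I\<close> are treated at once: a derivative of
      \<open>ev f\<close> along \<open>\<psi>\<close> is, up to the factor \<open>w\<close>, the
      value of another member \<open>\<delta> f\<close>, and Leibniz reduces the order by
      one.\<close>
    have all0: "\<forall>f\<in>I. (deriv ^^ n) (\<lambda>t. ev f (\<psi> t)) 0 = 0" for n
    proof (induction n rule: less_induct)
      case (less n)
      show ?case
      proof
        fix f assume f: "f \<in> I"
        show "(deriv ^^ n) (\<lambda>t. ev f (\<psi> t)) 0 = 0"
        proof (cases n)
          case 0
          then show ?thesis using f p by (simp add: \<psi>0 I_def)
        next
          case (Suc m)
          have hd: "deriv (\<lambda>t. ev f (\<psi> t)) holomorphic_on S" by (rule holomorphic_deriv[OF ev_hol S(1)])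
          have "(deriv ^^ n) (\<lambda>t. ev f (\<psi> t)) 0 = (deriv ^^ m) (deriv (\<lambda>t. ev f (\<psi> t))) 0"
            by (simp add: Suc funpow_Suc_right del: funpow.simps)
          also have "\<dots> = (deriv ^^ m) (\<lambda>t. ev (\<delta> f) (\<psi> t) * w t) 0"
            by (rule higher_deriv_transform_within_open[OF hd _ S(1,3)])
              (auto intro!: holomorphic_intros ev_hol w_hol dG)
          also have "\<dots> = (\<Sum>i = 0..m. of_nat (m choose i) * (deriv ^^ i) (\<lambda>t. ev (\<delta> f) (\<psi> t)) 0 * (deriv ^^ (m-i)) w 0)"
            by (rule higher_deriv_mult[OF ev_hol w_hol S(1,3)])
          also have "\<dots> = 0"
            using less.IH \<delta>I[OF f] Suc by (intro sum.neutral) auto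
          finally show ?thesis .
        qed
      qed
    qed
    have I0: "ev f (h c) = 0" if "f \<in> I" for f
    proof -
      have "ev f (\<psi> 1) = 0"
        by (rule holomorphic_fun_eq_0_on_connected[OF ev_hol S(1) convex_connected[OF S(2)] _ S(3,4)])
          (use all0 that in blast)
      then show ?thesis by (simp add: \<psi>_def v_def)
    qed
    have "g i \<in> I" if "i < q" for i using g_D[OF that] by (auto simp: I_def)
    moreover have "h c \<noteq> 0" using \<psi>N[OF S(4)] N(4) by (auto simp: \<psi>_def v_def)
    ultimately show ?thesis using g_base I0 by blast
  qed
  then show ?thesis using that[of \<epsilon> N h] N by blast
qed

end

section \<open>Coordinate frames at a singular point\<close>

definition dotp :: "complex^'n::finite \<Rightarrow> complex^'n \<Rightarrow> complex" where
  "dotp a v = (\<Sum>l\<in>UNIV. a $ l * v $ l)"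

lemma dotp_linear:
  "dotp (a + b) v = dotp a v + dotp b v" "dotp (c *s a) v = c * dotp a v" "dotp 0 v = 0"
  "dotp a (v + w) = dotp a v + dotp a w" "dotp a (c *s v) = c * dotp a v" "dotp a 0 = 0"
  by (auto simp: dotp_def algebra_simps sum.distrib sum_distrib_left)

lemma dotp_sum_right: "dotp a (\<Sum>k\<in>A. f k) = (\<Sum>k\<in>A. dotp a (f k))"
  by (induction A rule: infinite_finite_induct) (auto simp: dotp_linear)

lemma dotp_axis: "dotp (axis k 1) v = v $ k" "dotp a (axis k 1) = a $ k"
  by (auto simp: dotp_def axis_def if_distrib[of "\<lambda>x. x * _"] if_distrib[of "\<lambda>x. _ * x"] cong: if_cong)

lemma dotp_span_zero: "a \<in> vec.span A \<Longrightarrow> (\<And>b. b \<in> A \<Longrightarrow> dotp b v = 0) \<Longrightarrow> dotp a v = 0"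
  by (induction rule: vec.span_induct_alt) (auto simp: dotp_linear)

definition grad :: "'n::finite cpoly \<Rightarrow> complex^'n \<Rightarrow> complex^'n" where
  "grad f x = (\<chi> l. ev (partial_deriv l f) x)"

lemma dv_grad: "dv f x v = dotp (grad f x) v"
  by (simp add: dv_def dotp_def grad_def)

text \<open>Exchange in the space of linear forms: \<open>A\<close> is completed to a basis by
  coordinate forms, among them those with index in \<open>K1\<close>. As many indices remain as
  \<open>A\<close> has elements; they form \<open>J\<close>.\<close>

lemma extend_frame:
  fixes A :: "(complex^'n::finite) set"
  assumes A: "vec.independent (A \<union> (\<lambda>k. axis k 1) ` K1)" "A \<inter> (\<lambda>k. axis k 1) ` K1 = {}"
  obtains J \<phi> where "J \<inter> K1 = {}" "bij_betw \<phi> J A"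
    "det (\<chi> k. if k \<in> J then \<phi> k else axis k (1::complex)) \<noteq> 0"
proof -
  define ax where "ax = (\<lambda>k::'n. axis k (1::complex))"
  have inj_ax: "inj ax" by (rule injI) (auto simp: ax_def axis_eq_axis)
  obtain B where B: "A \<union> ax ` K1 \<subseteq> B" "B \<subseteq> A \<union> range ax" "vec.independent B" "A \<union> range ax \<subseteq> vec.span B"
    using vec.maximal_independent_subset_extend[of "A \<union> ax ` K1" "A \<union> range ax"] A(1)
    by (auto simp: ax_def)
  have finB: "finite B" using B(3) vec.finiteI_independent by blast
  have spanB: "vec.span B = UNIV"
  proof -
    have "v \<in> vec.span B" for v
    proof -
      have "v = (\<Sum>k\<in>UNIV. (v $ k) *s ax k)" unfolding ax_def by (rule vec_eq_sum_axis)
      also have "\<dots> \<in> vec.span B" using B(4) by (intro vec.span_sum vec.span_scale) auto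
      finally show ?thesis .
    qed
    then show ?thesis by blast
  qed
  have cardB: "card B = CARD('n)"
    using vec.dim_eq_card[of B UNIV] spanB B(3) by (simp add: vec_dim_card card_cart_basis)
  define K0 where "K0 = {k. ax k \<in> B - A}"
  have BA: "B - A = ax ` K0" using B(2) by (auto simp: K0_def)
  have "card (B - A) = card K0" unfolding BA using inj_ax by (intro card_image) (auto simp: inj_on_def)
  moreover have "card (B - A) = card B - card A" "card A \<le> card B"
    using B(1) finB by (auto intro!: card_Diff_subset card_mono dest: finite_subset)
  moreover have "card (- K0) = CARD('n) - card K0" by (simp add: Compl_eq_Diff_UNIV card_Diff_subset)
  ultimately have "card A = card (- K0)" using cardB by linarith
  moreover have "finite A" using finB B(1) finite_subset by blast
  ultimately obtain \<phi> where \<phi>: "bij_betw \<phi> (- K0) A"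
    using finite_same_card_bij[of "- K0" A] by auto
  show ?thesis
  proof (rule that[of "- K0" \<phi>])
    show "- K0 \<inter> K1 = {}" using B(1) A(2) by (auto simp: K0_def ax_def)
    show "bij_betw \<phi> (- K0) A" by (rule \<phi>)
    define M where "M = (\<chi> k. if k \<in> - K0 then \<phi> k else axis k (1::complex))"
    show "det (\<chi> k. if k \<in> - K0 then \<phi> k else axis k (1::complex)) \<noteq> 0"
      unfolding M_def[symmetric]
    proof (rule inj_imp_det_nonzero)
      fix v assume "M *v v = 0"
      then have Mk: "dotp (M $ k) v = 0" for k
        by (simp add: vec_eq_iff matrix_vector_mult_def dotp_def)
      have "dotp b v = 0" if b: "b \<in> B" for b
      proof (cases "b \<in> A")
        case True
        then obtain k where "k \<notin> K0" "b = \<phi> k" using \<phi> by (auto simp: bij_betw_def)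
        then show ?thesis using Mk[of k] by (simp add: M_def)
      next
        case False
        then obtain k where "k \<in> K0" "b = ax k" using BA b by auto
        then show ?thesis using Mk[of k] by (simp add: M_def ax_def)
      qed
      then have "dotp a v = 0" for a using dotp_span_zero[of a B v] spanB by auto
      from this[of "axis _ 1"] show "v = 0" by (simp add: vec_eq_iff dotp_axis)
    qed
  qed
qed

lemma kernel_dim:
  fixes M :: "complex^'n::finite^'n"
  assumes "det M \<noteq> 0"
  shows "vec.dim {v. \<forall>k\<in>J. (M *v v) $ k = 0} = card (- J)"
proof -
  define T where "T = {v. \<forall>k\<in>J. (M *v v) $ k = 0}"
  have inj: "inj ((*v) M)"
    by (rule injI) (use det_nonzero_inj[OF assms] in \<open>metis matrix_vector_mult_diff_distrib right_minus_eq\<close>)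
  have "(*v) M ` T = {w. \<forall>k. k \<notin> - J \<longrightarrow> w $ k = 0}"
  proof
    show "{w. \<forall>k. k \<notin> - J \<longrightarrow> w $ k = 0} \<subseteq> (*v) M ` T"
    proof
      fix w :: "complex^'n" assume w: "w \<in> {w. \<forall>k. k \<notin> - J \<longrightarrow> w $ k = 0}"
      have "M *v ((1 / det M) *s csol M w) = w" using assms by (simp add: cramer_csol)
      then show "w \<in> (*v) M ` T" using w by (intro image_eqI[of _ _ "(1 / det M) *s csol M w"]) (auto simp: T_def)
    qed
  qed (auto simp: T_def)
  moreover have "vec.dim ((*v) M ` T) = vec.dim T"
    by (rule vec.dim_image_eq[OF matrix_vector_mul_linear_gen]) (use inj in \<open>auto simp: inj_on_def\<close>)
  moreover have "vec.dim {w :: complex^'n. \<forall>k. k \<notin> - J \<longrightarrow> w $ k = 0} = card (- J)"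
    by (rule dim_substandard_cart)
  ultimately show ?thesis by (simp add: T_def)
qed

text \<open>The \<open>k\<close>-th column of the inverse of \<open>M\<close>: these vectors form
  the frame dual to the rows of \<open>M\<close>.\<close>

definition fcol :: "complex^'n^'n \<Rightarrow> 'n \<Rightarrow> complex^'n::finite" where
  "fcol M k = (1 / det M) *s csol M (axis k 1)"

lemma fcol: "det M \<noteq> 0 \<Longrightarrow> M *v fcol M k = axis k 1"
  by (simp add: cramer_csol fcol_def)

lemma expand_fcol:
  assumes "det M \<noteq> 0"
  shows "v = (\<Sum>k\<in>UNIV. (M *v v) $ k *s fcol M k)"
proof -
  have "M *v (\<Sum>k\<in>UNIV. (M *v v) $ k *s fcol M k) = (\<Sum>k\<in>UNIV. (M *v v) $ k *s axis k 1)"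
    by (simp add: matrix_vector_sum vector_scalar_commute fcol[OF assms])
  also have "\<dots> = M *v v" by (rule vec_eq_sum_axis[symmetric])
  finally have "M *v (v - (\<Sum>k\<in>UNIV. (M *v v) $ k *s fcol M k)) = 0"
    by (simp add: matrix_vector_mult_diff_distrib)
  then show ?thesis using det_nonzero_inj[OF assms] by force
qed

lemma euler_partial:
  assumes "f \<in> forms d"
  shows "(\<Sum>l\<in>UNIV. ev (partial_deriv l (partial_deriv k f)) x * x $ l) = (of_nat d - 1) * ev (partial_deriv k f) x"
proof -
  have "((\<lambda>c. poly_val (\<lambda>v. c * x $ v) (partial_deriv k f)) has_field_derivative
      (\<Sum>l\<in>UNIV. poly_val (\<lambda>v. 1 * x $ v) (partial_deriv l (partial_deriv k f)) * x $ l)) (at 1)"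
    by (rule poly_val_chain) (auto intro!: derivative_eq_intros)
  then have "((\<lambda>c. c * poly_val (\<lambda>v. c * x $ v) (partial_deriv k f)) has_field_derivative
      (ev (partial_deriv k f) x + (\<Sum>l\<in>UNIV. ev (partial_deriv l (partial_deriv k f)) x * x $ l))) (at 1)"
    by (auto intro!: derivative_eq_intros simp: ev_def)
  moreover have "((\<lambda>c. c ^ d * poly_val (($) x) (partial_deriv k f)) has_field_derivative
      of_nat d * ev (partial_deriv k f) x) (at 1)"
    by (auto intro!: derivative_eq_intros simp: ev_def)
  ultimately have "ev (partial_deriv k f) x + (\<Sum>l\<in>UNIV. ev (partial_deriv l (partial_deriv k f)) x * x $ l) =
      of_nat d * ev (partial_deriv k f) x"
    unfolding poly_val_partial_scale[OF assms] by (rule DERIV_unique)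
  then show ?thesis by (simp add: algebra_simps)
qed

lemma ev_euler: "f \<in> forms d \<Longrightarrow> dv f x x = of_nat d * ev f x"
  using poly_val_euler[of f d "($) x"] by (simp add: dv_def ev_def)

context base_locus
begin

lemma F_forms: "F t j \<in> forms d"
  unfolding F_def
proof -
  have "(\<Sum>i\<in>A. poly_const (t (j, i)) * g i) \<in> forms d" if "A \<subseteq> {..<q}" for A
    using finite_subset[OF that finite_lessThan] that
    by (induction A rule: finite_induct) (auto simp: forms_0 intro!: forms_add forms_scale g_form)
  then show "(\<Sum>i<q. poly_const (t (j, i)) * g i) \<in> forms d" by blast
qed

lemma F_D: "x \<in> D \<Longrightarrow> ev (F t j) x = 0"
  by (simp add: ev_F g_D)

definition hessS :: "(nat \<times> nat \<Rightarrow> complex) \<Rightarrow> (nat \<Rightarrow> complex) \<Rightarrow> complex^'n \<Rightarrow> complex^'n \<Rightarrow> complex^'n" where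
  "hessS t lam p w = (\<chi> l. \<Sum>j<r. lam j * hess (F t j) p w l)"

lemma hessS_linear:
  "hessS t lam p (\<Sum>k\<in>A. c k *s e k) = (\<Sum>k\<in>A. c k *s hessS t lam p (e k))"
proof -
  have "hess f p (\<Sum>k\<in>A. c k *s e k) l = (\<Sum>k\<in>A. c k * hess f p (e k) l)" for f l
    unfolding hess_def sum_component vector_smult_component sum_distrib_left
    by (subst sum.swap) (simp add: mult_ac)
  then show ?thesis
    unfolding hessS_def vec_eq_iff sum_component vector_smult_component vec_lambda_beta sum_distrib_left
    by (subst sum.swap) (simp add: mult_ac sum_distrib_left)
qed

text \<open>By Euler's relation, pairing the Hessian of a form with the point itself gives
  \<open>d - 1\<close> times its differential, and the combination of the differentials with
  coefficients \<open>lam\<close> is 0. So the Hessian at a singular point annihilates the radial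
  direction.\<close>

lemma hessS_euler:
  assumes "\<And>v. (\<Sum>j<r. lam j * dv (F t j) p v) = 0"
  shows "dotp (hessS t lam p w) p = 0"
proof -
  have "(\<Sum>l\<in>UNIV. hess (F t j) p w l * p $ l) = (of_nat d - 1) * dv (F t j) p w" for j
  proof -
    have "(\<Sum>l\<in>UNIV. hess (F t j) p w l * p $ l) =
        (\<Sum>k\<in>UNIV. (\<Sum>l\<in>UNIV. ev (partial_deriv l (partial_deriv k (F t j))) p * p $ l) * w $ k)"
      unfolding hess_def sum_distrib_right by (subst sum.swap) (simp add: mult_ac)
    then show ?thesis
      unfolding euler_partial[OF F_forms] by (simp add: dv_def sum_distrib_left mult.assoc)
  qed
  moreover have "dotp (hessS t lam p w) p = (\<Sum>j<r. lam j * (\<Sum>l\<in>UNIV. hess (F t j) p w l * p $ l))"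
    unfolding dotp_def hessS_def vec_lambda_beta sum_distrib_right sum_distrib_left
    by (subst sum.swap) (simp add: mult_ac)
  ultimately show ?thesis
    using assms[of w] by (simp add: mult.left_commute[of _ "of_nat d - 1"] flip: sum_distrib_left)
qed

lemma good_node:
  assumes "good t" and x: "x \<in> D" and "j0 < r" "lam j0 = 1" "\<And>v. (\<Sum>j<r. lam j * dv (F t j) x v) = 0"
    "\<And>j. j < r \<Longrightarrow> dv (F t j) x w = 0"
    "\<And>l. (\<Sum>j<r. lam j * hess (F t j) x w l) = (\<Sum>i<q. b i * ev (partial_deriv l (g i)) x)" "i < q"
  shows "dv (g i) x w = 0"
proof -
  have *: "\<forall>x\<in>D. \<forall>lam j0 w \<beta>. j0 < r \<longrightarrow> lam j0 = 1 \<longrightarrow> (\<forall>v. (\<Sum>j<r. lam j * dv (F t j) x v) = 0) \<longrightarrow>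
        (\<forall>j<r. dv (F t j) x w = 0) \<longrightarrow>
        (\<forall>l. (\<Sum>j<r. lam j * hess (F t j) x w l) = (\<Sum>i<q. \<beta> i * ev (partial_deriv l (g i)) x)) \<longrightarrow>
        (\<forall>i<q. dv (g i) x w = 0)"
    using assms(1) unfolding good_def by (elim conjE)
  have "j0 < r \<longrightarrow> lam j0 = 1 \<longrightarrow> (\<forall>v. (\<Sum>j<r. lam j * dv (F t j) x v) = 0) \<longrightarrow>
        (\<forall>j<r. dv (F t j) x w = 0) \<longrightarrow>
        (\<forall>l. (\<Sum>j<r. lam j * hess (F t j) x w l) = (\<Sum>i<q. b i * ev (partial_deriv l (g i)) x)) \<longrightarrow>
        (\<forall>i<q. dv (g i) x w = 0)"
    using spec[OF spec[OF spec[OF spec[OF bspec[OF * x], of lam], of j0], of w], of b] .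
  then show ?thesis using assms(3-) by simp
qed

text \<open>Coordinates at a singular point \<open>p\<close> of \<open>X t\<close> on
  \<open>D\<close>. The indices in \<open>J\<close> other than \<open>m1\<close> and
  \<open>m2\<close> carry the equations except the one with index \<open>j0\<close>;
  \<open>m1\<close> and \<open>m2\<close> are the directions normal to \<open>D\<close> in the
  fourfold cut out by those equations. Of the untouched coordinates, \<open>i\<close> is the
  homogenising one and \<open>k1\<close>, \<open>k2\<close> are coordinates along \<open>D\<close>.
  The last clause says that the Hessian pairs the two normal directions with the two tangent
  directions without kernel.\<close>

definition node_frame where
  "node_frame t p i lam j0 J G m1 m2 k1 k2 jj \<longleftrightarrow>
    j0 < r \<and> lam j0 = 1 \<and> (\<forall>v. (\<Sum>j<r. lam j * dv (F t j) p v) = 0) \<and>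
    card J = r + 1 \<and> m1 \<in> J \<and> m2 \<in> J \<and> m1 \<noteq> m2 \<and> - J = {i, k1, k2} \<and> i \<noteq> k1 \<and> i \<noteq> k2 \<and> k1 \<noteq> k2 \<and>
    bij_betw jj (J - {m1, m2}) ({..<r} - {j0}) \<and> (\<forall>k\<in>J - {m1, m2}. G k = F t (jj k)) \<and>
    (\<forall>k\<in>J. \<forall>x\<in>D. ev (G k) x = 0) \<and> det (jacM J G p) \<noteq> 0 \<and>
    (\<forall>c1 c2. (\<forall>k\<in>{k1, k2}. dotp (hessS t lam p (c1 *s fcol (jacM J G p) m1 + c2 *s fcol (jacM J G p) m2))
        (fcol (jacM J G p) k) = 0) \<longrightarrow> c1 = 0 \<and> c2 = 0)"

text \<open>The differentials of the \<open>g i\<close> span the conormal space of \<open>D\<close>.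
  A basis of it is built around a maximal independent set \<open>A0\<close> of differentials of
  equations other than that of index \<open>j0\<close>, and completed by coordinate forms. A priori
  the equations could have small rank at \<open>p\<close>; it is the nondegeneracy in
  \<open>good\<close> that excludes this.\<close>

lemma node_frame_exists:
  assumes t: "good t" and p: "p \<in> D" "p $ i = 1" and sing: "\<not> indep_at t p"
  shows "\<exists>lam j0 J G m1 m2 k1 k2 jj. node_frame t p i lam j0 J G m1 m2 k1 k2 jj"
proof -
  obtain lam j0 where lam: "j0 < r" "lam j0 = 1" "\<And>v. (\<Sum>j<r. lam j * dv (F t j) p v) = 0"
    by (rule not_indep_normalised[OF sing]) (rule that)
  define R where "R = (\<lambda>j. grad (F t j) p) ` ({..<r} - {j0})"
  define Cg where "Cg = (\<lambda>i. grad (g i) p) ` {..<q}"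
  have rF: "grad (F t j) p \<in> vec.span Cg" for j
  proof -
    have "grad (F t j) p = (\<Sum>i<q. t (j, i) *s grad (g i) p)"
      by (simp add: grad_def vec_eq_iff ev_partial_F)
    also have "\<dots> \<in> vec.span Cg" by (intro vec.span_sum vec.span_scale vec.span_base) (auto simp: Cg_def)
    finally show ?thesis .
  qed
  obtain A0 where A0: "A0 \<subseteq> R" "vec.independent A0" "R \<subseteq> vec.span A0"
    using vec.maximal_independent_subset[of R] by blast
  obtain A where A: "A0 \<subseteq> A" "A \<subseteq> A0 \<union> Cg" "vec.independent A" "A0 \<union> Cg \<subseteq> vec.span A"
    using vec.maximal_independent_subset_extend[of A0 "A0 \<union> Cg"] A0(2) by auto
  have ACg: "a \<in> vec.span Cg" if "a \<in> A" for a
    using that A(2) A0(1) rF by (auto simp: R_def intro: vec.span_base)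
  have gp: "dotp b p = 0" if "b \<in> Cg" for b
    using that g_D[OF _ p(1)] by (auto simp: Cg_def ev_euler[OF g_form] simp flip: dv_grad)
  \<comment> \<open>Forms in the conormal space annihilate \<open>p\<close> by Euler's relation, but
    \<open>p $ i = 1\<close>; so coordinate \<open>i\<close> may be kept in the frame.\<close>
  have "axis i 1 \<notin> vec.span A"
  proof
    assume "axis i 1 \<in> vec.span A"
    then have "dotp (axis i 1) p = 0"
      by (rule dotp_span_zero) (use ACg gp dotp_span_zero in blast)
    then show False using p(2) by (simp add: dotp_axis)
  qed
  then have "vec.independent (A \<union> (\<lambda>k. axis k 1) ` {i})" "A \<inter> (\<lambda>k. axis k 1) ` {i} = {}"
    using A(3) vec.independent_insert[of "axis i 1" A] vec.span_base[of _ A] by auto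
  then obtain J \<phi> where J: "J \<inter> {i} = {}" "bij_betw \<phi> J A"
    "det (\<chi> k. if k \<in> J then \<phi> k else axis k (1::complex)) \<noteq> 0"
    by (rule extend_frame) (rule that)
  have "\<forall>k\<in>J. \<exists>f j. (\<phi> k \<in> A0 \<longrightarrow> j \<in> {..<r} - {j0} \<and> f = F t j) \<and> (\<phi> k \<notin> A0 \<longrightarrow> j < q \<and> f = g j) \<and> grad f p = \<phi> k"
  proof
    fix k assume "k \<in> J"
    then have "\<phi> k \<in> A" using J(2) by (auto simp: bij_betw_def)
    then show "\<exists>f j. (\<phi> k \<in> A0 \<longrightarrow> j \<in> {..<r} - {j0} \<and> f = F t j) \<and> (\<phi> k \<notin> A0 \<longrightarrow> j < q \<and> f = g j) \<and> grad f p = \<phi> k"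
    proof (cases "\<phi> k \<in> A0")
      case True
      then obtain j where "j \<in> {..<r} - {j0}" "\<phi> k = grad (F t j) p" using A0(1) by (auto simp: R_def)
      then show ?thesis using True by (intro exI[of _ "F t j"] exI[of _ j]) simp
    next
      case False
      then obtain j where "j < q" "\<phi> k = grad (g j) p" using \<open>\<phi> k \<in> A\<close> A(2) by (auto simp: Cg_def)
      then show ?thesis using False by (intro exI[of _ "g j"] exI[of _ j]) simp
    qed
  qed
  then obtain G jj where G: "\<And>k. k \<in> J \<Longrightarrow> \<phi> k \<in> A0 \<Longrightarrow> jj k \<in> {..<r} - {j0} \<and> G k = F t (jj k)"
    "\<And>k. k \<in> J \<Longrightarrow> \<phi> k \<notin> A0 \<Longrightarrow> jj k < q \<and> G k = g (jj k)" "\<And>k. k \<in> J \<Longrightarrow> grad (G k) p = \<phi> k"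
    by metis
  define M where "M = jacM J G p"
  have M: "M = (\<chi> k. if k \<in> J then \<phi> k else axis k (1::complex))"
    using G(3) by (auto simp: M_def jacM_def grad_def vec_eq_iff axis_def)
  have det: "det M \<noteq> 0" using J(3) M by simp
  have Mk: "(M *v v) $ k = (if k \<in> J then dotp (\<phi> k) v else v $ k)" for v k
    using G(3) by (simp add: M_def jacM_mult dv_grad)
  have GD: "\<forall>k\<in>J. \<forall>x\<in>D. ev (G k) x = 0"
    using G(1,2) F_D g_D by metis
  have ker: "{v. \<forall>k\<in>J. (M *v v) $ k = 0} = {v. \<forall>i<q. dv (g i) p v = 0}"
  proof (intro Collect_cong iffI allI impI ballI)
    fix v i assume v: "\<forall>k\<in>J. (M *v v) $ k = 0" "i < q"
    have "dotp a v = 0" if a: "a \<in> A" for a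
    proof -
      obtain k where "k \<in> J" "a = \<phi> k" using a J(2) by (auto simp: bij_betw_def)
      then show ?thesis using v(1) by (auto simp: Mk)
    qed
    moreover have "grad (g i) p \<in> vec.span A" using A(4) v(2) by (auto simp: Cg_def)
    ultimately show "dv (g i) p v = 0" unfolding dv_grad using dotp_span_zero by blast
  next
    fix v k assume v: "\<forall>i<q. dv (g i) p v = 0" "k \<in> J"
    have "\<phi> k \<in> A" using v J(2) by (auto simp: bij_betw_def)
    moreover have "dotp b v = 0" if "b \<in> Cg" for b
      using that v(1) by (auto simp: Cg_def dv_grad)
    ultimately have "dotp (\<phi> k) v = 0" using dotp_span_zero[OF ACg] by blast
    then show "(M *v v) $ k = 0" using v by (simp add: Mk)
  qed
  then have "card (- J) = 3" using kernel_dim[OF det, of J] dim_tangent[OF p(1)] by simp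
  moreover have "card J + card (- J) = CARD('n)"
    by (metis Compl_disjoint Compl_partition card_Un_disjoint finite)
  ultimately have cardJ: "card J = r + 1" using card_n by simp
  have "card (- J - {i}) = 2" using \<open>card (- J) = 3\<close> J(1) by simp
  then obtain k1 k2 where k: "- J - {i} = {k1, k2}" "k1 \<noteq> k2" by (auto simp: card_2_iff)
  then have kk: "- J = {i, k1, k2}" "i \<noteq> k1" "i \<noteq> k2" using J(1) by auto
  define J' where "J' = {k\<in>J. \<phi> k \<notin> A0}"
  define e where "e = fcol M"
  have e: "M *v e k = axis k 1" for k using fcol[OF det] by (simp add: e_def)
  have Mp: "(M *v p) $ k = (if k \<in> J then 0 else p $ k)" for k
  proof -
    have "p \<in> {v. \<forall>i<q. dv (g i) p v = 0}" using gp by (auto simp: dv_grad Cg_def)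
    then show ?thesis using ker by (auto simp: Mk)
  qed
  \<comment> \<open>The point \<open>p\<close>, as a vector, is tangent to \<open>D\<close> and has
    coefficient 1 at \<open>e i\<close>. Since the Hessian annihilates \<open>p\<close>, its
    vanishing on \<open>e k1\<close> and \<open>e k2\<close> entails its vanishing on
    \<open>e i\<close>.\<close>
  have pe: "p = e i + p $ k1 *s e k1 + p $ k2 *s e k2"
  proof -
    have "p = (\<Sum>k\<in>UNIV. (M *v p) $ k *s e k)" unfolding e_def by (rule expand_fcol[OF det])
    also have "\<dots> = (\<Sum>k\<in>-J. p $ k *s e k)" by (rule sum.mono_neutral_cong_right) (auto simp: Mp)
    also have "\<dots> = e i + p $ k1 *s e k1 + p $ k2 *s e k2" using kk k(2) p(2) by simp
    finally show ?thesis .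
  qed
  \<comment> \<open>Here \<open>good\<close> enters. If the Hessian of the normal vector
    \<open>w\<close> annihilates the tangent space of \<open>D\<close>, then it is a combination of
    the differentials of the \<open>g i\<close>; by \<open>good_node\<close> the vector
    \<open>w\<close> is tangent to \<open>D\<close>, so its coefficients \<open>c\<close> are
    0.\<close>
  have nondeg: "\<forall>k\<in>J'. c k = 0"
    if c: "\<And>k. k \<in> {k1, k2} \<Longrightarrow> dotp (hessS t lam p (\<Sum>k\<in>J'. c k *s e k)) (e k) = 0" for c
  proof -
    define w where "w = (\<Sum>k\<in>J'. c k *s e k)"
    define \<eta> where "\<eta> = hessS t lam p w"
    have Mw: "(M *v w) $ k = (if k \<in> J' then c k else 0)" for k
      by (simp add: w_def matrix_vector_sum vector_scalar_commute e axis_def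
          if_distrib[of "\<lambda>x. _ * x"] cong: if_cong)
    have dF: "dv (F t j) p w = 0" if "j < r" for j
    proof -
      have 1: "dv (F t j) p w = 0" if "j < r" "j \<noteq> j0" for j
      proof -
        have "grad (F t j) p \<in> vec.span A0" using that A0(3) by (auto simp: R_def)
        moreover have "dotp a w = 0" if a: "a \<in> A0" for a
        proof -
          obtain k where k: "k \<in> J" "a = \<phi> k" using a A(1) J(2) by (auto simp: bij_betw_def)
          then have "k \<notin> J'" using a by (auto simp: J'_def)
          then show ?thesis using Mw[of k] Mk[of w k] k by simp
        qed
        ultimately show ?thesis unfolding dv_grad using dotp_span_zero by blast
      qed
      have "(\<Sum>j<r. lam j * dv (F t j) p w) = lam j0 * dv (F t j0) p w"
        using lam(1) by (subst sum.remove[of _ j0]) (auto intro!: sum.neutral simp: 1)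
      then have "dv (F t j0) p w = 0" using lam(2,3) by simp
      then show ?thesis using 1 that by (cases "j = j0") auto
    qed
    have \<eta>k: "dotp \<eta> (e k) = 0" if "k \<notin> J" for k
    proof -
      have 12: "dotp \<eta> (e k1) = 0" "dotp \<eta> (e k2) = 0" using c by (auto simp: \<eta>_def w_def)
      have "dotp \<eta> p = 0" unfolding \<eta>_def by (rule hessS_euler) (rule lam(3))
      then have "dotp \<eta> (e i) = 0" using 12 by (subst (asm) pe) (simp add: dotp_linear)
      moreover have "k \<in> {i, k1, k2}" using that kk by blast
      ultimately show ?thesis using 12 by auto
    qed
    \<comment> \<open>A form that annihilates the dual frame vectors with index outside
      \<open>J\<close> is a combination of the rows with index in \<open>J\<close>.\<close>
    have \<eta>l: "\<eta> $ l = (\<Sum>k\<in>J. dotp \<eta> (e k) * ev (partial_deriv l (G k)) p)" for l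
    proof -
      have "\<eta> $ l = dotp \<eta> (axis l 1)" by (simp add: dotp_axis)
      also have "axis l 1 = (\<Sum>k\<in>UNIV. (M *v axis l 1) $ k *s e k)" unfolding e_def by (rule expand_fcol[OF det])
      also have "dotp \<eta> \<dots> = (\<Sum>k\<in>UNIV. (M *v axis l 1) $ k * dotp \<eta> (e k))"
        by (simp add: dotp_sum_right dotp_linear)
      also have "\<dots> = (\<Sum>k\<in>J. (M *v axis l 1) $ k * dotp \<eta> (e k))"
        by (rule sum.mono_neutral_right) (auto simp: \<eta>k)
      also have "\<dots> = (\<Sum>k\<in>J. dotp \<eta> (e k) * ev (partial_deriv l (G k)) p)"
        using G(3) by (intro sum.cong) (auto simp: Mk dotp_axis grad_def vec_eq_iff)
      finally show ?thesis .
    qed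
    define \<gamma> where "\<gamma> k i = (if \<phi> k \<in> A0 then t (jj k, i) else if i = jj k then 1 else 0)" for k i
    have \<gamma>: "ev (partial_deriv l (G k)) p = (\<Sum>i<q. \<gamma> k i * ev (partial_deriv l (g i)) p)" if "k \<in> J" for k l
      using G(1,2)[OF that]
      by (cases "\<phi> k \<in> A0") (auto simp: \<gamma>_def ev_partial_F if_distrib[of "\<lambda>x. x * _"] cong: if_cong)
    have "(\<Sum>j<r. lam j * hess (F t j) p w l) =
        (\<Sum>i<q. (\<Sum>k\<in>J. dotp \<eta> (e k) * \<gamma> k i) * ev (partial_deriv l (g i)) p)" for l
    proof -
      have "(\<Sum>j<r. lam j * hess (F t j) p w l) = \<eta> $ l" by (simp add: \<eta>_def hessS_def)
      also have "\<dots> = (\<Sum>k\<in>J. \<Sum>i<q. dotp \<eta> (e k) * \<gamma> k i * ev (partial_deriv l (g i)) p)"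
        unfolding \<eta>l by (intro sum.cong refl) (simp add: \<gamma> sum_distrib_left mult.assoc)
      also have "\<dots> = (\<Sum>i<q. (\<Sum>k\<in>J. dotp \<eta> (e k) * \<gamma> k i) * ev (partial_deriv l (g i)) p)"
        by (subst sum.swap) (simp add: sum_distrib_right)
      finally show ?thesis .
    qed
    then have "\<forall>i<q. dv (g i) p w = 0"
      by (intro allI impI good_node[OF t p(1) lam(1,2,3) dF])
    then have Mw0: "(M *v w) $ k = 0" if "k \<in> J" for k using ker that by blast
    show ?thesis
    proof
      fix k assume k: "k \<in> J'"
      then have "k \<in> J" by (simp add: J'_def)
      then show "c k = 0" using Mw0[of k] Mw[of k] k by simp
    qed
  qed
  have finA0: "finite A0" using A0(2) vec.finiteI_independent by blast
  have cardA: "card A = r + 1" using bij_betw_same_card[OF J(2)] cardJ by simp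
  have J'A: "card J' = card A - card A0"
  proof -
    have "bij_betw \<phi> J' (A - A0)"
      using J(2) by (auto simp: bij_betw_def J'_def inj_on_def)
    then have "card J' = card (A - A0)" by (rule bij_betw_same_card)
    then show ?thesis using A(1) finA0 by (simp add: card_Diff_subset)
  qed
  have "card A0 \<le> card R" by (rule card_mono[OF _ A0(1)]) (simp add: R_def)
  also have "card R \<le> card ({..<r} - {j0})" unfolding R_def by (rule card_image_le) simp
  also have "\<dots> = r - 1" using lam(1) by simp
  finally have cA0: "card A0 \<le> r - 1" .
  \<comment> \<open>Three vectors would have a nontrivial combination satisfying the two conditions
    at \<open>k1\<close> and \<open>k2\<close>, against \<open>nondeg\<close>. With the bound on
    \<open>card A0\<close> this makes the rank of the equations at \<open>p\<close> exactly
    \<open>r - 1\<close>.\<close>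
  have "card J' \<le> 2"
  proof (rule ccontr)
    assume "\<not> card J' \<le> 2"
    then obtain c where c: "\<exists>k\<in>J'. c k \<noteq> 0"
      "\<forall>a<2. (\<Sum>k\<in>J'. c k * dotp (hessS t lam p (e k)) (e (if a = (0::nat) then k1 else k2))) = 0"
      using linear_dependence[of J' 2 "\<lambda>k a. dotp (hessS t lam p (e k)) (e (if a = 0 then k1 else k2))"] by auto
    have d: "dotp (hessS t lam p (\<Sum>k\<in>J'. c k *s e k)) v = (\<Sum>k\<in>J'. c k * dotp (hessS t lam p (e k)) v)" for v
    proof -
      have "dotp (\<Sum>k\<in>B. f k) v = (\<Sum>k\<in>B. dotp (f k) v)" for B and f :: "'n \<Rightarrow> complex^'n"
        by (induction B rule: infinite_finite_induct) (auto simp: dotp_linear)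
      then show ?thesis by (simp add: hessS_linear dotp_linear)
    qed
    have "\<forall>k\<in>J'. c k = 0"
    proof (rule nondeg)
      fix k assume "k \<in> {k1, k2}"
      then show "dotp (hessS t lam p (\<Sum>k\<in>J'. c k *s e k)) (e k) = 0"
        unfolding d using c(2)[rule_format, of 0] c(2)[rule_format, of 1] by auto
    qed
    then show False using c(1) by blast
  qed
  moreover have "card J' \<ge> 2" using J'A cA0 cardA lam(1) by simp
  ultimately have cJ': "card J' = 2" by simp
  then obtain m1 m2 where m: "J' = {m1, m2}" "m1 \<noteq> m2" by (auto simp: card_2_iff)
  then have mJ: "m1 \<in> J" "m2 \<in> J" by (auto simp: J'_def)
  have JJ': "J - {m1, m2} = {k\<in>J. \<phi> k \<in> A0}" using m by (auto simp: J'_def)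
  have bij: "bij_betw jj (J - {m1, m2}) ({..<r} - {j0})"
  proof -
    have inj: "inj_on jj (J - {m1, m2})"
    proof (rule inj_onI)
      fix a b assume ab: "a \<in> J - {m1, m2}" "b \<in> J - {m1, m2}" "jj a = jj b"
      then have "G a = G b" using G(1) by (auto simp: JJ')
      then have "\<phi> a = \<phi> b" using G(3) ab by (metis DiffE)
      then show "a = b" using J(2) ab by (auto simp: bij_betw_def inj_on_def)
    qed
    moreover have "jj ` (J - {m1, m2}) = {..<r} - {j0}"
    proof (rule card_subset_eq)
      show "jj ` (J - {m1, m2}) \<subseteq> {..<r} - {j0}" using G(1) by (auto simp: JJ')
      have "card (J - {m1, m2}) = r - 1" using mJ m(2) cardJ by (simp add: card_Diff_subset)
      then show "card (jj ` (J - {m1, m2})) = card ({..<r} - {j0})"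
        using card_image[OF inj] lam(1) by simp
    qed simp
    ultimately show ?thesis by (simp add: bij_betw_def)
  qed
  have Gjj: "\<forall>k\<in>J - {m1, m2}. G k = F t (jj k)" using G(1) by (auto simp: JJ')
  have nd: "c1 = 0 \<and> c2 = 0"
    if c: "\<forall>k\<in>{k1, k2}. dotp (hessS t lam p (c1 *s e m1 + c2 *s e m2)) (e k) = 0" for c1 c2
  proof -
    define c where "c k = (if k = m1 then c1 else c2)" for k
    have "(\<Sum>k\<in>J'. c k *s e k) = c1 *s e m1 + c2 *s e m2"
      using m(2) by (simp add: m(1) c_def)
    then have "\<forall>k\<in>J'. c k = 0" using c by (intro nondeg) auto
    then show ?thesis using m by (auto simp: c_def)
  qed
  have "node_frame t p i lam j0 J G m1 m2 k1 k2 jj"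
    unfolding node_frame_def M_def[symmetric] e_def[symmetric]
    by (rule conjI, rule lam(1), rule conjI, rule lam(2), rule conjI, rule allI, rule lam(3), rule conjI, rule cardJ,
      rule conjI, rule mJ(1), rule conjI, rule mJ(2), rule conjI, rule m(2), rule conjI, rule kk(1), rule conjI, rule kk(2),
      rule conjI, rule kk(3), rule conjI, rule k(2), rule conjI, rule bij, rule conjI, rule Gjj, rule conjI, rule GD,
      rule conjI, rule det, rule allI, rule allI, rule impI, rule nd)
  then show ?thesis by blast
qed

end

section \<open>Differences of chart values\<close>

definition had_coeff :: "'n::finite cpoly \<Rightarrow> 'n \<Rightarrow> ('n + 'n \<Rightarrow> complex) \<Rightarrow> complex" where
  "had_coeff f = (SOME A. (\<forall>v. polyfn (Inl ` UNIV \<union> Inr ` UNIV) (A v)) \<and>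
    (\<forall>z z'. poly_val z' f - poly_val z f = (\<Sum>v\<in>UNIV. A v (case_sum z z') * (z' v - z v))))"

definition had :: "'n::finite cpoly \<Rightarrow> 'n \<Rightarrow> complex^'n \<Rightarrow> complex^'n \<Rightarrow> complex" where
  "had f l x x' = had_coeff f l (case_sum (($) x') (($) x))"

lemma had_coeff:
  "polyfn (Inl ` UNIV \<union> Inr ` UNIV) (had_coeff f v)"
  "poly_val z' f - poly_val z f = (\<Sum>v\<in>UNIV. had_coeff f v (case_sum z z') * (z' v - z v))"
proof -
  define Q where "Q A \<longleftrightarrow> (\<forall>v. polyfn (Inl ` UNIV \<union> Inr ` UNIV) (A v)) \<and>
    (\<forall>z z'. poly_val z' f - poly_val z f = (\<Sum>v\<in>UNIV. A v (case_sum z z') * (z' v - z v)))" for A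
  have "\<exists>A. Q A"
    unfolding Q_def by (rule polyfn_hadamard[OF polyfn_poly_val_UNIV finite])
  then have "Q (had_coeff f)" unfolding had_coeff_def Q_def[symmetric] by (rule someI_ex)
  then show "polyfn (Inl ` UNIV \<union> Inr ` UNIV) (had_coeff f v)"
    "poly_val z' f - poly_val z f = (\<Sum>v\<in>UNIV. had_coeff f v (case_sum z z') * (z' v - z v))"
    unfolding Q_def by blast+
qed

lemma had_diff: "ev f x - ev f x' = (\<Sum>l\<in>UNIV. had f l x x' * (x $ l - x' $ l))"
  unfolding ev_def had_def by (rule had_coeff(2))

lemma had_diag: "had f l x x = ev (partial_deriv l f) x"
  unfolding had_def ev_def poly_val_partial_deriv
  by (rule sym, rule pdv_eq_hadamard[where V = UNIV]) (use had_coeff in auto)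

lemma hol_had:
  assumes "open U" "\<And>k. holomorphic_on_open (\<lambda>z. c z $ k) U" "\<And>k. holomorphic_on_open (\<lambda>z. c' z $ k) U"
  shows "holomorphic_on_open (\<lambda>z. had f l (c z) (c' z)) U"
  unfolding had_def
proof (rule hol_polyfn[OF had_coeff(1) assms(1)])
  fix v show "holomorphic_on_open (\<lambda>z. case_sum (($) (c' z)) (($) (c z)) v) U"
    using assms by (cases v) auto
qed

lemma continuous_on_had:
  assumes "\<And>k. continuous_on S (\<lambda>z. c z $ k)" "\<And>k. continuous_on S (\<lambda>z. c' z $ k)"
  shows "continuous_on S (\<lambda>z. had f l (c z) (c' z))"
  unfolding had_def
proof (rule continuous_on_polyfn[OF had_coeff(1)])
  fix v show "continuous_on S (\<lambda>z. case_sum (($) (c' z)) (($) (c z)) v)"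
    using assms by (cases v) auto
qed

text \<open>A mean value matrix of the chart: it sends \<open>x - x'\<close> to the difference of
  the chart values and equals the Jacobian matrix on the diagonal. Where it is invertible,
  differences of points are combinations of differences of chart values with holomorphic
  coefficients; this is the source of all explicit ideal memberships of germs below.\<close>

definition hmat :: "'n set \<Rightarrow> ('n \<Rightarrow> 'n cpoly) \<Rightarrow> complex^'n::finite \<Rightarrow> complex^'n \<Rightarrow> complex^'n^'n" where
  "hmat J G x x' = (\<chi> k l. if k \<in> J then had (G k) l x x' else if k = l then 1 else 0)"

lemma hmat_diag: "hmat J G x x = jacM J G x"
  by (simp add: hmat_def jacM_def had_diag vec_eq_iff)

lemma hmat_diff: "hmat J G x x' *v (x - x') = chart J G x - chart J G x'"
  by (simp add: vec_eq_iff hmat_def matrix_vector_mult_def chart_def had_diff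
      if_distrib[of "\<lambda>x. x * _"] cong: if_cong)

lemma hol_hmat:
  assumes "open U" "\<And>k. holomorphic_on_open (\<lambda>z. c z $ k) U" "\<And>k. holomorphic_on_open (\<lambda>z. c' z $ k) U"
  shows "holomorphic_on_open (\<lambda>z. hmat J G (c z) (c' z) $ k $ l) U"
  using assms by (cases "k \<in> J") (auto simp: hmat_def intro: hol_had hol_const)

lemma hol_fcol:
  assumes "open U" "\<And>k l. holomorphic_on_open (\<lambda>z. M z $ k $ l) U" "\<And>z. z \<in> U \<Longrightarrow> det (M z) \<noteq> 0"
  shows "holomorphic_on_open (\<lambda>z. fcol (M z) k $ l) U"
proof -
  have "holomorphic_on_open (\<lambda>z. csol (M z) (axis k 1) $ l) U"
    unfolding csol_def vec_lambda_beta
  proof (rule hol_det[OF assms(1)])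
    fix i j
    show "holomorphic_on_open (\<lambda>z. (\<chi> i j. if j = l then axis k 1 $ i else M z $ i $ j) $ i $ j) U"
      using assms by (cases "j = l") (auto intro: hol_const)
  qed
  moreover have "holomorphic_on_open (\<lambda>z. det (M z)) U" by (rule hol_det[OF assms(1,2)])
  ultimately have "holomorphic_on_open (\<lambda>z. csol (M z) (axis k 1) $ l / det (M z)) U"
    using assms(3) by (rule hol_divide)
  then show ?thesis by (simp add: fcol_def)
qed

definition hcoef where
  "hcoef J G h k c c' = fcol (hmat J G (h c) (h c')) k"

lemma hcoef_diff:
  assumes h: "homeomorphism N B (chart J G) h" and c: "c \<in> B" "c' \<in> B" and d: "det (hmat J G (h c) (h c')) \<noteq> 0"
  shows "h c - h c' = (\<Sum>k\<in>UNIV. (c $ k - c' $ k) *s hcoef J G h k c c')"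
proof -
  have "hmat J G (h c) (h c') *v (h c - h c') = c - c'"
    unfolding hmat_diff using h c by (simp add: homeomorphism_def)
  then show ?thesis using expand_fcol[OF d, of "h c - h c'"] by (simp add: hcoef_def)
qed

text \<open>Hadamard quotients of \<open>f\<close> with respect to the chart coordinates in place of
  the linear ones.\<close>

definition pcoef where
  "pcoef J G h f k c c' = (\<Sum>l\<in>UNIV. had f l (h c) (h c') * hcoef J G h k c c' $ l)"

lemma pcoef_diff:
  assumes "homeomorphism N B (chart J G) h" "c \<in> B" "c' \<in> B" "det (hmat J G (h c) (h c')) \<noteq> 0"
  shows "ev f (h c) - ev f (h c') = (\<Sum>k\<in>UNIV. pcoef J G h f k c c' * (c $ k - c' $ k))"
proof -
  have "(h c - h c') $ l = (\<Sum>k\<in>UNIV. (c $ k - c' $ k) * hcoef J G h k c c' $ l)" for l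
    by (subst hcoef_diff[OF assms]) (simp only: sum_component vector_smult_component)
  then have "h c $ l - h c' $ l = (\<Sum>k\<in>UNIV. (c $ k - c' $ k) * hcoef J G h k c c' $ l)" for l by simp
  then have "ev f (h c) - ev f (h c') = (\<Sum>l\<in>UNIV. had f l (h c) (h c') *
      (\<Sum>k\<in>UNIV. (c $ k - c' $ k) * hcoef J G h k c c' $ l))"
    unfolding had_diff by simp
  also have "\<dots> = (\<Sum>k\<in>UNIV. pcoef J G h f k c c' * (c $ k - c' $ k))"
    unfolding pcoef_def sum_distrib_left sum_distrib_right by (subst sum.swap) (simp add: mult_ac)
  finally show ?thesis .
qed

lemma hol_hcoef:
  assumes "open U" "\<And>k. holomorphic_on_open (\<lambda>z. h (c z) $ k) U" "\<And>k. holomorphic_on_open (\<lambda>z. h (c' z) $ k) U"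
    "\<And>z. z \<in> U \<Longrightarrow> det (hmat J G (h (c z)) (h (c' z))) \<noteq> 0"
  shows "holomorphic_on_open (\<lambda>z. hcoef J G h k (c z) (c' z) $ l) U"
  unfolding hcoef_def by (rule hol_fcol[OF assms(1) hol_hmat[OF assms(1-3)] assms(4)])

lemma hol_pcoef:
  assumes "open U" "\<And>k. holomorphic_on_open (\<lambda>z. h (c z) $ k) U" "\<And>k. holomorphic_on_open (\<lambda>z. h (c' z) $ k) U"
    "\<And>z. z \<in> U \<Longrightarrow> det (hmat J G (h (c z)) (h (c' z))) \<noteq> 0"
  shows "holomorphic_on_open (\<lambda>z. pcoef J G h f k (c z) (c' z)) U"
  unfolding pcoef_def by (intro hol_sum hol_mult hol_had hol_hcoef assms)

lemma pbox_mono: "\<epsilon>' \<le> \<epsilon> \<Longrightarrow> pbox a \<epsilon>' \<subseteq> pbox a \<epsilon>"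
  unfolding pbox_def by (auto intro: less_le_trans)

lemma hmat_nonzero_near:
  assumes h: "homeomorphism N (pbox a \<epsilon>) (chart J G) h" "p \<in> N" "a = chart J G p" "\<epsilon> > 0"
    and det: "det (jacM J G p) \<noteq> 0"
  obtains \<epsilon>' where "0 < \<epsilon>'" "\<epsilon>' \<le> \<epsilon>"
    "\<And>c c'. c \<in> pbox a \<epsilon>' \<Longrightarrow> c' \<in> pbox a \<epsilon>' \<Longrightarrow> det (hmat J G (h c) (h c')) \<noteq> 0"
proof -
  define S where "S = pbox a \<epsilon> \<times> pbox a \<epsilon>"
  have S: "open S" unfolding S_def by (intro open_Times open_pbox)
  have hc: "continuous_on (pbox a \<epsilon>) h" using h(1) homeomorphism_cont2 by blast
  have c1: "continuous_on S (\<lambda>z. h (fst z) $ k)" for k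
    by (intro continuous_on_component continuous_on_compose2[OF hc]) (auto simp: S_def intro!: continuous_intros)
  have c2: "continuous_on S (\<lambda>z. h (snd z) $ k)" for k
    by (intro continuous_on_component continuous_on_compose2[OF hc]) (auto simp: S_def intro!: continuous_intros)
  have "continuous_on S (\<lambda>z. hmat J G (h (fst z)) (h (snd z)) $ k $ l)" for k l
    by (cases "k \<in> J") (auto simp: hmat_def intro!: continuous_on_had c1 c2)
  then have "continuous_on S (\<lambda>z. det (hmat J G (h (fst z)) (h (snd z))))"
    unfolding det_def by (intro continuous_on_sum continuous_on_mult continuous_on_prod continuous_on_const)
  then have op: "open {z\<in>S. det (hmat J G (h (fst z)) (h (snd z))) \<in> - {0}}"
    using continuous_open_preimage[OF _ S, of "\<lambda>z. det (hmat J G (h (fst z)) (h (snd z)))" "- {0}"]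
      open_delete[OF open_UNIV, of "0::complex"]
    by (simp add: vimage_def Int_def Compl_eq_Diff_UNIV)
  have "h a = p" using h by (simp add: homeomorphism_def)
  then have "(a, a) \<in> {z\<in>S. det (hmat J G (h (fst z)) (h (snd z))) \<in> - {0}}"
    using det h(4) by (simp add: S_def hmat_diag pbox_def)
  from open_prod_elim[OF op this] obtain A B where AB: "open A" "open B" "(a, a) \<in> A \<times> B"
    "A \<times> B \<subseteq> {z\<in>S. det (hmat J G (h (fst z)) (h (snd z))) \<in> - {0}}" by blast
  obtain \<delta> where \<delta>: "\<delta> > 0" "pbox a \<delta> \<subseteq> A \<inter> B"
    using pbox_subset_open[of "A \<inter> B" a] AB by auto
  have sub: "pbox a (min \<epsilon> \<delta>) \<subseteq> pbox a \<delta>" by (rule pbox_mono) simp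
  show ?thesis
  proof (rule that[of "min \<epsilon> \<delta>"])
    fix c c' assume "c \<in> pbox a (min \<epsilon> \<delta>)" "c' \<in> pbox a (min \<epsilon> \<delta>)"
    then have "(c, c') \<in> A \<times> B" using sub \<delta>(2) by blast
    then show "det (hmat J G (h c) (h c')) \<noteq> 0" using AB(4) by auto
  qed (use \<delta> h(4) in auto)
qed

lemma homeomorphism_shrink:
  assumes h: "homeomorphism N (pbox a \<epsilon>) f h" and N: "open N" "N \<subseteq> U" "p \<in> N" "a = f p" and \<epsilon>: "0 < \<epsilon>'" "\<epsilon>' \<le> \<epsilon>"
  shows "\<exists>N'. open N' \<and> N' \<subseteq> N \<and> p \<in> N' \<and> homeomorphism N' (pbox a \<epsilon>') f h"
proof (intro exI conjI)
  have sub: "pbox a \<epsilon>' \<subseteq> pbox a \<epsilon>" using \<epsilon> by (intro pbox_mono)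
  have contf: "continuous_on N f" using h homeomorphism_cont1 by blast
  show "open {z\<in>N. f z \<in> pbox a \<epsilon>'}"
    using continuous_open_preimage[OF contf N(1) open_pbox] by (simp add: vimage_def Int_def)
  show "homeomorphism {z\<in>N. f z \<in> pbox a \<epsilon>'} (pbox a \<epsilon>') f h"
  proof (rule homeomorphism_of_subsets[OF h])
    show "f ` {z\<in>N. f z \<in> pbox a \<epsilon>'} = pbox a \<epsilon>'"
    proof
      show "pbox a \<epsilon>' \<subseteq> f ` {z\<in>N. f z \<in> pbox a \<epsilon>'}"
      proof
        fix w assume w: "w \<in> pbox a \<epsilon>'"
        then have "f (h w) = w" "h w \<in> N" using h sub by (auto simp: homeomorphism_def)
        then show "w \<in> f ` {z\<in>N. f z \<in> pbox a \<epsilon>'}" using w by (intro image_eqI[of _ _ "h w"]) auto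
      qed
    qed auto
  qed (use sub in auto)
qed (use N \<epsilon> in \<open>auto simp: pbox_def\<close>)

text \<open>A two by two matrix with trivial kernel has nonzero determinant, hence its transpose has
  trivial kernel as well.\<close>

lemma two_by_two:
  fixes P11 :: complex
  assumes "\<And>c1 c2. c1 * P11 + c2 * P12 = 0 \<Longrightarrow> c1 * P21 + c2 * P22 = 0 \<Longrightarrow> c1 = 0 \<and> c2 = 0"
    and "v * P11 + w * P21 = 0" "v * P12 + w * P22 = 0"
  shows "v = 0 \<and> w = 0"
proof -
  define e where "e = P11 * P22 - P12 * P21"
  have "e \<noteq> 0"
  proof
    assume "e = 0"
    then have *: "P11 * P22 = P12 * P21" by (simp add: e_def)
    have "P12 = 0 \<and> - P11 = 0" by (rule assms(1)) (use * in \<open>auto simp: algebra_simps\<close>)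
    moreover have "P22 = 0 \<and> - P21 = 0" by (rule assms(1)) (use * in \<open>auto simp: algebra_simps\<close>)
    ultimately have "(1::complex) = 0 \<and> (0::complex) = 0" by (intro assms(1)) auto
    then show False by simp
  qed
  moreover have "v * e = 0" "w * e = 0"
  proof -
    have "v * e = (v * P11 + w * P21) * P22 - (v * P12 + w * P22) * P21" by (simp add: e_def algebra_simps)
    then show "v * e = 0" using assms(2,3) by simp
    have "w * e = (v * P12 + w * P22) * P11 - (v * P11 + w * P21) * P12" by (simp add: e_def algebra_simps)
    then show "w * e = 0" using assms(2,3) by simp
  qed
  ultimately show ?thesis by simp
qed

locale node_chart = base_locus D d r q g x0
  for D :: "(complex^'n::finite) set" and d r q g x0 +
  fixes t p i lam j0 J and G :: "'n \<Rightarrow> 'n cpoly" and m1 m2 k1 k2 jj \<epsilon> N h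
  assumes good: "good t" and pD: "p \<in> D" and pi: "p $ i = 1"
    and nf: "node_frame t p i lam j0 J G m1 m2 k1 k2 jj"
    and eps: "0 < \<epsilon>" and N: "open N" "p \<in> N"
    and homeo: "homeomorphism N (pbox (chart J G p) \<epsilon>) (chart J G) h"
    and hol_h: "\<And>k. holomorphic_on_open (\<lambda>w. h w $ k) (pbox (chart J G p) \<epsilon>)"
    and det_N: "\<And>z. z \<in> N \<Longrightarrow> det (jacM J G z) \<noteq> 0"
    and h_D: "\<And>c. c \<in> pbox (chart J G p) \<epsilon> \<Longrightarrow> (\<And>k. k \<in> J \<Longrightarrow> c $ k = 0) \<Longrightarrow> h c \<in> D"
    and hmat_nonzero: "\<And>c c'. c \<in> pbox (chart J G p) \<epsilon> \<Longrightarrow> c' \<in> pbox (chart J G p) \<epsilon> \<Longrightarrow>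
      det (hmat J G (h c) (h c')) \<noteq> 0"

lemma (in base_locus) node_chart_exists:
  assumes t: "good t" and p: "p \<in> D" "p $ i = 1" and nf: "node_frame t p i lam j0 J G m1 m2 k1 k2 jj"
  shows "\<exists>\<epsilon> N h. node_chart D d r q g x0 t p i lam j0 J G m1 m2 k1 k2 jj \<epsilon> N h"
proof -
  have J: "card J = r + 1" and GD: "\<And>k x. k \<in> J \<Longrightarrow> x \<in> D \<Longrightarrow> ev (G k) x = 0" and det: "det (jacM J G p) \<noteq> 0"
    using nf by (auto simp: node_frame_def)
  show ?thesis
  proof (rule D_local[of p J G UNIV, OF p(1) GD J open_UNIV UNIV_I det])
    fix \<epsilon> N h
    assume N: "\<epsilon> > 0" "open N" "p \<in> N" "N \<subseteq> UNIV"
    "homeomorphism N (pbox (chart J G p) \<epsilon>) (chart J G) h"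
    "\<And>i. holomorphic_on_open (\<lambda>w. h w $ i) (pbox (chart J G p) \<epsilon>)"
    "\<And>z. z \<in> N \<Longrightarrow> det (jacM J G z) \<noteq> 0"
    "\<And>c. c \<in> pbox (chart J G p) \<epsilon> \<Longrightarrow> (\<And>k. k \<in> J \<Longrightarrow> c $ k = 0) \<Longrightarrow> h c \<in> D"
  obtain \<epsilon>' where e: "0 < \<epsilon>'" "\<epsilon>' \<le> \<epsilon>"
    "\<And>c c'. c \<in> pbox (chart J G p) \<epsilon>' \<Longrightarrow> c' \<in> pbox (chart J G p) \<epsilon>' \<Longrightarrow> det (hmat J G (h c) (h c')) \<noteq> 0"
    by (rule hmat_nonzero_near[OF N(5,3) refl N(1) det]) (rule that)
  obtain N' where N': "open N'" "N' \<subseteq> N" "p \<in> N'" "homeomorphism N' (pbox (chart J G p) \<epsilon>') (chart J G) h"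
    using homeomorphism_shrink[OF N(5,2,4,3) refl e(1,2)] by blast
  have sub: "pbox (chart J G p) \<epsilon>' \<subseteq> pbox (chart J G p) \<epsilon>" using e by (intro pbox_mono)
  have "node_chart D d r q g x0 t p i lam j0 J G m1 m2 k1 k2 jj \<epsilon>' N' h"
  proof (unfold_locales)
    show "homeomorphism N' (pbox (chart J G p) \<epsilon>') (chart J G) h" by fact
    show "holomorphic_on_open (\<lambda>w. h w $ k) (pbox (chart J G p) \<epsilon>')" for k
      by (rule hol_subset[OF N(6) open_pbox sub])
    show "det (jacM J G z) \<noteq> 0" if "z \<in> N'" for z using N(7) N'(2) that by blast
    show "h c \<in> D" if "c \<in> pbox (chart J G p) \<epsilon>'" "\<And>k. k \<in> J \<Longrightarrow> c $ k = 0" for c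
      by (rule N(8)) (use that sub in auto)
  qed (use t p nf e N' in auto)
    then show ?thesis by blast
  qed
qed

section \<open>The normal form at a singular point\<close>

lemma DERIV_sum_product_zero:
  assumes "\<And>l. l \<in> S \<Longrightarrow> ((\<lambda>\<tau>. a l \<tau>) has_field_derivative a' l) (at \<tau>0)" "\<And>l. l \<in> S \<Longrightarrow> a l \<tau>0 = 0"
    "\<And>l. l \<in> S \<Longrightarrow> ((\<lambda>\<tau>. b l \<tau>) has_field_derivative b' l) (at \<tau>0)"
  shows "((\<lambda>\<tau>. \<Sum>l\<in>S. a l \<tau> * b l \<tau>) has_field_derivative (\<Sum>l\<in>S. a' l * b l \<tau>0)) (at \<tau>0)"
proof -
  have "((\<lambda>\<tau>. \<Sum>l\<in>S. a l \<tau> * b l \<tau>) has_field_derivative (\<Sum>l\<in>S. a' l * b l \<tau>0 + b' l * a l \<tau>0)) (at \<tau>0)"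
    by (rule DERIV_sum, rule DERIV_mult) (use assms in auto)
  then show ?thesis by (simp add: assms(2))
qed

context node_chart
begin

lemma frame:
  "j0 < r" "lam j0 = 1" "(\<Sum>j<r. lam j * dv (F t j) p v) = 0"
  "card J = r + 1" "m1 \<in> J" "m2 \<in> J" "m1 \<noteq> m2" "- J = {i, k1, k2}" "i \<noteq> k1" "i \<noteq> k2" "k1 \<noteq> k2"
  "bij_betw jj (J - {m1, m2}) ({..<r} - {j0})" "k \<in> J - {m1, m2} \<Longrightarrow> G k = F t (jj k)"
  "k \<in> J \<Longrightarrow> x \<in> D \<Longrightarrow> ev (G k) x = 0" "det (jacM J G p) \<noteq> 0"
  using nf unfolding node_frame_def by (elim conjE, assumption | (elim conjE, erule spec) | blast)+

lemma frame_nondegenerate: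
  assumes "dotp (hessS t lam p (c1 *s fcol (jacM J G p) m1 + c2 *s fcol (jacM J G p) m2)) (fcol (jacM J G p) k1) = 0"
   "dotp (hessS t lam p (c1 *s fcol (jacM J G p) m1 + c2 *s fcol (jacM J G p) m2)) (fcol (jacM J G p) k2) = 0"
  shows "c1 = 0 \<and> c2 = 0"
proof -
  have "\<forall>c1 c2. (\<forall>k\<in>{k1, k2}. dotp (hessS t lam p (c1 *s fcol (jacM J G p) m1 + c2 *s fcol (jacM J G p) m2))
        (fcol (jacM J G p) k) = 0) \<longrightarrow> c1 = 0 \<and> c2 = 0"
    using nf unfolding node_frame_def by (elim conjE)
  from spec[OF spec[OF this, of c1], of c2] show ?thesis using assms by simp
qed

lemma not_J: "i \<notin> J" "k1 \<notin> J" "k2 \<notin> J"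
  using frame(8) by auto

lemma neqs: "m1 \<noteq> i" "m1 \<noteq> k1" "m1 \<noteq> k2" "m2 \<noteq> i" "m2 \<noteq> k1" "m2 \<noteq> k2"
  using frame(5,6) not_J by auto

lemma index_cases: "k \<in> J - {m1, m2} \<or> k = m1 \<or> k = m2 \<or> k = i \<or> k = k1 \<or> k = k2"
  using frame(8) by auto

abbreviation "c0 \<equiv> chart J G p"

lemma c0: "k \<in> J \<Longrightarrow> c0 $ k = 0" "k \<notin> J \<Longrightarrow> c0 $ k = p $ k" "h c0 = p"
  using frame(14)[OF _ pD] homeo N(2) by (auto simp: chart_def homeomorphism_def)

text \<open>Inclusion, in chart coordinates, of the fourfold cut out by the equations other than
  \<open>j0\<close> in the affine chart where coordinate \<open>i\<close> is 1. The entries 1 and 3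
  are normal to \<open>D\<close>; the entries 2 and 4 run along \<open>D\<close> and are counted
  from \<open>p\<close>. \<open>yc\<close> is the projection in the opposite direction, and
  \<open>z0\<close> projects the fourfold to \<open>D\<close>.\<close>

definition nu :: "complex^4 \<Rightarrow> complex^'n" where
  "nu y = (\<chi> k. if k = m1 then y $ 1 else if k = m2 then y $ 3 else if k = k1 then p $ k1 + y $ 2
     else if k = k2 then p $ k2 + y $ 4 else if k = i then 1 else 0)"

definition yc :: "complex^'n \<Rightarrow> complex^4" where
  "yc c = (\<chi> a. if a = 1 then c $ m1 else if a = 2 then c $ k1 - p $ k1 else if a = 3 then c $ m2 else c $ k2 - p $ k2)"

definition z0 :: "complex^4 \<Rightarrow> complex^4" where
  "z0 y = (\<chi> a. if a = 1 \<or> a = 3 then 0 else y $ a)"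

lemma nu_simps:
  "nu y $ m1 = y $ 1" "nu y $ m2 = y $ 3" "nu y $ k1 = p $ k1 + y $ 2" "nu y $ k2 = p $ k2 + y $ 4" "nu y $ i = 1"
  "k \<in> J - {m1, m2} \<Longrightarrow> nu y $ k = 0"
  using frame(7,9,10,11) neqs not_J by (auto simp: nu_def)

lemma four_cases: "(a::4) = 1 \<or> a = 2 \<or> a = 3 \<or> a = 4" by (rule exhaust_4)

lemma yc_simps: "yc c $ 1 = c $ m1" "yc c $ 2 = c $ k1 - p $ k1" "yc c $ 3 = c $ m2" "yc c $ 4 = c $ k2 - p $ k2"
  by (simp_all add: yc_def)

lemma yc_nu: "yc (nu y) = y"
  by (simp add: vec_eq_iff forall_4 yc_simps nu_simps)

lemma nu_0: "nu 0 = c0"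
proof (simp add: vec_eq_iff, intro allI)
  fix k show "nu 0 $ k = c0 $ k"
    using index_cases[of k] by (elim disjE) (auto simp: nu_simps c0 frame not_J pi)
qed

lemma nu_pbox: "y \<in> pbox 0 \<epsilon> \<longleftrightarrow> nu y \<in> pbox c0 \<epsilon>"
proof
  assume y: "y \<in> pbox 0 \<epsilon>"
  then have y': "cmod (y $ a) < \<epsilon>" for a by (simp add: pbox_def)
  show "nu y \<in> pbox c0 \<epsilon>"
    unfolding pbox_def
  proof (simp, intro allI)
    fix k show "dist (c0 $ k) (nu y $ k) < \<epsilon>"
      using index_cases[of k] by (elim disjE) (use y' eps in \<open>auto simp: nu_simps c0 frame not_J pi dist_norm\<close>)
  qed
next
  assume *: "nu y \<in> pbox c0 \<epsilon>"
  have "dist (c0 $ k) (nu y $ k) < \<epsilon>" for k using * by (simp add: pbox_def)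
  from this[of m1] this[of m2] this[of k1] this[of k2]
  show "y \<in> pbox 0 \<epsilon>"
    by (simp add: pbox_def forall_4 nu_simps c0 frame not_J dist_norm)
qed

lemma z0_pbox: "y \<in> pbox 0 \<epsilon> \<Longrightarrow> z0 y \<in> pbox 0 \<epsilon>"
  using eps by (auto simp: pbox_def z0_def)

lemma z0_eq: "y $ 1 = 0 \<Longrightarrow> y $ 3 = 0 \<Longrightarrow> z0 y = y"
  by (auto simp: z0_def vec_eq_iff)

lemma hol_nu: "open U \<Longrightarrow> (\<And>a. holomorphic_on_open (\<lambda>z. Y z $ a) U) \<Longrightarrow> holomorphic_on_open (\<lambda>z. nu (Y z) $ k) U"
  using index_cases[of k] by (elim disjE) (auto simp: nu_simps intro: hol_const hol_add)

lemma hol_z0: "open U \<Longrightarrow> (\<And>a. holomorphic_on_open (\<lambda>z. Y z $ a) U) \<Longrightarrow> holomorphic_on_open (\<lambda>z. z0 (Y z) $ k) U"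
  by (cases "k = 1 \<or> k = 3") (auto simp: z0_def intro: hol_const)

lemma hol_h_nu:
  assumes "open U" "\<And>a. holomorphic_on_open (\<lambda>z. Y z $ a) U" "\<And>z. z \<in> U \<Longrightarrow> Y z \<in> pbox 0 \<epsilon>"
  shows "holomorphic_on_open (\<lambda>z. h (nu (Y z)) $ k) U"
  by (rule hol_compose(1)[OF hol_h hol_nu[OF assms(1,2)]]) (use assms(3) nu_pbox in auto)

lemma h_z0_D: "y \<in> pbox 0 \<epsilon> \<Longrightarrow> h (nu (z0 y)) \<in> D"
proof (rule h_D)
  fix k assume "k \<in> J"
  then consider "k \<in> J - {m1, m2}" | "k = m1" | "k = m2" by blast
  then show "nu (z0 y) $ k = 0" by cases (auto simp: nu_simps z0_def)
qed (use nu_pbox z0_pbox in blast)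

definition fsum :: "'n cpoly" where "fsum = (\<Sum>j<r. poly_const (lam j) * F t j)"

lemma ev_fsum: "ev fsum x = (\<Sum>j<r. lam j * ev (F t j) x)"
  by (simp add: ev_def fsum_def poly_val_sum poly_val_mult)

lemma ev_partial_fsum: "ev (partial_deriv l fsum) x = (\<Sum>j<r. lam j * ev (partial_deriv l (F t j)) x)"
  unfolding ev_def fsum_def by (rule poly_val_partial_deriv_linear)

lemma ev_partial_fsum_p: "ev (partial_deriv l fsum) p = 0"
  using frame(3)[of "axis l 1"] by (simp add: ev_partial_fsum dv_grad dotp_axis grad_def)

definition Aco :: "'n \<Rightarrow> complex^4 \<Rightarrow> complex" where
  "Aco m y = pcoef J G h fsum m (nu y) (nu (z0 y))"

text \<open>The polynomial \<open>fsum\<close> vanishes on \<open>D\<close>, which is \<open>y $ 1 = y $ 3 = 0\<close>; the \<open>Aco m\<close> are its Hadamard quotients.\<close>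

definition kmap :: "complex^4 \<Rightarrow> complex^4" where
  "kmap y = (\<chi> a. if a = 1 then y $ 1 else if a = 2 then Aco m1 y else if a = 3 then y $ 3 else Aco m2 y)"

lemma kmap_simps: "kmap y $ 1 = y $ 1" "kmap y $ 2 = Aco m1 y" "kmap y $ 3 = y $ 3" "kmap y $ 4 = Aco m2 y"
  by (simp_all add: kmap_def)

lemma hol_Aco: "holomorphic_on_open (Aco m) (pbox 0 \<epsilon>)"
  unfolding Aco_def
proof (rule hol_pcoef[where c = nu and c' = "\<lambda>y. nu (z0 y)"])
  show "holomorphic_on_open (\<lambda>y. h (nu y) $ k) (pbox 0 \<epsilon>)" for k
    by (rule hol_h_nu) (auto intro: hol_coord open_pbox)
  show "holomorphic_on_open (\<lambda>y. h (nu (z0 y)) $ k) (pbox 0 \<epsilon>)" for k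
    by (rule hol_h_nu[OF open_pbox hol_z0[OF open_pbox hol_coord[OF open_pbox]] z0_pbox])
  show "det (hmat J G (h (nu y)) (h (nu (z0 y)))) \<noteq> 0" if "y \<in> pbox 0 \<epsilon>" for y
    by (rule hmat_nonzero) (use that z0_pbox nu_pbox in blast)+
qed (rule open_pbox)

lemma hol_kmap: "holomorphic_on_open (\<lambda>y. kmap y $ a) (pbox 0 \<epsilon>)"
  using four_cases[of a] by (elim disjE) (auto simp: kmap_simps intro: hol_coord open_pbox hol_Aco)

text \<open>Hadamard expansion of \<open>fsum\<close> from the projection \<open>z0 y\<close> on
  \<open>D\<close>, where it vanishes, to \<open>y\<close>; the two points differ only in the
  coordinates \<open>m1\<close> and \<open>m2\<close>.\<close>

lemma fsum_factor:
  assumes y: "y \<in> pbox 0 \<epsilon>"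
  shows "ev fsum (h (nu y)) = kmap y $ 1 * kmap y $ 2 + kmap y $ 3 * kmap y $ 4"
proof -
  have b: "nu y \<in> pbox c0 \<epsilon>" "nu (z0 y) \<in> pbox c0 \<epsilon>" using y z0_pbox nu_pbox by auto
  have "ev fsum (h (nu (z0 y))) = 0" by (simp add: ev_fsum F_D[OF h_z0_D[OF y]])
  then have "ev fsum (h (nu y)) = (\<Sum>k\<in>UNIV. Aco k y * (nu y $ k - nu (z0 y) $ k))"
    using pcoef_diff[OF homeo b hmat_nonzero[OF b], of fsum] by (simp add: Aco_def)
  also have "\<dots> = (\<Sum>k\<in>{m1, m2}. Aco k y * (nu y $ k - nu (z0 y) $ k))"
  proof (rule sum.mono_neutral_right)
    show "\<forall>k\<in>UNIV - {m1, m2}. Aco k y * (nu y $ k - nu (z0 y) $ k) = 0"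
    proof
      fix k assume k: "k \<in> UNIV - {m1, m2}"
      show "Aco k y * (nu y $ k - nu (z0 y) $ k) = 0"
        using index_cases[of k] by (elim disjE) (use k in \<open>auto simp: nu_simps z0_def\<close>)
    qed
  qed auto
  also have "\<dots> = kmap y $ 1 * kmap y $ 2 + kmap y $ 3 * kmap y $ 4"
    using frame(7) by (simp add: kmap_simps nu_simps z0_def mult.commute)
  finally show ?thesis .
qed

lemma Aco_diag: "z0 y = y \<Longrightarrow> Aco m y = (\<Sum>l\<in>UNIV. ev (partial_deriv l fsum) (h (nu y)) * fcol (jacM J G (h (nu y))) m $ l)"
  by (simp add: Aco_def pcoef_def hcoef_def had_diag hmat_diag)

lemma kmap_0: "kmap 0 = 0"
proof -
  have "z0 0 = 0" by (simp add: z0_def vec_eq_iff)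
  then have "Aco m 0 = 0" for m using Aco_diag[of 0] by (simp add: nu_0 c0 ev_partial_fsum_p)
  then show ?thesis by (simp add: vec_eq_iff forall_4 kmap_simps)
qed

text \<open>Along \<open>D\<close> the quotient \<open>Aco m\<close> is the differential of
  \<open>fsum\<close> applied to the frame vector of \<open>m\<close>. At \<open>p\<close> all
  partial derivatives of \<open>fsum\<close> are 0, so the motion of the frame vector contributes
  nothing and only the Hessian remains.\<close>

lemma DERIV_Aco:
  assumes v: "v $ 1 = 0" "v $ 3 = 0"
  shows "((\<lambda>\<tau>. Aco m (\<tau> *s v)) has_field_derivative
    dotp (hessS t lam p (fcol (jacM J G p) m)) (v $ 2 *s fcol (jacM J G p) k1 + v $ 4 *s fcol (jacM J G p) k2)) (at 0)"
proof -
  define V where "V = v $ 2 *s axis k1 1 + v $ 4 *s (axis k2 1 :: complex^'n)"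
  have nuV: "nu (\<tau> *s v) = c0 + \<tau> *s V" for \<tau>
  proof (simp add: vec_eq_iff, intro allI)
    fix k show "nu (\<tau> *s v) $ k = c0 $ k + \<tau> * V $ k"
      using index_cases[of k]
      by (elim disjE) (use neqs frame(5,6,9,10,11) not_J v in \<open>auto simp: nu_simps V_def axis_def c0 pi\<close>)
  qed
  have z: "z0 (\<tau> *s v) = \<tau> *s v" for \<tau> using v by (intro z0_eq) auto
  have b0: "c0 + 0 *s V \<in> pbox c0 \<epsilon>" using eps by (simp add: pbox_def)
  obtain u where u: "\<And>k. ((\<lambda>\<tau>. h (c0 + \<tau> *s V) $ k) has_field_derivative u $ k) (at 0)"
    "jacM J G (h (c0 + 0 *s V)) *v u = V"
    using chart_inverse_curve[OF homeo hol_h b0] by blast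
  have h0: "h (c0 + 0 *s V) = p" using c0 by simp
  have "u = (\<Sum>k\<in>UNIV. V $ k *s fcol (jacM J G p) k)"
    using expand_fcol[OF frame(15), of u] u(2) h0 by simp
  also have "\<dots> = (\<Sum>k\<in>{k1, k2}. V $ k *s fcol (jacM J G p) k)"
    by (rule sum.mono_neutral_right) (auto simp: V_def axis_def)
  also have "\<dots> = v $ 2 *s fcol (jacM J G p) k1 + v $ 4 *s fcol (jacM J G p) k2"
    using frame(11) by (simp add: V_def axis_def)
  finally have ueq: "u = v $ 2 *s fcol (jacM J G p) k1 + v $ 4 *s fcol (jacM J G p) k2" .
  have d1: "((\<lambda>\<tau>. ev (partial_deriv l fsum) (h (c0 + \<tau> *s V))) has_field_derivative
      (\<Sum>k\<in>UNIV. ev (partial_deriv k (partial_deriv l fsum)) p * u $ k)) (at 0)" for l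
    unfolding ev_def using poly_val_chain[of "\<lambda>\<tau>. ($) (h (c0 + \<tau> *s V))" "\<lambda>k. u $ k" 0, OF u(1)] unfolding h0 .
  have d2: "((\<lambda>\<tau>. fcol (jacM J G (h (c0 + \<tau> *s V))) m $ l) has_field_derivative
      (\<Sum>k\<in>UNIV. pdc (\<lambda>c. fcol (jacM J G (h c)) m $ l) k (c0 + 0 *s V) * V $ k)) (at 0)" for l
  proof (rule hol_curve[where U = "pbox c0 \<epsilon>"])
    have "holomorphic_on_open (\<lambda>c. hcoef J G h m c c $ l) (pbox c0 \<epsilon>)"
      by (rule hol_hcoef[OF open_pbox]) (use hol_h hmat_nonzero in auto)
    then show "holomorphic_on_open (\<lambda>c. fcol (jacM J G (h c)) m $ l) (pbox c0 \<epsilon>)"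
      by (simp add: hcoef_def hmat_diag)
  qed (use b0 in \<open>auto intro!: derivative_eq_intros\<close>)
  have "((\<lambda>\<tau>. \<Sum>l\<in>UNIV. ev (partial_deriv l fsum) (h (c0 + \<tau> *s V)) * fcol (jacM J G (h (c0 + \<tau> *s V))) m $ l)
    has_field_derivative (\<Sum>l\<in>UNIV. (\<Sum>k\<in>UNIV. ev (partial_deriv k (partial_deriv l fsum)) p * u $ k) *
      fcol (jacM J G (h (c0 + 0 *s V))) m $ l)) (at 0)"
    by (rule DERIV_sum_product_zero) (use d1 d2 h0 ev_partial_fsum_p in auto)
  moreover have "(\<Sum>l\<in>UNIV. (\<Sum>k\<in>UNIV. ev (partial_deriv k (partial_deriv l fsum)) p * u $ k) *
      fcol (jacM J G p) m $ l) = dotp (hessS t lam p (fcol (jacM J G p) m)) u"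
  proof -
    have "ev (partial_deriv k (partial_deriv l fsum)) p = (\<Sum>j<r. lam j * ev (partial_deriv k (partial_deriv l (F t j))) p)" for k l
    proof -
      have "poly_val z (partial_deriv l fsum) = poly_val z (\<Sum>j<r. poly_const (lam j) * partial_deriv l (F t j))" for z
        unfolding fsum_def poly_val_partial_deriv_linear by (simp add: poly_val_sum poly_val_mult)
      then have "poly_val z (partial_deriv k (partial_deriv l fsum)) =
          poly_val z (partial_deriv k (\<Sum>j<r. poly_const (lam j) * partial_deriv l (F t j)))" for z
        unfolding poly_val_partial_deriv[of _ k] by presburger
      then show ?thesis unfolding ev_def poly_val_partial_deriv_linear by simp
    qed
    note E = this
    have "(\<Sum>l\<in>UNIV. (\<Sum>k\<in>UNIV. ev (partial_deriv k (partial_deriv l fsum)) p * u $ k) * fcol (jacM J G p) m $ l)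
      = (\<Sum>k\<in>UNIV. (\<Sum>l\<in>UNIV. ev (partial_deriv k (partial_deriv l fsum)) p * fcol (jacM J G p) m $ l) * u $ k)"
      unfolding sum_distrib_right by (subst sum.swap) (simp add: mult_ac)
    moreover have "(\<Sum>l\<in>UNIV. ev (partial_deriv k (partial_deriv l fsum)) p * fcol (jacM J G p) m $ l)
      = hessS t lam p (fcol (jacM J G p) m) $ k" for k
      unfolding hessS_def hess_def vec_lambda_beta E sum_distrib_right sum_distrib_left
      by (subst sum.swap) (simp add: mult_ac)
    ultimately show ?thesis by (simp add: dotp_def)
  qed
  ultimately show ?thesis
    unfolding Aco_diag[OF z] nuV h0 ueq[symmetric] by simp
qed

text \<open>The first and third components force \<open>v $ 1 = v $ 3 = 0\<close>; on such vectors
  the other two are given by the Hessian pairing, which is nondegenerate by the choice of the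
  frame.\<close>

lemma jac_kmap_inj:
  assumes "jac kmap 0 v = 0"
  shows "v = 0"
proof -
  have 0: "(0::complex^4) \<in> pbox 0 \<epsilon>" using eps by (simp add: pbox_def)
  have D: "((\<lambda>\<tau>. kmap (\<tau> *s v) $ a) has_field_derivative 0) (at 0)" for a
  proof -
    have "((\<lambda>\<tau>. kmap (\<tau> *s v) $ a) has_field_derivative
        (\<Sum>k\<in>UNIV. pdc (\<lambda>z. kmap z $ a) k (0 *s v) * v $ k)) (at 0)"
      by (rule hol_curve[OF hol_kmap]) (use 0 in \<open>auto intro!: derivative_eq_intros\<close>)
    moreover have "jac kmap 0 v $ a = 0" using assms by simp
    ultimately show ?thesis by (simp add: jac_def)
  qed
  have "((\<lambda>\<tau>. \<tau> * v $ a) has_field_derivative v $ a) (at 0)" for a by (auto intro!: derivative_eq_intros)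
  note lin = this
  have v13: "v $ 1 = 0" "v $ 3 = 0"
    using DERIV_unique[OF D[of 1], of "v $ 1"] DERIV_unique[OF D[of 3], of "v $ 3"] lin by (auto simp: kmap_simps)
  have A: "dotp (hessS t lam p (fcol (jacM J G p) m)) (v $ 2 *s fcol (jacM J G p) k1 + v $ 4 *s fcol (jacM J G p) k2) = 0"
    if "m = m1 \<or> m = m2" for m
    using that DERIV_unique[OF DERIV_Aco[OF v13, of m]] D[of 2] D[of 4] by (auto simp: kmap_simps)
  have hl: "hessS t lam p (c1 *s a + c2 *s b) = c1 *s hessS t lam p a + c2 *s hessS t lam p b" for c1 c2 a b
    using hessS_linear[of t lam p "\<lambda>k. if k then c1 else c2" "\<lambda>k. if k then a else b" "{True, False}"]
    by simp
  have "v $ 2 = 0 \<and> v $ 4 = 0"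
  proof (rule two_by_two[of
      "dotp (hessS t lam p (fcol (jacM J G p) m1)) (fcol (jacM J G p) k1)"
      "dotp (hessS t lam p (fcol (jacM J G p) m2)) (fcol (jacM J G p) k1)"
      "dotp (hessS t lam p (fcol (jacM J G p) m1)) (fcol (jacM J G p) k2)"
      "dotp (hessS t lam p (fcol (jacM J G p) m2)) (fcol (jacM J G p) k2)"])
    fix c1 c2 :: complex
    assume *: "c1 * dotp (hessS t lam p (fcol (jacM J G p) m1)) (fcol (jacM J G p) k1) +
        c2 * dotp (hessS t lam p (fcol (jacM J G p) m2)) (fcol (jacM J G p) k1) = 0"
      "c1 * dotp (hessS t lam p (fcol (jacM J G p) m1)) (fcol (jacM J G p) k2) +
        c2 * dotp (hessS t lam p (fcol (jacM J G p) m2)) (fcol (jacM J G p) k2) = 0"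
    show "c1 = 0 \<and> c2 = 0"
      by (rule frame_nondegenerate; unfold hl dotp_linear; fact *)
  qed (use A[of m1] A[of m2] in \<open>simp_all add: dotp_linear\<close>)
  then show ?thesis using v13 by (simp add: vec_eq_iff forall_4)
qed

end

locale node_coords = node_chart D d r q g x0 t p i lam j0 J G m1 m2 k1 k2 jj \<epsilon> N h
  for D :: "(complex^'n::finite) set" and d r q g x0 t p i lam j0 J and G :: "'n \<Rightarrow> 'n cpoly"
    and m1 m2 k1 k2 jj \<epsilon> N h +
  fixes \<delta> N4 \<kappa>
  assumes delta: "0 < \<delta>" and N4: "open N4" "0 \<in> N4" "N4 \<subseteq> pbox 0 \<epsilon>"
    and homeo4: "homeomorphism N4 (pbox 0 \<delta>) kmap \<kappa>"
    and hol_kappa: "\<And>k. holomorphic_on_open (\<lambda>w. \<kappa> w $ k) (pbox 0 \<delta>)"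

lemma (in node_chart) node_coords_exists:
  "\<exists>\<delta> N4 \<kappa>. node_coords D d r q g x0 t p i lam j0 J G m1 m2 k1 k2 jj \<epsilon> N h \<delta> N4 \<kappa>"
proof -
  have 0: "(0::complex^4) \<in> pbox 0 \<epsilon>" using eps by (simp add: pbox_def)
  show ?thesis
  proof (rule hol_inverse_function[OF hol_kmap 0 jac_kmap_inj])
    fix \<delta> N4 \<kappa>
    assume *: "\<delta> > 0" "open N4" "0 \<in> N4" "N4 \<subseteq> pbox 0 \<epsilon>" "homeomorphism N4 (pbox (kmap 0) \<delta>) kmap \<kappa>"
      "\<And>i. holomorphic_on_open (\<lambda>w. \<kappa> w $ i) (pbox (kmap 0) \<delta>)"
    have "node_coords D d r q g x0 t p i lam j0 J G m1 m2 k1 k2 jj \<epsilon> N h \<delta> N4 \<kappa>"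
      by unfold_locales (use * kmap_0 in auto)
    then show ?thesis by blast
  qed
qed

section \<open>Ordinary double points\<close>

lemma germ_ideal_gen:
  assumes "finite G" "g \<in> G"
  shows "in_germ_ideal p G g"
  unfolding in_germ_ideal_def
proof (intro exI conjI ballI)
  show "p \<in> UNIV" "open (UNIV :: (complex^'a) set)" by auto
  show "holomorphic_on_open (\<lambda>_. if g' = g then 1 else 0) UNIV" for g' by (rule hol_const) simp
  show "g z = (\<Sum>g'\<in>G. (if g' = g then 1 else 0) * g' z)" for z
    using assms by (simp add: if_distrib[of "\<lambda>x. x * _"] cong: if_cong)
qed

lemma germ_ideal_cong:
  assumes "in_germ_ideal p G f" "open U" "p \<in> U" "\<And>z. z \<in> U \<Longrightarrow> f' z = f z"
  shows "in_germ_ideal p G f'"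
proof -
  obtain V a where V: "p \<in> V" "open V" "\<And>g. g \<in> G \<Longrightarrow> holomorphic_on_open (a g) V"
    "\<And>z. z \<in> V \<Longrightarrow> f z = (\<Sum>g\<in>G. a g z * g z)" using assms(1) unfolding in_germ_ideal_def by blast
  show ?thesis unfolding in_germ_ideal_def
    by (intro exI[of _ "U \<inter> V"] exI[of _ a]) (use V assms in \<open>auto intro: hol_subset\<close>)
qed

lemma germ_ideal_zero: "in_germ_ideal p G (\<lambda>_. 0)"
  unfolding in_germ_ideal_def
  by (intro exI[of _ UNIV] exI[of _ "\<lambda>_ _. 0"]) (auto intro: hol_const)

lemma germ_ideal_add:
  assumes "in_germ_ideal p G f" "in_germ_ideal p G f'"
  shows "in_germ_ideal p G (\<lambda>z. f z + f' z)"
proof -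
  obtain V a where V: "p \<in> V" "open V" "\<And>g. g \<in> G \<Longrightarrow> holomorphic_on_open (a g) V"
    "\<And>z. z \<in> V \<Longrightarrow> f z = (\<Sum>g\<in>G. a g z * g z)" using assms(1) unfolding in_germ_ideal_def by blast
  obtain V' a' where V': "p \<in> V'" "open V'" "\<And>g. g \<in> G \<Longrightarrow> holomorphic_on_open (a' g) V'"
    "\<And>z. z \<in> V' \<Longrightarrow> f' z = (\<Sum>g\<in>G. a' g z * g z)" using assms(2) unfolding in_germ_ideal_def by blast
  show ?thesis unfolding in_germ_ideal_def
  proof (intro exI conjI ballI)
    show "p \<in> V \<inter> V'" "open (V \<inter> V')" using V V' by auto
    show "holomorphic_on_open (\<lambda>z. a g z + a' g z) (V \<inter> V')" if "g \<in> G" for g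
      using that V V' by (intro hol_add) (auto intro: hol_subset)
    show "f z + f' z = (\<Sum>g\<in>G. (a g z + a' g z) * g z)" if "z \<in> V \<inter> V'" for z
      using that V V' by (simp add: distrib_right sum.distrib)
  qed
qed

lemma germ_ideal_mult:
  assumes "in_germ_ideal p G f" "holomorphic_on_open b U" "p \<in> U"
  shows "in_germ_ideal p G (\<lambda>z. b z * f z)"
proof -
  obtain V a where V: "p \<in> V" "open V" "\<And>g. g \<in> G \<Longrightarrow> holomorphic_on_open (a g) V"
    "\<And>z. z \<in> V \<Longrightarrow> f z = (\<Sum>g\<in>G. a g z * g z)" using assms(1) unfolding in_germ_ideal_def by blast
  show ?thesis unfolding in_germ_ideal_def
  proof (intro exI conjI ballI)
    show "p \<in> V \<inter> U" "open (V \<inter> U)" using V assms hol_open[OF assms(2)] by auto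
    then show "holomorphic_on_open (\<lambda>z. b z * a g z) (V \<inter> U)" if "g \<in> G" for g
      using that V assms by (intro hol_mult) (auto intro: hol_subset)
    show "b z * f z = (\<Sum>g\<in>G. b z * a g z * g z)" if "z \<in> V \<inter> U" for z
      using that V by (simp add: sum_distrib_left mult.assoc)
  qed
qed

lemma germ_ideal_sum:
  "(\<And>i. i \<in> A \<Longrightarrow> in_germ_ideal p G (f i)) \<Longrightarrow> in_germ_ideal p G (\<lambda>z. \<Sum>i\<in>A. f i z)"
proof (induction A rule: infinite_finite_induct)
  case (insert x A)
  then show ?case by (simp add: germ_ideal_add)
qed (simp_all add: germ_ideal_zero)

lemma germ_ideal_uminus: "in_germ_ideal p G f \<Longrightarrow> in_germ_ideal p G (\<lambda>z. - f z)"
  using germ_ideal_mult[OF _ hol_const[OF open_UNIV, of "-1"]] by fastforce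

lemma germ_ideal_diff: "in_germ_ideal p G f \<Longrightarrow> in_germ_ideal p G f' \<Longrightarrow> in_germ_ideal p G (\<lambda>z. f z - f' z)"
  using germ_ideal_add[OF _ germ_ideal_uminus] by fastforce

text \<open>The linear change of coordinates that factors each sum of two squares, in accordance
  with the shape of \<open>fsum_factor\<close>.\<close>

definition split_quadric :: "complex^4 \<Rightarrow> complex^4" where
  "split_quadric z = (\<chi> a. if a = 1 then z $ 1 - \<i> * z $ 2 else if a = 2 then z $ 1 + \<i> * z $ 2
     else if a = 3 then z $ 3 - \<i> * z $ 4 else z $ 3 + \<i> * z $ 4)"

definition sum_quadric :: "complex^4 \<Rightarrow> complex^4" where
  "sum_quadric w = (\<chi> a. if a = 1 then (w $ 1 + w $ 2) / 2 else if a = 2 then \<i> * (w $ 1 - w $ 2) / 2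
     else if a = 3 then (w $ 3 + w $ 4) / 2 else \<i> * (w $ 3 - w $ 4) / 2)"

lemma quadric_simps:
  "split_quadric z $ 1 = z $ 1 - \<i> * z $ 2" "split_quadric z $ 2 = z $ 1 + \<i> * z $ 2"
  "split_quadric z $ 3 = z $ 3 - \<i> * z $ 4" "split_quadric z $ 4 = z $ 3 + \<i> * z $ 4"
  "sum_quadric z $ 1 = (z $ 1 + z $ 2) / 2" "sum_quadric z $ 2 = \<i> * (z $ 1 - z $ 2) / 2"
  "sum_quadric z $ 3 = (z $ 3 + z $ 4) / 2" "sum_quadric z $ 4 = \<i> * (z $ 3 - z $ 4) / 2"
  by (simp_all add: split_quadric_def sum_quadric_def)

lemma split_sum_quadric: "sum_quadric (split_quadric z) = z"
  by (simp add: vec_eq_iff forall_4 quadric_simps)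

lemma sum_split_quadric: "split_quadric (sum_quadric w) = w"
  by (simp add: vec_eq_iff forall_4 quadric_simps field_simps)

lemma quadric_form: "(\<Sum>j\<in>UNIV. (z $ j)\<^sup>2) =
    split_quadric z $ 1 * split_quadric z $ 2 + split_quadric z $ 3 * split_quadric z $ 4"
  by (simp add: sum_4 quadric_simps algebra_simps power2_eq_square)

lemma hol_split_quadric: "open U \<Longrightarrow> holomorphic_on_open (\<lambda>z. split_quadric z $ a) U"
  using exhaust_4[of a]
  by (elim disjE) (auto simp: quadric_simps intro!: hol_diff hol_add hol_mult hol_const hol_coord)

lemma hol_sum_quadric:
  "open U \<Longrightarrow> (\<And>a. holomorphic_on_open (\<lambda>z. Y z $ a) U) \<Longrightarrow> holomorphic_on_open (\<lambda>z. sum_quadric (Y z) $ a) U"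
  using exhaust_4[of a]
  by (elim disjE) (auto simp: quadric_simps intro!: hol_diff hol_add hol_mult hol_const hol_divide)

lemma hol_continuous_vec: "(\<And>k. holomorphic_on_open (\<lambda>z. f z $ k) U) \<Longrightarrow> continuous_on U f"
  using continuous_on_vec_lambda[of U "\<lambda>k z. f z $ k"] hol_continuous_on by auto

lemma open_hol_preimage:
  assumes "\<And>k. holomorphic_on_open (\<lambda>z. f z $ k) U" "open V"
  shows "open {z\<in>U. f z \<in> V}"
  using continuous_open_preimage[OF hol_continuous_vec[OF assms(1)] hol_open[OF assms(1)] assms(2)]
  by (simp add: vimage_def Int_def)

context node_coords
begin

definition yx :: "complex^'n \<Rightarrow> complex^4" where "yx x = yc (chart J G x)"

lemma hol_yx: "open U \<Longrightarrow> holomorphic_on_open (\<lambda>x. yx x $ a) U"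
  using exhaust_4[of a] unfolding yx_def
  by (elim disjE) (auto simp: yc_simps intro!: hol_diff hol_const hol_chart)

definition Up where "Up = {x\<in>N. yx x \<in> N4}"

lemma Up: "open Up" "p \<in> Up" "Up \<subseteq> N"
proof -
  show "open Up" unfolding Up_def by (rule open_hol_preimage[OF hol_yx[OF N(1)] N4(1)])
  have "yx p = 0" unfolding yx_def nu_0[symmetric] yc_nu ..
  then show "p \<in> Up" using N N4 by (simp add: Up_def)
qed (auto simp: Up_def)

definition Uq where "Uq = {z. split_quadric z \<in> pbox 0 \<delta>}"

lemma Uq: "open Uq" "0 \<in> Uq"
proof -
  show "open Uq" using open_hol_preimage[OF hol_split_quadric[OF open_UNIV] open_pbox] by (simp add: Uq_def)
  show "0 \<in> Uq" using delta by (simp add: Uq_def pbox_def forall_4 quadric_simps)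
qed

definition Phi where "Phi x = sum_quadric (kmap (yx x))"

definition Psi where "Psi z = h (nu (\<kappa> (split_quadric z)))"

lemma kappa: "w \<in> pbox 0 \<delta> \<Longrightarrow> kmap (\<kappa> w) = w" "w \<in> pbox 0 \<delta> \<Longrightarrow> \<kappa> w \<in> N4"
  "y \<in> N4 \<Longrightarrow> \<kappa> (kmap y) = y" "y \<in> N4 \<Longrightarrow> kmap y \<in> pbox 0 \<delta>" "w \<in> pbox 0 \<delta> \<Longrightarrow> \<kappa> w \<in> pbox 0 \<epsilon>"
  using homeo4 N4(3) by (auto simp: homeomorphism_def)

lemma h_inv: "c \<in> pbox c0 \<epsilon> \<Longrightarrow> chart J G (h c) = c" "c \<in> pbox c0 \<epsilon> \<Longrightarrow> h c \<in> N" "x \<in> N \<Longrightarrow> h (chart J G x) = x"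
  "x \<in> N \<Longrightarrow> chart J G x \<in> pbox c0 \<epsilon>"
  using homeo by (auto simp: homeomorphism_def)

text \<open>A retraction of a neighbourhood of \<open>p\<close> onto the fourfold; it is congruent
  to the identity modulo the equations that define the fourfold.\<close>

definition rho where "rho x = h (nu (yx x))"

lemma hol_Phi: "holomorphic_on_open (\<lambda>x. Phi x $ a) Up"
  unfolding Phi_def
  by (rule hol_sum_quadric[OF Up(1)], rule hol_compose(1)[OF hol_kmap hol_yx[OF Up(1)]]) (use N4(3) in \<open>auto simp: Up_def\<close>)

lemma hol_h_kappa: "holomorphic_on_open (\<lambda>w. h (nu (\<kappa> w)) $ k) (pbox 0 \<delta>)"
  by (rule hol_h_nu[OF open_pbox hol_kappa]) (use kappa in auto)

lemma hol_Psi: "holomorphic_on_open (\<lambda>z. Psi z $ k) Uq"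
  unfolding Psi_def
  by (rule hol_compose(1)[OF hol_h_kappa hol_split_quadric[OF Uq(1)]]) (auto simp: Uq_def)

abbreviation eqs :: "(complex^'n \<Rightarrow> complex) set" where
  "eqs \<equiv> insert (\<lambda>z. z $ i - 1) ((\<lambda>g z. poly_val (($) z) g) ` F t ` {..<r})"

lemma finite_eqs: "finite eqs" by simp

lemma eqs_F: "j < r \<Longrightarrow> in_germ_ideal p eqs (\<lambda>z. ev (F t j) z)"
  by (rule germ_ideal_gen[OF finite_eqs]) (auto simp: ev_def)

lemma jj: "k \<in> J - {m1, m2} \<Longrightarrow> jj k < r"
  using frame(12) by (auto simp: bij_betw_def)

lemma eqs_chart: "in_germ_ideal p eqs (\<lambda>x. chart J G x $ k - nu (yx x) $ k)"
proof -
  consider "k \<in> J - {m1, m2}" | "k = i" | "k \<in> {m1, m2, k1, k2}" using index_cases[of k] by auto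
  then show ?thesis
  proof cases
    case 1
    then show ?thesis using eqs_F[OF jj[OF 1]] frame(13)[OF 1] by (simp add: nu_simps chart_def)
  next
    case 2
    then show ?thesis using germ_ideal_gen[OF finite_eqs, of "\<lambda>z. z $ i - 1"] not_J by (simp add: nu_simps chart_def)
  next
    case 3
    then show ?thesis using germ_ideal_zero by (auto simp: nu_simps yx_def yc_simps)
  qed
qed

lemma Up_nu: "x \<in> Up \<Longrightarrow> nu (yx x) \<in> pbox c0 \<epsilon>" "x \<in> Up \<Longrightarrow> chart J G x \<in> pbox c0 \<epsilon>"
  using N4(3) nu_pbox h_inv(4) by (auto simp: Up_def)

lemma hol_h_chart: "holomorphic_on_open (\<lambda>x. h (chart J G x) $ k) Up"
  by (rule hol_compose(1)[OF hol_h hol_chart[OF Up(1)]]) (use Up_nu in auto)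

lemma hol_h_nu_yx: "holomorphic_on_open (\<lambda>x. h (nu (yx x)) $ k) Up"
  by (rule hol_h_nu[OF Up(1) hol_yx[OF Up(1)]]) (use N4(3) in \<open>auto simp: Up_def\<close>)

text \<open>In chart coordinates \<open>x\<close> and \<open>rho x\<close> differ by members of
  \<open>eqs\<close> or not at all (\<open>eqs_chart\<close>), and the invertible mean value matrix
  carries this over to the linear coordinates.\<close>

lemma eqs_rho: "in_germ_ideal p eqs (\<lambda>x. x $ k - rho x $ k)"
proof (rule germ_ideal_cong[OF _ Up(1,2)])
  show "in_germ_ideal p eqs (\<lambda>x. \<Sum>m\<in>UNIV. hcoef J G h m (chart J G x) (nu (yx x)) $ k * (chart J G x $ m - nu (yx x) $ m))"
    by (rule germ_ideal_sum, rule germ_ideal_mult[OF eqs_chart _ Up(2)],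
        rule hol_hcoef[OF Up(1), where c = "chart J G" and c' = "\<lambda>x. nu (yx x)", OF hol_h_chart hol_h_nu_yx]) (use Up_nu hmat_nonzero in blast)
  fix x assume x: "x \<in> Up"
  then have "x - rho x = (\<Sum>m\<in>UNIV. (chart J G x $ m - nu (yx x) $ m) *s hcoef J G h m (chart J G x) (nu (yx x)))"
    using hcoef_diff[OF homeo Up_nu(2)[OF x] Up_nu(1)[OF x]] hmat_nonzero[OF Up_nu(2)[OF x] Up_nu(1)[OF x]] h_inv(3)[of x] Up(3)
    by (auto simp: rho_def)
  then have "(x - rho x) $ k = (\<Sum>m\<in>UNIV. (chart J G x $ m - nu (yx x) $ m) * hcoef J G h m (chart J G x) (nu (yx x)) $ k)"
    by (simp only: sum_component vector_smult_component)
  then show "x $ k - rho x $ k = (\<Sum>m\<in>UNIV. hcoef J G h m (chart J G x) (nu (yx x)) $ k * (chart J G x $ m - nu (yx x) $ m))"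
    by (simp add: mult.commute)
qed

lemma eqs_fsum_rho: "in_germ_ideal p eqs (\<lambda>x. ev fsum (rho x))"
proof -
  have "in_germ_ideal p eqs (\<lambda>x. ev fsum x - ev fsum (rho x))"
  proof (rule germ_ideal_cong[OF _ Up(1,2)])
    show "in_germ_ideal p eqs (\<lambda>x. \<Sum>m\<in>UNIV. pcoef J G h fsum m (chart J G x) (nu (yx x)) * (chart J G x $ m - nu (yx x) $ m))"
      by (rule germ_ideal_sum, rule germ_ideal_mult[OF eqs_chart _ Up(2)],
          rule hol_pcoef[OF Up(1), where c = "chart J G" and c' = "\<lambda>x. nu (yx x)", OF hol_h_chart hol_h_nu_yx]) (use Up_nu hmat_nonzero in blast)
    show "ev fsum x - ev fsum (rho x) = (\<Sum>m\<in>UNIV. pcoef J G h fsum m (chart J G x) (nu (yx x)) * (chart J G x $ m - nu (yx x) $ m))"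
      if x: "x \<in> Up" for x
      using pcoef_diff[OF homeo Up_nu(2)[OF x] Up_nu(1)[OF x] hmat_nonzero[OF Up_nu(2)[OF x] Up_nu(1)[OF x]], of fsum]
        h_inv(3)[of x] Up(3) x by (auto simp: rho_def)
  qed
  moreover have "in_germ_ideal p eqs (\<lambda>x. ev fsum x)"
    unfolding ev_fsum
    by (rule germ_ideal_sum, rule germ_ideal_mult[OF eqs_F hol_const[OF open_UNIV]]) auto
  ultimately show ?thesis using germ_ideal_diff[of p eqs "\<lambda>x. ev fsum x" "\<lambda>x. ev fsum x - ev fsum (rho x)"] by simp
qed

text \<open>The equations with index other than \<open>j0\<close> are chart coordinates which
  \<open>nu\<close> sets to 0. On the fourfold \<open>fsum\<close> therefore coincides with the
  equation of index \<open>j0\<close>, because \<open>lam j0 = 1\<close>.\<close>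

lemma F_Psi:
  assumes w: "w \<in> pbox 0 \<delta>"
  shows "j < r \<Longrightarrow> j \<noteq> j0 \<Longrightarrow> ev (F t j) (h (nu (\<kappa> w))) = 0"
    and "ev (F t j0) (h (nu (\<kappa> w))) = w $ 1 * w $ 2 + w $ 3 * w $ 4"
    and "h (nu (\<kappa> w)) $ i = 1"
proof -
  have b: "nu (\<kappa> w) \<in> pbox c0 \<epsilon>" using kappa(5)[OF w] nu_pbox by blast
  have c: "chart J G (h (nu (\<kappa> w))) = nu (\<kappa> w)" using h_inv(1)[OF b] .
  then have "chart J G (h (nu (\<kappa> w))) $ i = 1" by (simp add: nu_simps)
  then show "h (nu (\<kappa> w)) $ i = 1" using not_J by (simp add: chart_def)
  have 0: "ev (F t j) (h (nu (\<kappa> w))) = 0" if "j < r" "j \<noteq> j0" for j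
  proof -
    have "j \<in> jj ` (J - {m1, m2})" using that frame(12) by (simp add: bij_betw_def)
    then obtain k where k: "k \<in> J - {m1, m2}" "j = jj k" by blast
    have "chart J G (h (nu (\<kappa> w))) $ k = 0" unfolding c using k(1) by (simp add: nu_simps)
    then show ?thesis using k frame(13)[OF k(1)] by (simp add: chart_def)
  qed
  then show "j < r \<Longrightarrow> j \<noteq> j0 \<Longrightarrow> ev (F t j) (h (nu (\<kappa> w))) = 0" .
  have "ev fsum (h (nu (\<kappa> w))) = (\<Sum>j\<in>{j0}. lam j * ev (F t j) (h (nu (\<kappa> w))))"
    unfolding ev_fsum by (rule sum.mono_neutral_right) (use frame(1) 0 in auto)
  then show "ev (F t j0) (h (nu (\<kappa> w))) = w $ 1 * w $ 2 + w $ 3 * w $ 4"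
    using fsum_factor[OF kappa(5)[OF w]] kappa(1)[OF w] frame(2) by simp
qed

text \<open>\<open>Phi\<close> after \<open>Psi\<close> is the identity near 0, while
  \<open>Psi\<close> after \<open>Phi\<close> is \<open>rho\<close>, which induces the identity of
  the germ of \<open>X t\<close> by \<open>eqs_rho\<close>.\<close>

lemma node_ordinary: "ordinary_double_point (F t ` {..<r}) p"
  unfolding ordinary_double_point_def germs_isomorphic_def
proof (intro exI[of _ i] conjI exI[of _ Phi] exI[of _ Psi] allI ballI)
  have [simp]: "inverse (p $ i) *s p = p" by (simp add: pi)
  show "p $ i \<noteq> 0" by (simp add: pi)
  show "holomorphic_near (\<lambda>z. Phi z $ a) (inverse (p $ i) *s p)" for a
    unfolding holomorphic_near_def using hol_Phi Up by auto
  have yp: "yx p = 0" unfolding yx_def nu_0[symmetric] yc_nu ..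
  show "Phi (inverse (p $ i) *s p) = 0"
    by (simp add: Phi_def yp kmap_0) (simp add: vec_eq_iff forall_4 quadric_simps)
  show "holomorphic_near (\<lambda>w. Psi w $ k) 0" for k
    unfolding holomorphic_near_def using hol_Psi Uq by auto
  have sq0: "split_quadric 0 = 0" by (simp add: vec_eq_iff forall_4 quadric_simps)
  have "\<kappa> 0 = 0" using kappa(3)[OF N4(2)] by (simp add: kmap_0)
  then show "Psi 0 = inverse (p $ i) *s p" by (simp add: Psi_def sq0 nu_0 c0)
  show "in_germ_ideal (inverse (p $ i) *s p) eqs (hh \<circ> Phi)" if "hh \<in> {\<lambda>w. \<Sum>j\<in>UNIV. (w $ j)\<^sup>2}" for hh :: "complex^4 \<Rightarrow> complex"
  proof -
    have "hh \<circ> Phi = (\<lambda>x. kmap (yx x) $ 1 * kmap (yx x) $ 2 + kmap (yx x) $ 3 * kmap (yx x) $ 4)"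
      using that by (auto simp: fun_eq_iff quadric_form Phi_def sum_split_quadric)
    moreover have "in_germ_ideal p eqs (\<lambda>x. kmap (yx x) $ 1 * kmap (yx x) $ 2 + kmap (yx x) $ 3 * kmap (yx x) $ 4)"
      by (rule germ_ideal_cong[OF eqs_fsum_rho Up(1,2)])
        (use fsum_factor N4(3) in \<open>auto simp: Up_def rho_def\<close>)
    ultimately show ?thesis by simp
  qed
  show "in_germ_ideal 0 {\<lambda>w. \<Sum>j\<in>UNIV. (w $ j)\<^sup>2} (gg \<circ> Psi)" if gg: "gg \<in> eqs" for gg
  proof -
    consider "gg = (\<lambda>z. z $ i - 1)" | j where "j < r" "j \<noteq> j0" "gg = (\<lambda>z. ev (F t j) z)" | "gg = (\<lambda>z. ev (F t j0) z)"
      using gg unfolding ev_def by blast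
    then show ?thesis
    proof cases
      case 1
      show ?thesis by (rule germ_ideal_cong[OF germ_ideal_zero Uq]) (use F_Psi in \<open>auto simp: 1 Psi_def Uq_def\<close>)
    next
      case (2 j)
      show ?thesis by (rule germ_ideal_cong[OF germ_ideal_zero Uq]) (use F_Psi 2 in \<open>auto simp: Psi_def Uq_def\<close>)
    next
      case 3
      show ?thesis
        by (rule germ_ideal_cong[OF germ_ideal_gen Uq])
          (use F_Psi(2) in \<open>auto simp: 3 Psi_def Uq_def quadric_form\<close>)
    qed
  qed
  show "in_germ_ideal (inverse (p $ i) *s p) eqs (\<lambda>z. Psi (Phi z) $ k - z $ k)" for k
  proof -
    have "in_germ_ideal p eqs (\<lambda>z. Psi (Phi z) $ k - z $ k)"
      by (rule germ_ideal_cong[OF germ_ideal_uminus[OF eqs_rho[of k]] Up(1,2)])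
        (auto simp: Psi_def Phi_def sum_split_quadric rho_def Up_def kappa)
    then show ?thesis by simp
  qed
  show "in_germ_ideal 0 {\<lambda>w. \<Sum>j\<in>UNIV. (w $ j)\<^sup>2} (\<lambda>w. Phi (Psi w) $ a - w $ a)" for a
  proof (rule germ_ideal_cong[OF germ_ideal_zero Uq])
    fix z assume "z \<in> Uq"
    then have w: "split_quadric z \<in> pbox 0 \<delta>" by (simp add: Uq_def)
    have b: "nu (\<kappa> (split_quadric z)) \<in> pbox c0 \<epsilon>" using kappa(5)[OF w] nu_pbox by blast
    show "Phi (Psi z) $ a - z $ a = 0"
      by (simp add: Phi_def Psi_def yx_def h_inv(1)[OF b] yc_nu kappa(1)[OF w] split_sum_quadric)
  qed
qed

end

section \<open>The smooth locus near a node\<close>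

lemma connected_punctured_pbox: "2 \<le> CARD('m::finite) \<Longrightarrow> connected (pbox (0 :: complex^'m) \<epsilon> - {0})"
  by (rule connected_open_delete[OF open_pbox convex_connected[OF convex_pbox]]) simp

text \<open>Factorisation with the entry of largest modulus as pivot. The modulus of the pivot is
  shared equally between the two factors, so that matrices bounded by \<open>\<delta>\<close> come
  from vectors bounded by the square root of \<open>\<delta>\<close>.\<close>

lemma rank_one_factor:
  fixes x y z w :: complex
  assumes q: "x * w = y * z" and x: "x \<noteq> 0" "cmod y \<le> cmod x" "cmod z \<le> cmod x"
  shows "\<exists>a b \<alpha> \<beta>. x = \<alpha> * a \<and> y = \<alpha> * b \<and> z = \<beta> * a \<and> w = \<beta> * b \<and>
    cmod a \<le> sqrt (cmod x) \<and> cmod b \<le> sqrt (cmod x) \<and> cmod \<alpha> \<le> sqrt (cmod x) \<and> cmod \<beta> \<le> sqrt (cmod x)"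
proof -
  define m where "m = complex_of_real (sqrt (cmod x))"
  have m: "m \<noteq> 0" "cmod m = sqrt (cmod x)" using x by (simp_all add: m_def)
  have mm: "sqrt (cmod x) * sqrt (cmod x) = cmod x" by simp
  have w: "w = y * z / x" using q x by (simp add: field_simps)
  show ?thesis
  proof (rule exI[of _ "x / m"], rule exI[of _ "y / m"], rule exI[of _ m], rule exI[of _ "z * m / x"], intro conjI)
    show "cmod (x / m) \<le> sqrt (cmod x)" using x by (simp add: norm_divide m real_div_sqrt)
    show "cmod (y / m) \<le> sqrt (cmod x)" using x
      by (simp add: norm_divide m divide_le_eq mm)
    show "cmod (z * m / x) \<le> sqrt (cmod x)" using x
      by (simp add: norm_divide norm_mult m divide_le_eq mult.commute mult_left_mono)
  qed (use m x w in \<open>simp_all add: m(2)\<close>)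
qed

lemma smult_component_fun: "($) (c *s x) = (\<lambda>v. c * x $ v)"
  by (simp add: fun_eq_iff)

definition node_cone :: "real \<Rightarrow> (complex^4) set" where
  "node_cone \<delta> = {w \<in> pbox 0 \<delta>. w \<noteq> 0 \<and> w $ 1 * w $ 2 + w $ 3 * w $ 4 = 0}"

text \<open>The column \<open>v\<close> times the row \<open>u\<close> is the matrix with rows
  \<open>w1, w3\<close> and \<open>w4, - w2\<close>, whose determinant is
  \<open>- (w1 w2 + w3 w4)\<close>.\<close>

definition segre :: "(complex^2) \<times> (complex^2) \<Rightarrow> complex^4" where
  "segre uv = (\<chi> a. if a = 1 then snd uv $ 1 * fst uv $ 1 else if a = 2 then - snd uv $ 2 * fst uv $ 2
     else if a = 3 then snd uv $ 1 * fst uv $ 2 else snd uv $ 2 * fst uv $ 1)"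

lemma segre_simps: "segre (u, v) $ 1 = v $ 1 * u $ 1" "segre (u, v) $ 2 = - v $ 2 * u $ 2"
  "segre (u, v) $ 3 = v $ 1 * u $ 2" "segre (u, v) $ 4 = v $ 2 * u $ 1"
  by (simp_all add: segre_def)

text \<open>A point of the cone is a two by two matrix of rank one.\<close>

lemma node_cone_segre:
  assumes "0 < \<delta>"
  shows "node_cone \<delta> = segre ` ((pbox 0 (sqrt \<delta>) - {0}) \<times> (pbox 0 (sqrt \<delta>) - {0}))"
proof
  show "segre ` ((pbox 0 (sqrt \<delta>) - {0}) \<times> (pbox 0 (sqrt \<delta>) - {0})) \<subseteq> node_cone \<delta>"
  proof
    fix w assume "w \<in> segre ` ((pbox 0 (sqrt \<delta>) - {0}) \<times> (pbox 0 (sqrt \<delta>) - {0}))"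
    then obtain u v where weq: "w = segre (u, v)" and
      uv: "u \<in> pbox 0 (sqrt \<delta>)" "u \<noteq> 0" "v \<in> pbox 0 (sqrt \<delta>)" "v \<noteq> 0" by auto
    have "cmod (v $ a * u $ b) < \<delta>" for a b
    proof -
      have "cmod (v $ a) < sqrt \<delta>" "cmod (u $ b) < sqrt \<delta>" using uv by (simp_all add: pbox_def)
      then have "cmod (v $ a) * cmod (u $ b) < sqrt \<delta> * sqrt \<delta>" by (rule mult_strict_mono') auto
      then show ?thesis using assms by (simp add: norm_mult)
    qed
    then have "segre (u, v) \<in> pbox 0 \<delta>" by (simp add: pbox_def forall_4 segre_simps)
    moreover have "segre (u, v) \<noteq> 0"
    proof
      assume "segre (u, v) = 0"
      then have "\<forall>a. segre (u, v) $ a = 0" by simp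
      then show False using uv(2,4) by (auto simp: forall_4 segre_simps vec_eq_iff forall_2)
    qed
    ultimately show "w \<in> node_cone \<delta>" by (simp add: node_cone_def segre_simps weq)
  qed
  show "node_cone \<delta> \<subseteq> segre ` ((pbox 0 (sqrt \<delta>) - {0}) \<times> (pbox 0 (sqrt \<delta>) - {0}))"
  proof
    fix w assume "w \<in> node_cone \<delta>"
    then have w: "cmod (w $ a) < \<delta>" "w \<noteq> 0" "w $ 1 * w $ 2 + w $ 3 * w $ 4 = 0" for a
      by (auto simp: node_cone_def pbox_def)
    define M where "M = Max (range (\<lambda>a. cmod (w $ a)))"
    have le: "cmod (w $ a) \<le> M" for a unfolding M_def by (intro Max_ge) auto
    have "M \<in> range (\<lambda>a. cmod (w $ a))" unfolding M_def by (intro Max_in) auto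
    then obtain k where k: "M = cmod (w $ k)" by blast
    have M: "M > 0" "M < \<delta>"
    proof -
      obtain a where "w $ a \<noteq> 0" using w(2) by (auto simp: vec_eq_iff)
      then show "M > 0" using le[of a] by (meson less_le_trans zero_less_norm_iff)
    qed (use w(1) k in simp)
    \<comment> \<open>In each case the rows and columns are permuted such that an entry of modulus
      \<open>M\<close> becomes the pivot.\<close>
    obtain u1 u2 v1 v2 where uv: "w $ 1 = v1 * u1" "w $ 3 = v1 * u2" "w $ 4 = v2 * u1" "- w $ 2 = v2 * u2"
      "cmod u1 \<le> sqrt M" "cmod u2 \<le> sqrt M" "cmod v1 \<le> sqrt M" "cmod v2 \<le> sqrt M"
    proof -
      have q: "w $ 1 * (- w $ 2) = w $ 3 * w $ 4" using w(3) by (simp add: add_eq_0_iff)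
      consider "k = 1" | "k = 2" | "k = 3" | "k = 4" using exhaust_4 by blast
      then show ?thesis
      proof cases
        case 1
        have n: "w $ 1 \<noteq> 0" "cmod (w $ 3) \<le> cmod (w $ 1)" "cmod (w $ 4) \<le> cmod (w $ 1)"
          using M(1) k le unfolding 1 by auto
        have q': "w $ 1 * - w $ 2 = w $ 3 * w $ 4" using q by (simp add: mult.commute)
        have MM: "M = cmod (w $ 1)" using k unfolding 1 by simp
        obtain a b \<alpha> \<beta> where
          "w $ 1 = \<alpha> * a \<and> w $ 3 = \<alpha> * b \<and> w $ 4 = \<beta> * a \<and> - w $ 2 = \<beta> * b \<and> cmod a \<le> sqrt M \<and> cmod b \<le> sqrt M
            \<and> cmod \<alpha> \<le> sqrt M \<and> cmod \<beta> \<le> sqrt M"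
          using rank_one_factor[OF q' n] unfolding MM[symmetric] by (elim exE) (rule that)
        then show ?thesis by (intro that[where ?u1.0 = a and ?u2.0 = b and ?v1.0 = \<alpha> and ?v2.0 = \<beta>]) auto
      next
        case 2
        have n: "- w $ 2 \<noteq> 0" "cmod (w $ 4) \<le> cmod (- w $ 2)" "cmod (w $ 3) \<le> cmod (- w $ 2)"
          using M(1) k le unfolding 2 by auto
        have q': "- w $ 2 * w $ 1 = w $ 4 * w $ 3" using q by (simp add: mult.commute)
        have MM: "M = cmod (- w $ 2)" using k unfolding 2 by simp
        obtain a b \<alpha> \<beta> where
          "- w $ 2 = \<alpha> * a \<and> w $ 4 = \<alpha> * b \<and> w $ 3 = \<beta> * a \<and> w $ 1 = \<beta> * b \<and> cmod a \<le> sqrt M \<and> cmod b \<le> sqrt M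
            \<and> cmod \<alpha> \<le> sqrt M \<and> cmod \<beta> \<le> sqrt M"
          using rank_one_factor[OF q' n] unfolding MM[symmetric] by (elim exE) (rule that)
        then show ?thesis by (intro that[where ?u1.0 = b and ?u2.0 = a and ?v1.0 = \<beta> and ?v2.0 = \<alpha>]) auto
      next
        case 3
        have n: "w $ 3 \<noteq> 0" "cmod (w $ 1) \<le> cmod (w $ 3)" "cmod (- w $ 2) \<le> cmod (w $ 3)"
          using M(1) k le unfolding 3 by auto
        have q': "w $ 3 * w $ 4 = w $ 1 * - w $ 2" using q by (simp add: mult.commute)
        have MM: "M = cmod (w $ 3)" using k unfolding 3 by simp
        obtain a b \<alpha> \<beta> where
          "w $ 3 = \<alpha> * a \<and> w $ 1 = \<alpha> * b \<and> - w $ 2 = \<beta> * a \<and> w $ 4 = \<beta> * b \<and> cmod a \<le> sqrt M \<and> cmod b \<le> sqrt M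
            \<and> cmod \<alpha> \<le> sqrt M \<and> cmod \<beta> \<le> sqrt M"
          using rank_one_factor[OF q' n] unfolding MM[symmetric] by (elim exE) (rule that)
        then show ?thesis by (intro that[where ?u1.0 = b and ?u2.0 = a and ?v1.0 = \<alpha> and ?v2.0 = \<beta>]) auto
      next
        case 4
        have n: "w $ 4 \<noteq> 0" "cmod (- w $ 2) \<le> cmod (w $ 4)" "cmod (w $ 1) \<le> cmod (w $ 4)"
          using M(1) k le unfolding 4 by auto
        have q': "w $ 4 * w $ 3 = - w $ 2 * w $ 1" using q by (simp add: mult.commute)
        have MM: "M = cmod (w $ 4)" using k unfolding 4 by simp
        obtain a b \<alpha> \<beta> where
          "w $ 4 = \<alpha> * a \<and> - w $ 2 = \<alpha> * b \<and> w $ 1 = \<beta> * a \<and> w $ 3 = \<beta> * b \<and> cmod a \<le> sqrt M \<and> cmod b \<le> sqrt M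
            \<and> cmod \<alpha> \<le> sqrt M \<and> cmod \<beta> \<le> sqrt M"
          using rank_one_factor[OF q' n] unfolding MM[symmetric] by (elim exE) (rule that)
        then show ?thesis by (intro that[where ?u1.0 = a and ?u2.0 = b and ?v1.0 = \<beta> and ?v2.0 = \<alpha>]) auto
      qed
    qed
    have sM: "sqrt M < sqrt \<delta>" using M by simp
    define u :: "complex^2" where "u = (\<chi> a. if a = 1 then u1 else u2)"
    define v :: "complex^2" where "v = (\<chi> a. if a = 1 then v1 else v2)"
    have us: "u $ 1 = u1" "u $ 2 = u2" "v $ 1 = v1" "v $ 2 = v2" by (simp_all add: u_def v_def)
    have eq: "w = segre (u, v)"
      using uv(1-4) by (simp add: vec_eq_iff forall_4 segre_simps us) (metis minus_minus)
    have "u \<noteq> 0" "v \<noteq> 0" using w(2) unfolding eq by (auto simp: vec_eq_iff forall_4 segre_simps)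
    moreover have "u \<in> pbox 0 (sqrt \<delta>)" "v \<in> pbox 0 (sqrt \<delta>)"
      using le_less_trans[OF uv(5) sM] le_less_trans[OF uv(6) sM] le_less_trans[OF uv(7) sM] le_less_trans[OF uv(8) sM]
      by (simp_all add: pbox_def forall_2 us)
    ultimately show "w \<in> segre ` ((pbox 0 (sqrt \<delta>) - {0}) \<times> (pbox 0 (sqrt \<delta>) - {0}))"
      unfolding eq by blast
  qed
qed

text \<open>A polydisc in the complex plane of dimension two stays connected without its centre, and
  the cone is a continuous image of a product of two such sets.\<close>

lemma connected_node_cone:
  assumes "0 < \<delta>"
  shows "connected (node_cone \<delta>)"
  unfolding node_cone_segre[OF assms]
proof (rule connected_continuous_image)
  have "continuous_on S (\<lambda>uv. \<chi> a. segre uv $ a)" for S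
  proof (rule continuous_on_vec_lambda)
    fix a :: 4 show "continuous_on S (\<lambda>uv. segre uv $ a)"
      using exhaust_4[of a] unfolding segre_def by (elim disjE) (auto intro!: continuous_intros)
  qed
  then show "continuous_on ((pbox 0 (sqrt \<delta>) - {0}) \<times> (pbox 0 (sqrt \<delta>) - {0})) segre" by simp
qed (intro connected_Times connected_punctured_pbox; simp)

section \<open>Invariance of the smooth locus under scalars, and its connectedness near a
  node\<close>

context base_locus
begin

definition R :: "(nat \<times> nat \<Rightarrow> complex) \<Rightarrow> (complex^'n) set" where
  "R t = {x \<in> X t. indep_at t x}"

lemma ev_F_scale: "ev (F t j) (c *s x) = c ^ d * ev (F t j) x"
  using poly_val_forms_scale[OF F_forms[of t j], of c "($) x"] by (simp add: ev_def smult_component_fun)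

lemma X_scale: "x \<in> X t \<Longrightarrow> c \<noteq> 0 \<Longrightarrow> c *s x \<in> X t"
  by (simp add: X_def ev_F_scale)

lemma dv_F_scale: "c * dv (F t j) (c *s x) v = c ^ d * dv (F t j) x v"
proof -
  have "c * ev (partial_deriv l (F t j)) (c *s x) = c ^ d * ev (partial_deriv l (F t j)) x" for l
    using poly_val_partial_scale[OF F_forms[of t j], of c "($) x" l] by (simp add: ev_def smult_component_fun)
  then show ?thesis by (simp add: dv_def sum_distrib_left flip: mult.assoc)
qed

lemma indep_at_scale:
  assumes "indep_at t x" "c \<noteq> 0"
  shows "indep_at t (c *s x)"
  unfolding indep_at_def
proof (intro allI impI)
  fix lam j assume *: "\<forall>v. (\<Sum>j<r. lam j * dv (F t j) (c *s x) v) = 0" and j: "j < r"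
  have "(\<Sum>j<r. lam j * dv (F t j) x v) = 0" for v
  proof -
    have "c ^ d * (\<Sum>j<r. lam j * dv (F t j) x v) = (\<Sum>j<r. lam j * (c ^ d * dv (F t j) x v))"
      by (simp add: sum_distrib_left mult_ac)
    also have "\<dots> = c * (\<Sum>j<r. lam j * dv (F t j) (c *s x) v)"
      unfolding dv_F_scale[symmetric] by (simp add: sum_distrib_left mult_ac)
    finally show ?thesis using * assms(2) by simp
  qed
  then show "lam j = 0" using assms(1) j unfolding indep_at_def by blast
qed

lemma R_scale: "x \<in> R t \<Longrightarrow> c \<noteq> 0 \<Longrightarrow> c *s x \<in> R t"
  using X_scale indep_at_scale by (simp add: R_def)

lemma R_scale_iff: "c \<noteq> 0 \<Longrightarrow> c *s x \<in> R t \<longleftrightarrow> x \<in> R t"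
  using R_scale[of x t c] R_scale[of "c *s x" t "inverse c"] by auto

end

context node_coords
begin

definition psi where "psi w = h (nu (\<kappa> w))"

lemma psi:
  assumes w: "w \<in> pbox 0 \<delta>"
  shows "psi w \<in> Up" "yx (psi w) = \<kappa> w" "kmap (yx (psi w)) = w"
proof -
  have b: "nu (\<kappa> w) \<in> pbox c0 \<epsilon>" using kappa(5)[OF w] nu_pbox by blast
  show y: "yx (psi w) = \<kappa> w" by (simp add: psi_def yx_def h_inv(1)[OF b] yc_nu)
  show "psi w \<in> Up" using y h_inv(2)[OF b] kappa(2)[OF w] by (simp add: Up_def psi_def)
  show "kmap (yx (psi w)) = w" unfolding y by (rule kappa(1)[OF w])
qed

lemma psi_surj:
  assumes z: "z \<in> Up" "z \<in> X t" "z $ i = 1"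
  obtains w where "w \<in> pbox 0 \<delta>" "z = psi w" "w $ 1 * w $ 2 + w $ 3 * w $ 4 = 0"
proof
  have y: "yx z \<in> N4" "z \<in> N" using z by (auto simp: Up_def)
  show w: "kmap (yx z) \<in> pbox 0 \<delta>" using kappa(4)[OF y(1)] .
  have "chart J G z = nu (yx z)"
  proof (simp add: vec_eq_iff, intro allI)
    fix k
    consider "k \<in> J - {m1, m2}" | "k = i" | "k \<in> {m1, m2, k1, k2}" using index_cases[of k] by auto
    then show "chart J G z $ k = nu (yx z) $ k"
    proof cases
      case 1
      then have "ev (F t (jj k)) z = 0" using z(2) jj by (simp add: X_def)
      then show ?thesis using 1 frame(13)[OF 1] by (simp add: nu_simps chart_def)
    qed (use z(3) not_J in \<open>auto simp: nu_simps chart_def yx_def yc_simps\<close>)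
  qed
  then show eq: "z = psi (kmap (yx z))" using h_inv(3)[OF y(2)] kappa(3)[OF y(1)] by (simp add: psi_def)
  have "ev (F t j0) z = 0" using z(2) frame(1) by (simp add: X_def)
  then show "kmap (yx z) $ 1 * kmap (yx z) $ 2 + kmap (yx z) $ 3 * kmap (yx z) $ 4 = 0"
    using F_Psi(2)[OF w] eq by (simp add: psi_def)
qed

lemma psi_X:
  assumes w: "w \<in> pbox 0 \<delta>" "w $ 1 * w $ 2 + w $ 3 * w $ 4 = 0"
  shows "psi w \<in> X t" "psi w $ i = 1"
proof -
  show 1: "psi w $ i = 1" using F_Psi(3)[OF w(1)] by (simp add: psi_def)
  then have "psi w \<noteq> 0" by auto
  moreover have "ev (F t j) (psi w) = 0" if "j < r" for j
    using F_Psi(1)[OF w(1) that] F_Psi(2)[OF w(1)] w(2) by (cases "j = j0") (auto simp: psi_def)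
  ultimately show "psi w \<in> X t" by (simp add: X_def)
qed

lemma psi_0: "psi 0 = p"
proof -
  have "\<kappa> 0 = 0" using kappa(3)[OF N4(2)] by (simp add: kmap_0)
  then show ?thesis by (simp add: psi_def nu_0 c0)
qed

lemma rows_independent:
  assumes z: "z \<in> N" and mu: "\<And>v. (\<Sum>j\<in>{..<r} - {j0}. \<mu> j * dv (F t j) z v) = 0" and j: "j < r" "j \<noteq> j0"
  shows "\<mu> j = 0"
proof -
  have "j \<in> jj ` (J - {m1, m2})" using j frame(12) by (simp add: bij_betw_def)
  then obtain k where k: "k \<in> J - {m1, m2}" "j = jj k" by blast
  define v where "v = fcol (jacM J G z) k"
  have d: "dv (G m) z v = (if m = k then 1 else 0)" if "m \<in> J" for m
    using arg_cong[OF fcol[OF det_N[OF z], of k], of "\<lambda>a. a $ m"] that unfolding jacM_mult v_def by (auto simp: axis_def)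
  have "(\<Sum>j\<in>{..<r} - {j0}. \<mu> j * dv (F t j) z v) = (\<Sum>m\<in>J - {m1, m2}. \<mu> (jj m) * dv (F t (jj m)) z v)"
    by (rule sum.reindex_bij_betw[OF frame(12), symmetric])
  also have "\<dots> = (\<Sum>m\<in>J - {m1, m2}. \<mu> (jj m) * dv (G m) z v)"
    by (rule sum.cong) (use frame(13) in auto)
  also have "\<dots> = (\<Sum>m\<in>J - {m1, m2}. if m = k then \<mu> j else 0)"
    by (rule sum.cong) (use d k in auto)
  finally show ?thesis using k mu[of v] by simp
qed

text \<open>Pulled back along \<open>psi\<close>, a relation between the differentials becomes
  \<open>\<mu> j0\<close> times the differential of \<open>w1 w2 + w3 w4\<close>, which is nonzero
  off the origin; hence \<open>\<mu> j0 = 0\<close>. The remaining differentials are rows of an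
  invertible Jacobian matrix.\<close>

lemma psi_indep:
  assumes w: "w \<in> pbox 0 \<delta>" "w \<noteq> 0"
  shows "indep_at t (psi w)"
  unfolding indep_at_def
proof (intro allI impI)
  fix \<mu> j assume mu: "\<forall>v. (\<Sum>j<r. \<mu> j * dv (F t j) (psi w) v) = 0" and j: "j < r"
  have zN: "psi w \<in> N" using psi(1)[OF w(1)] Up(3) by blast
  have hol: "holomorphic_on_open (\<lambda>w. psi w $ k) (pbox 0 \<delta>)" for k unfolding psi_def by (rule hol_h_kappa)
  have grad0: "\<mu> j0 * (e $ 1 * w $ 2 + w $ 1 * e $ 2 + e $ 3 * w $ 4 + w $ 3 * e $ 4) = 0" for e :: "complex^4"
  proof -
    define v where "v = (\<chi> k. \<Sum>l\<in>UNIV. pdc (\<lambda>w. psi w $ k) l (w + 0 *s e) * e $ l)"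
    have c: "((\<lambda>s. psi (w + s *s e) $ k) has_field_derivative v $ k) (at 0)" for k
      unfolding v_def vec_lambda_beta
      by (rule hol_curve[OF hol]) (use w in \<open>auto intro!: derivative_eq_intros\<close>)
    have "((\<lambda>s. ev (F t j) (psi (w + s *s e))) has_field_derivative dv (F t j) (psi w) v) (at 0)" for j
      unfolding ev_def dv_def using poly_val_chain[of "\<lambda>s. ($) (psi (w + s *s e))" "\<lambda>k. v $ k" 0, OF c] by simp
    then have "((\<lambda>s. \<Sum>j<r. \<mu> j * ev (F t j) (psi (w + s *s e))) has_field_derivative
        (\<Sum>j<r. \<mu> j * dv (F t j) (psi w) v)) (at 0)"
      by (intro DERIV_sum DERIV_cmult)
    then have 1: "((\<lambda>s. \<Sum>j<r. \<mu> j * ev (F t j) (psi (w + s *s e))) has_field_derivative 0) (at 0)"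
      using mu by simp
    define S where "S = {s. w + s *s e \<in> pbox 0 \<delta>}"
    have S: "open S" "0 \<in> S" unfolding S_def using w by (auto intro: open_line_preimage open_pbox)
    have "((\<lambda>s. \<mu> j0 * ((w $ 1 + s * e $ 1) * (w $ 2 + s * e $ 2) + (w $ 3 + s * e $ 3) * (w $ 4 + s * e $ 4)))
      has_field_derivative 0) (at 0)"
    proof (rule has_field_derivative_transform_within_open[OF 1 S])
      fix s assume "s \<in> S"
      then have s: "w + s *s e \<in> pbox 0 \<delta>" by (simp add: S_def)
      have "(\<Sum>j<r. \<mu> j * ev (F t j) (psi (w + s *s e))) = (\<Sum>j\<in>{j0}. \<mu> j * ev (F t j) (psi (w + s *s e)))"
        by (rule sum.mono_neutral_right) (use frame(1) F_Psi(1)[OF s] in \<open>auto simp: psi_def\<close>)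
      then show "(\<Sum>j<r. \<mu> j * ev (F t j) (psi (w + s *s e))) =
          \<mu> j0 * ((w $ 1 + s * e $ 1) * (w $ 2 + s * e $ 2) + (w $ 3 + s * e $ 3) * (w $ 4 + s * e $ 4))"
        using F_Psi(2)[OF s] by (simp add: psi_def)
    qed
    moreover have "((\<lambda>s. \<mu> j0 * ((w $ 1 + s * e $ 1) * (w $ 2 + s * e $ 2) + (w $ 3 + s * e $ 3) * (w $ 4 + s * e $ 4)))
      has_field_derivative \<mu> j0 * (e $ 1 * w $ 2 + w $ 1 * e $ 2 + e $ 3 * w $ 4 + w $ 3 * e $ 4)) (at 0)"
      by (auto intro!: derivative_eq_intros simp: algebra_simps)
    ultimately show ?thesis using DERIV_unique by blast
  qed
  have "\<mu> j0 = 0"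
  proof (rule ccontr)
    assume "\<mu> j0 \<noteq> 0"
    then have "e $ 1 * w $ 2 + w $ 1 * e $ 2 + e $ 3 * w $ 4 + w $ 3 * e $ 4 = 0" for e :: "complex^4"
      using grad0 by simp
    note * = this
    have "w $ 2 = 0" "w $ 1 = 0" "w $ 4 = 0" "w $ 3 = 0"
      using *[of "axis 1 1"] *[of "axis 2 1"] *[of "axis 3 1"] *[of "axis 4 1"] by (simp_all add: axis_def)
    then show False using w(2) by (simp add: vec_eq_iff forall_4)
  qed
  moreover have "(\<Sum>j\<in>{..<r} - {j0}. \<mu> j * dv (F t j) (psi w) v) = 0" for v
    using mu[rule_format, of v] sum.remove[of "{..<r}" j0 "\<lambda>j. \<mu> j * dv (F t j) (psi w) v"] frame(1) \<open>\<mu> j0 = 0\<close> by simp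
  ultimately show "\<mu> j = 0" using rows_independent[OF zN _ j] by (cases "j = j0") auto
qed

lemma not_indep_p: "\<not> indep_at t p"
proof
  assume "indep_at t p"
  moreover have "\<forall>v. (\<Sum>j<r. lam j * dv (F t j) p v) = 0" using nf unfolding node_frame_def by (elim conjE)
  ultimately have "\<forall>j<r. lam j = 0" unfolding indep_at_def by blast
  then show False using frame(1,2) by simp
qed

text \<open>\<open>X t\<close> is a cone, so a neighbourhood of \<open>p\<close> consists of
  multiples of points of the affine chart; the radius 1/2 keeps the scalar away from 0.\<close>

definition node_nbhd where
  "node_nbhd = {x. x $ i \<in> ball 1 (1/2) \<and> inverse (x $ i) *s x \<in> Up}"

lemma open_node_nbhd: "open node_nbhd" "p \<in> node_nbhd"
proof -
  define U where "U = {x :: complex^'n. x $ i \<in> ball 1 (1/2)}"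
  have U: "open U" unfolding U_def by (intro open_vimage[of _ "\<lambda>x. x $ i", unfolded vimage_def] continuous_intros open_ball)
  have nz: "x $ i \<noteq> 0" if "x \<in> U" for x using that by (auto simp: U_def dist_norm)
  have "open {x\<in>U. inverse (x $ i) *s x \<in> Up}"
    by (rule open_hol_preimage[OF _ Up(1)]) (auto intro!: hol_mult hol_inverse hol_coord U nz)
  then show "open node_nbhd" by (simp add: node_nbhd_def U_def)
  show "p \<in> node_nbhd" using Up(2) pi by (simp add: node_nbhd_def)
qed

lemma node_nbhd_R: "node_nbhd \<inter> R t = (\<lambda>(\<sigma>, w). \<sigma> *s psi w) ` (ball 1 (1/2) \<times> node_cone \<delta>)"
proof
  show "(\<lambda>(\<sigma>, w). \<sigma> *s psi w) ` (ball 1 (1/2) \<times> node_cone \<delta>) \<subseteq> node_nbhd \<inter> R t"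
  proof clarify
    fix \<sigma> :: complex and w assume \<sigma>: "\<sigma> \<in> ball 1 (1/2)" and w: "w \<in> node_cone \<delta>"
    have s0: "\<sigma> \<noteq> 0" using \<sigma> by (auto simp: dist_norm)
    have w': "w \<in> pbox 0 \<delta>" "w \<noteq> 0" "w $ 1 * w $ 2 + w $ 3 * w $ 4 = 0" using w by (auto simp: node_cone_def)
    have "psi w \<in> R t" using psi_X[OF w'(1,3)] psi_indep[OF w'(1,2)] by (simp add: R_def)
    moreover have "\<sigma> *s psi w \<in> node_nbhd"
      using \<sigma> s0 psi_X[OF w'(1,3)] psi(1)[OF w'(1)] by (simp add: node_nbhd_def)
    ultimately show "\<sigma> *s psi w \<in> node_nbhd \<inter> R t" using R_scale s0 by blast
  qed
  show "node_nbhd \<inter> R t \<subseteq> (\<lambda>(\<sigma>, w). \<sigma> *s psi w) ` (ball 1 (1/2) \<times> node_cone \<delta>)"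
  proof
    fix x assume x: "x \<in> node_nbhd \<inter> R t"
    define \<sigma> where "\<sigma> = x $ i"
    define z where "z = inverse \<sigma> *s x"
    have \<sigma>: "\<sigma> \<in> ball 1 (1/2)" "z \<in> Up" using x by (auto simp: node_nbhd_def \<sigma>_def z_def)
    have s0: "\<sigma> \<noteq> 0" using \<sigma> by (auto simp: dist_norm)
    have zR: "z \<in> R t" using x s0 by (simp add: z_def R_scale_iff)
    have z1: "z $ i = 1" using s0 by (simp add: z_def \<sigma>_def)
    obtain w where w: "w \<in> pbox 0 \<delta>" "z = psi w" "w $ 1 * w $ 2 + w $ 3 * w $ 4 = 0"
      using psi_surj[OF \<sigma>(2) _ z1] zR by (auto simp: R_def)
    have "w \<noteq> 0" using w(2) zR not_indep_p psi_0 by (auto simp: R_def)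
    then have "w \<in> node_cone \<delta>" using w by (simp add: node_cone_def)
    moreover have "x = \<sigma> *s psi w" using w(2) s0 unfolding z_def[symmetric] w(2)[symmetric] by (simp add: z_def)
    ultimately show "x \<in> (\<lambda>(\<sigma>, w). \<sigma> *s psi w) ` (ball 1 (1/2) \<times> node_cone \<delta>)" using \<sigma>(1) by force
  qed
qed

lemma continuous_psi: "continuous_on (pbox 0 \<delta>) psi"
  by (rule hol_continuous_vec) (unfold psi_def, rule hol_h_kappa)

lemma connected_node_nbhd: "connected (node_nbhd \<inter> R t)"
  unfolding node_nbhd_R
proof (rule connected_continuous_image)
  have sub: "ball 1 (1/2) \<times> node_cone \<delta> \<subseteq> UNIV \<times> pbox 0 \<delta>" by (auto simp: node_cone_def)
  have "continuous_on (UNIV \<times> pbox 0 \<delta>) (\<lambda>x. psi (snd x))"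
    by (rule continuous_on_compose2[OF continuous_psi]) (auto intro!: continuous_intros)
  then have "continuous_on (UNIV \<times> pbox 0 \<delta>) (\<lambda>x. \<chi> k. fst x * psi (snd x) $ k)"
    by (intro continuous_on_vec_lambda continuous_intros continuous_on_component)
  then have "continuous_on (UNIV \<times> pbox 0 \<delta>) (\<lambda>(\<sigma>, w). \<sigma> *s psi w)"
    by (simp add: case_prod_unfold vector_scalar_mult_def)
  then show "continuous_on (ball 1 (1/2) \<times> node_cone \<delta>) (\<lambda>(\<sigma>, w). \<sigma> *s psi w)"
    using sub by (rule continuous_on_subset)
qed (intro connected_Times connected_node_cone delta; simp)

lemma node_closure: "p \<in> closure (R t)"
proof (subst closure_iff_nhds_not_empty, intro allI impI)
  fix A S assume S: "S \<subseteq> A" "open S" "p \<in> S"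
  have "open {w\<in>pbox 0 \<delta>. psi w \<in> S}" "0 \<in> {w\<in>pbox 0 \<delta>. psi w \<in> S}"
    using continuous_open_preimage[OF continuous_psi open_pbox S(2)] S(3) delta psi_0
    by (auto simp: vimage_def Int_def pbox_def)
  then obtain \<eta> where \<eta>: "\<eta> > 0" "pbox 0 \<eta> \<subseteq> {w\<in>pbox 0 \<delta>. psi w \<in> S}" using pbox_subset_open by blast
  define w :: "complex^4" where "w = axis 1 (of_real (\<eta>/2))"
  have "w \<in> pbox 0 \<eta>" using \<eta>(1) by (auto simp: pbox_def w_def axis_def)
  then have w: "w \<in> pbox 0 \<delta>" "psi w \<in> S" using \<eta>(2) by auto
  have q: "w $ 1 * w $ 2 + w $ 3 * w $ 4 = 0" "w $ 1 \<noteq> 0" using \<eta>(1) by (auto simp: w_def axis_def)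
  then have "w \<noteq> 0" by (metis zero_index)
  then have "psi w \<in> R t" using psi_X[OF w(1) q(1)] psi_indep[OF w(1)] by (auto simp: R_def)
  then show "R t \<inter> A \<noteq> {}" using w(2) S(1) by blast
qed

end

context base_locus
begin

lemma node_local_normalised:
  assumes t: "good t" and p: "p \<in> D" "p $ i = 1" "\<not> indep_at t p"
  shows "\<exists>N. open N \<and> p \<in> N \<and> connected (N \<inter> R t)" "p \<in> closure (R t)" "ordinary_double_point (F t ` {..<r}) p"
proof -
  obtain lam j0 J G m1 m2 k1 k2 jj where nf: "node_frame t p i lam j0 J G m1 m2 k1 k2 jj"
    using node_frame_exists[OF t p] by (elim exE)
  obtain \<epsilon> N h where "node_chart D d r q g x0 t p i lam j0 J G m1 m2 k1 k2 jj \<epsilon> N h"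
    using node_chart_exists[OF t p(1,2) nf] by (elim exE)
  then obtain \<delta> N4 \<kappa> where "node_coords D d r q g x0 t p i lam j0 J G m1 m2 k1 k2 jj \<epsilon> N h \<delta> N4 \<kappa>"
    by (rule node_chart.node_coords_exists[THEN exE], elim exE) (rule that)
  then interpret node_coords D d r q g x0 t p i lam j0 J G m1 m2 k1 k2 jj \<epsilon> N h \<delta> N4 \<kappa> .
  show "\<exists>N. open N \<and> p \<in> N \<and> connected (N \<inter> R t)" using open_node_nbhd connected_node_nbhd by blast
  show "p \<in> closure (R t)" by (rule node_closure)
  show "ordinary_double_point (F t ` {..<r}) p" by (rule node_ordinary)
qed

lemma ordinary_double_point_scale:
  assumes "c \<noteq> 0" "ordinary_double_point G x"
  shows "ordinary_double_point G (c *s x)"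
proof -
  have "inverse ((c *s x) $ i) *s (c *s x) = inverse (x $ i) *s x" for i
    using assms(1) by (simp add: vec_eq_iff)
  then show ?thesis using assms unfolding ordinary_double_point_def
    by (elim exE conjE, intro exI conjI) (auto simp only: vector_smult_component mult_eq_0_iff)
qed

lemma node_local:
  assumes t: "good t" and x: "x \<in> X t" "x \<notin> R t"
  shows "\<exists>N. open N \<and> x \<in> N \<and> connected (N \<inter> R t)" "x \<in> closure (R t)" "ordinary_double_point (F t ` {..<r}) x"
proof -
  have sing: "\<not> indep_at t x" using x by (simp add: R_def)
  have xD: "x \<in> D" using t x(1) sing unfolding good_def by blast
  have "x \<noteq> 0" using xD D_nonzero by auto
  then obtain i where i: "x $ i \<noteq> 0" by (auto simp: vec_eq_iff)
  define c where "c = x $ i"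
  define p where "p = inverse c *s x"
  have c: "c \<noteq> 0" "x = c *s p" "p = inverse c *s x" "p $ i = 1" using i by (simp_all add: c_def p_def)
  have p: "p \<in> D"
  proof (rule g_base)
    show "p \<noteq> 0" using c(4) by auto
    show "ev (g k) p = 0" if "k < q" for k
      using poly_val_forms_scale[OF g_form[OF that], of "inverse c" "($) x"] g_D[OF that xD]
      by (simp add: p_def ev_def smult_component_fun)
  qed
  have ps: "\<not> indep_at t p" using indep_at_scale[of t p c] c(1) sing unfolding c(2)[symmetric] by auto
  note n = node_local_normalised[OF t p c(4) ps]
  have bij: "open ((*s) c ` S)" if "open S" for S :: "(complex^'n) set"
  proof -
    have "(*s) c ` S = (*s) (inverse c) -` S"
    proof
      show "(*s) c ` S \<subseteq> (*s) (inverse c) -` S" using c(1) by auto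
      show "(*s) (inverse c) -` S \<subseteq> (*s) c ` S"
      proof
        fix z assume "z \<in> (*s) (inverse c) -` S"
        then show "z \<in> (*s) c ` S" using c(1) by (intro image_eqI[of _ _ "inverse c *s z"]) auto
      qed
    qed
    moreover have "continuous_on UNIV (\<lambda>z. inverse c *s (z :: complex^'n))"
      unfolding vector_scalar_mult_def by (intro continuous_on_vec_lambda continuous_intros)
    ultimately show ?thesis using that by (metis open_vimage)
  qed
  obtain N where N: "open N" "p \<in> N" "connected (N \<inter> R t)" using n(1) by blast
  have cont: "continuous_on S (\<lambda>z. c *s (z :: complex^'n))" for S
    unfolding vector_scalar_mult_def by (intro continuous_on_vec_lambda continuous_intros)
  have "(*s) c ` N \<inter> R t = (*s) c ` (N \<inter> R t)"
    using R_scale_iff[OF c(1)] by auto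
  then have "connected ((*s) c ` N \<inter> R t)" using connected_continuous_image[OF cont N(3)] by simp
  then show "\<exists>N. open N \<and> x \<in> N \<and> connected (N \<inter> R t)" using bij[OF N(1)] N(2) c(2) by blast
  have "(*s) c ` closure (R t) \<subseteq> closure ((*s) c ` R t)" by (rule image_closure_subset[OF cont]) (auto intro: closure_subset[THEN subsetD])
  also have "\<dots> \<subseteq> closure (R t)" using R_scale[OF _ c(1)] by (intro closure_mono) auto
  finally show "x \<in> closure (R t)" using n(2) c(2) by blast
  show "ordinary_double_point (F t ` {..<r}) x"
    using ordinary_double_point_scale[OF c(1) n(3)] c(2) by simp
qed

end

section \<open>Smooth points in families\<close>

text \<open>The additional index \<open>None\<close> carries the parameter of a family, so that the
  inverse function theorem can be applied to the total space.\<close>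

definition emb :: "complex^'n::finite \<Rightarrow> complex \<Rightarrow> complex^'n option" where
  "emb x \<tau> = (\<chi> a. case a of None \<Rightarrow> \<tau> | Some k \<Rightarrow> x $ k)"

definition prj :: "complex^'n option \<Rightarrow> complex^'n::finite" where
  "prj z = (\<chi> k. z $ Some k)"

lemma emb_simps [simp]: "emb x \<tau> $ None = \<tau>" "emb x \<tau> $ Some k = x $ k" "prj z $ k = z $ Some k" "prj (emb x \<tau>) = x"
  by (simp_all add: emb_def prj_def vec_eq_iff)

lemma emb_prj: "emb (prj z) (z $ None) = z"
  by (simp add: vec_eq_iff split_option_all)

lemma vec_option_eqI: "z $ None = w $ None \<Longrightarrow> (\<And>k. z $ Some k = w $ Some k) \<Longrightarrow> z = w"
  by (simp add: vec_eq_iff split_option_all)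

lemma continuous_on_emb: "continuous_on S (\<lambda>p. emb (fst p) (snd p))"
  unfolding emb_def
proof (rule continuous_on_vec_lambda)
  fix o' :: "'a option"
  show "continuous_on S (\<lambda>p. case o' of None \<Rightarrow> snd p | Some k \<Rightarrow> fst p $ k)"
    by (cases o') (auto intro!: continuous_intros)
qed

lemma continuous_on_prj: "continuous_on S f \<Longrightarrow> continuous_on S (\<lambda>x. prj (f x))"
  unfolding prj_def by (intro continuous_on_vec_lambda continuous_on_component)

context base_locus
begin

lemma smooth_frame:
  assumes "indep_at t x"
  shows "\<exists>J jj. bij_betw jj J {..<r} \<and> det (jacM J (\<lambda>k. F t (jj k)) x) \<noteq> 0"
proof -
  define gr where "gr j = grad (F t j) x" for j
  have rel: "\<forall>j<r. lam j = 0" if l: "(\<Sum>j<r. lam j *s gr j) = 0" for lam :: "nat \<Rightarrow> complex"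
  proof -
    have "(\<Sum>j<r. lam j * dv (F t j) x v) = dotp (\<Sum>j<r. lam j *s gr j) v" for v
      unfolding dv_grad gr_def dotp_def
      by (simp add: sum_distrib_left sum_distrib_right mult.assoc) (rule sum.swap)
    then have "\<forall>v. (\<Sum>j<r. lam j * dv (F t j) x v) = 0" using l by (simp add: dotp_linear)
    then show ?thesis using assms unfolding indep_at_def by blast
  qed
  have inj: "inj_on gr {..<r}"
  proof (rule inj_onI, rule ccontr)
    fix a b assume ab: "a \<in> {..<r}" "b \<in> {..<r}" "gr a = gr b" "a \<noteq> b"
    define lam where "lam j = (if j = a then 1 else if j = b then - 1 else 0 :: complex)" for j
    have "(\<Sum>j<r. lam j *s gr j) = (\<Sum>j\<in>{a, b}. lam j *s gr j)"
      by (rule sum.mono_neutral_right) (use ab in \<open>auto simp: lam_def\<close>)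
    also have "\<dots> = 0" using ab by (simp add: lam_def)
    finally have "lam a = 0" using rel ab(1) by blast
    then show False by (simp add: lam_def)
  qed
  have ind: "vec.independent (gr ` {..<r})"
  proof
    assume "vec.dependent (gr ` {..<r})"
    then obtain u v where uv: "v \<in> gr ` {..<r}" "u v \<noteq> 0" "(\<Sum>v\<in>gr ` {..<r}. u v *s v) = 0"
      by (auto simp: vec.dependent_finite)
    have "(\<Sum>j<r. u (gr j) *s gr j) = 0" using uv(3) by (simp add: sum.reindex[OF inj])
    from rel[OF this] show False using uv(1,2) by auto
  qed
  have ind': "vec.independent (gr ` {..<r} \<union> (\<lambda>k. axis k 1) ` {})" "gr ` {..<r} \<inter> (\<lambda>k. axis k 1) ` {} = {}"
    using ind by auto
  obtain J \<phi> where J: "bij_betw \<phi> J (gr ` {..<r})"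
    "det (\<chi> k. if k \<in> J then \<phi> k else axis k (1::complex)) \<noteq> 0"
    by (rule extend_frame[OF ind']) (rule that)
  define jj where "jj = inv_into {..<r} gr \<circ> \<phi>"
  have bij: "bij_betw jj J {..<r}" unfolding jj_def
    by (rule bij_betw_trans[OF J(1) bij_betw_inv_into]) (simp add: bij_betw_def inj)
  have "gr (jj k) = \<phi> k" if "k \<in> J" for k
    unfolding jj_def comp_apply by (rule f_inv_into_f) (use J(1) that in \<open>auto simp: bij_betw_def\<close>)
  then have "jacM J (\<lambda>k. F t (jj k)) x = (\<chi> k. if k \<in> J then \<phi> k else axis k 1)"
    by (auto simp: vec_eq_iff jacM_def gr_def grad_def axis_def)
  then have "det (jacM J (\<lambda>k. F t (jj k)) x) \<noteq> 0" using J(2) by simp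
  with bij show ?thesis by (intro exI[of _ J] exI[of _ jj]) (rule conjI)
qed

lemma smooth_frame_indep:
  assumes jj: "bij_betw jj J {..<r}" and det: "det (jacM J (\<lambda>k. F t (jj k)) z) \<noteq> 0"
  shows "indep_at t z"
  unfolding indep_at_def
proof (intro allI impI)
  fix \<mu> j assume mu: "\<forall>v. (\<Sum>j<r. \<mu> j * dv (F t j) z v) = 0" and j: "j < r"
  have "j \<in> jj ` J" using jj j by (simp add: bij_betw_def)
  then obtain k where k: "k \<in> J" "j = jj k" by blast
  define v where "v = fcol (jacM J (\<lambda>k. F t (jj k)) z) k"
  have d: "dv (F t (jj m)) z v = (if m = k then 1 else 0)" if "m \<in> J" for m
    using arg_cong[OF fcol[OF det, of k], of "\<lambda>a. a $ m"] that unfolding jacM_mult v_def by (auto simp: axis_def)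
  have "(\<Sum>j<r. \<mu> j * dv (F t j) z v) = (\<Sum>m\<in>J. \<mu> (jj m) * dv (F t (jj m)) z v)"
    by (rule sum.reindex_bij_betw[OF jj, symmetric])
  also have "\<dots> = (\<Sum>m\<in>J. if m = k then \<mu> j else 0)"
    by (rule sum.cong) (use d k in auto)
  finally show "\<mu> j = 0" using k mu[rule_format, of v] by simp
qed

text \<open>The chart of a family, relative to its parameter: the coordinate \<open>None\<close> is
  kept, and the equations of the member at that parameter replace the coordinates in
  \<open>J\<close>.\<close>

definition fch :: "(complex \<Rightarrow> nat \<times> nat \<Rightarrow> complex) \<Rightarrow> 'n set \<Rightarrow> ('n \<Rightarrow> nat) \<Rightarrow> complex^'n option \<Rightarrow> complex^'n option" where
  "fch tt J jj z = emb (chart J (\<lambda>k. F (tt (z $ None)) (jj k)) (prj z)) (z $ None)"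

lemma hol_fch:
  assumes tt: "\<And>v. polyfn {()} (\<lambda>z. tt (z ()) v)" and U: "open U"
  shows "holomorphic_on_open (\<lambda>z. fch tt J jj z $ o') U"
proof (cases o')
  case None
  then show ?thesis by (simp add: fch_def hol_coord U)
next
  case (Some k)
  have "holomorphic_on_open (\<lambda>z. ev (F (tt (z $ None)) j) (prj z)) U" for j
    unfolding ev_F
  proof (intro hol_sum hol_mult U)
    show "holomorphic_on_open (\<lambda>z. tt (z $ None) (j, i)) U" for i
      using hol_polyfn[OF tt U, of "\<lambda>z _. z $ None"] by (simp add: hol_coord U)
    show "holomorphic_on_open (\<lambda>z. ev (g i) (prj z)) U" for i
      by (rule hol_compose(1)[OF hol_ev[OF open_UNIV]]) (auto intro: hol_coord U)
  qed
  then show ?thesis using Some by (cases "k \<in> J") (simp_all add: fch_def chart_def hol_coord U)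
qed

lemma jac_fch:
  assumes tt: "\<And>v. polyfn {()} (\<lambda>z. tt (z ()) v)"
  shows "jac (fch tt J jj) (emb z \<tau>) (emb v 0) = emb (jacM J (\<lambda>k. F (tt \<tau>) (jj k)) z *v v) 0"
proof (rule vec_option_eqI)
  have line: "((\<lambda>s. fch tt J jj (emb z \<tau> + s *s emb v 0) $ o') has_field_derivative jac (fch tt J jj) (emb z \<tau>) (emb v 0) $ o') (at 0)" for o'
    unfolding jac_def vec_lambda_beta
    by (rule hol_curve[OF hol_fch[OF tt open_UNIV], where c = "\<lambda>s. emb z \<tau> + s *s emb v 0" and \<tau> = 0, simplified])
      (auto intro!: derivative_eq_intros)
  have "((\<lambda>s. \<tau>) has_field_derivative jac (fch tt J jj) (emb z \<tau>) (emb v 0) $ None) (at 0)"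
    using line[of None] by (simp add: fch_def)
  then show "jac (fch tt J jj) (emb z \<tau>) (emb v 0) $ None = emb (jacM J (\<lambda>k. F (tt \<tau>) (jj k)) z *v v) 0 $ None"
    using DERIV_unique[OF _ DERIV_const] by force
  fix k
  have p: "prj (emb z \<tau> + s *s emb v 0) = z + s *s v" for s by (simp add: vec_eq_iff)
  have 1: "((\<lambda>s. chart J (\<lambda>k. F (tt \<tau>) (jj k)) (z + s *s v) $ k) has_field_derivative
      jac (fch tt J jj) (emb z \<tau>) (emb v 0) $ Some k) (at 0)"
    using line[of "Some k"] by (simp add: fch_def p)
  have c: "((\<lambda>s. (z + s *s v) $ l) has_field_derivative v $ l) (at 0)" for l
    by (auto intro!: derivative_eq_intros)
  have "((\<lambda>s. chart J (\<lambda>k. F (tt \<tau>) (jj k)) (z + s *s v) $ k) has_field_derivative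
      (jacM J (\<lambda>k. F (tt \<tau>) (jj k)) z *v v) $ k) (at 0)"
    unfolding jacM_mult
    using c[of k] poly_val_chain[of "\<lambda>s. ($) (z + s *s v)" "($) v" 0 "F (tt \<tau>) (jj k)", OF c]
    by (cases "k \<in> J") (simp_all add: chart_def ev_def dv_def)
  then show "jac (fch tt J jj) (emb z \<tau>) (emb v 0) $ Some k = emb (jacM J (\<lambda>k. F (tt \<tau>) (jj k)) z *v v) 0 $ Some k"
    using DERIV_unique[OF 1] by simp
qed

text \<open>The last clause is the identity theorem on the fibres of the patch.\<close>

definition smooth_patch :: "(complex \<Rightarrow> nat \<times> nat \<Rightarrow> complex) \<Rightarrow> ((complex^'n) \<times> complex) set \<Rightarrow> bool" where
  "smooth_patch tt N \<longleftrightarrow> open N \<and>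
    (\<forall>z \<tau>. (z, \<tau>) \<in> N \<longrightarrow> z \<in> X (tt \<tau>) \<longrightarrow> z \<in> R (tt \<tau>)) \<and>
    (\<forall>\<tau>. connected {z. (z, \<tau>) \<in> N \<and> z \<in> X (tt \<tau>)}) \<and>
    (\<forall>z \<tau> V. (z, \<tau>) \<in> N \<longrightarrow> z \<in> X (tt \<tau>) \<longrightarrow> open V \<longrightarrow> z \<in> V \<longrightarrow>
      (\<exists>\<delta>>0. \<forall>\<tau>'\<in>ball \<tau> \<delta>. \<exists>z'\<in>V. (z', \<tau>') \<in> N \<and> z' \<in> X (tt \<tau>'))) \<and>
    (\<forall>f z0 \<tau> V z. (z0, \<tau>) \<in> N \<longrightarrow> z0 \<in> X (tt \<tau>) \<longrightarrow> open V \<longrightarrow> z0 \<in> V \<longrightarrow>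
      (\<forall>z\<in>V. (z, \<tau>) \<in> N \<longrightarrow> z \<in> X (tt \<tau>) \<longrightarrow> ev f z = 0) \<longrightarrow> (z, \<tau>) \<in> N \<longrightarrow> z \<in> X (tt \<tau>) \<longrightarrow> ev f z = 0)"

text \<open>The relative chart turns the members \<open>X (tt \<tau>)\<close> near \<open>y\<close>
  into the slices \<open>S \<tau>\<close> of one polydisc. The slices are convex, which yields
  connectedness and, by restriction to complex lines, the identity theorem; a slice is carried to
  its neighbours by changing the coordinate \<open>None\<close>.\<close>

lemma smooth_family_chart:
  assumes tt: "\<And>v. polyfn {()} (\<lambda>z. tt (z ()) v)" and y: "y \<in> R (tt \<tau>1)"
  shows "\<exists>N. smooth_patch tt N \<and> (y, \<tau>1) \<in> N"
proof -
  have ind: "indep_at (tt \<tau>1) y" using y by (simp add: R_def)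
  obtain J jj where jj: "bij_betw jj J {..<r}" and det: "det (jacM J (\<lambda>k. F (tt \<tau>1) (jj k)) y) \<noteq> 0"
    by (rule smooth_frame[OF ind, THEN exE], elim exE conjE) (rule that)
  define U :: "(complex^'n option) set" where "U = {z. prj z \<noteq> 0}"
  have U: "open U" unfolding U_def by (intro open_Collect_neq continuous_on_prj continuous_intros)
  have yU: "emb y \<tau>1 \<in> U" using y by (auto simp: U_def R_def X_def)
  define f where "f = fch tt J jj"
  have hf: "holomorphic_on_open (\<lambda>z. f z $ o') U" for o' unfolding f_def by (rule hol_fch[OF tt U])
  have f_None: "f z $ None = z $ None" for z by (simp add: f_def fch_def)
  have f_J: "f z $ Some k = ev (F (tt (z $ None)) (jj k)) (prj z)" if "k \<in> J" for z k using that by (simp add: f_def fch_def chart_def)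
  have inj: "v = 0" if v: "jac f (emb y \<tau>1) v = 0" for v
  proof -
    have "jac f (emb y \<tau>1) v $ None = v $ None"
      unfolding jac_def vec_lambda_beta f_None pdc_coord by (simp add: if_distrib[of "\<lambda>x. x * _"] cong: if_cong)
    then have v0: "v $ None = 0" using v by simp
    have "v = emb (prj v) 0" using emb_prj[of v] v0 by simp
    then have "emb (jacM J (\<lambda>k. F (tt \<tau>1) (jj k)) y *v prj v) 0 = 0" using v jac_fch[OF tt, where J = J and jj = jj and z = y and \<tau> = \<tau>1 and v = "prj v"] by (simp add: f_def)
    then have "prj (emb (jacM J (\<lambda>k. F (tt \<tau>1) (jj k)) y *v prj v) 0) = prj 0" by simp
    then have "jacM J (\<lambda>k. F (tt \<tau>1) (jj k)) y *v prj v = 0" by (simp add: vec_eq_iff)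
    then have "prj v = 0" using det_nonzero_inj[OF det] by blast
    then show "v = 0" using \<open>v = emb (prj v) 0\<close> by (simp add: vec_eq_iff split_option_all)
  qed
  show ?thesis
  proof (rule hol_inverse_function[of f U "emb y \<tau>1", OF hf yU inj])
    fix \<epsilon> N h
    assume e: "\<epsilon> > 0" and N: "open N" "emb y \<tau>1 \<in> N" "N \<subseteq> U" and hom: "homeomorphism N (pbox (f (emb y \<tau>1)) \<epsilon>) f h"
      and hol: "\<And>o'. holomorphic_on_open (\<lambda>w. h w $ o') (pbox (f (emb y \<tau>1)) \<epsilon>)"
      and reg: "\<And>z v. z \<in> N \<Longrightarrow> jac f z v = 0 \<Longrightarrow> v = 0"
    define B where "B = pbox (f (emb y \<tau>1)) \<epsilon>"
    note hom = hom[folded B_def] and hol = hol[folded B_def]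
    have fh: "w \<in> B \<Longrightarrow> f (h w) = w" "w \<in> B \<Longrightarrow> h w \<in> N" "z \<in> N \<Longrightarrow> h (f z) = z" "z \<in> N \<Longrightarrow> f z \<in> B" for w z
      using hom by (auto simp: homeomorphism_def)
    have oB: "open B" "convex B" unfolding B_def by (rule open_pbox, rule convex_pbox)
    have h_None: "h w $ None = w $ None" if "w \<in> B" for w using f_None[of "h w"] fh(1)[OF that] by simp
    define M where "M = {p. emb (fst p) (snd p) \<in> N}"
    have M: "(z, \<tau>) \<in> M \<longleftrightarrow> emb z \<tau> \<in> N" for z \<tau> by (simp add: M_def)
    have oM: "open M" using open_vimage[OF N(1) continuous_on_emb[of UNIV]] by (simp add: M_def vimage_def)
    define S where "S \<tau> = {w\<in>B. w $ None = \<tau> \<and> (\<forall>k\<in>J. w $ Some k = 0)}" for \<tau>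
    have inX: "z \<in> X (tt \<tau>) \<longleftrightarrow> f (emb z \<tau>) \<in> S \<tau>" if "emb z \<tau> \<in> N" for z \<tau>
    proof -
      have "z \<noteq> 0" using that N(3) by (auto simp: U_def)
      then have "z \<in> X (tt \<tau>) \<longleftrightarrow> (\<forall>j\<in>jj ` J. ev (F (tt \<tau>) j) z = 0)"
        using jj by (auto simp: X_def bij_betw_def)
      also have "\<dots> \<longleftrightarrow> f (emb z \<tau>) \<in> S \<tau>" using fh(4)[OF that] by (auto simp: S_def f_J f_None)
      finally show ?thesis .
    qed
    have hS: "emb (prj (h w)) \<tau> = h w" if "w \<in> S \<tau>" for w \<tau>
      using emb_prj[of "h w"] h_None[of w] that by (simp add: S_def)
    have SX: "(prj (h w), \<tau>) \<in> M \<and> prj (h w) \<in> X (tt \<tau>)" if w: "w \<in> S \<tau>" for w \<tau>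
    proof -
      have "w \<in> B" using w by (simp add: S_def)
      then show ?thesis using inX[of "prj (h w)" \<tau>] w fh(1,2) unfolding M hS[OF w] by simp
    qed
    have conth: "continuous_on B h" using hom homeomorphism_cont2 by blast
    have "smooth_patch tt M"
      unfolding smooth_patch_def
    proof (intro conjI allI impI oM)
      fix z \<tau> assume z: "(z, \<tau>) \<in> M" "z \<in> X (tt \<tau>)"
      have "det (jacM J (\<lambda>k. F (tt \<tau>) (jj k)) z) \<noteq> 0"
      proof (rule inj_imp_det_nonzero)
        fix v assume "jacM J (\<lambda>k. F (tt \<tau>) (jj k)) z *v v = 0"
        then have "jac f (emb z \<tau>) (emb v 0) = 0" unfolding f_def jac_fch[OF tt] by (simp add: vec_eq_iff split_option_all)
        then have "emb v 0 = 0" using reg z(1) M by blast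
        then have "prj (emb v 0) = prj 0" by simp
        then show "v = 0" by (simp add: vec_eq_iff)
      qed
      then show "z \<in> R (tt \<tau>)" using z(2) smooth_frame_indep[OF jj] by (simp add: R_def)
    next
      fix \<tau>
      have "{z. (z, \<tau>) \<in> M \<and> z \<in> X (tt \<tau>)} = (\<lambda>w. prj (h w)) ` S \<tau>"
      proof
        show "(\<lambda>w. prj (h w)) ` S \<tau> \<subseteq> {z. (z, \<tau>) \<in> M \<and> z \<in> X (tt \<tau>)}" using SX by auto
        show "{z. (z, \<tau>) \<in> M \<and> z \<in> X (tt \<tau>)} \<subseteq> (\<lambda>w. prj (h w)) ` S \<tau>"
        proof clarify
          fix z assume z: "(z, \<tau>) \<in> M" "z \<in> X (tt \<tau>)"
          then show "z \<in> (\<lambda>w. prj (h w)) ` S \<tau>"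
            using inX[of z \<tau>] fh(3)[of "emb z \<tau>"] unfolding M by (intro image_eqI[of _ _ "f (emb z \<tau>)"]) auto
        qed
      qed
      moreover have "convex (S \<tau>)"
      proof (rule convexI)
        fix a b and u v :: real assume *: "a \<in> S \<tau>" "b \<in> S \<tau>" "0 \<le> u" "0 \<le> v" "u + v = 1"
        have "u *\<^sub>R a + v *\<^sub>R b \<in> B" using * oB(2) by (auto simp: S_def convex_def)
        moreover have "u *\<^sub>R \<tau> + v *\<^sub>R \<tau> = \<tau>" using *(5) by (metis scaleR_left_distrib scaleR_one)
        ultimately show "u *\<^sub>R a + v *\<^sub>R b \<in> S \<tau>" using * by (simp add: S_def)
      qed
      moreover have "continuous_on (S \<tau>) (\<lambda>w. prj (h w))"
        by (rule continuous_on_prj, rule continuous_on_subset[OF conth]) (auto simp: S_def)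
      ultimately show "connected {z. (z, \<tau>) \<in> M \<and> z \<in> X (tt \<tau>)}"
        by (metis connected_continuous_image convex_connected)
    next
      fix z \<tau> V assume z: "(z, \<tau>) \<in> M" "z \<in> X (tt \<tau>)" "open V" "z \<in> V"
      \<comment> \<open>Only the coordinate \<open>None\<close> moves, so the curve passes through
        the neighbouring slices.\<close>
      define w where "w \<tau>' = f (emb z \<tau>) + (\<tau>' - \<tau>) *s axis None 1" for \<tau>'
      have w: "w \<tau>' $ None = \<tau>'" "w \<tau>' $ Some k = f (emb z \<tau>) $ Some k" for \<tau>' k
        by (simp_all add: w_def f_None axis_def)
      have w\<tau>: "w \<tau> = f (emb z \<tau>)" by (simp add: w_def)
      have zS: "f (emb z \<tau>) \<in> S \<tau>" using inX z M by blast
      have "open (B \<inter> (\<lambda>w. prj (h w)) -` V)"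
        by (rule continuous_open_preimage[OF continuous_on_prj[OF conth] oB(1) z(3)])
      moreover have "continuous_on UNIV w"
        unfolding w_def vector_scalar_mult_def by (intro continuous_intros continuous_on_vec_lambda)
      ultimately have "open (w -` (B \<inter> (\<lambda>w. prj (h w)) -` V))" by (rule open_vimage)
      moreover have "\<tau> \<in> w -` (B \<inter> (\<lambda>w. prj (h w)) -` V)" using zS z(4) fh(3)[of "emb z \<tau>"] z(1) M w\<tau> by (simp add: S_def)
      ultimately obtain \<delta> where \<delta>: "\<delta> > 0" "ball \<tau> \<delta> \<subseteq> w -` (B \<inter> (\<lambda>w. prj (h w)) -` V)"
        using open_contains_ball by blast
      have "\<exists>z'\<in>V. (z', \<tau>') \<in> M \<and> z' \<in> X (tt \<tau>')" if "\<tau>' \<in> ball \<tau> \<delta>" for \<tau>'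
      proof -
        have "w \<tau>' \<in> S \<tau>'" using that \<delta>(2) zS by (auto simp: S_def w)
        from SX[OF this] show ?thesis using that \<delta>(2) by (intro bexI[of _ "prj (h (w \<tau>'))"]) auto
      qed
      then show "\<exists>\<delta>>0. \<forall>\<tau>'\<in>ball \<tau> \<delta>. \<exists>z'\<in>V. (z', \<tau>') \<in> M \<and> z' \<in> X (tt \<tau>')" using \<delta>(1) by blast
    next
      fix e z0 \<tau> V z
      assume z0: "(z0, \<tau>) \<in> M" "z0 \<in> X (tt \<tau>)" and V: "open V" "z0 \<in> V"
        and van: "\<forall>z\<in>V. (z, \<tau>) \<in> M \<longrightarrow> z \<in> X (tt \<tau>) \<longrightarrow> ev e z = 0" and z: "(z, \<tau>) \<in> M" "z \<in> X (tt \<tau>)"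
      define a where "a = f (emb z0 \<tau>)"
      define v where "v = f (emb z \<tau>) - a"
      have aS: "a \<in> S \<tau>" using inX z0 M by (auto simp: a_def)
      have bS: "f (emb z \<tau>) \<in> S \<tau>" using inX z M by auto
      have vJ: "v $ None = 0" "\<And>k. k \<in> J \<Longrightarrow> v $ Some k = 0" using aS bS by (auto simp: v_def S_def)
      define \<Omega> where "\<Omega> = {s. a + s *s v \<in> B}"
      have \<Omega>: "open \<Omega>" "convex \<Omega>" "0 \<in> \<Omega>" "1 \<in> \<Omega>"
        unfolding \<Omega>_def by (rule open_line_preimage[OF oB(1)], rule convex_line_preimage[OF oB(2)])
          (use aS bS in \<open>auto simp: S_def v_def\<close>)
      have lS: "a + s *s v \<in> S \<tau>" if "s \<in> \<Omega>" for s using that aS vJ by (auto simp: \<Omega>_def S_def)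
      define c where "c s = prj (h (a + s *s v))" for s
      have "((\<lambda>s. h (a + s *s v) $ o') has_field_derivative (\<Sum>k\<in>UNIV. pdc (\<lambda>w. h w $ o') k (a + s *s v) * v $ k)) (at s)"
        if "s \<in> \<Omega>" for s o'
        by (rule hol_curve[OF hol]) (use that in \<open>auto intro!: derivative_eq_intros simp: \<Omega>_def\<close>)
      then have hc: "(\<lambda>s. c s $ k) holomorphic_on \<Omega>" for k
        unfolding c_def holomorphic_on_def field_differentiable_def by (auto intro: has_field_derivative_at_within)
      have hol1: "(\<lambda>s. ev e (c s)) holomorphic_on \<Omega>"
        unfolding ev_def by (rule holomorphic_on_polyfn[OF polyfn_poly_val_UNIV]) (rule hc)
      have "continuous_on \<Omega> (\<lambda>s. \<chi> k. c s $ k)"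
        by (intro continuous_on_vec_lambda holomorphic_on_imp_continuous_on hc)
      then have cc: "continuous_on \<Omega> c" by simp
      define S' where "S' = \<Omega> \<inter> c -` V"
      have c0: "c 0 = z0" using fh(3)[of "emb z0 \<tau>"] z0(1) M by (simp add: c_def a_def)
      have c1: "c 1 = z" using fh(3)[of "emb z \<tau>"] z(1) M by (simp add: c_def v_def)
      have "ev e (c 1) = 0"
      proof (rule analytic_continuation_open[of S' \<Omega> "\<lambda>s. ev e (c s)" "\<lambda>_. 0"])
        show "open S'" unfolding S'_def by (rule continuous_open_preimage[OF cc \<Omega>(1) V(1)])
        show "S' \<noteq> {}" using \<Omega>(3) c0 V(2) by (auto simp: S'_def)
        show "ev e (c s) = 0" if s: "s \<in> S'" for s
          using van SX[OF lS[of s]] s by (auto simp: S'_def c_def)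
      qed (use \<Omega> hol1 convex_connected in \<open>auto simp: S'_def\<close>)
      then show "ev e z = 0" by (simp add: c1)
    qed
    then show ?thesis using M N(2) by blast
  qed
qed

text \<open>At a smooth point the tangent space of the cone \<open>X t\<close> has dimension 4 and
  that of \<open>D\<close> has dimension 3. A curve on \<open>X t\<close> whose velocity is not
  tangent to \<open>D\<close> has to leave \<open>D\<close>.\<close>

lemma off_D_near:
  assumes x: "x \<in> R t" "x \<in> D" and V: "open V" "x \<in> V"
  shows "\<exists>z\<in>V. z \<in> X t \<and> z \<notin> D"
proof (rule ccontr)
  assume *: "\<not> (\<exists>z\<in>V. z \<in> X t \<and> z \<notin> D)"
  have ind: "indep_at t x" using x by (simp add: R_def)
  obtain J jj where jj: "bij_betw jj J {..<r}" and det: "det (jacM J (\<lambda>k. F t (jj k)) x) \<noteq> 0"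
    by (rule smooth_frame[OF ind, THEN exE], elim exE conjE) (rule that)
  define G where "G k = F t (jj k)" for k
  note det = det[folded G_def]
  have cJ: "card J = r" using bij_betw_same_card[OF jj] by simp
  define K where "K = {v. \<forall>k\<in>J. (jacM J G x *v v) $ k = 0}"
  have dK: "vec.dim K = 4"
    unfolding K_def kernel_dim[OF det] using card_n cJ by (simp add: Compl_eq_Diff_UNIV card_Diff_subset)
  define T where "T = {v. \<forall>i<q. dv (g i) x v = 0}"
  have dT: "vec.dim T = 3" unfolding T_def by (rule dim_tangent[OF x(2)])
  have "\<not> K \<subseteq> T" using vec.dim_subset[of K T] dK dT by auto
  then obtain v where v: "v \<in> K" "v \<notin> T" by blast
  then obtain i where i: "i < q" "dv (g i) x v \<noteq> 0" by (auto simp: T_def)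
  have U: "open (V - {0})" "x \<in> V - {0}" using V x(2) D_nonzero by auto
  show False
  proof (rule chart_inverse[OF U det])
    fix \<epsilon> N h
    assume e: "\<epsilon> > 0" and N: "open N" "x \<in> N" "N \<subseteq> V - {0}" and hom: "homeomorphism N (pbox (chart J G x) \<epsilon>) (chart J G) h"
      and hol: "\<And>i. holomorphic_on_open (\<lambda>w. h w $ i) (pbox (chart J G x) \<epsilon>)"
    define w where "w = jacM J G x *v v"
    have b: "chart J G x + 0 *s w \<in> pbox (chart J G x) \<epsilon>" using e by (simp add: pbox_def)
    have h0: "h (chart J G x + 0 *s w) = x" using hom N(2) by (simp add: homeomorphism_def)
    obtain u where u: "\<And>k. ((\<lambda>s. h (chart J G x + s *s w) $ k) has_field_derivative u $ k) (at 0)"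
      "jacM J G (h (chart J G x + 0 *s w)) *v u = w"
      by (rule chart_inverse_curve[OF hom hol b]) (rule that)
    have "jacM J G x *v (u - v) = 0" using u(2)[unfolded h0] by (simp add: matrix_vector_mult_diff_distrib w_def)
    then have uv: "u = v" using det_nonzero_inj[OF det, of "u - v"] by simp
    have 1: "((\<lambda>s. ev (g i) (h (chart J G x + s *s w))) has_field_derivative dv (g i) x v) (at 0)"
      unfolding ev_def dv_def using poly_val_chain[of "\<lambda>s. ($) (h (chart J G x + s *s w))" "($) u" 0 "g i", OF u(1)] h0 uv
      by simp
    define S where "S = {s. chart J G x + s *s w \<in> pbox (chart J G x) \<epsilon>}"
    have S: "open S" "0 \<in> S" unfolding S_def using b by (auto intro: open_line_preimage open_pbox)
    have "((\<lambda>s. 0) has_field_derivative dv (g i) x v) (at 0)"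
    proof (rule has_field_derivative_transform_within_open[OF 1 S])
      fix s assume "s \<in> S"
      then have s: "chart J G x + s *s w \<in> pbox (chart J G x) \<epsilon>" by (simp add: S_def)
      define z where "z = h (chart J G x + s *s w)"
      have zN: "z \<in> N" "chart J G z = chart J G x + s *s w" using hom s by (auto simp: homeomorphism_def z_def)
      have "ev (F t (jj k)) z = 0" if k: "k \<in> J" for k
      proof -
        have "chart J G z $ k = 0"
          unfolding zN(2) using k v(1) x jj by (auto simp: w_def K_def chart_def G_def R_def X_def bij_betw_def)
        then show ?thesis using k by (simp add: chart_def G_def)
      qed
      then have "\<forall>j\<in>jj ` J. ev (F t j) z = 0" by blast
      then have "\<forall>j<r. ev (F t j) z = 0" using jj by (simp add: bij_betw_def Ball_def)
      then have "z \<in> X t" using zN(1) N(3) by (auto simp: X_def)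
      then have "z \<in> D" using * zN(1) N(3) by blast
      then show "ev (g i) (h (chart J G x + s *s w)) = 0" using g_D[OF i(1)] by (simp add: z_def)
    qed
    then have "dv (g i) x v = 0" using DERIV_unique[OF DERIV_const] by metis
    then show False using i by simp
  qed
qed

end

section \<open>Connectedness of the smooth locus\<close>

context base_locus
begin

lemma patch_open: "smooth_patch tt N \<Longrightarrow> open N"
  by (simp add: smooth_patch_def)

lemma patch_R:
  assumes "smooth_patch tt N" "(z, \<tau>) \<in> N" "z \<in> X (tt \<tau>)"
  shows "z \<in> R (tt \<tau>)"
  using assms unfolding smooth_patch_def by (elim conjE) simp

lemma patch_connected:
  assumes "smooth_patch tt N"
  shows "connected {z. (z, \<tau>) \<in> N \<and> z \<in> X (tt \<tau>)}"
  using assms unfolding smooth_patch_def by (elim conjE) simp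

lemma patch_move:
  assumes "smooth_patch tt N" "(z, \<tau>) \<in> N" "z \<in> X (tt \<tau>)" "open V" "z \<in> V"
  shows "\<exists>\<delta>>0. \<forall>\<tau>'\<in>ball \<tau> \<delta>. \<exists>z'\<in>V. (z', \<tau>') \<in> N \<and> z' \<in> X (tt \<tau>')"
proof -
  have "\<forall>z \<tau> V. (z, \<tau>) \<in> N \<longrightarrow> z \<in> X (tt \<tau>) \<longrightarrow> open V \<longrightarrow> z \<in> V \<longrightarrow>
      (\<exists>\<delta>>0. \<forall>\<tau>'\<in>ball \<tau> \<delta>. \<exists>z'\<in>V. (z', \<tau>') \<in> N \<and> z' \<in> X (tt \<tau>'))"
    using assms(1) unfolding smooth_patch_def by (elim conjE)
  from spec[OF spec[OF spec[OF this, of z], of \<tau>], of V] show ?thesis using assms(2-) by simp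
qed

lemma patch_identity:
  assumes "smooth_patch tt N" "(z0, \<tau>) \<in> N" "z0 \<in> X (tt \<tau>)" "open V" "z0 \<in> V"
    "\<And>z. z \<in> V \<Longrightarrow> (z, \<tau>) \<in> N \<Longrightarrow> z \<in> X (tt \<tau>) \<Longrightarrow> ev f z = 0" "(z, \<tau>) \<in> N" "z \<in> X (tt \<tau>)"
  shows "ev f z = 0"
proof -
  have "\<forall>f z0 \<tau> V z. (z0, \<tau>) \<in> N \<longrightarrow> z0 \<in> X (tt \<tau>) \<longrightarrow> open V \<longrightarrow> z0 \<in> V \<longrightarrow>
      (\<forall>z\<in>V. (z, \<tau>) \<in> N \<longrightarrow> z \<in> X (tt \<tau>) \<longrightarrow> ev f z = 0) \<longrightarrow> (z, \<tau>) \<in> N \<longrightarrow> z \<in> X (tt \<tau>) \<longrightarrow> ev f z = 0"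
    using assms(1) unfolding smooth_patch_def by (elim conjE)
  from spec[OF spec[OF spec[OF spec[OF spec[OF this, of f], of z0], of \<tau>], of V], of z] show ?thesis
    using assms(2-) by simp
qed

lemma const_patch:
  assumes "x \<in> R t"
  obtains N where "smooth_patch (\<lambda>_. t) N" "(x, 0) \<in> N" "open {z. (z, 0) \<in> N}"
proof -
  have "\<exists>N. smooth_patch (\<lambda>_. t) N \<and> (x, 0) \<in> N"
    by (rule smooth_family_chart[where tt = "\<lambda>_. t"]) (use assms in \<open>auto intro: polyfn_const\<close>)
  then obtain N where N: "smooth_patch (\<lambda>_. t) N" "(x, 0) \<in> N" by (elim exE conjE)
  have "open ((\<lambda>z. (z, 0)) -` N)"
    by (rule open_vimage[OF patch_open[OF N(1)]]) (intro continuous_intros)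
  then have "open {z. (z, 0) \<in> N}" by (simp add: vimage_def)
  with N that show thesis by blast
qed

lemma R_subset_X: "R t \<subseteq> X t"
  by (auto simp: R_def)

lemma smooth_local:
  assumes "x \<in> R t"
  shows "\<exists>N. open N \<and> x \<in> N \<and> connected (N \<inter> R t)"
proof -
  obtain N where N: "smooth_patch (\<lambda>_. t) N" "(x, 0) \<in> N" "open {z. (z, 0) \<in> N}"
    using const_patch[OF assms] .
  have "{z. (z, 0) \<in> N \<and> z \<in> X t} = {z. (z, 0) \<in> N} \<inter> R t"
    using patch_R[OF N(1)] R_subset_X by auto
  with patch_connected[OF N(1), of 0] have "connected ({z. (z, 0) \<in> N} \<inter> R t)" by simp
  with N show ?thesis by blast
qed

lemma local_connected:
  assumes "good t" "x \<in> X t"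
  shows "\<exists>N. open N \<and> x \<in> N \<and> connected (N \<inter> R t)" "x \<in> closure (R t)"
proof -
  show "\<exists>N. open N \<and> x \<in> N \<and> connected (N \<inter> R t)"
    using smooth_local node_local(1)[OF assms] by blast
  show "x \<in> closure (R t)" using node_local(2)[OF assms] closure_subset by blast
qed

lemma off_D_component:
  assumes x: "x \<in> R t" "x \<in> D"
  shows "\<exists>z. z \<in> X t \<and> z \<notin> D \<and> connected_component (R t) z x"
proof -
  obtain N where N: "smooth_patch (\<lambda>_. t) N" "(x, 0) \<in> N" "open {z. (z, 0) \<in> N}"
    using const_patch[OF x(1)] .
  obtain z where z: "z \<in> {z. (z, 0) \<in> N}" "z \<in> X t" "z \<notin> D"
    using off_D_near[OF x N(3)] N(2) by blast
  have "connected_component (R t) z x"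
    unfolding connected_component_def
    by (intro exI[of _ "{z. (z, 0) \<in> N \<and> z \<in> X t}"])
      (use patch_connected[OF N(1), of 0] patch_R[OF N(1)] z N(2) x R_subset_X in auto)
  then show ?thesis using z by blast
qed

lemma scale_component:
  assumes "x \<in> R t" "c \<noteq> 0"
  shows "connected_component (R t) x (c *s x)"
  unfolding connected_component_def
proof (intro exI conjI)
  have "continuous_on (- {0}) (\<lambda>c. c *s x)"
    unfolding vector_scalar_mult_def by (intro continuous_on_vec_lambda continuous_intros)
  then show "connected ((\<lambda>c. c *s x) ` (- {0}))"
    using connected_continuous_image connected_open_delete_finite[of UNIV "{0::complex}"]
    by (auto simp: Compl_eq_Diff_UNIV)
  show "(\<lambda>c. c *s x) ` (- {0}) \<subseteq> R t" using R_scale[OF assms(1)] by auto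
  show "x \<in> (\<lambda>c. c *s x) ` (- {0})" by (intro image_eqI[of _ _ 1]) auto
  show "c *s x \<in> (\<lambda>c. c *s x) ` (- {0})" using assms(2) by blast
qed

text \<open>\<open>Q y\<close> says that all points near \<open>y\<close> on the members near
  \<open>\<tau>1\<close> are joined to \<open>x0\<close> within the smooth loci. It holds at
  \<open>x0\<close>, which lies on every member, and spreads inside each smooth patch; hence it
  holds along the connected set that joins \<open>x0\<close> to \<open>x \<tau>1\<close>.\<close>

lemma component_open:
  assumes tt: "\<And>v. polyfn {()} (\<lambda>z. tt (z ()) v)" and x: "continuous_on UNIV x" "open W" "\<tau>1 \<in> W" "\<And>\<tau>. \<tau> \<in> W \<Longrightarrow> x \<tau> \<in> X (tt \<tau>)"
    and con: "connected_component (R (tt \<tau>1)) (x \<tau>1) x0"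
  shows "\<exists>\<delta>>0. \<forall>\<tau>\<in>ball \<tau>1 \<delta>. connected_component (R (tt \<tau>)) (x \<tau>) x0"
proof -
  define Q where "Q y \<longleftrightarrow> (\<exists>M \<delta>. open M \<and> y \<in> M \<and> \<delta> > 0 \<and>
    (\<forall>\<tau>\<in>ball \<tau>1 \<delta>. \<forall>z\<in>M \<inter> X (tt \<tau>). connected_component (R (tt \<tau>)) z x0))" for y
  have box: "\<exists>A \<delta>. open A \<and> y \<in> A \<and> \<delta> > 0 \<and> A \<times> ball \<tau>1 \<delta> \<subseteq> N" if "open N" "(y, \<tau>1) \<in> N" for N y
  proof -
    obtain A B where "open A" "open B" "(y, \<tau>1) \<in> A \<times> B" "A \<times> B \<subseteq> N" using open_prod_elim[OF \<open>open N\<close> \<open>(y, \<tau>1) \<in> N\<close>] by blast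
    moreover then obtain \<delta> where "\<delta> > 0" "ball \<tau>1 \<delta> \<subseteq> B" using open_contains_ball by blast
    ultimately show ?thesis by (intro exI[of _ A] exI[of _ \<delta>]) auto
  qed
  have link: "connected_component (R (tt \<tau>)) z z'"
    if "smooth_patch tt N" "(z, \<tau>) \<in> N" "z \<in> X (tt \<tau>)" "(z', \<tau>) \<in> N" "z' \<in> X (tt \<tau>)" for N z z' \<tau>
    unfolding connected_component_def
    by (intro exI[of _ "{z. (z, \<tau>) \<in> N \<and> z \<in> X (tt \<tau>)}"])
      (use patch_connected[OF that(1), of \<tau>] patch_R[OF that(1)] that in auto)
  obtain S where S: "connected S" "S \<subseteq> R (tt \<tau>1)" "x \<tau>1 \<in> S" "x0 \<in> S"
    using con unfolding connected_component_def by blast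
  have "Q (x \<tau>1)"
  proof (rule connected_induction_simple[OF S(1) S(4) S(3), where P = Q])
    have "x0 \<in> R (tt \<tau>1)" using S by blast
    from smooth_family_chart[OF tt this] obtain N where N: "smooth_patch tt N" "(x0, \<tau>1) \<in> N" by (elim exE conjE)
    obtain A \<delta> where A: "open A" "x0 \<in> A" "\<delta> > 0" "A \<times> ball \<tau>1 \<delta> \<subseteq> N" using box[OF patch_open[OF N(1)] N(2)] by blast
    have "connected_component (R (tt \<tau>)) z x0" if "\<tau> \<in> ball \<tau>1 \<delta>" "z \<in> A \<inter> X (tt \<tau>)" for z \<tau>
      by (rule link[OF N(1)]) (use that A D_sub_X x0 in auto)
    then show "Q x0" unfolding Q_def using A by blast
  next
    fix y assume "y \<in> S"
    then have yR: "y \<in> R (tt \<tau>1)" using S by blast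
    from smooth_family_chart[OF tt yR] obtain N where N: "smooth_patch tt N" "(y, \<tau>1) \<in> N" by (elim exE conjE)
    obtain B \<beta> where B: "open B" "y \<in> B" "\<beta> > 0" "B \<times> ball \<tau>1 \<beta> \<subseteq> N" using box[OF patch_open[OF N(1)] N(2)] by blast
    have step: "Q z" if y': "y' \<in> S \<inter> B" "Q y'" and z: "z \<in> S \<inter> B" for y' z
    proof -
      obtain M \<delta> where M: "open M" "y' \<in> M" "\<delta> > 0"
        "\<And>\<tau> z. \<tau> \<in> ball \<tau>1 \<delta> \<Longrightarrow> z \<in> M \<inter> X (tt \<tau>) \<Longrightarrow> connected_component (R (tt \<tau>)) z x0"
        using y'(2) unfolding Q_def by blast
      have y'N: "(y', \<tau>1) \<in> N" using y' B by auto
      have y'X: "y' \<in> X (tt \<tau>1)" using y' S R_subset_X by blast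
      \<comment> \<open>Every nearby member has a point in \<open>M\<close> on the patch of
        \<open>y\<close>: it is joined to \<open>x0\<close> by the assumption on \<open>y'\<close>,
        and to \<open>w\<close> inside the patch.\<close>
      from patch_move[OF N(1) y'N y'X M(1,2)] obtain \<delta>1 where d1: "\<delta>1 > 0"
        "\<forall>\<tau>'\<in>ball \<tau>1 \<delta>1. \<exists>z'\<in>M. (z', \<tau>') \<in> N \<and> z' \<in> X (tt \<tau>')" by (elim exE conjE)
      have "connected_component (R (tt \<tau>)) w x0"
        if \<tau>: "\<tau> \<in> ball \<tau>1 (min \<beta> (min \<delta> \<delta>1))" and w: "w \<in> B \<inter> X (tt \<tau>)" for \<tau> w
      proof -
        obtain z' where z': "z' \<in> M" "(z', \<tau>) \<in> N" "z' \<in> X (tt \<tau>)" using bspec[OF d1(2), of \<tau>] \<tau> by auto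
        have "connected_component (R (tt \<tau>)) w z'"
          by (rule link[OF N(1)]) (use \<tau> w B z' in auto)
        moreover have "connected_component (R (tt \<tau>)) z' x0" using M(4)[of \<tau> z'] \<tau> z' by auto
        ultimately show ?thesis by (rule connected_component_trans)
      qed
      moreover have "0 < min \<beta> (min \<delta> \<delta>1)" using B M d1 by simp
      ultimately show "Q z" unfolding Q_def using B(1) z by blast
    qed
    show "\<exists>T. openin (top_of_set S) T \<and> y \<in> T \<and> (\<forall>x\<in>T. \<forall>y\<in>T. Q x \<longrightarrow> Q y)"
    proof (intro exI[of _ "S \<inter> B"] conjI ballI impI)
      show "openin (top_of_set S) (S \<inter> B)" by (rule openin_open_Int[OF B(1)])
    qed (use step B(2) \<open>y \<in> S\<close> in blast)+
  qed
  then obtain M \<delta> where M: "open M" "x \<tau>1 \<in> M" "\<delta> > 0"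
    "\<And>\<tau> z. \<tau> \<in> ball \<tau>1 \<delta> \<Longrightarrow> z \<in> M \<inter> X (tt \<tau>) \<Longrightarrow> connected_component (R (tt \<tau>)) z x0"
    unfolding Q_def by blast
  have "open (x -` M \<inter> W)" "\<tau>1 \<in> x -` M \<inter> W" using M(2) x(3) by (auto intro: open_Int open_vimage[OF M(1) x(1)] x(2))
  then obtain \<eta> where \<eta>: "\<eta> > 0" "ball \<tau>1 \<eta> \<subseteq> x -` M \<inter> W" by (rule openE) (rule that)
  show ?thesis
  proof (intro exI[of _ "min \<delta> \<eta>"] conjI ballI)
    fix \<tau> assume "\<tau> \<in> ball \<tau>1 (min \<delta> \<eta>)"
    then have "\<tau> \<in> ball \<tau>1 \<delta>" "\<tau> \<in> ball \<tau>1 \<eta>" by auto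
    then show "connected_component (R (tt \<tau>)) (x \<tau>) x0" using M(4) \<eta>(2) x(4) by blast
  qed (use M(3) \<eta>(1) in simp)
qed

lemma tendsto_ev_F:
  assumes tt: "\<And>v. polyfn {()} (\<lambda>z. tt (z ()) v)" and z: "z \<longlonglongrightarrow> l" and \<tau>: "\<tau> \<longlonglongrightarrow> \<tau>1"
  shows "(\<lambda>n. ev (F (tt (\<tau> n)) j) (z n)) \<longlonglongrightarrow> ev (F (tt \<tau>1) j) l"
  unfolding ev_F
proof (intro tendsto_sum tendsto_mult)
  show "(\<lambda>n. tt (\<tau> n) (j, i)) \<longlonglongrightarrow> tt \<tau>1 (j, i)" for i
    using tendsto_polyfn[OF tt, of "\<lambda>n _. \<tau> n" "\<lambda>_. \<tau>1"] \<tau> by simp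
  show "(\<lambda>n. ev (g i) (z n)) \<longlonglongrightarrow> ev (g i) l" for i
    unfolding ev_def by (rule tendsto_polyfn[OF polyfn_poly_val_UNIV]) (intro tendsto_vec_nth z)
qed

lemma closed_X: "closed (X t \<union> {0})"
proof -
  have "closed {x. ev (F t j) x = 0}" for j
    unfolding ev_def by (intro closed_Collect_eq continuous_on_polyfn[OF polyfn_poly_val_UNIV] continuous_intros)
  then have "closed ((\<Inter>j<r. {x. ev (F t j) x = 0}) \<union> {0})" by (intro closed_Un closed_INT) auto
  moreover have "X t \<union> {0} = (\<Inter>j<r. {x. ev (F t j) x = 0}) \<union> {0}" by (auto simp: X_def)
  ultimately show ?thesis by simp
qed

text \<open>If \<open>x \<tau>1\<close> and \<open>x0\<close> lie in different components of \<open>R (tt \<tau>1)\<close>, then the closures of the component of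
  \<open>x0\<close> and of its complement are disjoint, and on the unit sphere they have disjoint open neighbourhoods, which
  contain the normalised points of the nearby \<open>X (tt \<tau>)\<close> by compactness.\<close>

lemma component_closed:
  assumes tt: "\<And>v. polyfn {()} (\<lambda>z. tt (z ()) v)" and x: "continuous_on UNIV x"
    and good: "good (tt \<tau>1)" and R1: "x \<tau>1 \<in> R (tt \<tau>1)"
    and con: "\<not> connected_component (R (tt \<tau>1)) (x \<tau>1) x0"
  shows "\<exists>\<delta>>0. \<forall>\<tau>\<in>ball \<tau>1 \<delta>. \<not> connected_component (R (tt \<tau>)) (x \<tau>) x0"
proof -
  define t1 where "t1 = tt \<tau>1"
  define nrm :: "complex^'n \<Rightarrow> complex^'n" where "nrm z = of_real (inverse (norm z)) *s z" for z
  have norm_s: "norm (of_real a *s (z :: complex^'n)) = \<bar>a\<bar> * norm z" for a z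
  proof -
    have "of_real a *s z = a *\<^sub>R z" by (simp add: vec_eq_iff scaleR_conv_of_real[where 'a = complex])
    then show ?thesis by simp
  qed
  have nrm1: "norm (nrm z) = 1" if "z \<noteq> 0" for z using that unfolding nrm_def norm_s by simp
  have x0R: "x0 \<in> R t1" using good x0 D_sub_X unfolding good_def R_def t1_def by blast
  define K where "K = {y \<in> R t1. connected_component (R t1) y x0}"
  \<comment> \<open>Open sets that meet the smooth locus only inside the component of
    \<open>x0\<close>, or only outside. They cover \<open>X t1\<close> because the smooth locus is
    locally connected at every point of \<open>X t1\<close>, and on \<open>X t1\<close> they do not
    overlap because the smooth locus is dense.\<close>
  define OK where "OK = \<Union>{N. open N \<and> N \<inter> R t1 \<subseteq> K}"
  define OL where "OL = \<Union>{N. open N \<and> N \<inter> R t1 \<inter> K = {}}"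
  have op: "open OK" "open OL" by (auto simp: OK_def OL_def)
  have cover: "y \<in> OK \<or> y \<in> OL" if yX: "y \<in> X t1" for y
  proof -
    obtain N where N: "open N" "y \<in> N" "connected (N \<inter> R t1)" by (rule local_connected(1)[OF good[folded t1_def] yX, THEN exE], elim conjE) (rule that)
    show ?thesis
    proof (cases "N \<inter> R t1 \<inter> K = {}")
      case False
      then obtain w where w: "w \<in> N \<inter> R t1" "connected_component (R t1) w x0" by (auto simp: K_def)
      have "connected_component (R t1) z w" if "z \<in> N \<inter> R t1" for z
        unfolding connected_component_def by (intro exI[of _ "N \<inter> R t1"]) (use N(3) that w in auto)
      then have "N \<inter> R t1 \<subseteq> K" using w(2) connected_component_trans by (auto simp: K_def) blast
      then show ?thesis using N unfolding OK_def by blast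
    qed (use N in \<open>auto simp: OL_def\<close>)
  qed
  have disj: "OK \<inter> OL \<inter> X t1 = {}"
  proof (rule ccontr)
    assume "OK \<inter> OL \<inter> X t1 \<noteq> {}"
    then obtain y where y: "y \<in> X t1" "y \<in> OK" "y \<in> OL" by blast
    then obtain N N' where N: "open N" "y \<in> N" "N \<inter> R t1 \<subseteq> K" "open N'" "y \<in> N'" "N' \<inter> R t1 \<inter> K = {}"
      unfolding OK_def OL_def by blast
    have "y \<in> closure (R t1)" using local_connected(2)[OF good] y(1) unfolding t1_def by blast
    then have "R t1 \<inter> (N \<inter> N') \<noteq> {}" using N(1,2,4,5)
      by (metis Int_iff closure_iff_nhds_not_empty open_Int order_refl)
    then show False using N(3,6) by blast
  qed
  have K_in: "y \<in> OK" if "y \<in> K" for y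
  proof -
    have "y \<in> R t1" using that by (simp add: K_def)
    then have "y \<in> OK \<or> y \<in> OL" using cover R_subset_X by blast
    moreover have "y \<notin> OL" using that \<open>y \<in> R t1\<close> unfolding OL_def by blast
    ultimately show ?thesis by blast
  qed
  have K_out: "y \<in> OL" if "y \<in> R t1" "y \<notin> K" for y
  proof -
    have "y \<in> OK \<or> y \<in> OL" using cover R_subset_X that by blast
    moreover have "y \<notin> OK" using that unfolding OK_def by blast
    ultimately show ?thesis by blast
  qed
  define Sp where "Sp = sphere (0 :: complex^'n) 1"
  have XS: "closed (X t1 \<inter> Sp)"
  proof -
    have "X t1 \<inter> Sp = (X t1 \<union> {0}) \<inter> Sp" by (auto simp: Sp_def)
    then show ?thesis using closed_X by (metis Sp_def closed_Int closed_sphere)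
  qed
  define KS where "KS = X t1 \<inter> Sp - OL"
  define LS where "LS = X t1 \<inter> Sp - OK"
  have "closed KS" "closed LS" "KS \<inter> LS = {}"
    unfolding KS_def LS_def using XS op cover by (auto intro: closed_Diff)
  then obtain U V where UV: "open U" "open V" "KS \<subseteq> U" "LS \<subseteq> V" "U \<inter> V = {}" using separation_normal by metis
  have XUV: "X t1 \<inter> Sp \<subseteq> U \<union> V" using UV(3,4) disj unfolding KS_def LS_def by blast
  have x0n: "x0 \<noteq> 0" using D_nonzero x0 by metis
  have nx0: "nrm x0 \<in> U"
  proof -
    have c: "connected_component (R t1) x0 (nrm x0)" unfolding nrm_def by (rule scale_component[OF x0R]) (use x0n in simp)
    then have "nrm x0 \<in> R t1" using connected_component_in by blast
    then have "nrm x0 \<in> K" using c connected_component_sym by (auto simp: K_def)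
    then have "nrm x0 \<in> X t1 \<inter> Sp - OL"
      using K_in disj R_subset_X nrm1[OF x0n] by (auto simp: K_def Sp_def)
    then show ?thesis using UV(3) by (auto simp: KS_def)
  qed
  have xn: "x \<tau>1 \<noteq> 0" using R1 by (auto simp: R_def X_def)
  have nx: "nrm (x \<tau>1) \<in> V"
  proof -
    have c: "connected_component (R t1) (x \<tau>1) (nrm (x \<tau>1))" unfolding nrm_def
      by (rule scale_component) (use xn R1 in \<open>simp_all add: t1_def\<close>)
    then have "nrm (x \<tau>1) \<in> R t1" using connected_component_in by blast
    moreover have "nrm (x \<tau>1) \<notin> K" using con c connected_component_trans unfolding K_def t1_def by blast
    ultimately have "nrm (x \<tau>1) \<in> X t1 \<inter> Sp - OK"
      using K_out disj R_subset_X nrm1[OF xn] by (auto simp: Sp_def)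
    then show ?thesis using UV(4) by (auto simp: LS_def)
  qed
  have cont_nrm: "continuous_on (- {0}) nrm"
    unfolding nrm_def vector_scalar_mult_def by (intro continuous_on_vec_lambda continuous_intros) auto
  have "\<exists>\<delta>>0. \<forall>\<tau>\<in>ball \<tau>1 \<delta>. X (tt \<tau>) \<inter> Sp \<subseteq> U \<union> V"
  proof (rule ccontr)
    assume *: "\<not> (\<exists>\<delta>>0. \<forall>\<tau>\<in>ball \<tau>1 \<delta>. X (tt \<tau>) \<inter> Sp \<subseteq> U \<union> V)"
    have "\<exists>\<tau> z. \<tau> \<in> ball \<tau>1 (inverse (real (Suc n))) \<and> z \<in> X (tt \<tau>) \<and> z \<in> Sp - (U \<union> V)" for n
    proof -
      have "inverse (real (Suc n)) > 0" by simp
      then have "\<not> (\<forall>\<tau>\<in>ball \<tau>1 (inverse (real (Suc n))). X (tt \<tau>) \<inter> Sp \<subseteq> U \<union> V)" using * by blast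
      then show ?thesis by blast
    qed
    then obtain \<tau> z where \<tau>z: "\<And>n. \<tau> n \<in> ball \<tau>1 (inverse (real (Suc n)))" "\<And>n. z n \<in> X (tt (\<tau> n))" "\<And>n. z n \<in> Sp - (U \<union> V)"
      by metis
    have "\<tau> \<longlonglongrightarrow> \<tau>1"
    proof (rule metric_tendsto_imp_tendsto[OF LIMSEQ_inverse_real_of_nat])
      show "\<forall>\<^sub>F n in sequentially. dist (\<tau> n) \<tau>1 \<le> dist (inverse (real (Suc n))) 0"
        using \<tau>z(1) by (auto intro!: always_eventually simp: dist_commute less_imp_le)
    qed
    moreover have "compact (Sp - (U \<union> V))" unfolding Sp_def using UV by (intro compact_diff compact_sphere) auto
    then obtain l s where l: "l \<in> Sp - (U \<union> V)" "strict_mono (s :: nat \<Rightarrow> nat)" "(z \<circ> s) \<longlonglongrightarrow> l"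
      using \<tau>z(3) unfolding compact_def by metis
    ultimately have lim: "(\<lambda>n. \<tau> (s n)) \<longlonglongrightarrow> \<tau>1" "(\<lambda>n. z (s n)) \<longlonglongrightarrow> l"
      using LIMSEQ_subseq_LIMSEQ[of \<tau> \<tau>1 s] by (auto simp: comp_def)
    have "ev (F t1 j) l = 0" if "j < r" for j
    proof -
      have "(\<lambda>n. ev (F (tt (\<tau> (s n))) j) (z (s n))) = (\<lambda>n. 0)" using \<tau>z(2) that by (auto simp: X_def)
      then show ?thesis using tendsto_ev_F[where tt = tt and j = j, OF tt lim(2,1)] LIMSEQ_unique tendsto_const unfolding t1_def by metis
    qed
    moreover have "l \<noteq> 0" using l by (auto simp: Sp_def)
    ultimately have "l \<in> X t1" by (simp add: X_def)
    then show False using l XUV by blast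
  qed
  then obtain \<delta> where \<delta>: "\<delta> > 0" "\<And>\<tau>. \<tau> \<in> ball \<tau>1 \<delta> \<Longrightarrow> X (tt \<tau>) \<inter> Sp \<subseteq> U \<union> V" by blast
  have "open ((- {0}) \<inter> nrm -` V)" by (rule continuous_open_preimage[OF cont_nrm _ UV(2)]) auto
  from open_vimage[OF this x] have "open (x -` ((- {0}) \<inter> nrm -` V))" .
  moreover have "\<tau>1 \<in> x -` ((- {0}) \<inter> nrm -` V)" using nx xn by simp
  ultimately obtain \<eta> where \<eta>: "\<eta> > 0" "ball \<tau>1 \<eta> \<subseteq> x -` ((- {0}) \<inter> nrm -` V)"
    by (rule openE) (rule that)
  have "\<not> connected_component (R (tt \<tau>)) (x \<tau>) x0" if \<tau>: "\<tau> \<in> ball \<tau>1 (min \<delta> \<eta>)" for \<tau>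
  proof
    assume "connected_component (R (tt \<tau>)) (x \<tau>) x0"
    then obtain S where S: "connected S" "S \<subseteq> R (tt \<tau>)" "x \<tau> \<in> S" "x0 \<in> S"
      unfolding connected_component_def by blast
    have nz: "z \<noteq> 0" if "z \<in> S" for z using that S(2) by (auto simp: R_def X_def)
    have "connected (nrm ` S)"
      by (rule connected_continuous_image[OF continuous_on_subset[OF cont_nrm] S(1)]) (use nz in auto)
    moreover have "nrm ` S \<subseteq> X (tt \<tau>) \<inter> Sp"
    proof clarify
      fix z assume z: "z \<in> S"
      then have "nrm z \<in> X (tt \<tau>)" unfolding nrm_def by (intro X_scale) (use S(2) R_subset_X nz in auto)
      then show "nrm z \<in> X (tt \<tau>) \<inter> Sp" using nrm1[OF nz[OF z]] by (simp add: Sp_def)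
    qed
    then have "nrm ` S \<subseteq> U \<union> V" using \<delta>(2)[of \<tau>] \<tau> by auto
    moreover have "nrm x0 \<in> U \<inter> nrm ` S" using nx0 S(4) by blast
    moreover have "nrm (x \<tau>) \<in> V \<inter> nrm ` S" using \<eta>(2) \<tau> S(3) by auto
    ultimately show False using connectedD[of "nrm ` S" U V] UV(1,2,5) by blast
  qed
  then show ?thesis using \<delta>(1) \<eta>(1) by (intro exI[of _ "min \<delta> \<eta>"]) auto
qed

text \<open>Forms of degree 0 are constant; vanishing at \<open>x0\<close>, all \<open>g i\<close>
  would vanish at \<open>x\<close> as well, and \<open>x\<close> would lie on
  \<open>D\<close>.\<close>

lemma d_pos:
  assumes "x \<noteq> 0" "x \<notin> D"
  shows "d > 0"
proof (rule ccontr)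
  assume "\<not> d > 0"
  then have d0: "d = 0" by simp
  obtain i where i: "i < q" "ev (g i) x \<noteq> 0" using g_base assms by blast
  have "ev (g i) y = poly_val (\<lambda>v. 0) (g i)" for y
    using poly_val_forms_scale[OF g_form[OF i(1)], of 0 "($) y"] by (simp add: ev_def d0)
  then have "ev (g i) x = ev (g i) x0" by metis
  then show False using i g_D[OF i(1) x0] by simp
qed

text \<open>Genericity is supplied as a polynomial \<open>P\<close> because the argument moves along
  a line of parameters, on which a nonzero polynomial fails at finitely many points only and leaves
  a connected set.\<close>

theorem connected_R:
  assumes P: "polyfn ({..<r} \<times> {..<q}) P" "\<And>t. P t \<noteq> 0 \<Longrightarrow> good t" and t: "P t \<noteq> 0"
  shows "connected (R t)"
proof -
  have gt: "good t" by (rule P(2)[OF t])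
  have x0R: "x0 \<in> R t" using gt x0 D_sub_X unfolding good_def R_def by blast
  obtain xs where xs: "xs \<in> X t" "xs \<notin> D" "connected_component (R t) xs x0"
    using off_D_component[OF x0R x0] by blast
  have main: "connected_component (R t) x x0" if x: "x \<in> X t" "x \<notin> D" for x
  proof -
    have xn: "x \<noteq> 0" "xs \<noteq> 0" using x xs by (auto simp: X_def)
    have dp: "d > 0" by (rule d_pos[OF xn(1) x(2)])
    define gg where "gg c z = (\<Sum>i<q. c i * ev (g i) z)" for c :: "nat \<Rightarrow> complex" and z
    obtain i i' where i: "i < q" "ev (g i) x \<noteq> 0" "i' < q" "ev (g i') xs \<noteq> 0" using g_base xn x(2) xs(2) by blast
    have gg1: "gg (\<lambda>j. if j = k then 1 else 0) z = ev (g k) z" if "k < q" for k z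
      using that unfolding gg_def by (simp add: if_distrib[of "\<lambda>x. x * _"] cong: if_cong)
    have gg_add: "gg (\<lambda>j. a j + b j) z = gg a z + gg b z" for a b z
      by (simp add: gg_def distrib_right sum.distrib)
    have "\<exists>c. gg c x \<noteq> 0 \<and> gg c xs \<noteq> 0"
    proof (cases "ev (g i) xs = 0 \<and> ev (g i') x = 0")
      case True
      show ?thesis
        by (rule exI[of _ "\<lambda>j. (if j = i then 1 else 0) + (if j = i' then 1 else 0)"])
          (use True i in \<open>simp add: gg_add gg1\<close>)
    next
      case False
      then show ?thesis using gg1[OF i(1)] gg1[OF i(3)] i by metis
    qed
    then obtain c' where c': "gg c' x \<noteq> 0" "gg c' xs \<noteq> 0" by blast
    define c where "c j = c' j / gg c' x" for j
    have ggc: "gg c z = gg c' z / gg c' x" for z by (simp add: gg_def c_def sum_divide_distrib)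
    have gx: "gg c x = 1" "gg c xs \<noteq> 0" using c' by (simp_all add: ggc)
    \<comment> \<open>The point \<open>xs\<close> is rescaled by a \<open>d\<close>-th root so that
      \<open>gg c\<close> has the value 1 at both ends of the line; this is what makes
      \<open>tt 0 = tt 1 = t\<close>.\<close>
    obtain \<sigma> where \<sigma>: "\<sigma> \<noteq> 0" "1 / gg c xs = \<sigma> ^ d" using exists_complex_root_nonzero[of "1 / gg c xs" d] gx dp by auto
    define x1 where "x1 = \<sigma> *s xs"
    have g_scale: "ev (g i) (a *s z) = a ^ d * ev (g i) z" if "i < q" for i a z
      using poly_val_forms_scale[OF g_form[OF that], of a "($) z"] by (simp add: ev_def smult_component_fun)
    have gg_scale: "gg c (a *s z) = a ^ d * gg c z" for a z
      unfolding gg_def sum_distrib_left by (rule sum.cong) (auto simp: g_scale)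
    have gx1: "gg c x1 = 1" using gx \<sigma> by (simp add: x1_def gg_scale flip: \<sigma>(2))
    have x1: "x1 \<in> X t" unfolding x1_def by (rule X_scale[OF xs(1) \<sigma>(1)])
    have xsR: "xs \<in> R t" using xs(3) connected_component_in by blast
    have x1c: "connected_component (R t) x1 x0"
      using connected_component_trans[OF connected_component_sym[OF scale_component[OF xsR \<sigma>(1)]] xs(3)] by (simp add: x1_def)
    define xx where "xx \<tau> = x + \<tau> *s (x1 - x)" for \<tau>
    \<comment> \<open>At \<open>\<tau>\<close>, each equation is \<open>gg c (xx \<tau>)\<close>
      times the old one minus its value at \<open>xx \<tau>\<close> times \<open>gg c\<close>; so it
      vanishes at \<open>xx \<tau>\<close> and still belongs to the linear system.\<close>
    define tt where "tt \<tau> = (\<lambda>(j, i). if j < r then gg c (xx \<tau>) * t (j, i) - ev (F t j) (xx \<tau>) * c i else t (j, i))" for \<tau>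
    have xx01: "xx 0 = x" "xx 1 = x1" by (simp_all add: xx_def)
    have tt01: "tt 0 = t" "tt 1 = t"
      using gx(1) gx1 x(1) x1 by (auto simp: tt_def xx01 fun_eq_iff X_def)
    have pol_ev: "polyfn {()} (\<lambda>z. ev f (xx (z ())))" for f
      unfolding ev_def
    proof (rule polyfn_comp[OF polyfn_poly_val_UNIV, where h = "\<lambda>v z. xx (z ()) $ v"])
      show "polyfn {()} (\<lambda>z. xx (z ()) $ v)" for v unfolding xx_def by (auto intro!: polyfn_intros)
    qed
    have pol_gg: "polyfn {()} (\<lambda>z. gg c (xx (z ())))" unfolding gg_def by (intro polyfn_intros pol_ev)
    have tt_pol: "polyfn {()} (\<lambda>z. tt (z ()) v)" for v
      by (cases v; cases "fst v < r") (auto simp: tt_def intro!: polyfn_intros pol_ev pol_gg)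
    have F_tt: "ev (F (tt \<tau>) j) z = gg c (xx \<tau>) * ev (F t j) z - ev (F t j) (xx \<tau>) * gg c z" if "j < r" for j \<tau> z
    proof -
      have "ev (F (tt \<tau>) j) z = (\<Sum>i<q. (gg c (xx \<tau>) * t (j, i) - ev (F t j) (xx \<tau>) * c i) * ev (g i) z)"
        unfolding ev_F[of "tt \<tau>"] using that by (simp add: tt_def)
      then show ?thesis
        unfolding ev_F[of t j z] gg_def[of c z] sum_distrib_left left_diff_distrib sum_subtractf by (simp add: mult_ac)
    qed
    define T where "T = {\<tau>. P (tt \<tau>) \<noteq> 0 \<and> gg c (xx \<tau>) \<noteq> 0}"
    have f1: "finite {\<tau>. P (tt \<tau>) = 0}"
      by (rule polyfn_line_zeros_finite[OF P(1) _ tt_pol, where ?c0.0 = 0]) (use t tt01 in auto)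
    have f2: "finite {\<tau>. gg c (xx \<tau>) = 0}"
      using polyfn_zeros_finite[OF pol_gg, of "\<lambda>_. 0" "\<lambda>_. 0"] gx(1) xx01 by simp
    have "T = UNIV - ({\<tau>. P (tt \<tau>) = 0} \<union> {\<tau>. gg c (xx \<tau>) = 0})" by (auto simp: T_def)
    then have conT: "connected T" using connected_open_delete_finite[of UNIV "{\<tau>. P (tt \<tau>) = 0} \<union> {\<tau>. gg c (xx \<tau>) = 0}"] f1 f2 connected_UNIV by simp
    have T01: "0 \<in> T" "1 \<in> T" using t gx(1) gx1 by (auto simp: T_def tt01 xx01)
    have contx: "continuous_on UNIV xx"
      unfolding xx_def vector_scalar_mult_def by (intro continuous_intros continuous_on_vec_lambda)
    have nz: "xx \<tau> \<noteq> 0 \<and> xx \<tau> \<notin> D" if "gg c (xx \<tau>) \<noteq> 0" for \<tau>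
    proof
      show "xx \<tau> \<notin> D" using that g_D by (auto simp: gg_def)
      show "xx \<tau> \<noteq> 0" using that gg_scale[of 0 0] dp by (auto simp: power_0_left split: if_splits)
    qed
    have xX: "xx \<tau> \<in> X (tt \<tau>)" if "gg c (xx \<tau>) \<noteq> 0" for \<tau>
      using nz[OF that] by (simp add: X_def F_tt)
    have xR: "xx \<tau> \<in> R (tt \<tau>)" "good (tt \<tau>)" if "\<tau> \<in> T" for \<tau>
    proof -
      show g: "good (tt \<tau>)" using that P(2) by (simp add: T_def)
      show "xx \<tau> \<in> R (tt \<tau>)" using that g xX[of \<tau>] nz[of \<tau>] unfolding R_def good_def T_def by blast
    qed
    have "connected_component (R (tt 0)) (xx 0) x0"
    proof (rule connected_induction_simple[OF conT T01(2,1), where P = "\<lambda>\<tau>. connected_component (R (tt \<tau>)) (xx \<tau>) x0"])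
      show "connected_component (R (tt 1)) (xx 1) x0" using x1c by (simp add: tt01 xx01)
      fix \<tau>1 assume \<tau>1: "\<tau>1 \<in> T"
      have "\<exists>\<delta>>0. (\<forall>\<tau>\<in>ball \<tau>1 \<delta>. connected_component (R (tt \<tau>)) (xx \<tau>) x0) \<or>
          (\<forall>\<tau>\<in>ball \<tau>1 \<delta>. \<not> connected_component (R (tt \<tau>)) (xx \<tau>) x0)"
      proof (cases "connected_component (R (tt \<tau>1)) (xx \<tau>1) x0")
        case True
        have W: "open {\<tau>. gg c (xx \<tau>) \<noteq> 0}"
          using finite_imp_closed[OF f2] by (simp add: closed_def Collect_neg_eq)
        from component_open[OF tt_pol contx W _ _ True] show ?thesis using xX \<tau>1 by (auto simp: T_def)
      next
        case False
        from component_closed[OF tt_pol contx xR(2)[OF \<tau>1] xR(1)[OF \<tau>1] False] show ?thesis by blast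
      qed
      then obtain \<delta> where \<delta>: "\<delta> > 0" "(\<forall>\<tau>\<in>ball \<tau>1 \<delta>. connected_component (R (tt \<tau>)) (xx \<tau>) x0) \<or>
          (\<forall>\<tau>\<in>ball \<tau>1 \<delta>. \<not> connected_component (R (tt \<tau>)) (xx \<tau>) x0)" by blast
      show "\<exists>S. openin (top_of_set T) S \<and> \<tau>1 \<in> S \<and> (\<forall>a\<in>S. \<forall>b\<in>S.
          connected_component (R (tt a)) (xx a) x0 \<longrightarrow> connected_component (R (tt b)) (xx b) x0)"
      proof (intro exI[of _ "T \<inter> ball \<tau>1 \<delta>"] conjI)
        show "openin (top_of_set T) (T \<inter> ball \<tau>1 \<delta>)" by (rule openin_open_Int) simp
        show "\<forall>a\<in>T \<inter> ball \<tau>1 \<delta>. \<forall>b\<in>T \<inter> ball \<tau>1 \<delta>.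
          connected_component (R (tt a)) (xx a) x0 \<longrightarrow> connected_component (R (tt b)) (xx b) x0"
          using \<delta>(2) by blast
      qed (use \<tau>1 \<delta> in auto)
    qed
    then show ?thesis by (simp add: tt01 xx01)
  qed
  have "connected_component (R t) x x0" if "x \<in> R t" for x
  proof (cases "x \<in> D")
    case True
    then obtain z where "z \<in> X t" "z \<notin> D" "connected_component (R t) z x" using off_D_component \<open>x \<in> R t\<close> by blast
    then show ?thesis using main connected_component_trans connected_component_sym by blast
  qed (use main that R_subset_X in blast)
  then show ?thesis
    unfolding connected_iff_connected_component using connected_component_trans connected_component_sym by blast
qed

end

section \<open>Irreducibility and dimension\<close>

lemma zero_locus_ev: "zero_locus G = {x. x \<noteq> 0 \<and> (\<forall>g\<in>G. ev g x = 0)}"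
  by (simp add: zero_locus_def ev_def)

lemma ev_form_scale: "f \<in> forms e \<Longrightarrow> ev f (c *s x) = c ^ e * ev f x"
  using poly_val_forms_scale[of f e c "($) x"] by (simp add: ev_def smult_component_fun)

lemma algebraic_cone:
  assumes "algebraic_set Z" "x \<in> Z" "c \<noteq> 0"
  shows "c *s x \<in> Z"
proof -
  obtain G where G: "G \<subseteq> (\<Union>d. forms d)" "Z = zero_locus G" using assms(1) by (auto simp: algebraic_set_def)
  have "ev g (c *s x) = 0" if g: "g \<in> G" for g
  proof -
    obtain e where "g \<in> forms e" using G g by blast
    then show ?thesis using assms(2) G g by (simp add: ev_form_scale zero_locus_ev)
  qed
  then show ?thesis using assms(2,3) G by (simp add: zero_locus_ev)
qed

lemma algebraic_inter_form:
  assumes "algebraic_set Z" "f \<in> forms e"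
  shows "algebraic_set {x\<in>Z. ev f x = 0}"
proof -
  obtain G where G: "G \<subseteq> (\<Union>d. forms d)" "Z = zero_locus G" using assms(1) by (auto simp: algebraic_set_def)
  show ?thesis unfolding algebraic_set_def
    by (intro exI[of _ "insert f G"]) (use G assms(2) in \<open>auto simp: zero_locus_ev\<close>)
qed

lemma algebraic_closed: "closed (zero_locus G \<union> {0})"
proof -
  have "closed {x. ev g x = 0}" for g :: "'a cpoly"
    unfolding ev_def by (intro closed_Collect_eq continuous_on_polyfn[OF polyfn_poly_val_UNIV] continuous_intros)
  then have "closed ((\<Inter>g\<in>G. {x. ev g x = 0}) \<union> {0})" by (intro closed_Un closed_INT) auto
  moreover have "zero_locus G \<union> {0} = (\<Inter>g\<in>G. {x. ev g x = 0}) \<union> {0}" by (auto simp: zero_locus_ev)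
  ultimately show ?thesis by simp
qed

text \<open>The polynomial \<open>p\<close> is not assumed to be homogeneous. Off the zeros of the
  form \<open>f\<close> it vanishes on all multiples of a point, so each of its graded components
  vanishes there, and irreducibility applies to each component.\<close>

lemma irreducible_prime:
  assumes Z: "irreducible_set Z" and f: "f \<in> forms e" and prod: "\<And>x. x \<in> Z \<Longrightarrow> ev f x * ev p x = 0"
    and nz: "a \<in> Z" "ev f a \<noteq> 0" and x: "x \<in> Z"
  shows "ev p x = 0"
proof -
  have alg: "algebraic_set Z" using Z by (simp add: irreducible_set_def)
  have comp: "ev (restrict_keys (\<lambda>m. mdeg m = k) p) y = 0" if y: "y \<in> Z" for k y
  proof -
    have "Z = {x\<in>Z. ev f x = 0} \<union> {x\<in>Z. ev (restrict_keys (\<lambda>m. mdeg m = k) p) x = 0}"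
    proof (intro subset_antisym subsetI)
      fix y assume y: "y \<in> Z"
      show "y \<in> {x\<in>Z. ev f x = 0} \<union> {x\<in>Z. ev (restrict_keys (\<lambda>m. mdeg m = k) p) x = 0}"
      proof (cases "ev f y = 0")
        case False
        have "poly_val (\<lambda>v. c * y $ v) p = 0" if c: "c \<noteq> 0" for c
        proof -
          have "c ^ e * ev f y * ev p (c *s y) = 0"
            using prod[OF algebraic_cone[OF alg y c]] by (simp add: ev_form_scale[OF f])
          then have "ev p (c *s y) = 0" using c False by simp
          then show ?thesis by (simp add: ev_def smult_component_fun)
        qed
        then have "poly_val (($) y) (restrict_keys (\<lambda>m. mdeg m = k) p) = 0" by (rule cone_components_vanish)
        then show ?thesis using y by (simp add: ev_def)
      qed (use y in simp)
    qed auto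
    moreover have "algebraic_set {x\<in>Z. ev f x = 0}" "algebraic_set {x\<in>Z. ev (restrict_keys (\<lambda>m. mdeg m = k) p) x = 0}"
      by (rule algebraic_inter_form[OF alg f], rule algebraic_inter_form[OF alg restrict_mdeg_forms])
    ultimately have "Z = {x\<in>Z. ev f x = 0} \<or> Z = {x\<in>Z. ev (restrict_keys (\<lambda>m. mdeg m = k) p) x = 0}"
      using Z unfolding irreducible_set_def by blast
    then show ?thesis using nz y by blast
  qed
  obtain M where "poly_val (($) x) p = (\<Sum>k\<le>M. poly_val (($) x) (restrict_keys (\<lambda>m. mdeg m = k) p))"
    using poly_val_sum_graded[of "($) x" p mdeg] by blast
  then show ?thesis using comp[OF x] by (simp add: ev_def)
qed

lemma ev_surj:
  fixes f :: "nat \<Rightarrow> 'n::finite cpoly"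
  assumes "polyfn T Q"
  shows "\<exists>p. \<forall>x. ev p x = Q (\<lambda>i. ev (f i) x)"
proof -
  have "polyfn UNIV (\<lambda>z. Q (\<lambda>i. poly_val z (f i)))"
    by (rule polyfn_comp[OF assms]) (rule polyfn_poly_val_UNIV)
  from polyfn_imp_poly_val[OF this] obtain p where "\<And>z. poly_val z p = Q (\<lambda>i. poly_val z (f i))" by blast
  then show ?thesis unfolding ev_def by blast
qed

lemma polyfn_infinite_zeros:
  assumes "polyfn {v} Q" "infinite {c. Q (z(v := c)) = 0}"
  shows "Q z' = 0"
  using polyfn_zeros_finite[OF assms(1), of z' z] assms(2) by blast

text \<open>Each strict inclusion contributes a form \<open>h\<close> that vanishes on
  \<open>C k\<close> but not on \<open>C (Suc k)\<close>; it is independent of the functions that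
  are independent on \<open>C k\<close>. The chain starts with a coordinate that takes every nonzero
  value on the cone over a point, so a chain of \<open>k + 1\<close> sets gives \<open>k + 1\<close>
  functions.\<close>

lemma chain_independent:
  fixes C :: "nat \<Rightarrow> (complex^'n::finite) set"
  assumes "\<And>i. i \<le> k \<Longrightarrow> irreducible_set (C i)" "\<And>i. i < k \<Longrightarrow> C i \<subset> C (Suc i)"
  shows "\<exists>f :: nat \<Rightarrow> 'n cpoly. \<forall>Q. polyfn {..k} Q \<longrightarrow> (\<forall>x\<in>C k. Q (\<lambda>i. ev (f i) x) = 0) \<longrightarrow> (\<forall>z. Q z = 0)"
  using assms
proof (induction k)
  case 0
  have irr: "irreducible_set (C 0)" using 0 by simp
  then obtain a where a: "a \<in> C 0" by (auto simp: irreducible_set_def)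
  have alg: "algebraic_set (C 0)" using irr by (simp add: irreducible_set_def)
  have "a \<noteq> 0" using alg a by (auto simp: algebraic_set_def zero_locus_def)
  then obtain i where i: "a $ i \<noteq> 0" by (auto simp: vec_eq_iff)
  show ?case
  proof (intro exI[of _ "\<lambda>_. poly_var i"] allI impI)
    fix Q z assume Q: "polyfn {..0::nat} Q" "\<forall>x\<in>C 0. Q (\<lambda>_. ev (poly_var i) x) = 0"
    have Q0: "polyfn {0} Q" using polyfn_mono[OF Q(1), of "{0}"] by simp
    have "Q ((\<lambda>_. 0)(0 := c)) = 0" if "c \<noteq> 0" for c
    proof -
      have "(c / a $ i) *s a \<in> C 0" using algebraic_cone[OF alg a, of "c / a $ i"] that i by simp
      then have "Q (\<lambda>_. c) = 0" using Q(2) i by (force simp: ev_def)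
      moreover have "Q (\<lambda>_. c) = Q ((\<lambda>_. 0)(0 := c))" by (rule polyfn_cong[OF Q0]) auto
      ultimately show ?thesis by simp
    qed
    then have "- {0} \<subseteq> {c. Q ((\<lambda>_. 0)(0 := c)) = 0}" by auto
    moreover have "infinite (- {0::complex})" using infinite_UNIV_char_0[where 'a = complex] by (simp add: Compl_eq_Diff_UNIV)
    ultimately have "infinite {c. Q ((\<lambda>_. 0)(0 := c)) = 0}" using infinite_super by blast
    then show "Q z = 0" by (rule polyfn_infinite_zeros[OF Q0])
  qed
next
  case (Suc k)
  have "\<exists>f :: nat \<Rightarrow> 'n cpoly. \<forall>Q. polyfn {..k} Q \<longrightarrow> (\<forall>x\<in>C k. Q (\<lambda>i. ev (f i) x) = 0) \<longrightarrow> (\<forall>z. Q z = 0)"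
    by (rule Suc.IH) (use Suc.prems in auto)
  then obtain f :: "nat \<Rightarrow> 'n cpoly" where f: "\<And>Q z. polyfn {..k} Q \<Longrightarrow> (\<And>x. x \<in> C k \<Longrightarrow> Q (\<lambda>i. ev (f i) x) = 0) \<Longrightarrow> Q z = 0"
    by blast
  have irr: "irreducible_set (C k)" "irreducible_set (C (Suc k))" and sub: "C k \<subset> C (Suc k)" using Suc.prems by auto
  obtain G where G: "G \<subseteq> (\<Union>d. forms d)" "C k = zero_locus G" using irr(1) by (auto simp: irreducible_set_def algebraic_set_def)
  obtain a where a: "a \<in> C (Suc k)" "a \<notin> C k" using sub by blast
  have "a \<noteq> 0" using irr(2) a(1) by (auto simp: irreducible_set_def algebraic_set_def zero_locus_def)
  then obtain h where h: "h \<in> G" "ev h a \<noteq> 0" using a(2) G(2) by (auto simp: zero_locus_ev)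
  obtain e where e: "h \<in> forms e" using h G by blast
  have hk: "ev h x = 0" if "x \<in> C k" for x using that h(1) G(2) by (simp add: zero_locus_ev)
  show ?case
  proof (intro exI[of _ "f(Suc k := h)"] allI impI)
    fix Q z assume Q: "polyfn {..Suc k} Q" "\<forall>x\<in>C (Suc k). Q (\<lambda>i. ev ((f(Suc k := h)) i) x) = 0"
    have "polyfn (insert (Suc k) {..k}) Q" using Q(1) by (simp add: atMost_Suc)
    from polyfn_expand[OF this] obtain m qq where qq: "\<And>j. polyfn {..k} (qq j)" "\<And>z. Q z = (\<Sum>j<(m::nat). qq j z * z (Suc k) ^ j)"
      by (elim exE conjE) blast
    have "qq j z = 0" if "j < m" for j z
      using that
    proof (induction j arbitrary: z rule: less_induct)
      case (less j)
      \<comment> \<open>The lower coefficients vanish by induction, so \<open>Q\<close> is the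
        \<open>j\<close>-th power of the last variable times \<open>Q'\<close>. On
        \<open>C (Suc k)\<close> the power of \<open>h\<close> can be cancelled, and on
        \<open>C k\<close>, where \<open>h\<close> is 0, only the coefficient \<open>qq j\<close>
        remains.\<close>
      define Q' where "Q' z = (\<Sum>i\<in>{j..<m}. qq i z * z (Suc k) ^ (i - j))" for z
      have qm: "polyfn {..Suc k} (qq i)" for i by (rule polyfn_mono[OF qq(1)]) auto
      have Q'p: "polyfn {..Suc k} Q'" unfolding Q'_def by (auto intro!: polyfn_intros qm)
      have QQ': "Q z = z (Suc k) ^ j * Q' z" for z
      proof -
        have "Q z = (\<Sum>i\<in>{j..<m}. qq i z * z (Suc k) ^ i)"
          unfolding qq(2) by (rule sum.mono_neutral_right) (use less in \<open>auto simp: not_le\<close>)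
        also have "\<dots> = (\<Sum>i\<in>{j..<m}. z (Suc k) ^ j * (qq i z * z (Suc k) ^ (i - j)))"
          by (rule sum.cong) (auto simp flip: power_add)
        finally show ?thesis by (simp add: Q'_def sum_distrib_left)
      qed
      obtain p where p: "\<And>x. ev p x = Q' (\<lambda>i. ev ((f(Suc k := h)) i) x)" using ev_surj[OF Q'p] by blast
      have hj: "ev (h ^ j) x = ev h x ^ j" for x by (simp add: ev_def poly_val_power)
      have hjf: "ev h x * ev p x = 0" if "x \<in> C (Suc k)" for x
      proof -
        have "ev h x ^ j * ev p x = 0" using Q(2) that QQ' by (simp add: p)
        then show ?thesis by (cases "j = 0") auto
      qed
      have p0: "ev p x = 0" if "x \<in> C (Suc k)" for x
        by (rule irreducible_prime[OF irr(2) e hjf a(1) h(2) that])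
      show "qq j z = 0"
      proof (rule f[OF qq(1)])
        fix x assume x: "x \<in> C k"
        then have "Q' (\<lambda>i. ev ((f(Suc k := h)) i) x) = 0" using p0[of x] p sub by auto
        moreover have "Q' (\<lambda>i. ev ((f(Suc k := h)) i) x) = (\<Sum>i\<in>{j}. qq i (\<lambda>i. ev ((f(Suc k := h)) i) x) * 0 ^ (i - j))"
          unfolding Q'_def using hk[OF x] less.prems
          by (intro sum.mono_neutral_cong_right) auto
        ultimately have "qq j (\<lambda>i. ev ((f(Suc k := h)) i) x) = 0" by simp
        moreover have "qq j (\<lambda>i. ev ((f(Suc k := h)) i) x) = qq j (\<lambda>i. ev (f i) x)"
          by (rule polyfn_cong[OF qq(1)]) auto
        ultimately show "qq j (\<lambda>i. ev (f i) x) = 0" by simp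
      qed
    qed
    then show "Q z = 0" by (simp add: qq(2))
  qed
qed

text \<open>Blocks of variables for \<open>chain_bound\<close>: the values of the five polynomials,
  the point, the coefficients of their differentials, and those of the differentials of the
  equations.\<close>

type_synonym 'a kvar = "nat + 'a + nat + nat"

context base_locus
begin

lemma X_zero_locus: "X t = zero_locus (F t ` {..<r})"
  by (auto simp: X_def zero_locus_ev)

lemma algebraic_X: "algebraic_set (X t)"
  unfolding algebraic_set_def X_zero_locus
  by (rule exI[of _ "F t ` {..<r}"]) (use F_forms in auto)

text \<open>Near a smooth point one of the two sets contains all of \<open>X t\<close>: if an
  equation of \<open>A\<close> is nonzero somewhere on the patch, then it is nonzero on an open
  part, which lies in \<open>B\<close>, and the identity theorem puts the whole patch into
  \<open>B\<close>. The set that wins at \<open>x0\<close> spreads over the connected smooth locus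
  and, being closed apart from 0, contains its closure.\<close>

lemma irreducible_X:
  assumes t: "good t" and con: "connected (R t)"
  shows "irreducible_set (X t)"
  unfolding irreducible_set_def
proof (intro conjI allI impI algebraic_X)
  show "X t \<noteq> {}" using D_sub_X x0 by blast
  fix A B assume A: "algebraic_set A" and B: "algebraic_set B" and AB: "X t = A \<union> B"
  define near where "near A x \<longleftrightarrow> (\<exists>V. open V \<and> x \<in> V \<and> V \<inter> X t \<subseteq> A)" for A x
  have one: "near A x \<or> near B x" if A: "algebraic_set A" "algebraic_set B" "X t = A \<union> B" and x: "x \<in> R t" for x A B
  proof -
    obtain GA where GA: "A = zero_locus GA" using A(1) by (auto simp: algebraic_set_def)
    obtain GB where GB: "B = zero_locus GB" using A(2) by (auto simp: algebraic_set_def)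
    obtain N where N: "smooth_patch (\<lambda>_. t) N" "(x, 0) \<in> N" "open {z. (z, 0) \<in> N}" using const_patch[OF x] .
    show ?thesis
    proof (cases "{z. (z, 0) \<in> N} \<inter> X t \<subseteq> A")
      case True
      then show ?thesis using N(2,3) unfolding near_def by blast
    next
      case False
      then obtain z1 where z1: "(z1, 0) \<in> N" "z1 \<in> X t" "z1 \<notin> zero_locus GA" unfolding GA by blast
      have "z1 \<noteq> 0" using z1(2) by (simp add: X_def)
      then obtain f where f: "f \<in> GA" "ev f z1 \<noteq> 0" using z1(3) by (auto simp: zero_locus_ev)
      have "open {z. ev f z \<noteq> 0}"
        unfolding ev_def by (intro open_Collect_neq continuous_on_polyfn[OF polyfn_poly_val_UNIV] continuous_intros)
      note V = this
      have "ev f' z = 0" if f': "f' \<in> GB" and z: "(z, 0) \<in> N" "z \<in> X t" for f' z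
      proof (rule patch_identity[OF N(1) z1(1) z1(2) V _ _ z(1) z(2)])
        show "z1 \<in> {z. ev f z \<noteq> 0}" using f by simp
        fix y assume y: "y \<in> {z. ev f z \<noteq> 0}" "(y, 0) \<in> N" "y \<in> X t"
        then have "y \<notin> A" using f(1) by (auto simp: GA zero_locus_ev)
        then have "y \<in> B" using y(3) A(3) by blast
        then show "ev f' y = 0" using f' by (simp add: GB zero_locus_ev)
      qed
      then have "{z. (z, 0) \<in> N} \<inter> X t \<subseteq> B" by (auto simp: GB zero_locus_ev X_def)
      then show ?thesis using N(2,3) unfolding near_def by blast
    qed
  qed
  have spread: "X t \<subseteq> A" if A: "algebraic_set A" and a: "a \<in> R t" "near A a" for A a
  proof -
    obtain GA where GA: "A = zero_locus GA" using A by (auto simp: algebraic_set_def)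
    have all: "near A b" if b: "b \<in> R t" for b
    proof (rule connected_induction_simple[OF con a(1) b, where P = "near A", OF a(2)])
      fix x assume x: "x \<in> R t"
      obtain N where N: "smooth_patch (\<lambda>_. t) N" "(x, 0) \<in> N" "open {z. (z, 0) \<in> N}" using const_patch[OF x] .
      show "\<exists>T. openin (top_of_set (R t)) T \<and> x \<in> T \<and> (\<forall>y\<in>T. \<forall>z\<in>T. near A y \<longrightarrow> near A z)"
      proof (intro exI[of _ "R t \<inter> {z. (z, 0) \<in> N}"] conjI ballI impI)
        show "openin (top_of_set (R t)) (R t \<inter> {z. (z, 0) \<in> N})" by (rule openin_open_Int[OF N(3)])
        show "x \<in> R t \<inter> {z. (z, 0) \<in> N}" using x N by simp
        fix y z assume y: "y \<in> R t \<inter> {z. (z, 0) \<in> N}" "near A y" and z: "z \<in> R t \<inter> {z. (z, 0) \<in> N}"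
        obtain V where V: "open V" "y \<in> V" "V \<inter> X t \<subseteq> A" using y(2) unfolding near_def by blast
        have yN: "(y, 0) \<in> N" "y \<in> X t" using y R_subset_X by auto
        have "ev f w = 0" if f: "f \<in> GA" and w: "(w, 0) \<in> N" "w \<in> X t" for f w
        proof (rule patch_identity[OF N(1) yN(1) yN(2) V(1,2) _ w(1) w(2)])
          fix u assume "u \<in> V" "(u, 0) \<in> N" "u \<in> X t"
          then show "ev f u = 0" using V(3) f by (auto simp: GA zero_locus_ev)
        qed
        then have "{z. (z, 0) \<in> N} \<inter> X t \<subseteq> A" by (auto simp: GA zero_locus_ev X_def)
        then show "near A z" using N(3) z unfolding near_def by blast
      qed
    qed
    have RA: "R t \<subseteq> A" using all R_subset_X unfolding near_def by blast
    have "closure (R t) \<subseteq> A \<union> {0}" unfolding GA by (rule closure_minimal[OF _ algebraic_closed]) (use RA GA in blast)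
    then show ?thesis using local_connected(2)[OF t] by (auto simp: X_def)
  qed
  have x0R: "x0 \<in> R t" using t x0 D_sub_X unfolding good_def R_def by blast
  from one[OF A B AB x0R] spread[OF A x0R] spread[OF B x0R] AB show "X t = A \<or> X t = B" by blast
qed

text \<open>There are \<open>5 + r\<close> covectors in a space of dimension \<open>r + 4\<close>.
  Since the \<open>r\<close> differentials of the equations are independent, some \<open>f i\<close>
  has a nonzero coefficient, which is normalised to 1.\<close>

lemma differentials_dependent:
  fixes f :: "nat \<Rightarrow> 'n cpoly"
  assumes "indep_at t x"
  shows "\<exists>lam \<mu> i0. i0 < 5 \<and> lam i0 = 1 \<and>
    (\<forall>l. (\<Sum>i<5. lam i * ev (partial_deriv l (f i)) x) = (\<Sum>j<r. \<mu> j * ev (partial_deriv l (F t j)) x))"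
proof -
  obtain \<beta> :: "nat \<Rightarrow> 'n" where \<beta>: "bij_betw \<beta> {..<CARD('n)} UNIV"
    using ex_bij_betw_nat_finite[of "UNIV :: 'n set"] by (auto simp: atLeast0LessThan)
  define A where "A = {..<5::nat} <+> {..<r}"
  define \<alpha> where "\<alpha> a n = (case a of Inl i \<Rightarrow> ev (partial_deriv (\<beta> n) (f i)) x | Inr j \<Rightarrow> ev (partial_deriv (\<beta> n) (F t j)) x)"
    for a n
  have "finite A" "card A > CARD('n)" by (auto simp: A_def card_Plus card_n)
  from linear_dependence[OF this, of \<alpha>] obtain l where l: "\<exists>a\<in>A. l a \<noteq> 0" "\<forall>n<CARD('n). (\<Sum>a\<in>A. l a * \<alpha> a n) = 0"
    by (elim exE conjE)
  have rel: "(\<Sum>i<5. l (Inl i) * ev (partial_deriv k (f i)) x) + (\<Sum>j<r. l (Inr j) * ev (partial_deriv k (F t j)) x) = 0" for k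
  proof -
    obtain n where n: "n < CARD('n)" "k = \<beta> n" using \<beta> by (metis bij_betw_iff_bijections UNIV_I lessThan_iff)
    have "(\<Sum>a\<in>A. l a * \<alpha> a n) = 0" using l(2) n(1) by blast
    then show ?thesis unfolding A_def by (subst (asm) sum.Plus) (simp_all add: \<alpha>_def n(2))
  qed
  have "\<exists>i0<5. l (Inl i0) \<noteq> 0"
  proof (rule ccontr)
    assume "\<not> (\<exists>i0<5. l (Inl i0) \<noteq> 0)"
    then have z: "\<And>i. i < 5 \<Longrightarrow> l (Inl i) = 0" by blast
    then have r0: "(\<Sum>j<r. l (Inr j) * ev (partial_deriv k (F t j)) x) = 0" for k using rel[of k] by simp
    have "(\<Sum>j<r. l (Inr j) * dv (F t j) x v) = 0" for v
    proof -
      have "(\<Sum>j<r. l (Inr j) * dv (F t j) x v) = (\<Sum>k\<in>UNIV. (\<Sum>j<r. l (Inr j) * ev (partial_deriv k (F t j)) x) * v $ k)"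
        unfolding dv_def sum_distrib_left sum_distrib_right by (subst sum.swap) (simp add: mult.assoc)
      then show ?thesis by (simp add: r0)
    qed
    then have "\<forall>j<r. l (Inr j) = 0"
      using spec[OF assms[unfolded indep_at_def], of "\<lambda>j. l (Inr j)"] by simp
    then show False using l(1) z by (auto simp: A_def)
  qed
  then obtain i0 where i0: "i0 < 5" "l (Inl i0) \<noteq> 0" by blast
  show ?thesis
  proof (rule exI[of _ "\<lambda>i. l (Inl i) / l (Inl i0)"], rule exI[of _ "\<lambda>j. - l (Inr j) / l (Inl i0)"], rule exI[of _ i0], intro conjI allI)
    fix k
    have "(\<Sum>i<5. l (Inl i) / l (Inl i0) * ev (partial_deriv k (f i)) x) = (\<Sum>i<5. l (Inl i) * ev (partial_deriv k (f i)) x) / l (Inl i0)"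
      by (simp add: sum_divide_distrib)
    also have "\<dots> = - (\<Sum>j<r. l (Inr j) * ev (partial_deriv k (F t j)) x) / l (Inl i0)"
      using rel[of k] by (simp add: eq_neg_iff_add_eq_0 flip: add_divide_distrib)
    also have "\<dots> = (\<Sum>j<r. - l (Inr j) / l (Inl i0) * ev (partial_deriv k (F t j)) x)"
      by (simp add: sum_divide_distrib sum_negf)
    finally show "(\<Sum>i<5. l (Inl i) / l (Inl i0) * ev (partial_deriv k (f i)) x) =
        (\<Sum>j<r. - l (Inr j) / l (Inl i0) * ev (partial_deriv k (F t j)) x)" .
  qed (use i0 in auto)
qed

text \<open>Now the parameters are the values of the five polynomials. A tangent vector that moves
  only the value of \<open>f i0\<close> is annihilated by the differentials of the equations, hence
  by the dependent combination of the differentials of the \<open>f i\<close>, whose coefficient at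
  \<open>i0\<close> is 1; this is absurd. So on \<open>X t\<close> outside \<open>D\<close> the five
  values satisfy a polynomial relation.\<close>

lemma chain_bound:
  fixes f :: "nat \<Rightarrow> 'n cpoly"
  assumes t: "good t" and f: "\<And>Q z. polyfn {..4} Q \<Longrightarrow> (\<And>x. x \<in> C \<Longrightarrow> Q (\<lambda>i. ev (f i) x) = 0) \<Longrightarrow> Q z = 0"
    and C: "irreducible_set C" "C \<subseteq> X t" "\<not> C \<subseteq> D"
  shows False
proof -
  obtain a where a: "a \<in> C" "a \<notin> D" using C by blast
  have "a \<noteq> 0" using a C by (auto simp: X_def)
  then obtain k where k: "k < q" "ev (g k) a \<noteq> 0" using a(2) g_base by blast
  define TT :: "'n kvar set" where "TT = Inl ` {..<5}"
  define V :: "'n kvar set" where "V = TT \<union> range (\<lambda>l. Inr (Inl l)) \<union> (\<lambda>i. Inr (Inr (Inl i))) ` {..<5} \<union> (\<lambda>j. Inr (Inr (Inr j))) ` {..<r}"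
  have V: "finite V" "TT \<subseteq> V" by (auto simp: V_def TT_def)
  have Vs: "Inr (Inl l) \<in> V" "i < 5 \<Longrightarrow> Inl i \<in> V" "i < 5 \<Longrightarrow> Inr (Inr (Inl i)) \<in> V" "j < r \<Longrightarrow> Inr (Inr (Inr j)) \<in> V" for l i j
    by (auto simp: V_def TT_def)
  define Y where "Y i0 = {z :: 'n kvar \<Rightarrow> complex. (\<forall>i<5. z (Inl i) - poly_val (\<lambda>l. z (Inr (Inl l))) (f i) = 0) \<and>
      (\<forall>j<r. poly_val (\<lambda>l. z (Inr (Inl l))) (F t j) = 0) \<and> z (Inr (Inr (Inl i0))) = 1 \<and>
      (\<forall>l. (\<Sum>i<5. z (Inr (Inr (Inl i))) * poly_val (\<lambda>l. z (Inr (Inl l))) (partial_deriv l (f i))) -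
        (\<Sum>j<r. z (Inr (Inr (Inr j))) * poly_val (\<lambda>l. z (Inr (Inl l))) (partial_deriv l (F t j))) = 0)}" for i0
  have pX: "polyfn V (\<lambda>z. poly_val (\<lambda>l. z (Inr (Inl l))) p)" for p
    by (rule polyfn_comp[OF polyfn_poly_val_UNIV]) (rule polyfn_var[OF Vs(1)])
  have "\<exists>P. polyfn TT P \<and> (\<exists>z. P z \<noteq> 0) \<and> (\<forall>y\<in>Y i0. P y = 0)" if i0: "i0 < 5" for i0
  proof (rule generic_avoid[OF V, where ?t1.0 = "Inl i0"])
    show "Inl i0 \<in> TT" using i0 by (simp add: TT_def)
    fix z w :: "'n kvar \<Rightarrow> complex"
    assume w: "w (Inl i0) = 1" "\<And>t. t \<in> TT - {Inl i0} \<Longrightarrow> w t = 0"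
      and van: "\<And>p. polyfn V p \<Longrightarrow> (\<And>y. y \<in> Y i0 \<Longrightarrow> p y = 0) \<Longrightarrow>
        p z = 0 \<and> ((\<lambda>\<tau>. p (\<lambda>v. z v + \<tau> * w v)) has_field_derivative 0) (at 0)"
    define lam where "lam i = z (Inr (Inr (Inl i)))" for i
    define x where "x l = z (Inr (Inl l))" for l
    define \<xi> where "\<xi> l = w (Inr (Inl l))" for l
    have lin: "((\<lambda>\<tau>. poly_val (\<lambda>l. z (Inr (Inl l)) + \<tau> * w (Inr (Inl l))) p) has_field_derivative
        (\<Sum>l\<in>UNIV. poly_val x (partial_deriv l p) * \<xi> l)) (at 0)" for p
    proof -
      have "((\<lambda>\<tau>. z (Inr (Inl v)) + \<tau> * w (Inr (Inl v))) has_field_derivative \<xi> v) (at 0)" for v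
        by (auto intro!: derivative_eq_intros simp: \<xi>_def)
      from poly_val_chain[of "\<lambda>\<tau> v. z (Inr (Inl v)) + \<tau> * w (Inr (Inl v))" \<xi> 0 p, OF this]
      show ?thesis by (simp add: x_def[abs_def])
    qed
    have df: "(\<Sum>l\<in>UNIV. poly_val x (partial_deriv l (f i)) * \<xi> l) = w (Inl i)" if i: "i < 5" for i
    proof -
      have pp: "polyfn V (\<lambda>z. z (Inl i) - poly_val (\<lambda>l. z (Inr (Inl l))) (f i))"
        by (intro polyfn_diff polyfn_var pX Vs i)
      have "((\<lambda>\<tau>. (z (Inl i) + \<tau> * w (Inl i)) - poly_val (\<lambda>l. z (Inr (Inl l)) + \<tau> * w (Inr (Inl l))) (f i))
          has_field_derivative 0) (at 0)" by (rule conjunct2[OF van[OF pp]]) (use i in \<open>simp add: Y_def\<close>)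
      moreover have "((\<lambda>\<tau>. (z (Inl i) + \<tau> * w (Inl i)) - poly_val (\<lambda>l. z (Inr (Inl l)) + \<tau> * w (Inr (Inl l))) (f i))
          has_field_derivative w (Inl i) - (\<Sum>l\<in>UNIV. poly_val x (partial_deriv l (f i)) * \<xi> l)) (at 0)"
        by (rule DERIV_diff[OF _ lin]) (auto intro!: derivative_eq_intros)
      ultimately show ?thesis using DERIV_unique by fastforce
    qed
    have dF: "(\<Sum>l\<in>UNIV. poly_val x (partial_deriv l (F t j)) * \<xi> l) = 0" if j: "j < r" for j
    proof -
      from van[OF pX[of "F t j"]] have "((\<lambda>\<tau>. poly_val (\<lambda>l. z (Inr (Inl l)) + \<tau> * w (Inr (Inl l))) (F t j))
          has_field_derivative 0) (at 0)" using j by (simp add: Y_def)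
      then show ?thesis using lin DERIV_unique by blast
    qed
    have rel: "(\<Sum>i<5. lam i * poly_val x (partial_deriv l (f i))) =
        (\<Sum>j<r. z (Inr (Inr (Inr j))) * poly_val x (partial_deriv l (F t j)))" for l
    proof -
      have "polyfn V (\<lambda>z. (\<Sum>i<5. z (Inr (Inr (Inl i))) * poly_val (\<lambda>l. z (Inr (Inl l))) (partial_deriv l (f i))) -
        (\<Sum>j<r. z (Inr (Inr (Inr j))) * poly_val (\<lambda>l. z (Inr (Inl l))) (partial_deriv l (F t j))))"
        by (intro polyfn_diff polyfn_sum polyfn_mult polyfn_var pX Vs) auto
      from van[OF this] have "(\<Sum>i<5. z (Inr (Inr (Inl i))) * poly_val (\<lambda>l. z (Inr (Inl l))) (partial_deriv l (f i))) -
        (\<Sum>j<r. z (Inr (Inr (Inr j))) * poly_val (\<lambda>l. z (Inr (Inl l))) (partial_deriv l (F t j))) = 0"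
        by (simp add: Y_def)
      then show ?thesis by (simp add: lam_def x_def[abs_def])
    qed
    have "polyfn V (\<lambda>z. z (Inr (Inr (Inl i0))) - 1)" by (intro polyfn_diff polyfn_var polyfn_const Vs i0)
    from van[OF this] have l1: "lam i0 = 1" by (simp add: Y_def lam_def)
    have "(\<Sum>i<5. lam i * w (Inl i)) = (\<Sum>i<5. lam i * (\<Sum>l\<in>UNIV. poly_val x (partial_deriv l (f i)) * \<xi> l))"
      by (rule sum.cong) (auto simp: df)
    also have "\<dots> = (\<Sum>l\<in>UNIV. (\<Sum>i<5. lam i * poly_val x (partial_deriv l (f i))) * \<xi> l)"
      unfolding sum_distrib_left sum_distrib_right by (subst sum.swap) (simp add: mult.assoc)
    also have "\<dots> = (\<Sum>j<r. z (Inr (Inr (Inr j))) * (\<Sum>l\<in>UNIV. poly_val x (partial_deriv l (F t j)) * \<xi> l))"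
      unfolding rel sum_distrib_left sum_distrib_right by (subst sum.swap) (simp add: mult.assoc)
    also have "\<dots> = 0" by (simp add: dF)
    finally have s0: "(\<Sum>i<5. lam i * w (Inl i)) = 0" .
    have "(\<Sum>i<5. lam i * w (Inl i)) = (\<Sum>i\<in>{i0}. lam i * w (Inl i))"
      by (rule sum.mono_neutral_right) (use w(2) i0 in \<open>auto simp: TT_def\<close>)
    then show False using s0 w(1) l1 by simp
  qed
  then obtain P where P: "\<And>i. i < 5 \<Longrightarrow> polyfn TT (P i)" "\<And>i. i < 5 \<Longrightarrow> \<exists>z. P i z \<noteq> 0"
    "\<And>i y. i < 5 \<Longrightarrow> y \<in> Y i \<Longrightarrow> P i y = 0" by metis
  define PP where "PP z = (\<Prod>i<5. P i z)" for z
  have "\<exists>z. PP z \<noteq> 0" unfolding PP_def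
    by (rule polyfn_prod_nonzero[where V = TT]) (use P(1,2) in \<open>auto simp: TT_def\<close>)
  then obtain z1 where z1: "PP z1 \<noteq> 0" by blast
  have PPp: "polyfn TT PP" unfolding PP_def by (rule polyfn_prod) (use P in auto)
  define Q where "Q z = PP (\<lambda>v. case v of Inl i \<Rightarrow> z i | Inr _ \<Rightarrow> 0)" for z
  have Qp: "polyfn {..4} Q" unfolding Q_def
    by (rule polyfn_comp[OF PPp]) (auto simp: TT_def intro!: polyfn_var)
  obtain p where p: "\<And>x. ev p x = Q (\<lambda>i. ev (f i) x)" using ev_surj[OF Qp] by blast
  \<comment> \<open>Smoothness of \<open>X t\<close> is known only off \<open>D\<close>. The factor
    \<open>g k\<close>, which vanishes on \<open>D\<close> but not at \<open>a\<close>, makes the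
    relation hold on all of \<open>C\<close> and is removed again by irreducibility.\<close>
  have "ev (g k) x * ev p x = 0" if x: "x \<in> C" for x
  proof (cases "ev (g k) x = 0")
    case False
    then have "x \<notin> D" "x \<in> X t" using g_D[OF k(1)] x C(2) by auto
    then have ind: "indep_at t x" using t unfolding good_def by blast
    obtain lam \<mu> i0 where i0: "i0 < 5" "lam i0 = 1"
      "\<And>l. (\<Sum>i<5. lam i * ev (partial_deriv l (f i)) x) = (\<Sum>j<r. \<mu> j * ev (partial_deriv l (F t j)) x)"
      using differentials_dependent[OF ind, of f] by (elim exE conjE) blast
    define y :: "'n kvar \<Rightarrow> complex" where "y v = (case v of Inl i \<Rightarrow> ev (f i) x | Inr (Inl l) \<Rightarrow> x $ l |
       Inr (Inr (Inl i)) \<Rightarrow> lam i | Inr (Inr (Inr j)) \<Rightarrow> \<mu> j)" for v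
    have "y \<in> Y i0" unfolding Y_def y_def using i0 \<open>x \<in> X t\<close> by (simp add: X_def ev_def)
    then have "P i0 y = 0" by (rule P(3)[OF i0(1)])
    then have "PP y = 0" using i0(1) unfolding PP_def by (simp add: prod_zero_iff) blast
    moreover have "PP y = Q (\<lambda>i. ev (f i) x)" unfolding Q_def
      by (rule polyfn_cong[OF PPp]) (auto simp: TT_def y_def)
    ultimately show ?thesis by (simp add: p)
  qed simp
  then have "ev p x = 0" if "x \<in> C" for x
    by (rule irreducible_prime[OF C(1) g_form[OF k(1)] _ a(1) k(2) that])
  then have "Q z = 0" for z using f[OF Qp] p by simp
  moreover have "Q (\<lambda>i. z1 (Inl i)) = PP z1" unfolding Q_def
    by (rule polyfn_cong[OF PPp]) (auto simp: TT_def)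
  ultimately show False using z1 by simp
qed

text \<open>A chain of length 2 in \<open>D\<close> is prolonged by \<open>X t\<close>. Conversely,
  a longer chain in \<open>X t\<close> either stays inside \<open>D\<close>, against the dimension
  of \<open>D\<close>, or ends with a set not contained in \<open>D\<close>, to which
  \<open>chain_bound\<close> applies.\<close>

lemma has_dimension_X:
  assumes t: "good t" and con: "connected (R t)" and D: "has_dimension D 2"
  shows "has_dimension (X t) 3"
  unfolding has_dimension_def
proof (intro conjI allI impI)
  obtain C where C: "\<And>i. i \<le> 2 \<Longrightarrow> irreducible_set (C i) \<and> C i \<subseteq> D" "\<And>i. i < 2 \<Longrightarrow> C i \<subset> C (Suc i)"
    using D unfolding has_dimension_def irreducible_chain_def by (elim conjE exE) blast
  have DX: "D \<subset> X t"
  proof -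
    have x0R: "x0 \<in> R t" using t x0 D_sub_X unfolding good_def R_def by blast
    show ?thesis using off_D_component[OF x0R x0] D_sub_X by blast
  qed
  show "irreducible_chain (X t) 3"
    unfolding irreducible_chain_def
  proof (intro exI[of _ "C(3 := X t)"] conjI allI impI)
    fix i :: nat assume "i \<le> 3"
    then consider "i = 3" | "i \<le> 2" by linarith
    then show "irreducible_set ((C(3 := X t)) i)" "(C(3 := X t)) i \<subseteq> X t"
      using irreducible_X[OF t con] C(1)[of i] DX by (cases; auto)+
  next
    fix i :: nat assume "i < 3"
    then consider "i = 2" | "i < 2" by linarith
    then show "(C(3 := X t)) i \<subset> (C(3 := X t)) (Suc i)"
    proof cases
      case 1
      then show ?thesis using C(1)[of 2] DX by (simp add: numeral_3_eq_3) blast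
    next
      case 2
      then show ?thesis using C(2)[of i] by simp
    qed
  qed
  fix k assume "irreducible_chain (X t) k"
  then obtain C where C: "\<And>i. i \<le> k \<Longrightarrow> irreducible_set (C i) \<and> C i \<subseteq> X t" "\<And>i. i < k \<Longrightarrow> C i \<subset> C (Suc i)"
    unfolding irreducible_chain_def by (elim conjE exE) blast
  show "k \<le> 3"
  proof (rule ccontr)
    assume k: "\<not> k \<le> 3"
    have "\<exists>f :: nat \<Rightarrow> 'n cpoly. \<forall>Q. polyfn {..k} Q \<longrightarrow> (\<forall>x\<in>C k. Q (\<lambda>i. ev (f i) x) = 0) \<longrightarrow> (\<forall>z. Q z = 0)"
      by (rule chain_independent) (use C in auto)
    then obtain f :: "nat \<Rightarrow> 'n cpoly" where f: "\<And>Q z. polyfn {..k} Q \<Longrightarrow> (\<And>x. x \<in> C k \<Longrightarrow> Q (\<lambda>i. ev (f i) x) = 0) \<Longrightarrow> Q z = 0"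
      by blast
    show False
    proof (cases "C k \<subseteq> D")
      case True
      have mono: "C i \<subseteq> C k" if "i \<le> k" for i
        using that
      proof (induction rule: inc_induct)
        case (step n)
        then show ?case using C(2)[of n] by blast
      qed simp
      have "irreducible_chain D k"
        unfolding irreducible_chain_def
      proof (intro exI[of _ C] conjI allI impI)
        fix i assume i: "i \<le> k"
        show "irreducible_set (C i)" using C(1)[OF i] ..
        show "C i \<subseteq> D" using mono[OF i] True by (rule subset_trans)
      qed (rule C(2))
      moreover have "\<forall>j. irreducible_chain D j \<longrightarrow> j \<le> 2" using D unfolding has_dimension_def ..
      ultimately show False using k by fastforce
    next
      case False
      show False
      proof (rule chain_bound[OF t, where f = f and C = "C k"])
        fix Q z assume Q: "polyfn {..4::nat} Q" "\<And>x. x \<in> C k \<Longrightarrow> Q (\<lambda>i. ev (f i) x) = 0"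
        have "polyfn {..k} Q" by (rule polyfn_mono[OF Q(1)]) (use k in auto)
        then show "Q z = 0" by (rule f) (rule Q(2))
      qed (use C False in auto)
    qed
  qed
qed

end

section \<open>The parameter space\<close>

lemma DERIV_ev_line: "((\<lambda>\<tau>. ev f (x + \<tau> *s v)) has_field_derivative dv f x v) (at 0)"
proof -
  have "((\<lambda>\<tau>. (x + \<tau> *s v) $ k) has_field_derivative v $ k) (at 0)" for k by (auto intro!: derivative_eq_intros)
  from poly_val_chain[of "\<lambda>\<tau>. ($) (x + \<tau> *s v)" "($) v" 0 f, OF this] show ?thesis by (simp add: ev_def dv_def)
qed

lemma ev_add: "ev (a + b) x = ev a x + ev b x"
  by (simp add: ev_def poly_val_add)

lemma ev_mult: "ev (a * b) x = ev a x * ev b x"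
  by (simp add: ev_def poly_val_mult)

lemma dv_mult: "dv (a * b) x v = dv a x v * ev b x + dv b x v * ev a x"
proof -
  have "((\<lambda>\<tau>. ev a (x + \<tau> *s v) * ev b (x + \<tau> *s v)) has_field_derivative dv a x v * ev b (x + 0 *s v) + dv b x v * ev a (x + 0 *s v)) (at 0)"
    by (rule DERIV_mult[OF DERIV_ev_line DERIV_ev_line])
  then show ?thesis using DERIV_unique[OF DERIV_ev_line[of "a * b" x v]] by (simp add: ev_mult)
qed

lemma dv_add: "dv (a + b) x v = dv a x v + dv b x v"
  using DERIV_unique[OF DERIV_ev_line[of "a + b" x v] DERIV_add[OF DERIV_ev_line[of a x v] DERIV_ev_line[of b x v], folded ev_add]] .

lemma ev_0: "ev 0 x = 0" by (simp add: ev_def)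

lemma dv_0: "dv 0 x v = 0"
  using DERIV_unique[OF DERIV_ev_line[of 0 x v]] by (simp add: ev_0)

lemma ideal_vanishes:
  assumes "h \<in> cideal.span W" "\<And>w. w \<in> W \<Longrightarrow> ev w x = 0"
  shows "ev h x = 0" "(\<And>w. w \<in> W \<Longrightarrow> dv w x v = 0) \<Longrightarrow> dv h x v = 0"
proof -
  have "ev h x = 0 \<and> ((\<forall>w\<in>W. dv w x v = 0) \<longrightarrow> dv h x v = 0)"
    using assms(1)
    by (induction rule: cideal.span_induct_alt) (auto simp: ev_0 dv_0 ev_add ev_mult dv_add dv_mult assms(2))
  then show "ev h x = 0" "(\<And>w. w \<in> W \<Longrightarrow> dv w x v = 0) \<Longrightarrow> dv h x v = 0" by auto
qed

lemma finite_monomials: "finite {m :: 'n::finite \<Rightarrow>\<^sub>0 nat. mdeg m = d}"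
proof (rule finite_subset)
  show "{m :: 'n \<Rightarrow>\<^sub>0 nat. mdeg m = d} \<subseteq> {m. lk m \<in> (UNIV :: 'n set) \<rightarrow>\<^sub>E {..d}}"
  proof clarify
    fix m :: "'n \<Rightarrow>\<^sub>0 nat" assume d: "d = mdeg m"
    have "lk m v \<le> mdeg m" for v
    proof (cases "v \<in> ks m")
      case True
      then show ?thesis unfolding mdeg_def by (intro member_le_sum) auto
    qed (simp add: in_keys_iff)
    then show "lk m \<in> UNIV \<rightarrow>\<^sub>E {..mdeg m}" by auto
  qed
  have "inj_on lk {m. lk m \<in> (UNIV :: 'n set) \<rightarrow>\<^sub>E {..d}}" by (rule inj_onI) (simp add: poly_mapping_eqI)
  moreover have "lk ` {m. lk m \<in> (UNIV :: 'n set) \<rightarrow>\<^sub>E {..d}} \<subseteq> UNIV \<rightarrow>\<^sub>E {..d}" by blast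
  moreover have "finite ((UNIV :: 'n set) \<rightarrow>\<^sub>E {..d})" by (rule finite_PiE) auto
  ultimately show "finite {m. lk m \<in> (UNIV :: 'n set) \<rightarrow>\<^sub>E {..d}}" by (rule inj_on_finite)
qed

text \<open>Each \<open>m i\<close> is a pivot, so that the coordinates with respect to \<open>g\<close> are coefficients.\<close>

definition echelon :: "'n cpoly set \<Rightarrow> nat \<Rightarrow> (nat \<Rightarrow> 'n cpoly) \<Rightarrow> (nat \<Rightarrow> ('n \<Rightarrow>\<^sub>0 nat)) \<Rightarrow> bool" where
  "echelon V q g m \<longleftrightarrow> (\<forall>i<q. g i \<in> V) \<and> (\<forall>i<q. \<forall>k<q. lk (g i) (m k) = (if i = k then 1 else 0))"

lemma lookup_sum: "lk (\<Sum>i\<in>A. f i) m = (\<Sum>i\<in>A. lk (f i :: 'a \<Rightarrow>\<^sub>0 'b::comm_monoid_add) m)"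
  by (induction A rule: infinite_finite_induct) (auto simp: lookup_add)

text \<open>The number \<open>q\<close> of pivots is at most \<open>card M\<close>, so a maximal
  reduced echelon family exists. A member of \<open>V\<close> outside its span would leave a
  remainder that is 0 at all pivots and nonzero at a further monomial, which could serve as a new
  pivot.\<close>

lemma echelon_basis:
  fixes V :: "'n cpoly set"
  assumes V: "cpoly.subspace V" and fin: "finite M" and VM: "\<And>f. f \<in> V \<Longrightarrow> ks f \<subseteq> M"
  shows "\<exists>q g m. echelon V q g m \<and> (\<forall>f\<in>V. f = (\<Sum>i<q. poly_const (lk f (m i)) * g i))"
proof -
  have bound: "q \<le> card M" if e: "echelon V q g m" for q g m
  proof -
    have d: "lk (g i) (m k) = (if i = k then 1 else 0)" if "i < q" "k < q" for i k using e that by (simp add: echelon_def)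
    have "inj_on m {..<q}"
    proof (rule inj_onI)
      fix i k assume "i \<in> {..<q}" "k \<in> {..<q}" "m i = m k"
      then show "i = k" using d[of i i] d[of i k] by (auto split: if_splits)
    qed
    moreover have "m ` {..<q} \<subseteq> M"
    proof clarify
      fix i assume i: "i < q"
      then have "m i \<in> ks (g i)" using d[of i i] by (simp add: in_keys_iff)
      then show "m i \<in> M" using VM e i by (auto simp: echelon_def)
    qed
    ultimately show ?thesis using card_inj_on_le[of m "{..<q}" M] fin by simp
  qed
  define Q where "Q q \<longleftrightarrow> (\<exists>g m. echelon V q g m)" for q
  have "Q 0" by (simp add: Q_def echelon_def)
  moreover have "q \<le> card M" if "Q q" for q using that bound unfolding Q_def by (elim exE)
  ultimately obtain q where q: "Q q" "\<And>k. Q k \<Longrightarrow> k \<le> q"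
    using Greatest_le_nat[of Q _ "card M"] GreatestI_nat[of Q 0 "card M"] by blast
  obtain g m where gm: "echelon V q g m" using q(1) unfolding Q_def by (elim exE)
  have d: "lk (g i) (m k) = (if i = k then 1 else 0)" "g i \<in> V" if "i < q" "k < q" for i k
    using gm that by (auto simp: echelon_def)
  have "f = (\<Sum>i<q. poly_const (lk f (m i)) * g i)" if f: "f \<in> V" for f
  proof (rule ccontr)
    assume ne: "f \<noteq> (\<Sum>i<q. poly_const (lk f (m i)) * g i)"
    define f' where "f' = f - (\<Sum>i<q. poly_const (lk f (m i)) * g i)"
    have "f' \<in> V" unfolding f'_def
      by (intro cpoly.subspace_diff[OF V] cpoly.subspace_sum[OF V] cpoly.subspace_scale[OF V] f d(2)) auto
    have "f' \<noteq> 0" using ne by (simp add: f'_def)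
    then obtain mm where mm: "lk f' mm \<noteq> 0" by (metis lookup_zero poly_mapping_eqI)
    have f'm: "lk f' (m k) = 0" if "k < q" for k
    proof -
      have "lk f' (m k) = lk f (m k) - (\<Sum>i<q. lk f (m i) * lk (g i) (m k))"
        by (simp add: f'_def lookup_minus lookup_sum lookup_poly_const_mult)
      also have "(\<Sum>i<q. lk f (m i) * lk (g i) (m k)) = (\<Sum>i\<in>{k}. lk f (m i) * lk (g i) (m k))"
        by (rule sum.mono_neutral_right) (use that d in auto)
      finally show ?thesis using d(1)[OF that that] by simp
    qed
    define h where "h = poly_const (1 / lk f' mm) * f'"
    have h: "h \<in> V" "lk h mm = 1" "\<And>k. k < q \<Longrightarrow> lk h (m k) = 0"
      using mm f'm cpoly.subspace_scale[OF V \<open>f' \<in> V\<close>] by (simp_all add: h_def lookup_poly_const_mult)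
    \<comment> \<open>The new row \<open>h\<close> is subtracted from the old ones so that they
      vanish at the new pivot \<open>mm\<close>; at the old pivots \<open>h\<close> is 0 and changes
      nothing.\<close>
    define g' where "g' i = (if i = q then h else g i - poly_const (lk (g i) mm) * h)" for i
    define m' where "m' i = (if i = q then mm else m i)" for i
    have "echelon V (Suc q) g' m'"
      unfolding echelon_def
    proof (intro conjI allI impI)
      fix i assume i: "i < Suc q"
      show "g' i \<in> V"
        using i h(1) d(2)[of i i] by (auto simp: g'_def intro!: cpoly.subspace_diff[OF V] cpoly.subspace_scale[OF V])
      fix k assume k: "k < Suc q"
      show "lk (g' i) (m' k) = (if i = k then 1 else 0)"
        using i k h(2,3) d(1)[of i k] by (auto simp: g'_def m'_def lookup_minus lookup_poly_const_mult)
    qed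
    then have "Q (Suc q)" unfolding Q_def by blast
    then show False using q(2) by fastforce
  qed
  then show ?thesis using gm by blast
qed

section \<open>Rescaling of single equations, and nodality of good members\<close>

context base_locus
begin

lemma X_mult:
  assumes c: "\<And>j. j < r \<Longrightarrow> c j \<noteq> 0" and t': "\<And>j i. j < r \<Longrightarrow> t' (j, i) = c j * t (j, i)"
  shows "j < r \<Longrightarrow> ev (F t' j) x = c j * ev (F t j) x" "j < r \<Longrightarrow> dv (F t' j) x v = c j * dv (F t j) x v"
    "j < r \<Longrightarrow> hess (F t' j) x w l = c j * hess (F t j) x w l"
    "X t' = X t" "indep_at t' x \<longleftrightarrow> indep_at t x" "R t' = R t"
proof -
  show ev: "ev (F t' j) x = c j * ev (F t j) x" if "j < r" for j x using that t' by (simp add: ev_F sum_distrib_left mult.assoc)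
  show dv: "dv (F t' j) x v = c j * dv (F t j) x v" if "j < r" for j x v using that t' by (simp add: dv_F sum_distrib_left mult.assoc)
  show "hess (F t' j) x w l = c j * hess (F t j) x w l" if "j < r" for j using that t' by (simp add: hess_F sum_distrib_left mult.assoc)
  show X: "X t' = X t" using c by (auto simp: X_def ev)
  have s: "(\<Sum>j<r. lam j * dv (F t' j) x v) = (\<Sum>j<r. (lam j * c j) * dv (F t j) x v)" for lam x v
    by (rule sum.cong) (auto simp: dv)
  have s': "(\<Sum>j<r. lam j * dv (F t j) x v) = (\<Sum>j<r. (lam j / c j) * dv (F t' j) x v)" for lam x v
    by (rule sum.cong) (auto simp: dv c)
  show i: "indep_at t' x \<longleftrightarrow> indep_at t x" for x
  proof
    assume a: "indep_at t' x"
    show "indep_at t x" unfolding indep_at_def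
    proof (intro allI impI)
      fix lam j assume l: "\<forall>v. (\<Sum>j<r. lam j * dv (F t j) x v) = 0" and j: "j < r"
      have "\<forall>j<r. lam j / c j = 0" using spec[OF a[unfolded indep_at_def], of "\<lambda>j. lam j / c j"] l unfolding s' by blast
      then show "lam j = 0" using c[OF j] j by auto
    qed
  next
    assume a: "indep_at t x"
    show "indep_at t' x" unfolding indep_at_def
    proof (intro allI impI)
      fix lam j assume l: "\<forall>v. (\<Sum>j<r. lam j * dv (F t' j) x v) = 0" and j: "j < r"
      have "\<forall>j<r. lam j * c j = 0" using spec[OF a[unfolded indep_at_def], of "\<lambda>j. lam j * c j"] l unfolding s by blast
      then show "lam j = 0" using c[OF j] j by auto
    qed
  qed
  show "R t' = R t" by (auto simp: R_def X i)
qed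

lemma good_mult:
  assumes c: "\<And>j. j < r \<Longrightarrow> c j \<noteq> 0" and t': "\<And>j i. j < r \<Longrightarrow> t' (j, i) = c j * t (j, i)" and good: "good t'"
  shows "good t"
  unfolding good_def
proof (intro conjI allI impI ballI)
  note m = X_mult[where c = c and t = t and t' = t', OF c t']
  show "indep_at t x0" using good m(5) unfolding good_def by blast
  show "indep_at t x" if "x \<in> X t" "x \<notin> D" for x using good that m(4,5) unfolding good_def by blast
  fix x lam j0 w \<beta> i
  assume x: "x \<in> D" and j0: "j0 < r" "lam j0 = 1" and rel: "\<forall>v. (\<Sum>j<r. lam j * dv (F t j) x v) = 0"
    and w: "\<forall>j<r. dv (F t j) x w = 0"
    and h: "\<forall>l. (\<Sum>j<r. lam j * hess (F t j) x w l) = (\<Sum>i<q. \<beta> i * ev (partial_deriv l (g i)) x)" and i: "i < q"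
  \<comment> \<open>Division by \<open>c j\<close> compensates the rescaling of the equations; the
    factor \<open>c j0\<close> restores the normalisation at \<open>j0\<close>.\<close>
  define lam' where "lam' j = c j0 * lam j / c j" for j
  have a: "(\<Sum>j<r. lam' j * dv (F t' j) x v) = c j0 * (\<Sum>j<r. lam j * dv (F t j) x v)" for v
    unfolding sum_distrib_left by (rule sum.cong) (auto simp: lam'_def m(2) c)
  have b: "(\<Sum>j<r. lam' j * hess (F t' j) x w l) = c j0 * (\<Sum>j<r. lam j * hess (F t j) x w l)" for l
    unfolding sum_distrib_left by (rule sum.cong) (auto simp: lam'_def m(3) c)
  show "dv (g i) x w = 0"
  proof (rule good_node[OF good x, where ?j0.0 = j0 and lam = lam' and b = "\<lambda>i. c j0 * \<beta> i"])
    show "lam' j0 = 1" using j0 c by (simp add: lam'_def)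
    show "(\<Sum>j<r. lam' j * hess (F t' j) x w l) = (\<Sum>i<q. c j0 * \<beta> i * ev (partial_deriv l (g i)) x)" for l
      unfolding b h[rule_format] by (simp add: sum_distrib_left mult.assoc)
    show "(\<Sum>j<r. lam' j * dv (F t' j) x v) = 0" for v unfolding a using rel by simp
  qed (use j0 w i in \<open>simp_all add: m(2)\<close>)
qed

lemma smooth_tangent_dim:
  assumes "x \<in> R t"
  shows "vec.dim (tangent_space (F t ` {..<r}) x) = 3 + 1"
proof -
  have ind: "indep_at t x" using assms by (simp add: R_def)
  obtain J jj where jj: "bij_betw jj J {..<r}" and det: "det (jacM J (\<lambda>k. F t (jj k)) x) \<noteq> 0"
    by (rule smooth_frame[OF ind, THEN exE], elim exE conjE) (rule that)
  have "tangent_space (F t ` {..<r}) x = {v. \<forall>j\<in>jj ` J. dv (F t j) x v = 0}"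
    using jj by (auto simp: tangent_space_def dv_def ev_def bij_betw_def)
  also have "\<dots> = {v. \<forall>k\<in>J. (jacM J (\<lambda>k. F t (jj k)) x *v v) $ k = 0}" by (simp add: jacM_mult)
  also have "vec.dim \<dots> = card (- J)" by (rule kernel_dim[OF det])
  finally show ?thesis using card_n bij_betw_same_card[OF jj] by (simp add: Compl_eq_Diff_UNIV card_Diff_subset)
qed

theorem good_nodal:
  assumes t: "good t" and con: "connected (R t)" and D: "has_dimension D 2"
  shows "complete_intersection r (F t)" "nodal_threefold (F t ` {..<r})"
proof -
  have dim: "has_dimension (zero_locus (F t ` {..<r})) 3" using has_dimension_X[OF t con D] by (simp add: X_zero_locus)
  then show "complete_intersection r (F t)"
    unfolding complete_intersection_def using card_n by (intro exI[of _ 3]) simp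
  have irr: "irreducible_set (zero_locus (F t ` {..<r}))" using irreducible_X[OF t con] by (simp add: X_zero_locus)
  show "nodal_threefold (F t ` {..<r})"
    unfolding nodal_threefold_def
  proof (intro conjI ballI irr dim)
    fix x assume "x \<in> zero_locus (F t ` {..<r})"
    then have x: "x \<in> X t" by (simp add: X_zero_locus)
    show "vec.dim (tangent_space (F t ` {..<r}) x) = 3 + 1 \<or> ordinary_double_point (F t ` {..<r}) x"
      using smooth_tangent_dim node_local(3)[OF t x] by blast
  qed
qed

end

definition bdeg :: "nat \<Rightarrow> ((nat \<times> 'm) \<Rightarrow>\<^sub>0 nat) \<Rightarrow> nat" where
  "bdeg j M = (\<Sum>v\<in>{v \<in> ks M. fst v = j}. lk M v)"

lemma mval_block_scale:
  "mval (\<lambda>v. (if fst v = k then c else 1) * x v) M = c ^ bdeg k M * mval x M"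
proof -
  have "mval (\<lambda>v. (if fst v = k then c else 1) * x v) M =
      (\<Prod>v\<in>ks M. (if fst v = k then c ^ lk M v else 1) * x v ^ lk M v)"
    unfolding mval_def by (rule prod.cong) (auto simp: power_mult_distrib)
  also have "\<dots> = (\<Prod>v\<in>ks M. if fst v = k then c ^ lk M v else 1) * mval x M"
    by (simp add: prod.distrib mval_def)
  also have "(\<Prod>v\<in>ks M. if fst v = k then c ^ lk M v else 1) = (\<Prod>v\<in>{v \<in> ks M. fst v = k}. c ^ lk M v)"
    by (subst prod.inter_filter) auto
  also have "\<dots> = c ^ bdeg k M" by (simp add: bdeg_def power_sum)
  finally show ?thesis .
qed

text \<open>The blocks are made homogeneous one after the other by passing to a graded component
  that is nonzero at \<open>x\<close>. A component has only monomials that were there before, so the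
  earlier blocks stay homogeneous; it vanishes on \<open>B\<close> because \<open>B\<close> is
  stable under scaling a block. Blocks from \<open>r\<close> on do not occur and have degree
  0.\<close>

lemma multihomogeneous_component:
  fixes p :: "(nat \<times> 'm) cpoly" and B :: "(nat \<times> 'm \<Rightarrow> complex) set"
  assumes keys: "\<And>M v. M \<in> ks p \<Longrightarrow> v \<in> ks M \<Longrightarrow> fst v < r"
    and van: "\<And>z. z \<in> B \<Longrightarrow> poly_val z p = 0"
    and B: "\<And>z k c. z \<in> B \<Longrightarrow> c \<noteq> 0 \<Longrightarrow> (\<lambda>v. (if fst v = k then c else 1) * z v) \<in> B"
    and nz: "poly_val x p \<noteq> 0"
  shows "\<exists>P. multihomogeneous P \<and> (\<forall>z\<in>B. poly_val z P = 0) \<and> poly_val x P \<noteq> 0"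
proof -
  have "\<exists>P e. ks P \<subseteq> ks p \<and> (\<forall>M\<in>ks P. \<forall>j<k. bdeg j M = e j) \<and> (\<forall>z\<in>B. poly_val z P = 0) \<and> poly_val x P \<noteq> 0" for k
  proof (induction k)
    case 0
    show ?case using van nz by (intro exI[of _ p]) auto
  next
    case (Suc k)
    then obtain P and e :: "nat \<Rightarrow> nat" where P: "ks P \<subseteq> ks p" "\<forall>M\<in>ks P. \<forall>j<k. bdeg j M = e j" "\<forall>z\<in>B. poly_val z P = 0" "poly_val x P \<noteq> 0"
      by blast
    obtain N where "poly_val x P = (\<Sum>a\<le>N. poly_val x (restrict_keys (\<lambda>m. bdeg k m = a) P))"
      using poly_val_sum_graded by blast
    then obtain a where a: "poly_val x (restrict_keys (\<lambda>m. bdeg k m = a) P) \<noteq> 0"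
      using P(4) by (metis sum.neutral)
    show ?case
    proof (intro exI[of _ "restrict_keys (\<lambda>m. bdeg k m = a) P"] exI[of _ "e(k := a)"] conjI ballI allI impI)
      show "ks (restrict_keys (\<lambda>m. bdeg k m = a) P) \<subseteq> ks p" using P(1) by (auto simp: keys_restrict_keys)
      show "bdeg j M = (e(k := a)) j" if "M \<in> ks (restrict_keys (\<lambda>m. bdeg k m = a) P)" "j < Suc k" for M j
        using that P(2) by (auto simp: keys_restrict_keys less_Suc_eq)
      show "poly_val z (restrict_keys (\<lambda>m. bdeg k m = a) P) = 0" if z: "z \<in> B" for z
      proof (rule graded_components_vanish)
        show "poly_val (\<lambda>v. (if fst v = k then c else 1) * z v) P = 0" if "c \<noteq> 0" for c
          using P(3) B[OF z that] by blast
      qed (rule mval_block_scale)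
    qed (rule a)
  qed
  then obtain P and e :: "nat \<Rightarrow> nat" where P: "ks P \<subseteq> ks p" "\<forall>M\<in>ks P. \<forall>j<r. bdeg j M = e j" "\<forall>z\<in>B. poly_val z P = 0" "poly_val x P \<noteq> 0"
    by blast
  have "multihomogeneous P"
    unfolding multihomogeneous_def bdeg_def[symmetric]
  proof (intro exI[of _ "\<lambda>j. if j < r then e j else 0"] ballI allI)
    fix M j assume M: "M \<in> ks P"
    show "bdeg j M = (if j < r then e j else 0)"
    proof (cases "j < r")
      case False
      then have e: "{v \<in> ks M. fst v = j} = {}" using keys P(1) M by fastforce
      show ?thesis using False unfolding bdeg_def e by simp
    qed (use P(2) M in simp)
  qed
  then show ?thesis using P by blast
qed

text \<open>At a point with \<open>x $ i\<close> nonzero the factor \<open>poly_var i ^ N\<close> is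
  invertible. Hence a common zero of the \<open>g i\<close> is a zero of the whole ideal of
  \<open>D\<close>, and by Leibniz a vector killed by their differentials at a point of
  \<open>D\<close> is killed by the differential of every function vanishing on
  \<open>D\<close>.\<close>

lemma base_locus_of_smooth:
  fixes D :: "(complex^'n::finite) set"
  assumes card: "CARD('n) = r + 4" and D: "smooth_variety 2 D" and W: "linear_system d W" "scheme_base_locus W D"
  shows "\<exists>q g m x0. base_locus D d r q g x0 \<and> echelon (forms d \<inter> vanishing_ideal D) q g m \<and>
    (\<forall>f\<in>forms d \<inter> vanishing_ideal D. f = (\<Sum>i<q. poly_const (lk f (m i)) * g i))"
proof -
  have irr: "irreducible_set D" and dimT: "\<And>x. x \<in> D \<Longrightarrow> vec.dim (tangent_space (vanishing_ideal D) x) = 2 + 1"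
    using D by (auto simp: smooth_variety_def)
  have alg: "algebraic_set D" and ne: "D \<noteq> {}" using irr by (auto simp: irreducible_set_def)
  obtain x0 where x0: "x0 \<in> D" using ne by blast
  define V where "V = forms d \<inter> vanishing_ideal D"
  have "cpoly.subspace V"
    unfolding V_def cpoly.subspace_def vanishing_ideal_def
    by (auto simp: forms_0 forms_add forms_scale poly_val_add poly_val_mult)
  moreover have "ks f \<subseteq> {m. mdeg m = d}" if "f \<in> V" for f using that by (auto simp: V_def forms_iff)
  ultimately have "\<exists>q g m. echelon V q g m \<and> (\<forall>f\<in>V. f = (\<Sum>i<q. poly_const (lk f (m i)) * g i))"
    by (rule echelon_basis[OF _ finite_monomials])
  then obtain q g m where e: "echelon V q g m" and sp: "\<forall>f\<in>V. f = (\<Sum>i<q. poly_const (lk f (m i)) * g i)"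
    by (elim exE conjE)
  note span = bspec[OF sp]
  have gV: "g i \<in> V" if "i < q" for i using e that by (auto simp: echelon_def)
  have WV: "W \<subseteq> V" using W by (auto simp: V_def linear_system_def scheme_base_locus_def)
  have power: "\<exists>N. poly_var i ^ N * f \<in> cideal.span W" if "f \<in> vanishing_ideal D" for f i
    using W(2) that unfolding scheme_base_locus_def by blast
  have evW: "ev f x = (\<Sum>i<q. lk f (m i) * ev (g i) x)" if "f \<in> V" for f x
    by (subst span[OF that]) (simp add: ev_def poly_val_sum poly_val_mult)
  have dvW: "dv f x v = (\<Sum>i<q. lk f (m i) * dv (g i) x v)" if "f \<in> V" for f x v
  proof -
    have "((\<lambda>\<tau>. \<Sum>i<q. lk f (m i) * ev (g i) (x + \<tau> *s v)) has_field_derivative (\<Sum>i<q. lk f (m i) * dv (g i) x v)) (at 0)"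
      by (intro DERIV_sum DERIV_cmult DERIV_ev_line)
    then show ?thesis unfolding evW[OF that, symmetric] using DERIV_unique[OF DERIV_ev_line] by blast
  qed
  have ev_var: "ev (poly_var i ^ N) x = x $ i ^ N" for i N and x :: "complex^'n"
    by (simp add: ev_def poly_val_power)
  have tangent: "dv f x v = 0" if x: "x \<in> D" and f: "f \<in> vanishing_ideal D" and v: "\<And>i. i < q \<Longrightarrow> dv (g i) x v = 0" for x f v
  proof -
    have "x \<noteq> 0" using x alg by (auto simp: algebraic_set_def zero_locus_def)
    then obtain i where i: "x $ i \<noteq> 0" by (auto simp: vec_eq_iff)
    obtain N where N: "poly_var i ^ N * f \<in> cideal.span W" using power[OF f] by blast
    have fx: "ev f x = 0" using f x by (simp add: vanishing_ideal_def ev_def)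
    have "dv (poly_var i ^ N * f) x v = 0"
    proof (rule ideal_vanishes(2)[OF N])
      show "ev w x = 0" if "w \<in> W" for w using that WV x by (auto simp: V_def vanishing_ideal_def ev_def)
      show "dv w x v = 0" if "w \<in> W" for w using dvW[of w] that WV v by (simp add: subset_iff)
    qed
    then have "x $ i ^ N * dv f x v = 0" by (simp add: dv_mult fx ev_var mult.commute)
    then show ?thesis using i by simp
  qed
  have "base_locus D d r q g x0"
  proof
    show "CARD('n) = r + 4" by fact
    show "x0 \<in> D" by fact
    show "0 \<notin> D" using alg by (auto simp: algebraic_set_def zero_locus_def)
    show "g i \<in> forms d" if "i < q" for i using gV[OF that] by (simp add: V_def)
    show "ev (g i) x = 0" if "i < q" "x \<in> D" for i x using gV[OF that(1)] that(2) by (simp add: V_def vanishing_ideal_def ev_def)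
    show "x \<in> D" if x: "x \<noteq> 0" "\<And>i. i < q \<Longrightarrow> ev (g i) x = 0" for x
    proof -
      obtain i where i: "x $ i \<noteq> 0" using x(1) by (auto simp: vec_eq_iff)
      have "ev f x = 0" if f: "f \<in> vanishing_ideal D" for f
      proof -
        obtain N where N: "poly_var i ^ N * f \<in> cideal.span W" using power[OF f] by blast
        have "ev (poly_var i ^ N * f) x = 0"
          by (rule ideal_vanishes(1)[OF N]) (use evW WV x(2) in \<open>simp add: subset_iff\<close>)
        then show ?thesis using i by (simp add: ev_mult ev_var)
      qed
      moreover obtain G where G: "D = zero_locus G" using alg by (auto simp: algebraic_set_def)
      moreover have "G \<subseteq> vanishing_ideal D" by (auto simp: G vanishing_ideal_def zero_locus_def)
      ultimately show ?thesis using x(1) by (auto simp: zero_locus_ev)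
    qed
    show "vec.dim {v. \<forall>i<q. dv (g i) x v = 0} = 3" if x: "x \<in> D" for x
    proof -
      have "{v. \<forall>i<q. dv (g i) x v = 0} = tangent_space (vanishing_ideal D) x"
        using tangent[OF x] gV by (auto simp: tangent_space_def dv_def ev_def V_def)
      then show ?thesis using dimT[OF x] by simp
    qed
  qed (rule tangent)
  with e sp show ?thesis unfolding V_def by (intro exI conjI)
qed

theorem theorem2p1:
  fixes D :: "(complex^'n::finite) set"
    and W :: "'n cpoly set"
    and s d :: nat
  assumes "s \<ge> 1"
    and "CARD('n) = (s + 2) + 1"
    and "smooth_variety 2 D"
    and "linear_system d W"
    and "scheme_base_locus W D"
  shows "generic_tuple (s - 1) d D
           (\<lambda>F. complete_intersection (s - 1) F \<and> nodal_threefold (F ` {..<s - 1}))"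
proof -
  define r where "r = s - 1"
  have card: "CARD('n) = r + 4" using assms(1,2) by (simp add: r_def)
  obtain q g m x0 where bl: "base_locus D d r q g x0" and ech: "echelon (forms d \<inter> vanishing_ideal D) q g m"
    and sp: "\<forall>f\<in>forms d \<inter> vanishing_ideal D. f = (\<Sum>i<q. poly_const (lk f (m i)) * g i)"
    using base_locus_of_smooth[OF card assms(3-5)] by (elim exE conjE)
  interpret base_locus D d r q g x0 by (rule bl)
  have dimD: "has_dimension D 2" using assms(3) by (simp add: smooth_variety_def)
  obtain P t1 where P: "polyfn ({..<r} \<times> {..<q}) P" "P t1 \<noteq> 0" "\<And>t. P t \<noteq> 0 \<Longrightarrow> good t"
    using generic_good by (elim exE conjE) blast
  define T where "T = hypersurface_tuples r d D"
  \<comment> \<open>\<open>cf\<close> is the vector of all coefficients of a tuple;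
    \<open>pr\<close> selects the coefficients at the pivots, which are the coordinates with respect
    to \<open>g\<close>, hence the parameter \<open>t\<close>; \<open>bl\<close> rescales each
    equation by its own factor.\<close>
  define cf where "cf Fs = (\<lambda>(j, mm). lk (Fs j) mm)" for Fs :: "nat \<Rightarrow> 'n cpoly"
  define pr where "pr z = (\<lambda>(j, i). z (j, m i))" for z :: "nat \<times> ('n \<Rightarrow>\<^sub>0 nat) \<Rightarrow> complex"
  define bl where "bl c z = (\<lambda>v. c (fst v) * z v)" for c :: "nat \<Rightarrow> complex" and z :: "nat \<times> ('n \<Rightarrow>\<^sub>0 nat) \<Rightarrow> complex"
  \<comment> \<open>\<open>B\<close> is stable under rescaling single equations, so the multihomogeneous components of a polynomial
    vanishing on \<open>B\<close> vanish on \<open>B\<close> as well.\<close>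
  define B where "B = {z. \<forall>c. (\<forall>j. c j \<noteq> 0) \<longrightarrow> P (pr (bl c z)) = 0}"
  note span = bspec[OF sp]
  have FT: "Fs j = F (pr (cf Fs)) j" if "Fs \<in> T" "j < r" for Fs j
    using span[of "Fs j"] that by (auto simp: T_def hypersurface_tuples_def hypersurfaces_through_def F_def pr_def cf_def)
  have Good: "complete_intersection r Fs \<and> nodal_threefold (Fs ` {..<r})" if Fs: "Fs \<in> T" "cf Fs \<notin> B" for Fs
  proof -
    obtain c where c: "\<And>j. c j \<noteq> 0" "P (pr (bl c (cf Fs))) \<noteq> 0" using Fs(2) unfolding B_def by blast
    define t where "t = pr (cf Fs)"
    have tt: "pr (bl c (cf Fs)) (j, i) = c j * t (j, i)" for j i by (simp add: t_def pr_def bl_def)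
    have good': "good (pr (bl c (cf Fs)))" by (rule P(3)[OF c(2)])
    have good: "good t" by (rule good_mult[where c = c, OF _ tt good']) (rule c(1))
    have "connected (R (pr (bl c (cf Fs))))" by (rule connected_R[OF P(1) P(3) c(2)])
    moreover have "R (pr (bl c (cf Fs))) = R t" by (rule X_mult(6)[where c = c, OF _ tt]) (rule c(1))
    ultimately have con: "connected (R t)" by simp
    have eq: "Fs ` {..<r} = F t ` {..<r}" using FT[OF Fs(1)] by (auto simp: t_def)
    show ?thesis using good_nodal[OF good con dimD] unfolding complete_intersection_def eq by blast
  qed
  define S where "S = {p. multihomogeneous p \<and> (\<forall>z\<in>B. poly_val z p = 0)}"
  define U where "U = {Fs \<in> T. \<exists>p\<in>S. poly_val (cf Fs) p \<noteq> 0}"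
  have "zariski_open_in T U"
    unfolding zariski_open_in_def U_def cf_def by (rule exI[of _ S]) (simp add: S_def)
  moreover have "U \<noteq> {}"
  proof -
    \<comment> \<open>Tuples live in an extensional function space, so the value beyond
      \<open>r\<close> has to be \<open>undefined\<close>.\<close>
    define Fs where "Fs j = (if j < r then F t1 j else undefined)" for j
    have good1: "good t1" by (rule P(3)[OF P(2)])
    have "F t1 j \<noteq> 0" if j: "j < r" for j
    proof
      assume 0: "F t1 j = 0"
      have "(\<Sum>k<r. (if k = j then 1 else 0) * dv (F t1 k) x0 v) = 0" for v
        using 0 by (simp add: if_distrib[of "\<lambda>x. x * _"] dv_0 cong: if_cong)
      moreover have "indep_at t1 x0" using good1 by (simp add: good_def)
      ultimately have "\<forall>k<r. (if k = j then 1 else 0 :: complex) = 0"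
        unfolding indep_at_def by (elim allE[of _ "\<lambda>k. if k = j then 1 else 0"]) blast
      then show False using j by auto
    qed
    then have FsT: "Fs \<in> T"
      using F_forms F_D by (auto simp: T_def hypersurface_tuples_def hypersurfaces_through_def Fs_def vanishing_ideal_def
        simp flip: ev_def split: if_splits)
    \<comment> \<open>Through the pivots, \<open>P\<close> becomes a polynomial in the coefficients
      of the equations. It need not be multihomogeneous, so a component of it that is nonzero at
      \<open>Fs\<close> is taken.\<close>
    have "polyfn ({..<r} \<times> UNIV) (\<lambda>z. P (pr z))"
      unfolding pr_def by (rule polyfn_comp[OF P(1), where h = "\<lambda>v z. case v of (j, i) \<Rightarrow> z (j, m i)"]) (auto intro: polyfn_var)
    from polyfn_imp_poly_val[OF this] obtain p where p: "\<And>M. M \<in> ks p \<Longrightarrow> ks M \<subseteq> {..<r} \<times> UNIV" "\<And>z. poly_val z p = P (pr z)"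
      by (elim exE conjE) blast
    have "pr (cf Fs) v = t1 v" if vv: "v \<in> {..<r} \<times> {..<q}" for v
    proof -
      obtain j i where v: "v = (j, i)" "j < r" "i < q" using vv by auto
      have "lk (F t1 j) (m i) = (\<Sum>k<q. t1 (j, k) * lk (g k) (m i))"
        by (simp add: F_def lookup_sum lookup_poly_const_mult)
      also have "\<dots> = (\<Sum>k<q. if k = i then t1 (j, i) else 0)"
        by (rule sum.cong) (use ech v in \<open>auto simp: echelon_def\<close>)
      finally show ?thesis using v by (simp add: pr_def cf_def Fs_def)
    qed
    then have "P (pr (cf Fs)) = P t1" by (rule polyfn_cong[OF P(1)])
    then have nz: "poly_val (cf Fs) p \<noteq> 0" using P(2) by (simp add: p(2))
    have "\<exists>p'. multihomogeneous p' \<and> (\<forall>z\<in>B. poly_val z p' = 0) \<and> poly_val (cf Fs) p' \<noteq> 0"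
    proof (rule multihomogeneous_component[OF _ _ _ nz, where r = r])
      show "fst v < r" if "M \<in> ks p" "v \<in> ks M" for M v using p(1)[OF that(1)] that(2) by auto
      show "poly_val z p = 0" if "z \<in> B" for z
      proof -
        have "P (pr (bl (\<lambda>_. 1) z)) = 0" using that unfolding B_def by (elim CollectE allE[of _ "\<lambda>_. 1"]) simp
        then show ?thesis by (simp add: p(2) bl_def)
      qed
      show "(\<lambda>v. (if fst v = k then c else 1) * z v) \<in> B" if z: "z \<in> B" and c: "c \<noteq> 0" for z k c
        unfolding B_def
      proof (intro CollectI allI impI)
        fix c' :: "nat \<Rightarrow> complex" assume c': "\<forall>j. c' j \<noteq> 0"
        have "bl c' (\<lambda>v. (if fst v = k then c else 1) * z v) = bl (\<lambda>j. c' j * (if j = k then c else 1)) z"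
          by (simp add: bl_def fun_eq_iff)
        moreover have "P (pr (bl (\<lambda>j. c' j * (if j = k then c else 1)) z)) = 0"
          using z c c' unfolding B_def by (elim CollectE allE[of _ "\<lambda>j. c' j * (if j = k then c else 1)"]) simp
        ultimately show "P (pr (bl c' (\<lambda>v. (if fst v = k then c else 1) * z v))) = 0" by simp
      qed
    qed
    then have "Fs \<in> U" using FsT unfolding U_def S_def by blast
    then show ?thesis by blast
  qed
  moreover have "complete_intersection r Fs \<and> nodal_threefold (Fs ` {..<r})" if "Fs \<in> U" for Fs
    using that Good[of Fs] unfolding U_def S_def by blast
  ultimately show ?thesis unfolding generic_tuple_def T_def r_def by blast
qed

end
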